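(* Let $d\ge 3$ and fix constants $R,\mu,\lambda,C_V,\kappa,P_0>0$. If $\Theta_0>0$ is sufficiently small, there exists a unique continuously differentiable function $(P,U,\Theta)\in C^1([0,\infty))^3$ solving the following system of ordinary differential equations for $r>0$: $$-\tfrac12 rP'+P'U+P\Big(U'+\tfrac{d-1}{r}U\Big)=0,$$ $$-\tfrac12 PU-\tfrac12 r(PU)'+(PU^2)'+\tfrac{d-1}{r}PU^2+(PR\Theta)'=(2\mu+\lambda)\Big(U''+\tfrac{d-1}{r}U'-\tfrac{d-1}{r^2}U\Big),$$ $$\begin{aligned}&-P\Big(\tfrac{U^2}{2}+C_V\Theta\Big)-\tfrac12 r\Big(P\big(\tfrac{U^2}{2}+C_V\Theta\big)\Big)'+\Big(UP\big(\tfrac{U^2}{2}+C_V\Theta\big)+UPR\Theta\Big)'\\&\quad+\tfrac{d-1}{r}\Big(UP\big(\tfrac{U^2}{2}+C_V\Theta\big)+UPR\Theta\Big)-\kappa\Big(\Theta''+\tfrac{d-1}{r}\Theta'\Big)\\&=2\mu\Big((U')^2+\tfrac{d-1}{r^2}U^2\Big)+\lambda\Big(U'+\tfrac{d-1}{r}U\Big)^2+(2\mu+\lambda)\Big(U''+\tfrac{d-1}{r}U'-\tfrac{d-1}{r^2}U\Big)U,\end{aligned}$$ and such that, for $r$ small, $$P(0)=P_0,\qquad U(r)=O(r^2),\quad U'(r)=O(r),\qquad \Theta(0)=\Theta_0,\quad \Theta'(r)=O(r).$$ It satisfies, for all $r\geq 0$, the bounds $$|U(r)|\lesssim\frac{\Theta_0r^2}{(1+r)^3},\quad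 |U'(r)|\lesssim\frac{\Theta_0 r}{(1+r)^3},\quad |\Theta(r)|\lesssim\frac{\Theta_0}{(1+r)^2},\quad |\Theta'(r)|\lesssim\frac{\Theta_0r}{(1+r)^2}.$$ Furthermore, there exist $P_\infty>0$, $U_\infty<0$, $\Theta_\infty>0$ such that, as $r\to\infty$, $$P(r)=P_\infty+O\Big(\frac1{r^2}\Big),\quad U(r)=\frac{U_\infty}{r}+O\Big(\frac1{r^3}\Big),\quad \Theta(r)=\frac{\Theta_\infty}{r^2}+O\Big(\frac1{r^4}\Big).$$ Finally, $$U_\infty=-2R\Theta_0+O(\Theta_0^2),\qquad \Theta_\infty=\frac{2(d-2)\kappa}{C_VP_0}\Theta_0+O(\Theta_0^2).$$
   Context: The functions $P,U,\Theta$ are real-valued functions of $r$. They are the profiles of a radial forward self-similar solution $\rho(t,x)=P(|x|/\sqrt t)$, $u(t,x)=t^{-1/2}U(|x|/\sqrt t)\,x/|x|$, $\theta(t,x)=t^{-1}\Theta(|x|/\sqrt t)$ of the full compressible Navier-Stokes equations in $\mathbb R^d$ (ideal gas with gas constant $R$, heat constant $C_V$, Lamé coefficients $\lambda,\mu$, thermal conductivity $\kappa$), which reduce to the displayed ODE system. Convention: "sufficiently small" and the implicit constants in $\lesssim$ and $O(\cdot)$ depend only on the fixed constants $R,\mu,\lambda,C_V,P_0$ (and on $\kappa$ and $d$). $A\lesssim B$ means $A\le CB$ with such a constant $C$. *)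

theory Defs
  imports "HOL-Analysis.Analysis" "HOL-Library.Landau_Symbols"
begin

(* Derivative of a function on the half-line [0,\<infinity>): one-sided at 0, the usual derivative
   at r > 0.  Values at negative arguments never matter. *)
definition hderiv :: "(real \<Rightarrow> real) \<Rightarrow> real \<Rightarrow> real" where
  "hderiv f r = vector_derivative f (at r within {0..})"

definition C1_halfline :: "(real \<Rightarrow> real) \<Rightarrow> bool" where
  "C1_halfline f \<longleftrightarrow>
     (\<forall>r\<ge>0. f differentiable (at r within {0..})) \<and> continuous_on {0..} (hderiv f)"

definition mass_eq :: "nat \<Rightarrow> (real \<Rightarrow> real) \<Rightarrow> (real \<Rightarrow> real) \<Rightarrow> real \<Rightarrow> bool" where
  "mass_eq d P U r \<longleftrightarrow>
     - (1/2) * r * hderiv P r + hderiv P r * U r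
       + P r * (hderiv U r + (real d - 1) / r * U r) = 0"

definition momentum_eq ::
  "nat \<Rightarrow> real \<Rightarrow> real \<Rightarrow> real \<Rightarrow> (real \<Rightarrow> real) \<Rightarrow> (real \<Rightarrow> real) \<Rightarrow> (real \<Rightarrow> real) \<Rightarrow> real \<Rightarrow> bool" where
  "momentum_eq d R \<mu> lam P U \<Theta> r \<longleftrightarrow>
     - (1/2) * P r * U r
       - (1/2) * r * hderiv (\<lambda>s. P s * U s) r
       + hderiv (\<lambda>s. P s * (U s)\<^sup>2) r
       + (real d - 1) / r * P r * (U r)\<^sup>2
       + hderiv (\<lambda>s. P s * R * \<Theta> s) r
     = (2 * \<mu> + lam) *
         (hderiv (hderiv U) r + (real d - 1) / r * hderiv U r - (real d - 1) / r\<^sup>2 * U r)"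

definition energy_eq ::
  "nat \<Rightarrow> real \<Rightarrow> real \<Rightarrow> real \<Rightarrow> real \<Rightarrow> real
     \<Rightarrow> (real \<Rightarrow> real) \<Rightarrow> (real \<Rightarrow> real) \<Rightarrow> (real \<Rightarrow> real) \<Rightarrow> real \<Rightarrow> bool" where
  "energy_eq d R \<mu> lam C\<^sub>V \<kappa> P U \<Theta> r \<longleftrightarrow>
     - P r * ((U r)\<^sup>2 / 2 + C\<^sub>V * \<Theta> r)
       - (1/2) * r * hderiv (\<lambda>s. P s * ((U s)\<^sup>2 / 2 + C\<^sub>V * \<Theta> s)) r
       + hderiv (\<lambda>s. U s * P s * ((U s)\<^sup>2 / 2 + C\<^sub>V * \<Theta> s) + U s * P s * R * \<Theta> s) r
       + (real d - 1) / r * (U r * P r * ((U r)\<^sup>2 / 2 + C\<^sub>V * \<Theta> r) + U r * P r * R * \<Theta> r)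
       - \<kappa> * (hderiv (hderiv \<Theta>) r + (real d - 1) / r * hderiv \<Theta> r)
     = 2 * \<mu> * ((hderiv U r)\<^sup>2 + (real d - 1) / r\<^sup>2 * (U r)\<^sup>2)
       + lam * (hderiv U r + (real d - 1) / r * U r)\<^sup>2
       + (2 * \<mu> + lam) *
           (hderiv (hderiv U) r + (real d - 1) / r * hderiv U r - (real d - 1) / r\<^sup>2 * U r) * U r"

(* The implied constants of the conditions at r = 0 may depend on the solution, so that
   uniqueness is asserted in the largest class.  The values U 0 = 0, U' 0 = 0 and
   \<Theta>' 0 = 0, which the filter at_right 0 does not see, follow by continuity. *)
definition profile_solution ::
  "nat \<Rightarrow> real \<Rightarrow> real \<Rightarrow> real \<Rightarrow> real \<Rightarrow> real \<Rightarrow> real \<Rightarrow> real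
     \<Rightarrow> (real \<Rightarrow> real) \<Rightarrow> (real \<Rightarrow> real) \<Rightarrow> (real \<Rightarrow> real) \<Rightarrow> bool" where
  "profile_solution d R \<mu> lam C\<^sub>V \<kappa> P\<^sub>0 \<Theta>\<^sub>0 P U \<Theta> \<longleftrightarrow>
     C1_halfline P \<and> C1_halfline U \<and> C1_halfline \<Theta> \<and>
     (\<forall>r>0. hderiv U differentiable (at r) \<and> hderiv \<Theta> differentiable (at r) \<and>
        mass_eq d P U r \<and>
        momentum_eq d R \<mu> lam P U \<Theta> r \<and>
        energy_eq d R \<mu> lam C\<^sub>V \<kappa> P U \<Theta> r) \<and>
     P 0 = P\<^sub>0 \<and>
     U \<in> O[at_right 0](\<lambda>r. r\<^sup>2) \<and>
     hderiv U \<in> O[at_right 0](\<lambda>r. r) \<and>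
     \<Theta> 0 = \<Theta>\<^sub>0 \<and>
     hderiv \<Theta> \<in> O[at_right 0](\<lambda>r. r)"

end

theory Submission
  imports Defs
begin

text \<open>Write \<epsilon> for the central temperature \<Theta>(0), \<nu> = 2\<mu> + \<lambda>, and D = U' +
(d-1) U / r for the divergence of the velocity. The boundary conditions at the origin are those of
a regular radial flow, and they make every equation of the system integrable once, with known
values at the origin. The mass equation reads (r/2 - U) P' = P D, so that P = P(0) exp
(\<integral> D / (s/2 - U)). The viscous term of the momentum equation is \<nu> D', and
integration gives

\<nu> D = - r P U / 2 + P U^2 + R (P \<Theta> - P(0) \<epsilon>) + (d-1) \<integral> P U^2 / s.

The energy equation has to be multiplied by r first; with the energy flux H = U P (U^2/2 + (C_V +
R) \<Theta>) - 2\<mu> U U' - \<lambda> U D it becomes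

\<kappa> (r \<Theta>' + (d-2) \<Theta>) + C_V P r^2 \<Theta> / 2 = (d-2) \<kappa> \<epsilon> - r^2
P U^2 / 4 + r H + (d-2) \<integral> H.

The problem is thereby a system of first order equations in D and \<Theta>.

The unknowns are \<xi> = D / (\<epsilon> r) and \<zeta> = (\<Theta> / \<epsilon> - 1/(1+r^2)) / r,
continuous functions that vanish at 0. In these unknowns all quadratic effects and the variation
of P carry a factor \<epsilon>. What remains at \<epsilon> = 0 is triangular: a linear equation
for \<zeta>, and then one for \<xi> with \<zeta> in its source. All linear equations that occur
have the form r X' + k X + a r^2 X = g with k \<ge> 1 and a bounded below by a positive constant.
The function (1 + \<eta> r)^(-3) is a supersolution for them when \<eta> is small, so that a
source of size (1 + \<eta> r)^(-1) produces a solution of size (1 + \<eta> r)^(-3)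
(\<open>decay_bound_linear_ode\<close>). That rate is the one of the theorem: it means U of size
r^2/(1+r)^3 and \<Theta> of size 1/(1+r)^2.

Freezing the coefficients and the nonlinear terms at a given pair (\<xi>, \<zeta>) and solving the
linear equations defines a Picard step. A small calculus of bounds and Lipschitz bounds, uniform
in the inputs (\<open>tame\<close>), shows that its result differs from the solution at \<epsilon>
= 0 by O(\<epsilon>), with Lipschitz constant O(\<epsilon>), in the norm with weight (1 + \<eta>
r)^(-3) (\<open>contraction_estimate\<close>). For small \<epsilon> the step is a contraction and
has a fixed point, which is turned back into a solution (\<open>profile_solution\<close>).

The step is causal: its result on [0,T] depends only on the input on [0,T]. Uniqueness therefore
reduces to showing that an arbitrary solution in the class of the theorem gives a fixed point in
the ball of the contraction. Two points need an argument. The hypotheses give D = O(r), whereas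
\<xi> has to vanish at 0, which means D = o(r); this comes from iterating the mass and momentum
equations near the origin (\<open>divergence_over_radius_small\<close>). And the bound on [0,T]
has to be established for all T; since the step improves the bound M to M/2, it can never be lost
as T grows (\<open>bootstrap_bound\<close>).

For the far field, the decay makes P and the integrals above converge at the rate r^(-2). The
momentum balance then determines the limit of r U, and a barrier c/r^4 in the heat balance
determines the limit of r^2 \<Theta> (\<open>far_field\<close>).\<close>

section \<open>Comparison for singular linear equations\<close>

text \<open>After the last zero before a negative value V stays negative, so both k V and a r^2 V are
nonpositive there and the inequality forces V' \<ge> 0: V cannot have decreased. The argument also
covers p = 0, where the equation is singular, because it only looks at interior points.\<close>
lemma nonneg_of_differential_inequality:
  fixes V V' a :: "real \<Rightarrow> real"
  assumes "0 \<le> p" and cont: "continuous_on {p..T} V"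
    and der: "\<And>r. p < r \<Longrightarrow> r < T \<Longrightarrow> (V has_real_derivative V' r) (at r)"
    and a: "\<And>r. p < r \<Longrightarrow> r < T \<Longrightarrow> 0 \<le> a r" and k: "0 \<le> k"
    and ineq: "\<And>r. p < r \<Longrightarrow> r < T \<Longrightarrow> 0 \<le> r * V' r + k * V r + a r * r\<^sup>2 * V r"
    and init: "0 \<le> V p" and r: "r \<in> {p..T}"
  shows "0 \<le> V r"
proof (rule ccontr)
  assume neg: "\<not> 0 \<le> V r"
  define S where "S = {p..r} \<inter> V -` {0..}"
  have contr: "continuous_on {p..r} V"
    using r by (intro continuous_on_subset[OF cont]) auto
  have "compact S"
    unfolding S_def using contr
    by (metis continuous_closed_preimage[OF contr] closed_real_atLeastAtMost closed_atLeast
        compact_Icc compact_Int_closed Int_left_absorb Int_lower1 compact_eq_bounded_closed bounded_subset)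
  moreover have "S \<noteq> {}"
    using init r unfolding S_def by auto
  ultimately obtain s where s: "s \<in> S" "\<And>t. t \<in> S \<Longrightarrow> t \<le> s"
    using compact_attains_sup by metis
  have sr: "p \<le> s" "s < r" "0 \<le> V s"
    using s(1) neg unfolding S_def by (auto simp: less_le)
  have below: "V t < 0" if "s < t" "t \<le> r" for t
  proof (rule ccontr)
    assume "\<not> V t < 0"
    then have "t \<in> S" using that sr unfolding S_def by auto
    then show False using s(2) that by fastforce
  qed
  obtain c where c: "s < c" "c < r" "V r - V s = (r - s) * V' c"
  proof -
    have "\<exists>l z. s < z \<and> z < r \<and> (V has_real_derivative l) (at z) \<and> V r - V s = (r - s) * l"
    proof (rule MVT)
      show "continuous_on {s..r} V"
        using sr by (intro continuous_on_subset[OF contr]) auto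
      show "V differentiable at x" if "s < x" "x < r" for x
        using der[of x] that sr r real_differentiable_def by force
    qed (use sr in auto)
    then obtain l z where z: "s < z" "z < r" "(V has_real_derivative l) (at z)"
      "V r - V s = (r - s) * l" by blast
    moreover have "l = V' z"
      using der[of z] z sr r DERIV_unique by fastforce
    ultimately show ?thesis using that by blast
  qed
  have cT: "p < c" "c < T" using c sr r by auto
  have "(k + a c * c\<^sup>2) * V c \<le> 0"
    using below[of c] c a[OF cT] k by (intro mult_nonneg_nonpos) auto
  then have "0 \<le> c * V' c" using ineq[OF cT] by (simp add: algebra_simps)
  then have "0 \<le> V' c" using cT assms(1) by (simp add: zero_le_mult_iff)
  then have "0 \<le> (r - s) * V' c" using sr by simp
  then show False using c(3) sr neg by linarith
qed

lemma abs_le_supersolution: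
  fixes X X' Z Z' a :: "real \<Rightarrow> real"
  assumes "0 \<le> p" and "continuous_on {p..T} X" and "continuous_on {p..T} Z"
    and "\<And>r. p < r \<Longrightarrow> r < T \<Longrightarrow> (X has_real_derivative X' r) (at r)"
    and "\<And>r. p < r \<Longrightarrow> r < T \<Longrightarrow> (Z has_real_derivative Z' r) (at r)"
    and "\<And>r. p < r \<Longrightarrow> r < T \<Longrightarrow> 0 \<le> a r" and "0 \<le> k"
    and ineq: "\<And>r. p < r \<Longrightarrow> r < T \<Longrightarrow>
      \<bar>r * X' r + k * X r + a r * r\<^sup>2 * X r\<bar> \<le> r * Z' r + k * Z r + a r * r\<^sup>2 * Z r"
    and init: "\<bar>X p\<bar> \<le> Z p" and r: "r \<in> {p..T}"
  shows "\<bar>X r\<bar> \<le> Z r"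
proof -
  have "0 \<le> Z r - X r"
  proof (rule nonneg_of_differential_inequality[where V = "\<lambda>r. Z r - X r" and V' = "\<lambda>r. Z' r - X' r" and a = a and k = k and T = T and p = p])
    fix t assume t: "p < t" "t < T"
    show "((\<lambda>r. Z r - X r) has_real_derivative Z' t - X' t) (at t)"
      using assms t by (auto intro!: derivative_intros)
    show "0 \<le> t * (Z' t - X' t) + k * (Z t - X t) + a t * t\<^sup>2 * (Z t - X t)"
      using ineq[OF t] unfolding abs_le_iff by (simp add: algebra_simps)
  qed (use assms in \<open>auto intro!: continuous_intros\<close>)
  moreover have "0 \<le> Z r + X r"
  proof (rule nonneg_of_differential_inequality[where V = "\<lambda>r. Z r + X r" and V' = "\<lambda>r. Z' r + X' r" and a = a and k = k and T = T and p = p])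
    fix t assume t: "p < t" "t < T"
    show "((\<lambda>r. Z r + X r) has_real_derivative Z' t + X' t) (at t)"
      using assms t by (auto intro!: derivative_intros)
    show "0 \<le> t * (Z' t + X' t) + k * (Z t + X t) + a t * t\<^sup>2 * (Z t + X t)"
      using ineq[OF t] unfolding abs_le_iff by (simp add: algebra_simps)
  qed (use assms in \<open>auto intro!: continuous_intros\<close>)
  ultimately show ?thesis by linarith
qed

text \<open>The homogeneous equation has a second solution, which is singular at 0; continuity at 0 with a
prescribed value excludes it.\<close>
lemma linear_ode_unique:
  fixes X Y a g :: "real \<Rightarrow> real"
  assumes "continuous_on {0..T} X" and "continuous_on {0..T} Y"
    and X: "\<And>r. 0 < r \<Longrightarrow> r < T \<Longrightarrow> (X has_real_derivative (g r - k * X r - a r * r\<^sup>2 * X r) / r) (at r)"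
    and Y: "\<And>r. 0 < r \<Longrightarrow> r < T \<Longrightarrow> (Y has_real_derivative (g r - k * Y r - a r * r\<^sup>2 * Y r) / r) (at r)"
    and "\<And>r. 0 < r \<Longrightarrow> r < T \<Longrightarrow> 0 \<le> a r" and "0 \<le> k"
    and "X 0 = Y 0" and r: "r \<in> {0..T}"
  shows "X r = Y r"
proof -
  have "\<bar>X r - Y r\<bar> \<le> 0"
  proof (rule abs_le_supersolution[where X = "\<lambda>r. X r - Y r" and Z = "\<lambda>_. 0" and Z' = "\<lambda>_. 0" and a = a and k = k and p = 0 and T = T
      and X' = "\<lambda>r. (- k * (X r - Y r) - a r * r\<^sup>2 * (X r - Y r)) / r"])
    fix t assume t: "0 < t" "t < T"
    have "((\<lambda>r. X r - Y r) has_real_derivative (g t - k * X t - a t * t\<^sup>2 * X t) / t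
        - (g t - k * Y t - a t * t\<^sup>2 * Y t) / t) (at t)"
      using X[OF t] Y[OF t] by (rule DERIV_diff)
    then show "((\<lambda>r. X r - Y r) has_real_derivative
        (- k * (X t - Y t) - a t * t\<^sup>2 * (X t - Y t)) / t) (at t)"
      by (rule DERIV_cong) (use t in \<open>simp add: field_simps\<close>)
  qed (use assms in \<open>auto intro!: continuous_intros\<close>)
  then show ?thesis by simp
qed

lemma integral_has_derivative_interior:
  fixes g :: "real \<Rightarrow> real"
  assumes "continuous_on {0..T} g" and "0 < r" and "r < T"
  shows "((\<lambda>r. integral {0..r} g) has_real_derivative g r) (at r)"
  using integral_has_real_derivative[OF assms(1), of r] assms by (simp add: at_within_Icc_at)

lemma continuous_on_indefinite_integral:
  fixes g :: "real \<Rightarrow> real"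
  assumes "continuous_on {0..T} g"
  shows "continuous_on {0..T} (\<lambda>r. integral {0..r} g)"
  using assms by (intro indefinite_integral_continuous_1 integrable_continuous_real)

lemma continuous_on_halflineI:
  fixes f :: "real \<Rightarrow> real"
  assumes "\<And>T. 0 < T \<Longrightarrow> continuous_on {0..T} f"
  shows "continuous_on {0..} f"
  unfolding continuous_on_eq_continuous_within
proof
  fix x :: real assume x: "x \<in> {0..}"
  have "continuous (at x within {0..x+1}) f"
    using assms[of "x+1"] x by (auto simp: continuous_on_eq_continuous_within)
  moreover have "at x within {0..x+1} = at x within {0..}"
    by (rule at_within_nhd[of _ "{..<x+1}"]) (use x in auto)
  ultimately show "continuous (at x within {0..}) f" by simp
qed

lemma abs_integral_le_const:
  fixes f g :: "real \<Rightarrow> real"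
  assumes "f integrable_on S" and "g integrable_on S" and "\<And>s. s \<in> S \<Longrightarrow> \<bar>f s\<bar> \<le> g s"
  shows "\<bar>integral S f\<bar> \<le> integral S g"
  using integral_norm_bound_integral[of f S g] assms by auto

lemma integral_pow:
  assumes "0 \<le> (r::real)"
  shows "((\<lambda>s. s ^ n) has_integral r ^ Suc n / Suc n) {0..r}"
proof -
  have "((\<lambda>s. s ^ n) has_integral r ^ Suc n / Suc n - 0 ^ Suc n / Suc n) {0..r}"
    using assms
    by (intro fundamental_theorem_of_calculus)
       (auto intro!: derivative_eq_intros simp flip: has_real_derivative_iff_has_vector_derivative
         simp del: power_Suc)
  then show ?thesis by simp
qed

text \<open>The integrating factor is r^k exp (\<integral> a s). Integrating from the singular point 0 selects
the regular solution; it is continuous there with value 0 because \<bar>X r\<bar> is at most the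
maximum of \<bar>g\<bar> on [0,r].\<close>
lemma linear_ode_solution:
  fixes a g :: "real \<Rightarrow> real" and k :: nat
  assumes k: "1 \<le> k" and a: "continuous_on {0..} a" "\<And>r. 0 \<le> r \<Longrightarrow> 0 \<le> a r"
    and g: "continuous_on {0..} g" "g 0 = 0"
  obtains X where "continuous_on {0..} X" and "X 0 = 0"
    and "\<And>r. 0 < r \<Longrightarrow> (X has_real_derivative (g r - real k * X r - a r * r\<^sup>2 * X r) / r) (at r)"
proof -
  (* r^k exp (A r) is the integrating factor. *)
  define A where "A r = integral {0..r} (\<lambda>s. a s * s)" for r
  define h where "h = (\<lambda>s. s ^ (k-1) * exp (A s) * g s)"
  define X where "X r = integral {0..r} h / (r ^ k * exp (A r))" for r
  have cg: "continuous_on {0..T} g" and ca: "continuous_on {0..T} a" for T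
    using g(1) a(1) by (auto elim: continuous_on_subset)
  have contA: "continuous_on {0..T} A" for T
    unfolding A_def by (intro continuous_on_indefinite_integral continuous_intros ca)
  have derA: "(A has_real_derivative a r * r) (at r)" if "0 < r" for r
    unfolding A_def using that
    by (intro integral_has_derivative_interior[of "r+1"] continuous_intros ca) auto
  have conth: "continuous_on {0..T} h" for T
    unfolding h_def by (intro continuous_intros contA cg)
  have derX: "(X has_real_derivative (g r - real k * X r - a r * r\<^sup>2 * X r) / r) (at r)"
    if r: "0 < r" for r
  proof -
    have dI: "((\<lambda>r. integral {0..r} h) has_real_derivative h r) (at r)"
      using r by (intro integral_has_derivative_interior[of "r+1"] conth) auto
    have rk: "r ^ k = r * r ^ (k-1)" using k by (cases k) auto
    have "(X has_real_derivative (h r * (r ^ k * exp (A r)) - integral {0..r} h *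
       (real k * r ^ (k-1) * exp (A r) + r ^ k * (exp (A r) * (a r * r)))) / (r ^ k * exp (A r) * (r ^ k * exp (A r)))) (at r)"
      unfolding X_def using r
      by (auto intro!: derivative_eq_intros dI derA)
    then show ?thesis
      by (rule DERIV_cong)
         (use r in \<open>simp add: X_def h_def rk field_simps power2_eq_square\<close>)
  qed
  have Amono: "A s \<le> A r" if "0 \<le> s" "s \<le> r" for r s
    unfolding A_def using that
    by (intro integral_subset_le integrable_continuous_real continuous_intros ca)
       (auto intro!: a(2) mult_nonneg_nonneg)
  have small: "\<bar>X r\<bar> \<le> e" if e: "\<And>s. 0 \<le> s \<Longrightarrow> s \<le> r \<Longrightarrow> \<bar>g s\<bar> \<le> e" and r: "0 < r" for e r
  proof -
    have e0: "0 \<le> e" using e[of 0] r by fastforce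
    have "\<bar>integral {0..r} h\<bar> \<le> integral {0..r} (\<lambda>s. exp (A r) * e * s ^ (k-1))"
    proof (rule abs_integral_le_const)
      fix s assume s: "s \<in> {0..r}"
      have "\<bar>h s\<bar> = s ^ (k-1) * (exp (A s) * \<bar>g s\<bar>)" using s by (simp add: h_def abs_mult)
      also have "\<dots> \<le> s ^ (k-1) * (exp (A r) * e)"
        using s e[of s] Amono[of s r] by (intro mult_left_mono mult_mono) auto
      finally show "\<bar>h s\<bar> \<le> exp (A r) * e * s ^ (k-1)" by (simp add: mult_ac)
    qed (auto intro!: integrable_continuous_real continuous_intros conth)
    also have "\<dots> = exp (A r) * e * (r ^ k / k)"
      using integral_unique[OF integral_pow[of r "k-1"]] r k by simp
    also have "\<dots> \<le> exp (A r) * e * r ^ k"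
      using k r e0 by (intro mult_left_mono) (auto simp: divide_le_eq)
    finally have "\<bar>integral {0..r} h\<bar> \<le> e * (r ^ k * exp (A r))" by (simp add: mult_ac)
    then show ?thesis using r by (simp add: X_def abs_mult divide_le_eq)
  qed
  have X0: "X 0 = 0" unfolding X_def by simp
  have "continuous_on {0..} X"
    unfolding continuous_on_eq_continuous_within
  proof
    fix r :: real assume "r \<in> {0..}"
    then consider "r = 0" | "0 < r" by fastforce
    then show "continuous (at r within {0..}) X"
    proof cases
      case 1
      have "(X \<longlongrightarrow> X 0) (at 0 within {0..})"
      proof (rule tendstoI)
        fix e :: real assume "0 < e"
        have "continuous (at 0 within {0..}) g"
          using g(1) by (auto simp: continuous_on_eq_continuous_within)
        then obtain \<rho> where \<rho>: "\<rho> > 0" "\<And>s. s \<ge> 0 \<Longrightarrow> s < \<rho> \<Longrightarrow> \<bar>g s\<bar> < e/2"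
          using \<open>0 < e\<close> g(2) unfolding continuous_within_eps_delta
          by (metis atLeast_iff dist_0_norm dist_commute half_gt_zero real_norm_def abs_of_nonneg)
        show "\<forall>\<^sub>F x in at 0 within {0..}. dist (X x) (X 0) < e"
          unfolding eventually_at
        proof (intro exI[of _ \<rho>] conjI ballI impI)
          fix x :: real assume x: "x \<in> {0..}" "x \<noteq> 0 \<and> dist x 0 < \<rho>"
          then have "\<bar>X x\<bar> \<le> e/2" using \<rho>(2) by (intro small) (auto simp: less_imp_le)
          then show "dist (X x) (X 0) < e" using \<open>0 < e\<close> X0 by simp
        qed (use \<rho> in auto)
      qed
      then show ?thesis using 1 by (simp add: continuous_within)
    next
      case 2
      then show ?thesis using derX DERIV_isCont continuous_at_imp_continuous_at_within by blast
    qed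
  qed
  then show thesis using that X0 derX by blast
qed

section \<open>The weight and its barrier property\<close>

definition decay :: "real \<Rightarrow> real \<Rightarrow> real" where
  "decay \<eta> r = 1 / (1 + \<eta> * r)"

lemma decay_pos: "0 < \<eta> \<Longrightarrow> 0 \<le> r \<Longrightarrow> 0 < decay \<eta> r"
  by (simp add: decay_def add_pos_nonneg)

lemma decay_le_one: "0 < \<eta> \<Longrightarrow> 0 \<le> r \<Longrightarrow> decay \<eta> r \<le> 1"
  by (simp add: decay_def divide_le_eq add_pos_nonneg)

lemma decay_0 [simp]: "decay \<eta> 0 = 1"
  by (simp add: decay_def)

lemma mult_decay_le: "0 < \<eta> \<Longrightarrow> 0 \<le> r \<Longrightarrow> r * decay \<eta> r \<le> 1 / \<eta>"
  by (simp add: decay_def field_simps add_pos_nonneg)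

lemma decay_pow_antimono: "0 < \<eta> \<Longrightarrow> 0 \<le> r \<Longrightarrow> m \<le> n \<Longrightarrow> decay \<eta> r ^ n \<le> decay \<eta> r ^ m"
  using decay_pos decay_le_one by (intro power_decreasing) (auto simp: less_imp_le)

lemma continuous_on_decay: "0 < \<eta> \<Longrightarrow> S \<subseteq> {0..} \<Longrightarrow> continuous_on S (decay \<eta>)"
  unfolding decay_def by (intro continuous_intros) (auto simp: add_pos_nonneg add_nonneg_eq_0_iff subset_eq)

lemma has_derivative_decay_pow:
  assumes "0 < \<eta>" "0 \<le> r"
  shows "((\<lambda>r. decay \<eta> r ^ n) has_real_derivative - (real n * \<eta> * decay \<eta> r ^ Suc n)) (at r)"
proof -
  have "1 + \<eta> * r \<noteq> 0" using assms by (smt (verit) mult_nonneg_nonneg)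
  then have "(decay \<eta> has_real_derivative - (\<eta> * decay \<eta> r ^ 2)) (at r)"
    unfolding decay_def by (auto intro!: derivative_eq_intros simp: power2_eq_square field_simps)
  from DERIV_power[OF this, of n] show ?thesis
    by (cases n) (auto simp: power2_eq_square mult_ac)
qed

text \<open>This makes the running average of the squared weight equal to the weight itself.\<close>
lemma integral_decay_square:
  assumes "0 < \<eta>" "0 \<le> r"
  shows "((\<lambda>s. decay \<eta> s ^ 2) has_integral r * decay \<eta> r) {0..r}"
proof -
  have "((\<lambda>s. decay \<eta> s ^ 2) has_integral r * decay \<eta> r - 0 * decay \<eta> 0) {0..r}"
  proof (rule fundamental_theorem_of_calculus)
    fix x assume x: "x \<in> {0..r}"
    then have nz: "1 + \<eta> * x \<noteq> 0" using assms by (smt (verit) atLeastAtMost_iff mult_nonneg_nonneg)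
    have "((\<lambda>r. r * decay \<eta> r) has_real_derivative decay \<eta> x + x * (- (1 * \<eta> * decay \<eta> x ^ 2))) (at x)"
      using has_derivative_decay_pow[of \<eta> x 1] assms x
      by (auto intro!: derivative_eq_intros simp: power2_eq_square)
    moreover have "decay \<eta> x + x * (- (1 * \<eta> * decay \<eta> x ^ 2)) = decay \<eta> x ^ 2"
    proof -
      have "decay \<eta> x * (1 + \<eta> * x) = 1" using nz by (simp add: decay_def)
      then have "decay \<eta> x * (decay \<eta> x * (1 + \<eta> * x)) = decay \<eta> x" by simp
      then show ?thesis by (simp add: algebra_simps power2_eq_square)
    qed
    ultimately show "((\<lambda>r. r * decay \<eta> r) has_vector_derivative decay \<eta> x ^ 2) (at x within {0..r})"
      by (metis has_real_derivative_iff_has_vector_derivative has_field_derivative_at_within)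
  qed (use assms in auto)
  then show ?thesis by simp
qed

text \<open>The gain of two powers of decay. The term a r^2 X is what produces it: for large r it forces X to
be about g / (a r^2), while near 0 the term k X bounds X by g. The cube of the weight interpolates
between the two regimes and is a supersolution as soon as 9 \<eta>^2 \<le> a0. The constant 2 does
not depend on \<eta>, k or T.\<close>
lemma decay_bound_linear_ode:
  fixes X X' a :: "real \<Rightarrow> real"
  assumes \<eta>: "0 < \<eta>" "9 * \<eta>\<^sup>2 \<le> a0" and k: "1 \<le> k"
    and cont: "continuous_on {0..T} X" and X0: "X 0 = 0"
    and der: "\<And>r. 0 < r \<Longrightarrow> r < T \<Longrightarrow> (X has_real_derivative X' r) (at r)"
    and a: "\<And>r. 0 < r \<Longrightarrow> r < T \<Longrightarrow> a0 \<le> a r" and g: "0 \<le> g"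
    and eq: "\<And>r. 0 < r \<Longrightarrow> r < T \<Longrightarrow>
      \<bar>r * X' r + k * X r + a r * r\<^sup>2 * X r\<bar> \<le> g * decay \<eta> r"
    and r: "r \<in> {0..T}"
  shows "\<bar>X r\<bar> \<le> 2 * g * decay \<eta> r ^ 3"
proof (rule abs_le_supersolution[where X = X and X' = X' and Z = "\<lambda>r. 2 * g * decay \<eta> r ^ 3" and k = k
      and Z' = "\<lambda>r. 2 * g * (- (3 * \<eta> * decay \<eta> r ^ 4))" and a = a and p = 0 and T = T])
  have a0: "0 \<le> a0" using \<eta> by (smt (verit) zero_le_power2)
  fix t assume t: "0 < t" "t < T"
  show "((\<lambda>r. 2 * g * decay \<eta> r ^ 3) has_real_derivative 2 * g * (- (3 * \<eta> * decay \<eta> t ^ 4))) (at t)"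
    using has_derivative_decay_pow[of \<eta> t 3] \<eta> t
    by (intro DERIV_cmult) (auto simp: numeral_eq_Suc)
  show "0 \<le> a t" using a[OF t] a0 by linarith
  define s where "s = decay \<eta> t"
  have s: "s > 0" using decay_pos \<eta> t unfolding s_def by auto
  have pos: "1 + \<eta> * t > 0" using \<eta> t by (simp add: add_pos_pos)
  have s1: "s * (1 + \<eta> * t) = 1" using pos unfolding s_def decay_def by simp
  (* What the supersolution property of 2 g s^3 amounts to, with a0 replaced by its least value 9
     \<eta>^2: with x = \<eta> t the difference of the two sides is (1 - 4 x)^2 / 2 + x^2 / 2. *)
  have q: "(1 + \<eta> * t)\<^sup>2 / 2 \<le> 1 - 3 * \<eta> * t + a0 * t\<^sup>2"
  proof -
    have "0 \<le> (1 - 4 * (\<eta> * t))\<^sup>2 / 2 + \<eta>\<^sup>2 * t\<^sup>2 / 2 + (a0 - 9 * \<eta>\<^sup>2) * t\<^sup>2"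
      using \<eta> by (intro add_nonneg_nonneg mult_nonneg_nonneg) auto
    also have "\<dots> = 1 - 3 * \<eta> * t + a0 * t\<^sup>2 - (1 + \<eta> * t)\<^sup>2 / 2"
      by (simp add: field_simps power2_eq_square)
    finally show ?thesis by simp
  qed
  have "\<eta> * t * s \<le> \<eta> * t"
    using decay_le_one[of \<eta> t] \<eta> t unfolding s_def by (intro mult_left_le) auto
  then have "(1 + \<eta> * t)\<^sup>2 / 2 \<le> k - 3 * \<eta> * t * s + a0 * t\<^sup>2"
    using q k by linarith
  also have "\<dots> \<le> k - 3 * \<eta> * t * s + a t * t\<^sup>2"
    using a[OF t] by (intro add_left_mono mult_right_mono) auto
  finally have "2 * g * s ^ 3 * ((1 + \<eta> * t)\<^sup>2 / 2) \<le> 2 * g * s ^ 3 * (k - 3 * \<eta> * t * s + a t * t\<^sup>2)"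
    using g s by (intro mult_left_mono) auto
  moreover have "2 * g * s ^ 3 * ((1 + \<eta> * t)\<^sup>2 / 2) = g * s * (s * (1 + \<eta> * t))\<^sup>2"
    by (simp add: power2_eq_square power3_eq_cube)
  moreover have "g * s * (s * (1 + \<eta> * t))\<^sup>2 = g * s"
    by (simp only: s1 one_power2 mult_1_right)
  ultimately have "g * s \<le> 2 * g * s ^ 3 * (k - 3 * \<eta> * t * s + a t * t\<^sup>2)"
    by linarith
  also have "\<dots> = t * (2 * g * (- (3 * \<eta> * s ^ 4))) + k * (2 * g * s ^ 3) + a t * t\<^sup>2 * (2 * g * s ^ 3)"
    by (simp add: algebra_simps numeral_eq_Suc)
  finally show "\<bar>t * X' t + k * X t + a t * t\<^sup>2 * X t\<bar> \<le>
    t * (2 * g * (- (3 * \<eta> * decay \<eta> t ^ 4))) + k * (2 * g * decay \<eta> t ^ 3) + a t * t\<^sup>2 * (2 * g * decay \<eta> t ^ 3)"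
    using eq[OF t] unfolding s_def by linarith
qed (use cont der \<eta> k g X0 r in \<open>auto intro!: continuous_intros continuous_on_decay\<close>)

text \<open>The Cauchy criterion with a rate: the estimate between two radii survives the passage to the limit
in the larger one.\<close>
lemma limit_with_decay_rate:
  fixes f :: "real \<Rightarrow> real"
  assumes \<eta>: "0 < \<eta>"
    and est: "\<And>s r. 0 \<le> s \<Longrightarrow> s \<le> r \<Longrightarrow> \<bar>f r - f s\<bar> \<le> K * decay \<eta> s ^ 2"
  obtains L where "\<And>s. 0 \<le> s \<Longrightarrow> \<bar>f s - L\<bar> \<le> K * decay \<eta> s ^ 2"
proof -
  have d0: "(\<lambda>n. K * decay \<eta> (real n) ^ 2) \<longlonglongrightarrow> K * 0 ^ 2"
  proof (intro tendsto_intros)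
    have "filterlim (\<lambda>n. 1 + \<eta> * real n) at_top sequentially"
      using \<eta> by (intro filterlim_tendsto_add_at_top[OF tendsto_const]
          filterlim_tendsto_pos_mult_at_top[OF tendsto_const] filterlim_real_sequentially)
    then show "(\<lambda>n. decay \<eta> (real n)) \<longlonglongrightarrow> 0"
      unfolding decay_def by (intro tendsto_divide_0[OF tendsto_const]) (simp add: filterlim_at_top_imp_at_infinity)
  qed
  have "Cauchy (\<lambda>n. f (real n))"
  proof (rule metric_CauchyI)
    fix e :: real assume "0 < e"
    then have "\<forall>\<^sub>F n in sequentially. K * decay \<eta> (real n) ^ 2 < e"
      using order_tendstoD(2)[OF d0, of e] by simp
    then obtain N where N: "\<And>n. n \<ge> N \<Longrightarrow> K * decay \<eta> (real n) ^ 2 < e"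
      by (auto simp: eventually_sequentially)
    show "\<exists>M. \<forall>m\<ge>M. \<forall>n\<ge>M. dist (f (real m)) (f (real n)) < e"
    proof (intro exI allI impI)
      fix m n assume "N \<le> m" "N \<le> n"
      then show "dist (f (real m)) (f (real n)) < e"
        using est[of "real m" "real n"] est[of "real n" "real m"] N[of m] N[of n]
        by (cases "m \<le> n") (auto simp: dist_real_def abs_minus_commute)
    qed
  qed
  then obtain L where L: "(\<lambda>n. f (real n)) \<longlonglongrightarrow> L"
    using Cauchy_convergent_iff convergent_def by blast
  have "\<bar>f s - L\<bar> \<le> K * decay \<eta> s ^ 2" if s: "0 \<le> s" for s
  proof (rule tendsto_upperbound[of "\<lambda>n. \<bar>f s - f (real n)\<bar>" _ sequentially])
    show "(\<lambda>n. \<bar>f s - f (real n)\<bar>) \<longlonglongrightarrow> \<bar>f s - L\<bar>"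
      by (intro tendsto_intros L)
    show "\<forall>\<^sub>F n in sequentially. \<bar>f s - f (real n)\<bar> \<le> K * decay \<eta> s ^ 2"
      using eventually_ge_at_top[of "nat \<lceil>s\<rceil>"]
    proof eventually_elim
      case (elim n)
      then have "s \<le> real n" by linarith
      then show ?case using est[of s "real n"] s by (simp add: abs_minus_commute)
    qed
  qed auto
  then show thesis using that by blast
qed

lemma integral_decay_cube_tail:
  assumes "0 < \<eta>" "0 \<le> s" "s \<le> r"
  shows "integral {s..r} (\<lambda>t. decay \<eta> t ^ 3) \<le> decay \<eta> s ^ 2 / (2 * \<eta>)"
proof -
  have "((\<lambda>t. decay \<eta> t ^ 3) has_integral - (decay \<eta> r ^ 2) / (2*\<eta>) - - (decay \<eta> s ^ 2) / (2*\<eta>)) {s..r}"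
  proof (rule fundamental_theorem_of_calculus)
    fix x assume x: "x \<in> {s..r}"
    have "((\<lambda>t. - (decay \<eta> t ^ 2) / (2*\<eta>)) has_real_derivative
        - (- (real 2 * \<eta> * decay \<eta> x ^ Suc 2)) / (2*\<eta>)) (at x)"
      using assms x by (intro DERIV_cdivide DERIV_minus has_derivative_decay_pow) auto
    moreover have "- (- (real 2 * \<eta> * decay \<eta> x ^ Suc 2)) / (2*\<eta>) = decay \<eta> x ^ 3"
      using assms by (simp add: numeral_eq_Suc)
    ultimately show "((\<lambda>t. - (decay \<eta> t ^ 2) / (2*\<eta>)) has_vector_derivative decay \<eta> x ^ 3) (at x within {s..r})"
      by (metis has_real_derivative_iff_has_vector_derivative has_field_derivative_at_within)
  qed (use assms in auto)
  from integral_unique[OF this] show ?thesis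
    using divide_nonneg_pos[OF zero_le_power2[of "decay \<eta> r"], of "2 * \<eta>"] assms by linarith
qed

lemma integral_tail_decay:
  fixes f :: "real \<Rightarrow> real"
  assumes \<eta>: "0 < \<eta>" and cont: "continuous_on {0..} f"
    and est: "\<And>r. 0 \<le> r \<Longrightarrow> \<bar>f r\<bar> \<le> K * decay \<eta> r ^ 3" and K: "0 \<le> K"
    and s: "0 \<le> s" "s \<le> r"
  shows "\<bar>integral {0..r} f - integral {0..s} f\<bar> \<le> K / (2 * \<eta>) * decay \<eta> s ^ 2"
proof -
  have int: "f integrable_on {x..y}" if "0 \<le> x" for x y
    using that by (intro integrable_continuous_real continuous_on_subset[OF cont]) auto
  have "integral {0..s} f + integral {s..r} f = integral {0..r} f"
    using s int[of 0 r] by (intro Henstock_Kurzweil_Integration.integral_combine) auto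
  moreover have "\<bar>integral {s..r} f\<bar> \<le> integral {s..r} (\<lambda>t. K * decay \<eta> t ^ 3)"
    using s \<eta> by (intro abs_integral_le_const int est integrable_continuous_real continuous_intros continuous_on_decay) auto
  moreover have "\<dots> \<le> K * (decay \<eta> s ^ 2 / (2 * \<eta>))"
    using mult_left_mono[OF integral_decay_cube_tail[OF \<eta> s] K] by simp
  ultimately show ?thesis by simp
qed

section \<open>Bounds uniform in a family of inputs\<close>

text \<open>Estimates for the Picard step have to hold with one constant for all its inputs, and the same
estimates are needed for differences of two inputs. A family of functions indexed by
\<open>J\<close> carries both: each index \<open>j\<close> stands for one input on the interval
[0, \<open>T j\<close>] with the small parameter \<open>eps j\<close>, and a triple (j, k,
\<delta>) in \<open>pairs\<close> records that j and k are two inputs for the same parameter and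
interval at distance at most \<delta>.\<close>
locale uniform_family =
  fixes \<eta> :: real and J :: "'j set" and pairs :: "('j \<times> 'j \<times> real) set" and eps T :: "'j \<Rightarrow> real"
  assumes eta_pos: "0 < \<eta>"
    and eps_bounds: "\<And>j. j \<in> J \<Longrightarrow> 0 < eps j \<and> eps j \<le> 1"
    and pairsD: "\<And>j k \<delta>. (j, k, \<delta>) \<in> pairs \<Longrightarrow> j \<in> J \<and> k \<in> J \<and> eps k = eps j \<and> T k = T j \<and> 0 \<le> \<delta>"
begin

definition wt :: "nat \<Rightarrow> nat \<Rightarrow> 'j \<Rightarrow> real \<Rightarrow> real" where
  "wt e n j r = eps j ^ e * decay \<eta> r ^ n"

text \<open>Tame of type (e, n): of size \<open>eps ^ e * decay \<eta> ^ n\<close>, and Lipschitz in the input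
with a constant of the same size. Sums, products, averages and solutions of linear equations of
tame families are tame, with types that are read off from the expression. The constant K is not
tracked.\<close>
definition tame :: "nat \<Rightarrow> nat \<Rightarrow> ('j \<Rightarrow> real \<Rightarrow> real) \<Rightarrow> bool" where
  "tame e n f \<longleftrightarrow> (\<exists>K\<ge>0.
     (\<forall>j\<in>J. \<forall>r\<in>{0..T j}. \<bar>f j r\<bar> \<le> K * wt e n j r) \<and>
     (\<forall>(j, k, \<delta>)\<in>pairs. \<forall>r\<in>{0..T j}. \<bar>f j r - f k r\<bar> \<le> K * \<delta> * wt e n j r))"

lemma tameI:
  assumes "0 \<le> K" and "\<And>j r. j \<in> J \<Longrightarrow> 0 \<le> r \<Longrightarrow> r \<le> T j \<Longrightarrow> \<bar>f j r\<bar> \<le> K * wt e n j r"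
    and "\<And>j k \<delta> r. (j, k, \<delta>) \<in> pairs \<Longrightarrow> 0 \<le> r \<Longrightarrow> r \<le> T j \<Longrightarrow> \<bar>f j r - f k r\<bar> \<le> K * \<delta> * wt e n j r"
  shows "tame e n f"
  unfolding tame_def using assms by (intro exI[of _ K]) auto

lemma tameE:
  assumes "tame e n f"
  obtains K where "0 \<le> K" and "\<And>j r. j \<in> J \<Longrightarrow> 0 \<le> r \<Longrightarrow> r \<le> T j \<Longrightarrow> \<bar>f j r\<bar> \<le> K * wt e n j r"
    and "\<And>j k \<delta> r. (j, k, \<delta>) \<in> pairs \<Longrightarrow> 0 \<le> r \<Longrightarrow> r \<le> T j \<Longrightarrow> \<bar>f j r - f k r\<bar> \<le> K * \<delta> * wt e n j r"
proof -
  obtain K where "K \<ge> 0" "\<forall>j\<in>J. \<forall>r\<in>{0..T j}. \<bar>f j r\<bar> \<le> K * wt e n j r"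
     and D: "\<forall>(j, k, \<delta>)\<in>pairs. \<forall>r\<in>{0..T j}. \<bar>f j r - f k r\<bar> \<le> K * \<delta> * wt e n j r"
    using assms unfolding tame_def by blast
  moreover have "\<And>j k \<delta> r. (j, k, \<delta>) \<in> pairs \<Longrightarrow> 0 \<le> r \<Longrightarrow> r \<le> T j \<Longrightarrow> \<bar>f j r - f k r\<bar> \<le> K * \<delta> * wt e n j r"
    using D by fastforce
  ultimately show thesis using that[of K] by auto
qed

lemma wt_nonneg: "j \<in> J \<Longrightarrow> 0 \<le> r \<Longrightarrow> 0 \<le> wt e n j r"
  unfolding wt_def using eps_bounds decay_pos[OF eta_pos] by (simp add: less_imp_le)

lemma wt_antimono: "j \<in> J \<Longrightarrow> 0 \<le> r \<Longrightarrow> e' \<le> e \<Longrightarrow> n' \<le> n \<Longrightarrow> wt e n j r \<le> wt e' n' j r"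
  unfolding wt_def using eps_bounds[of j] decay_pos[OF eta_pos, of r] decay_le_one[OF eta_pos, of r]
  by (intro mult_mono power_decreasing) (auto simp: less_imp_le)

lemma wt_mult: "wt e n j r * wt e' n' j r = wt (e + e') (n + n') j r"
  unfolding wt_def by (simp add: power_add)

lemma wt_pair: "(j, k, \<delta>) \<in> pairs \<Longrightarrow> wt e n k r = wt e n j r"
  unfolding wt_def using pairsD by metis

lemma tame_mono:
  assumes "tame e n f" and "e' \<le> e" and "n' \<le> n"
  shows "tame e' n' f"
proof -
  from assms(1) obtain K where K: "0 \<le> K"
    "\<And>j r. j \<in> J \<Longrightarrow> 0 \<le> r \<Longrightarrow> r \<le> T j \<Longrightarrow> \<bar>f j r\<bar> \<le> K * wt e n j r"
    "\<And>j k \<delta> r. (j, k, \<delta>) \<in> pairs \<Longrightarrow> 0 \<le> r \<Longrightarrow> r \<le> T j \<Longrightarrow> \<bar>f j r - f k r\<bar> \<le> K * \<delta> * wt e n j r"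
    by (rule tameE) (rule that)
  show ?thesis
  proof (rule tameI[OF K(1)])
    fix j r assume j: "j \<in> J" "0 \<le> r" "r \<le> T j"
    have "K * wt e n j r \<le> K * wt e' n' j r"
      using K(1) j assms by (intro mult_left_mono wt_antimono) auto
    then show "\<bar>f j r\<bar> \<le> K * wt e' n' j r" using K(2)[OF j] by linarith
  next
    fix j k \<delta> r assume j: "(j, k, \<delta>) \<in> pairs" "0 \<le> r" "r \<le> T j"
    have "K * \<delta> * wt e n j r \<le> K * \<delta> * wt e' n' j r"
      using K(1) j assms pairsD[OF j(1)] by (intro mult_left_mono wt_antimono mult_nonneg_nonneg) auto
    then show "\<bar>f j r - f k r\<bar> \<le> K * \<delta> * wt e' n' j r" using K(3)[OF j] by linarith
  qed
qed

lemma tame_eq: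
  assumes "tame e n f" and "\<And>j r. j \<in> J \<Longrightarrow> 0 \<le> r \<Longrightarrow> r \<le> T j \<Longrightarrow> g j r = f j r"
  shows "tame e n g"
proof -
  from assms(1) obtain K where K: "0 \<le> K"
    "\<And>j r. j \<in> J \<Longrightarrow> 0 \<le> r \<Longrightarrow> r \<le> T j \<Longrightarrow> \<bar>f j r\<bar> \<le> K * wt e n j r"
    "\<And>j k \<delta> r. (j, k, \<delta>) \<in> pairs \<Longrightarrow> 0 \<le> r \<Longrightarrow> r \<le> T j \<Longrightarrow> \<bar>f j r - f k r\<bar> \<le> K * \<delta> * wt e n j r"
    by (rule tameE) (rule that)
  show ?thesis
    using K assms(2) pairsD by (intro tameI[OF K(1)]) metis+
qed

lemma tame_add:
  assumes "tame e n f" and "tame e n g"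
  shows "tame e n (\<lambda>j r. f j r + g j r)"
proof -
  from assms(1) obtain K where K: "0 \<le> K"
    "\<And>j r. j \<in> J \<Longrightarrow> 0 \<le> r \<Longrightarrow> r \<le> T j \<Longrightarrow> \<bar>f j r\<bar> \<le> K * wt e n j r"
    "\<And>j k \<delta> r. (j, k, \<delta>) \<in> pairs \<Longrightarrow> 0 \<le> r \<Longrightarrow> r \<le> T j \<Longrightarrow> \<bar>f j r - f k r\<bar> \<le> K * \<delta> * wt e n j r"
    by (rule tameE) (rule that)
  from assms(2) obtain L where L: "0 \<le> L"
    "\<And>j r. j \<in> J \<Longrightarrow> 0 \<le> r \<Longrightarrow> r \<le> T j \<Longrightarrow> \<bar>g j r\<bar> \<le> L * wt e n j r"
    "\<And>j k \<delta> r. (j, k, \<delta>) \<in> pairs \<Longrightarrow> 0 \<le> r \<Longrightarrow> r \<le> T j \<Longrightarrow> \<bar>g j r - g k r\<bar> \<le> L * \<delta> * wt e n j r"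
    by (rule tameE) (rule that)
  show ?thesis
  proof (rule tameI[of "K + L"])
    fix j r assume "j \<in> J" "0 \<le> r" "r \<le> T j"
    from K(2)[OF this] L(2)[OF this]
    show "\<bar>f j r + g j r\<bar> \<le> (K + L) * wt e n j r" by (simp add: algebra_simps)
  next
    fix j k \<delta> r assume "(j, k, \<delta>) \<in> pairs" "0 \<le> r" "r \<le> T j"
    from K(3)[OF this] L(3)[OF this]
    show "\<bar>f j r + g j r - (f k r + g k r)\<bar> \<le> (K + L) * \<delta> * wt e n j r" by (simp add: algebra_simps)
  qed (use K L in auto)
qed

lemma tame_mult:
  assumes "tame e n f" and "tame e' n' g"
  shows "tame (e + e') (n + n') (\<lambda>j r. f j r * g j r)"
proof -
  from assms(1) obtain K where K: "0 \<le> K"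
    "\<And>j r. j \<in> J \<Longrightarrow> 0 \<le> r \<Longrightarrow> r \<le> T j \<Longrightarrow> \<bar>f j r\<bar> \<le> K * wt e n j r"
    "\<And>j k \<delta> r. (j, k, \<delta>) \<in> pairs \<Longrightarrow> 0 \<le> r \<Longrightarrow> r \<le> T j \<Longrightarrow> \<bar>f j r - f k r\<bar> \<le> K * \<delta> * wt e n j r"
    by (rule tameE) (rule that)
  from assms(2) obtain L where L: "0 \<le> L"
    "\<And>j r. j \<in> J \<Longrightarrow> 0 \<le> r \<Longrightarrow> r \<le> T j \<Longrightarrow> \<bar>g j r\<bar> \<le> L * wt e' n' j r"
    "\<And>j k \<delta> r. (j, k, \<delta>) \<in> pairs \<Longrightarrow> 0 \<le> r \<Longrightarrow> r \<le> T j \<Longrightarrow> \<bar>g j r - g k r\<bar> \<le> L * \<delta> * wt e' n' j r"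
    by (rule tameE) (rule that)
  show ?thesis
  proof (rule tameI[of "2 * (K * L)"])
    fix j r assume j: "j \<in> J" "0 \<le> r" "r \<le> T j"
    have "\<bar>f j r * g j r\<bar> \<le> (K * wt e n j r) * (L * wt e' n' j r)"
      unfolding abs_mult using K(2)[OF j] L(2)[OF j] by (intro mult_mono) auto
    also have "\<dots> = K * L * wt (e + e') (n + n') j r" by (simp flip: wt_mult)
    also have "\<dots> \<le> 2 * (K * L) * wt (e + e') (n + n') j r"
      using K(1) L(1) wt_nonneg[OF j(1,2)] by (intro mult_right_mono) auto
    finally show "\<bar>f j r * g j r\<bar> \<le> 2 * (K * L) * wt (e + e') (n + n') j r" .
  next
    fix j k \<delta> r assume j: "(j, k, \<delta>) \<in> pairs" "0 \<le> r" "r \<le> T j"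
    have J: "j \<in> J" "k \<in> J" "r \<le> T k" using pairsD[OF j(1)] j by auto
    have "f j r * g j r - f k r * g k r = (f j r - f k r) * g j r + f k r * (g j r - g k r)"
      by (simp add: algebra_simps)
    also have "\<bar>\<dots>\<bar> \<le> \<bar>f j r - f k r\<bar> * \<bar>g j r\<bar> + \<bar>f k r\<bar> * \<bar>g j r - g k r\<bar>"
      by (metis abs_mult abs_triangle_ineq)
    also have "\<dots> \<le> (K * \<delta> * wt e n j r) * (L * wt e' n' j r) + (K * wt e n j r) * (L * \<delta> * wt e' n' j r)"
      using K(3)[OF j] L(2)[OF J(1) j(2,3)] K(2)[OF J(2) j(2) J(3)] L(3)[OF j] wt_pair[OF j(1)]
      by (intro add_mono mult_mono) auto
    also have "\<dots> = 2 * (K * L) * \<delta> * wt (e + e') (n + n') j r" by (simp flip: wt_mult)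
    finally show "\<bar>f j r * g j r - f k r * g k r\<bar> \<le> 2 * (K * L) * \<delta> * wt (e + e') (n + n') j r" .
  qed (use K L in auto)
qed

lemma tame_fixed:
  assumes "\<And>r. 0 \<le> r \<Longrightarrow> \<bar>b r\<bar> \<le> K * decay \<eta> r ^ n"
  shows "tame 0 n (\<lambda>j. b)"
proof -
  have K: "0 \<le> K" using assms[of 0] by auto
  show ?thesis
    using K assms pairsD decay_pos[OF eta_pos]
    by (intro tameI[OF K]) (auto simp: wt_def less_imp_le intro!: mult_nonneg_nonneg)
qed

lemma tame_const: "tame 0 0 (\<lambda>j r. c)"
  by (rule tame_fixed[of _ "\<bar>c\<bar>"]) auto

lemma tame_eps: "tame 1 0 (\<lambda>j r. eps j)"
proof (rule tameI[of 1])
  fix j k \<delta> r assume "(j, k, \<delta>) \<in> pairs" "0 \<le> r" "r \<le> T j"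
  then show "\<bar>eps j - eps k\<bar> \<le> 1 * \<delta> * wt 1 0 j r"
    using pairsD[of j k \<delta>] wt_nonneg[of j r] by auto
qed (use eps_bounds in \<open>auto simp: wt_def abs_of_pos\<close>)

lemma tame_cmult: "tame e n f \<Longrightarrow> tame e n (\<lambda>j r. c * f j r)"
  using tame_mult[OF tame_const] by auto

lemma tame_minus: "tame e n f \<Longrightarrow> tame e n (\<lambda>j r. - f j r)"
  using tame_cmult[of e n f "-1"] by simp

lemma tame_diff: "tame e n f \<Longrightarrow> tame e n g \<Longrightarrow> tame e n (\<lambda>j r. f j r - g j r)"
  using tame_add[OF _ tame_minus, of e n f g] by simp

lemma tame_product:
  "tame e1 n1 f \<Longrightarrow> tame e2 n2 g \<Longrightarrow> e \<le> e1 + e2 \<Longrightarrow> n \<le> n1 + n2 \<Longrightarrow> tame e n (\<lambda>j r. f j r * g j r)"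
  using tame_mono[OF tame_mult] by blast

lemma tame_divide_const: "tame e n f \<Longrightarrow> tame e n (\<lambda>j r. f j r / c)"
  using tame_cmult[of e n f "1 / c"] by simp

text \<open>A factor r costs one power of decay.\<close>
lemma tame_radius:
  assumes "tame e (Suc n) f"
  shows "tame e n (\<lambda>j r. r * f j r)"
proof -
  from assms obtain K where K: "0 \<le> K"
    "\<And>j r. j \<in> J \<Longrightarrow> 0 \<le> r \<Longrightarrow> r \<le> T j \<Longrightarrow> \<bar>f j r\<bar> \<le> K * wt e (Suc n) j r"
    "\<And>j k \<delta> r. (j, k, \<delta>) \<in> pairs \<Longrightarrow> 0 \<le> r \<Longrightarrow> r \<le> T j \<Longrightarrow> \<bar>f j r - f k r\<bar> \<le> K * \<delta> * wt e (Suc n) j r"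
    by (rule tameE) (rule that)
  have *: "r * wt e (Suc n) j r \<le> 1 / \<eta> * wt e n j r" if "j \<in> J" "0 \<le> r" for j r
  proof -
    have "r * wt e (Suc n) j r = (r * decay \<eta> r) * wt e n j r" by (simp add: wt_def)
    also have "\<dots> \<le> 1 / \<eta> * wt e n j r"
      using mult_decay_le[OF eta_pos] that wt_nonneg by (intro mult_right_mono) auto
    finally show ?thesis .
  qed
  show ?thesis
  proof (rule tameI[of "K / \<eta>"])
    fix j r assume j: "j \<in> J" "0 \<le> r" "r \<le> T j"
    have "\<bar>r * f j r\<bar> \<le> r * (K * wt e (Suc n) j r)"
      unfolding abs_mult using K(2)[OF j] j by (intro mult_mono) auto
    also have "\<dots> = K * (r * wt e (Suc n) j r)" by simp
    also have "\<dots> \<le> K * (1 / \<eta> * wt e n j r)" using *[OF j(1,2)] K(1) by (intro mult_left_mono) auto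
    finally show "\<bar>r * f j r\<bar> \<le> K / \<eta> * wt e n j r" by simp
  next
    fix j k \<delta> r assume j: "(j, k, \<delta>) \<in> pairs" "0 \<le> r" "r \<le> T j"
    have J: "j \<in> J" "0 \<le> \<delta>" using pairsD[OF j(1)] by auto
    have "\<bar>r * f j r - r * f k r\<bar> = r * \<bar>f j r - f k r\<bar>"
      using j by (simp add: abs_mult flip: right_diff_distrib)
    also have "\<dots> \<le> r * (K * \<delta> * wt e (Suc n) j r)" using K(3)[OF j] j by (intro mult_left_mono) auto
    also have "\<dots> = K * \<delta> * (r * wt e (Suc n) j r)" by simp
    also have "\<dots> \<le> K * \<delta> * (1 / \<eta> * wt e n j r)" using *[OF J(1) j(2)] K(1) J by (intro mult_left_mono) auto
    finally show "\<bar>r * f j r - r * f k r\<bar> \<le> K / \<eta> * \<delta> * wt e n j r" by simp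
  qed (use K eta_pos in auto)
qed

lemma tame_radius_power:
  assumes "tame e (m + n) f"
  shows "tame e n (\<lambda>j r. r ^ m * f j r)"
  using assms
proof (induction m arbitrary: n)
  case (Suc m)
  have "tame e (Suc n) (\<lambda>j r. r ^ m * f j r)" using Suc by simp
  from tame_radius[OF this] show ?case by (simp add: mult.assoc)
qed simp

lemma integral_wt_two:
  assumes "j \<in> J" "0 \<le> r"
  shows "integral {0..r} (wt e 2 j) = r * wt e 1 j r"
proof -
  have "wt e 2 j = (\<lambda>s. eps j ^ e * decay \<eta> s ^ 2)" by (auto simp: wt_def)
  then show ?thesis
    using integral_unique[OF integral_decay_square[OF eta_pos assms(2)]] by (simp add: wt_def)
qed

lemma wt_integrable: "0 \<le> r \<Longrightarrow> wt e n j integrable_on {0..r}"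
  unfolding wt_def by (intro integrable_continuous_real continuous_intros continuous_on_decay eta_pos) auto

lemma tame_average:
  assumes f: "tame e 2 f" and cont: "\<And>j. j \<in> J \<Longrightarrow> continuous_on {0..T j} (f j)"
  shows "tame e 1 (\<lambda>j r. integral {0..r} (f j) / r)"
proof -
  from f obtain K where K: "0 \<le> K"
    "\<And>j r. j \<in> J \<Longrightarrow> 0 \<le> r \<Longrightarrow> r \<le> T j \<Longrightarrow> \<bar>f j r\<bar> \<le> K * wt e 2 j r"
    "\<And>j k \<delta> r. (j, k, \<delta>) \<in> pairs \<Longrightarrow> 0 \<le> r \<Longrightarrow> r \<le> T j \<Longrightarrow> \<bar>f j r - f k r\<bar> \<le> K * \<delta> * wt e 2 j r"
    by (rule tameE) (rule that)
  have int: "f j integrable_on {0..r}" if "j \<in> J" "r \<le> T j" for j r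
    using that by (intro integrable_continuous_real continuous_on_subset[OF cont]) auto
  show ?thesis
  proof (rule tameI[OF K(1)])
    fix j r assume j: "j \<in> J" "0 \<le> r" "r \<le> T j"
    have "\<bar>integral {0..r} (f j)\<bar> \<le> integral {0..r} (\<lambda>s. K * wt e 2 j s)"
      using j by (intro abs_integral_le_const int K(2) integrable_on_mult_right wt_integrable) auto
    then have "\<bar>integral {0..r} (f j)\<bar> \<le> K * (r * wt e 1 j r)"
      using integral_wt_two[OF j(1,2)] by simp
    then show "\<bar>integral {0..r} (f j) / r\<bar> \<le> K * wt e 1 j r"
      using j K(1) wt_nonneg[OF j(1,2)] by (cases "r = 0") (auto simp: divide_le_eq mult_ac)
  next
    fix j k \<delta> r assume j: "(j, k, \<delta>) \<in> pairs" "0 \<le> r" "r \<le> T j"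
    have J: "j \<in> J" "k \<in> J" "r \<le> T k" "0 \<le> \<delta>" using pairsD[OF j(1)] j by auto
    have "\<bar>integral {0..r} (\<lambda>s. f j s - f k s)\<bar> \<le> integral {0..r} (\<lambda>s. K * \<delta> * wt e 2 j s)"
      using j J by (intro abs_integral_le_const integrable_diff int K(3) integrable_on_mult_right wt_integrable) auto
    then have "\<bar>integral {0..r} (f j) - integral {0..r} (f k)\<bar> \<le> K * \<delta> * (r * wt e 1 j r)"
      using integral_wt_two[OF J(1) j(2)] int J j(3) by (simp add: Henstock_Kurzweil_Integration.integral_diff)
    then show "\<bar>integral {0..r} (f j) / r - integral {0..r} (f k) / r\<bar> \<le> K * \<delta> * wt e 1 j r"
      using j K(1) J wt_nonneg[OF J(1) j(2)]
      by (cases "r = 0") (auto simp: divide_le_eq mult_ac simp flip: diff_divide_distrib)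
  qed
qed

lemma tame_integral:
  assumes f: "tame e 2 f" and cont: "\<And>j. j \<in> J \<Longrightarrow> continuous_on {0..T j} (f j)"
  shows "tame e 0 (\<lambda>j r. integral {0..r} (f j))"
proof -
  have "tame e 0 (\<lambda>j r. r * (integral {0..r} (f j) / r))"
    using tame_average[OF assms] by (intro tame_radius) simp
  then show ?thesis by (rule tame_eq) auto
qed

lemma abs_exp_diff_le:
  fixes x y :: real
  assumes "x \<le> b" "y \<le> b"
  shows "\<bar>exp x - exp y\<bar> \<le> exp b * \<bar>x - y\<bar>"
proof -
  have *: "exp u - exp v \<le> exp b * (u - v)" if "v \<le> u" "u \<le> b" for u v :: real
  proof -
    have "exp u * (1 - (u - v)) \<le> exp u * exp (-(u - v))"
      using exp_ge_add_one_self[of "-(u-v)"] by (intro mult_left_mono) (linarith, simp)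
    then have "exp u - exp v \<le> exp u * (u - v)" by (simp add: algebra_simps flip: exp_add)
    also have "\<dots> \<le> exp b * (u - v)" using that by (intro mult_right_mono) auto
    finally show ?thesis .
  qed
  show ?thesis using *[of y x] *[of x y] assms by (cases "y \<le> x") auto
qed

lemma tame_exp:
  assumes f: "tame 0 0 f"
  shows "tame 0 0 (\<lambda>j r. exp (f j r))"
proof -
  from f obtain K where K: "0 \<le> K"
    "\<And>j r. j \<in> J \<Longrightarrow> 0 \<le> r \<Longrightarrow> r \<le> T j \<Longrightarrow> \<bar>f j r\<bar> \<le> K * wt 0 0 j r"
    "\<And>j k \<delta> r. (j, k, \<delta>) \<in> pairs \<Longrightarrow> 0 \<le> r \<Longrightarrow> r \<le> T j \<Longrightarrow> \<bar>f j r - f k r\<bar> \<le> K * \<delta> * wt 0 0 j r"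
    by (rule tameE) (rule that)
  have le: "f j r \<le> K" if "j \<in> J" "0 \<le> r" "r \<le> T j" for j r
    using K(2)[OF that] by (simp add: wt_def)
  show ?thesis
  proof (rule tameI[of "exp K * (1 + K)"])
    fix j r assume j: "j \<in> J" "0 \<le> r" "r \<le> T j"
    have "exp K * 1 \<le> exp K * (1 + K)" using K(1) by (intro mult_left_mono) auto
    moreover have "exp (f j r) \<le> exp K" using le[OF j] by simp
    ultimately have "exp (f j r) \<le> exp K * (1 + K)" by linarith
    then show "\<bar>exp (f j r)\<bar> \<le> exp K * (1 + K) * wt 0 0 j r" by (simp add: wt_def)
  next
    fix j k \<delta> r assume j: "(j, k, \<delta>) \<in> pairs" "0 \<le> r" "r \<le> T j"
    have J: "j \<in> J" "k \<in> J" "r \<le> T k" "0 \<le> \<delta>" using pairsD[OF j(1)] j by auto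
    have "\<bar>exp (f j r) - exp (f k r)\<bar> \<le> exp K * \<bar>f j r - f k r\<bar>"
      using le J j by (intro abs_exp_diff_le) auto
    also have "\<dots> \<le> exp K * ((1 + K) * \<delta> * wt 0 0 j r)"
      using K(1) K(3)[OF j] J by (intro mult_left_mono) (auto simp: wt_def algebra_simps)
    finally show "\<bar>exp (f j r) - exp (f k r)\<bar> \<le> exp K * (1 + K) * \<delta> * wt 0 0 j r" by (simp add: mult_ac)
  qed (use K in auto)
qed

lemma tame_inverse:
  assumes f: "tame 0 0 f" and c: "0 < c" "\<And>j r. j \<in> J \<Longrightarrow> 0 \<le> r \<Longrightarrow> r \<le> T j \<Longrightarrow> c \<le> f j r"
  shows "tame 0 0 (\<lambda>j r. 1 / f j r)"
proof -
  from f obtain K where K: "0 \<le> K"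
    "\<And>j k \<delta> r. (j, k, \<delta>) \<in> pairs \<Longrightarrow> 0 \<le> r \<Longrightarrow> r \<le> T j \<Longrightarrow> \<bar>f j r - f k r\<bar> \<le> K * \<delta> * wt 0 0 j r"
    by (rule tameE) (rule that)
  show ?thesis
  proof (rule tameI[of "1 / c + K / c\<^sup>2"])
    fix j r assume j: "j \<in> J" "0 \<le> r" "r \<le> T j"
    have "\<bar>1 / f j r\<bar> \<le> 1 / c" using c(2)[OF j] c(1) by (auto simp: frac_le)
    moreover have "0 \<le> K / c\<^sup>2" using K by simp
    ultimately show "\<bar>1 / f j r\<bar> \<le> (1 / c + K / c\<^sup>2) * wt 0 0 j r"
      unfolding wt_def by simp
  next
    fix j k \<delta> r assume j: "(j, k, \<delta>) \<in> pairs" "0 \<le> r" "r \<le> T j"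
    have J: "j \<in> J" "k \<in> J" "r \<le> T k" "0 \<le> \<delta>" using pairsD[OF j(1)] j by auto
    have fp: "c \<le> f j r" "c \<le> f k r" using c(2) J j by auto
    have pos: "c\<^sup>2 \<le> f j r * f k r"
      unfolding power2_eq_square using fp c(1) by (intro mult_mono) auto
    have "1 / f j r - 1 / f k r = (f k r - f j r) / (f j r * f k r)"
      using fp c(1) by (simp add: field_simps)
    also have "\<bar>\<dots>\<bar> = \<bar>f j r - f k r\<bar> / (f j r * f k r)"
      using fp c(1) by (simp add: abs_mult abs_minus_commute)
    also have "\<dots> \<le> (K * \<delta>) / c\<^sup>2"
      using K(2)[OF j] pos c(1) by (intro frac_le) (auto simp: wt_def)
    also have "\<dots> \<le> (1 / c + K / c\<^sup>2) * \<delta>"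
      using J(4) c(1) by (simp add: algebra_simps)
    finally show "\<bar>1 / f j r - 1 / f k r\<bar> \<le> (1 / c + K / c\<^sup>2) * \<delta> * wt 0 0 j r"
      by (simp add: wt_def)
  qed (use K c in auto)
qed

text \<open>The barrier gives the size of X. For the Lipschitz bound, the difference of two solutions solves
the equation of the first with source (g j - g k) - (a j - a k) r^2 X k; two of the three powers
of decay of X k pay for r^2, and the barrier applies again.\<close>
lemma tame_linear_ode:
  assumes a: "tame 0 0 a" "0 < amin" "9 * \<eta>\<^sup>2 \<le> amin"
      "\<And>j r. j \<in> J \<Longrightarrow> 0 \<le> r \<Longrightarrow> r \<le> T j \<Longrightarrow> amin \<le> a j r"
    and k: "1 \<le> k" and g: "tame e 1 g"
    and X: "\<And>j. j \<in> J \<Longrightarrow> continuous_on {0..T j} (X j)" "\<And>j. j \<in> J \<Longrightarrow> X j 0 = 0"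
    and X': "\<And>j r. j \<in> J \<Longrightarrow> 0 < r \<Longrightarrow> r < T j \<Longrightarrow> (X j has_real_derivative X' j r) (at r)"
    and eq: "\<And>j r. j \<in> J \<Longrightarrow> 0 < r \<Longrightarrow> r < T j \<Longrightarrow> r * X' j r + k * X j r + a j r * r\<^sup>2 * X j r = g j r"
  shows "tame e 3 X"
proof -
  from g obtain K where K: "0 \<le> K"
    "\<And>j r. j \<in> J \<Longrightarrow> 0 \<le> r \<Longrightarrow> r \<le> T j \<Longrightarrow> \<bar>g j r\<bar> \<le> K * wt e 1 j r"
    "\<And>j k \<delta> r. (j, k, \<delta>) \<in> pairs \<Longrightarrow> 0 \<le> r \<Longrightarrow> r \<le> T j \<Longrightarrow> \<bar>g j r - g k r\<bar> \<le> K * \<delta> * wt e 1 j r"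
    by (rule tameE) (rule that)
  from a(1) obtain A where A: "0 \<le> A"
    "\<And>j k \<delta> r. (j, k, \<delta>) \<in> pairs \<Longrightarrow> 0 \<le> r \<Longrightarrow> r \<le> T j \<Longrightarrow> \<bar>a j r - a k r\<bar> \<le> A * \<delta> * wt 0 0 j r"
    by (rule tameE) (rule that)
  have eps0: "0 \<le> eps j" if "j \<in> J" for j using eps_bounds[OF that] by simp
  have bound: "\<bar>X j r\<bar> \<le> 2 * K * wt e 3 j r" if j: "j \<in> J" "0 \<le> r" "r \<le> T j" for j r
  proof -
    have "\<bar>X j r\<bar> \<le> 2 * (K * eps j ^ e) * decay \<eta> r ^ 3"
    proof (rule decay_bound_linear_ode[OF eta_pos a(3) k X(1)[OF j(1)] X(2)[OF j(1)], where a = "a j" and X' = "X' j"])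
      show "\<bar>t * X' j t + k * X j t + a j t * t\<^sup>2 * X j t\<bar> \<le> K * eps j ^ e * decay \<eta> t"
        if "0 < t" "t < T j" for t
        using K(2)[of j t] eq[OF j(1) that] that j by (simp add: wt_def mult_ac)
    qed (use X' a(4) K(1) eps0 j in auto)
    then show ?thesis by (simp add: wt_def mult_ac)
  qed
  show ?thesis
  proof (rule tameI[of "2 * K + 2 * (K + 2 * A * K / \<eta>\<^sup>2)"])
    fix j r assume j: "j \<in> J" "0 \<le> r" "r \<le> T j"
    have "2 * K * wt e 3 j r \<le> (2 * K + 2 * (K + 2 * A * K / \<eta>\<^sup>2)) * wt e 3 j r"
      using K(1) A(1) wt_nonneg[OF j(1,2)] by (intro mult_right_mono) auto
    then show "\<bar>X j r\<bar> \<le> (2 * K + 2 * (K + 2 * A * K / \<eta>\<^sup>2)) * wt e 3 j r" using bound[OF j] by linarith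
  next
    fix j i \<delta> r assume j: "(j, i, \<delta>) \<in> pairs" "0 \<le> r" "r \<le> T j"
    have J: "j \<in> J" "i \<in> J" "T i = T j" "0 \<le> \<delta>" using pairsD[OF j(1)] j by auto
    (* The source of the equation for the difference: K from g j - g i, and 2 A K / \<eta>^2 from (a
       j - a i) r^2 X i, where X i is bounded by 2 K. *)
    let ?G = "(K + 2 * A * K / \<eta>\<^sup>2) * \<delta> * eps j ^ e"
    have "\<bar>X j r - X i r\<bar> \<le> 2 * ?G * decay \<eta> r ^ 3"
    proof (rule decay_bound_linear_ode[where X = "\<lambda>r. X j r - X i r", OF eta_pos a(3) k, where a = "a j" and X' = "\<lambda>r. X' j r - X' i r" and T = "T j"])
      show "continuous_on {0..T j} (\<lambda>r. X j r - X i r)"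
        using X(1)[OF J(1)] X(1)[OF J(2)] J(3) by (intro continuous_intros) auto
      show "((\<lambda>r. X j r - X i r) has_real_derivative X' j t - X' i t) (at t)" if "0 < t" "t < T j" for t
        using X'[OF J(1)] X'[OF J(2)] J(3) that by (intro DERIV_diff) auto
      show "0 \<le> ?G" using K A J eps0 by simp
      fix t assume t: "0 < t" "t < T j"
      have eqs: "t * X' j t + k * X j t + a j t * t\<^sup>2 * X j t = g j t"
          "t * X' i t + k * X i t + a i t * t\<^sup>2 * X i t = g i t"
        using eq J t by auto
      have "t * (X' j t - X' i t) + k * (X j t - X i t) + a j t * t\<^sup>2 * (X j t - X i t)
          = (g j t - g i t) - (a j t - a i t) * (t\<^sup>2 * X i t)"
        unfolding eqs[symmetric] by (simp add: algebra_simps)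
      also have "\<bar>\<dots>\<bar> \<le> \<bar>g j t - g i t\<bar> + \<bar>a j t - a i t\<bar> * (t\<^sup>2 * \<bar>X i t\<bar>)"
        by (rule order_trans[OF abs_triangle_ineq4]) (simp add: abs_mult)
      also have "\<dots> \<le> K * \<delta> * wt e 1 j t + A * \<delta> * (t\<^sup>2 * (2 * K * wt e 3 j t))"
        using K(3)[OF j(1), of t] A(2)[OF j(1), of t] bound[OF J(2), of t, unfolded wt_pair[OF j(1)]] t J K(1) A(1)
        by (intro add_mono mult_mono) (auto simp: wt_def)
      also have "t\<^sup>2 * (2 * K * wt e 3 j t) = 2 * K * eps j ^ e * (t * decay \<eta> t)\<^sup>2 * decay \<eta> t"
        by (simp add: wt_def power2_eq_square power3_eq_cube)
      also have "\<dots> \<le> 2 * K * eps j ^ e * (1 / \<eta>)\<^sup>2 * decay \<eta> t"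
        using mult_decay_le[OF eta_pos, of t] decay_pos[OF eta_pos, of t] t K(1) eps0[OF J(1)]
        by (intro mult_right_mono mult_left_mono power_mono) auto
      finally have "\<bar>t * (X' j t - X' i t) + k * (X j t - X i t) + a j t * t\<^sup>2 * (X j t - X i t)\<bar>
          \<le> K * \<delta> * wt e 1 j t + A * \<delta> * (2 * K * eps j ^ e * (1 / \<eta>)\<^sup>2 * decay \<eta> t)"
        using A(1) J(4) by (simp add: mult_left_mono)
      then show "\<bar>t * (X' j t - X' i t) + k * (X j t - X i t) + a j t * t\<^sup>2 * (X j t - X i t)\<bar> \<le> ?G * decay \<eta> t"
        by (simp add: wt_def algebra_simps power_divide)
    qed (use X J a(4) j in auto)
    also have "\<dots> = 2 * (K + 2 * A * K / \<eta>\<^sup>2) * \<delta> * wt e 3 j r" by (simp add: wt_def)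
    also have "\<dots> \<le> (2 * K + 2 * (K + 2 * A * K / \<eta>\<^sup>2)) * \<delta> * wt e 3 j r"
      using K(1) J wt_nonneg[OF J(1) j(2)] by (intro mult_right_mono) auto
    finally show "\<bar>X j r - X i r\<bar> \<le> (2 * K + 2 * (K + 2 * A * K / \<eta>\<^sup>2)) * \<delta> * wt e 3 j r" .
  qed (use K A in auto)
qed

end

section \<open>From the divergence to the velocity\<close>

lemma has_derivative_cong_on_interval:
  fixes f g :: "real \<Rightarrow> real"
  assumes "(f has_real_derivative y) (at r)" and "a < r" "r < b" and "\<And>s. a < s \<Longrightarrow> s < b \<Longrightarrow> g s = f s"
  shows "(g has_real_derivative y) (at r)"
  using has_field_derivative_transform_within_open[OF assms(1), of "{a<..<b}" g] assms by auto

text \<open>If D = \<epsilon> r \<xi> is the divergence of the radial field U, then (r^(d-1) U)' = r^(d-1) D,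
so that U = \<epsilon> r^2 mean d \<xi>. Up to the factor d + 1 this is the average of \<xi> with
density s^d on [0,r]. At r = 0 it is 0, by the convention for division, and this is the continuous
value when \<xi> 0 = 0.\<close>
definition mean :: "nat \<Rightarrow> (real \<Rightarrow> real) \<Rightarrow> real \<Rightarrow> real" where
  "mean d \<xi> r = integral {0..r} (\<lambda>s. s ^ d * \<xi> s) / r ^ (d + 1)"

lemma mean_0 [simp]: "mean d \<xi> 0 = 0"
  by (simp add: mean_def)

lemma mean_cong:
  "(\<And>s. 0 \<le> s \<Longrightarrow> s \<le> r \<Longrightarrow> \<xi> s = \<xi>' s) \<Longrightarrow> mean d \<xi> r = mean d \<xi>' r"
  unfolding mean_def by (intro arg_cong2[where f = "(/)"] integral_cong refl) auto

lemma mean_diff: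
  assumes "continuous_on {0..r} f" "continuous_on {0..r} g"
  shows "mean d (\<lambda>s. f s - g s) r = mean d f r - mean d g r"
  unfolding mean_def right_diff_distrib
  by (subst Henstock_Kurzweil_Integration.integral_diff)
     (use assms in \<open>auto intro!: integrable_continuous_real continuous_intros simp: diff_divide_distrib\<close>)

text \<open>Averaging with density s^d preserves cubic decay because d \<ge> 3: the function s * decay s is
increasing, so its cube can be taken out of the integral at s = r.\<close>
lemma abs_mean_le:
  assumes d: "3 \<le> d" and \<eta>: "0 < \<eta>" and cont: "continuous_on {0..r} \<xi>" and r: "0 \<le> r" and K: "0 \<le> K"
    and b: "\<And>s. 0 \<le> s \<Longrightarrow> s \<le> r \<Longrightarrow> \<bar>\<xi> s\<bar> \<le> K * decay \<eta> s ^ 3"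
  shows "\<bar>mean d \<xi> r\<bar> \<le> K * decay \<eta> r ^ 3"
proof (cases "r = 0")
  case True
  then show ?thesis using K decay_pos[OF \<eta> r] by simp
next
  case False
  then have r: "0 < r" using r by simp
  obtain m where m: "d = m + 3" using d le_Suc_ex[of 3 d] by (metis add.commute)
  have "\<bar>integral {0..r} (\<lambda>s. s ^ d * \<xi> s)\<bar> \<le> integral {0..r} (\<lambda>s. K * (r * decay \<eta> r) ^ 3 * s ^ m)"
  proof (rule abs_integral_le_const)
    fix s assume s: "s \<in> {0..r}"
    have mono: "s * decay \<eta> s \<le> r * decay \<eta> r"
      using s \<eta> r by (simp add: decay_def field_simps add_pos_nonneg)
    have "\<bar>s ^ d * \<xi> s\<bar> = s ^ d * \<bar>\<xi> s\<bar>" using s by (simp add: abs_mult)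
    also have "\<dots> \<le> s ^ d * (K * decay \<eta> s ^ 3)" using s b by (intro mult_left_mono) auto
    also have "\<dots> = K * (s * decay \<eta> s) ^ 3 * s ^ m" by (simp add: m power_add power_mult_distrib)
    also have "\<dots> \<le> K * (r * decay \<eta> r) ^ 3 * s ^ m"
      using s K mono decay_pos[OF \<eta>, of s] by (intro mult_right_mono mult_left_mono power_mono) auto
    finally show "\<bar>s ^ d * \<xi> s\<bar> \<le> K * (r * decay \<eta> r) ^ 3 * s ^ m" .
  qed (use cont in \<open>auto intro!: integrable_continuous_real continuous_intros\<close>)
  also have "\<dots> = K * (r * decay \<eta> r) ^ 3 * (r ^ Suc m / Suc m)"
    using integral_unique[OF integral_pow[of r m]] r by simp
  also have "\<dots> \<le> K * (r * decay \<eta> r) ^ 3 * r ^ Suc m"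
    using r K decay_pos[OF \<eta>, of r] by (intro mult_left_mono) (auto simp: divide_le_eq)
  also have "\<dots> = K * decay \<eta> r ^ 3 * r ^ (d + 1)" by (simp add: m power_add power_mult_distrib eval_nat_numeral)
  finally show ?thesis using r by (simp add: mean_def abs_mult divide_le_eq)
qed

text \<open>The equation r m' + (d+1) m = \<xi> for m = mean d \<xi>, which is U' + (d-1) U / r = D.\<close>
lemma mean_has_derivative:
  assumes cont: "continuous_on {0..T} \<xi>" and r: "0 < r" "r < T"
  shows "(mean d \<xi> has_real_derivative (\<xi> r - (real d + 1) * mean d \<xi> r) / r) (at r)"
proof -
  have dI: "((\<lambda>r. integral {0..r} (\<lambda>s. s ^ d * \<xi> s)) has_real_derivative r ^ d * \<xi> r) (at r)"
    using r cont by (intro integral_has_derivative_interior[of T] continuous_intros) auto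
  have "((\<lambda>r. integral {0..r} (\<lambda>s. s ^ d * \<xi> s) / r ^ (d + 1)) has_real_derivative
      (r ^ d * \<xi> r * r ^ (d + 1) - integral {0..r} (\<lambda>s. s ^ d * \<xi> s) * (real (d + 1) * r ^ d)) / (r ^ (d + 1) * r ^ (d + 1))) (at r)"
    by (rule DERIV_cong) (use r in \<open>auto intro!: derivative_eq_intros dI simp del: power_Suc\<close>)
  then show ?thesis unfolding mean_def
    by (rule DERIV_cong) (use r in \<open>simp add: field_simps\<close>)
qed

lemma continuous_on_mean:
  assumes cont: "continuous_on {0..T} \<xi>" and \<xi>0: "\<xi> 0 = 0"
  shows "continuous_on {0..T} (mean d \<xi>)"
proof (cases "0 < T")
  case False
  then have "{0..T} = {} \<or> {0..T} = {0}" by auto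
  then show ?thesis by auto
next
  case T: True
  have small: "\<bar>mean d \<xi> r\<bar> \<le> e" if e: "\<And>s. 0 \<le> s \<Longrightarrow> s \<le> r \<Longrightarrow> \<bar>\<xi> s\<bar> \<le> e" and r: "0 < r" "r \<le> T" for e r
  proof -
    have e0: "0 \<le> e" using e[of 0] r by auto
    have "\<bar>integral {0..r} (\<lambda>s. s ^ d * \<xi> s)\<bar> \<le> integral {0..r} (\<lambda>s. e * s ^ d)"
    proof (rule abs_integral_le_const)
      fix s assume s: "s \<in> {0..r}"
      then show "\<bar>s ^ d * \<xi> s\<bar> \<le> e * s ^ d"
        using e[of s] mult_left_mono[of "\<bar>\<xi> s\<bar>" e "s ^ d"] by (simp add: abs_mult mult.commute)
    next
      show "(\<lambda>s. s ^ d * \<xi> s) integrable_on {0..r}"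
        using r by (intro integrable_continuous_real continuous_intros continuous_on_subset[OF cont]) auto
    qed (auto intro!: integrable_continuous_real continuous_intros)
    also have "\<dots> = e * (r ^ Suc d / Suc d)" using integral_unique[OF integral_pow[of r d]] r by simp
    also have "\<dots> \<le> e * r ^ Suc d" using e0 r by (intro mult_left_mono) (auto simp: divide_le_eq)
    finally show ?thesis using r by (simp add: mean_def abs_mult divide_le_eq)
  qed
  show ?thesis
    unfolding continuous_on_eq_continuous_within
  proof
    fix r assume "r \<in> {0..T}"
    then consider "r = 0" | "0 < r" "r < T" | "r = T" by fastforce
    then show "continuous (at r within {0..T}) (mean d \<xi>)"
    proof cases
      case 1
      have "(mean d \<xi> \<longlongrightarrow> mean d \<xi> 0) (at 0 within {0..T})"
      proof (rule tendstoI)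
        fix e :: real assume "0 < e"
        have "continuous (at 0 within {0..T}) \<xi>"
          using cont T by (auto simp: continuous_on_eq_continuous_within)
        then obtain \<rho> where \<rho>: "\<rho> > 0" "\<And>s. s \<ge> 0 \<Longrightarrow> s \<le> T \<Longrightarrow> s < \<rho> \<Longrightarrow> \<bar>\<xi> s\<bar> < e/2"
          using \<open>0 < e\<close> \<xi>0 unfolding continuous_within_eps_delta
          by (metis atLeastAtMost_iff dist_0_norm dist_commute half_gt_zero real_norm_def abs_of_nonneg)
        show "\<forall>\<^sub>F x in at 0 within {0..T}. dist (mean d \<xi> x) (mean d \<xi> 0) < e"
          unfolding eventually_at
        proof (intro exI[of _ \<rho>] conjI ballI impI)
          fix x :: real assume x: "x \<in> {0..T}" "x \<noteq> 0 \<and> dist x 0 < \<rho>"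
          have "\<bar>mean d \<xi> x\<bar> \<le> e/2" using \<rho>(2) x by (intro small) (auto simp: less_imp_le)
          then show "dist (mean d \<xi> x) (mean d \<xi> 0) < e" using \<open>0 < e\<close> by simp
        qed (use \<rho> in auto)
      qed
      then show ?thesis using 1 by (simp add: continuous_within)
    next
      case 2
      then show ?thesis using mean_has_derivative[OF cont] DERIV_isCont continuous_at_imp_continuous_at_within by blast
    next
      case 3
      have "continuous_on {0..T} (\<lambda>r. integral {0..r} (\<lambda>s. s ^ d * \<xi> s))"
        by (intro continuous_on_indefinite_integral continuous_intros cont)
      then have "continuous (at r within {0..T}) (\<lambda>r. integral {0..r} (\<lambda>s. s ^ d * \<xi> s))"
        using 3 T by (auto simp: continuous_on_eq_continuous_within)
      then show ?thesis unfolding mean_def using 3 T by (intro continuous_intros) auto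
    qed
  qed
qed

section \<open>The linear equations of a Picard step\<close>

locale gas =
  fixes d :: nat and R \<mu> lam Cv \<kappa> P0 :: real
  assumes d_ge: "3 \<le> d" and R_pos: "0 < R" and mu_pos: "0 < \<mu>" and lam_pos: "0 < lam"
    and Cv_pos: "0 < Cv" and kappa_pos: "0 < \<kappa>" and P0_pos: "0 < P0"
begin

definition \<nu> :: real where "\<nu> = 2 * \<mu> + lam"

lemma nu_pos: "0 < \<nu>"
  using mu_pos lam_pos by (simp add: \<nu>_def)

text \<open>In the unknown \<xi> the mass equation is (log P)' = \<epsilon> rate.\<close>
definition rate :: "real \<Rightarrow> (real \<Rightarrow> real) \<Rightarrow> real \<Rightarrow> real" where
  "rate \<epsilon> \<xi> s = \<xi> s / (1/2 - \<epsilon> * (s * mean d \<xi> s))"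

definition density :: "real \<Rightarrow> (real \<Rightarrow> real) \<Rightarrow> real \<Rightarrow> real" where
  "density \<epsilon> \<xi> r = P0 * exp (\<epsilon> * integral {0..r} (rate \<epsilon> \<xi>))"

text \<open>\<Theta> / \<epsilon> in terms of \<zeta>. The function 1/(1+r^2) takes the value 1 at 0 and has
the decay r^(-2) of the temperature, which leaves a \<zeta> that vanishes at 0 and decays like
r^(-3).\<close>
definition temp :: "(real \<Rightarrow> real) \<Rightarrow> real \<Rightarrow> real" where
  "temp \<zeta> r = 1 / (1 + r\<^sup>2) + r * \<zeta> r"

text \<open>The energy flux is H = \<epsilon> U work.\<close>
definition work :: "real \<Rightarrow> (real \<Rightarrow> real) \<Rightarrow> (real \<Rightarrow> real) \<Rightarrow> real \<Rightarrow> real" where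
  "work \<epsilon> \<xi> \<zeta> r = density \<epsilon> \<xi> r * (\<epsilon> * (r ^ 4 * (mean d \<xi> r)\<^sup>2) / 2 + (Cv + R) * temp \<zeta> r)
     - 2 * \<mu> * (r * (\<xi> r - (real d - 1) * mean d \<xi> r)) - lam * (r * \<xi> r)"

text \<open>The energy flux H divided by \<epsilon>^2; see \<open>energy_flux_eq\<close>.\<close>
definition heat_flux :: "real \<Rightarrow> (real \<Rightarrow> real) \<Rightarrow> (real \<Rightarrow> real) \<Rightarrow> real \<Rightarrow> real" where
  "heat_flux \<epsilon> \<xi> \<zeta> s = s\<^sup>2 * (mean d \<xi> s * work \<epsilon> \<xi> \<zeta> s)"

text \<open>The right-hand side of the integrated energy equation without its constant, divided by
\<epsilon>^2 r. Apart from \<open>density\<close>, it contains all nonlinear terms of that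
equation.\<close>
definition heat_source :: "real \<Rightarrow> (real \<Rightarrow> real) \<Rightarrow> (real \<Rightarrow> real) \<Rightarrow> real \<Rightarrow> real" where
  "heat_source \<epsilon> \<xi> \<zeta> r = - (1/4) * (density \<epsilon> \<xi> r * (r ^ 5 * (mean d \<xi> r)\<^sup>2)) + heat_flux \<epsilon> \<xi> \<zeta> r
     + (real d - 2) * (integral {0..r} (heat_flux \<epsilon> \<xi> \<zeta>) / r)"

text \<open>The source of the linear equation for \<zeta>: the equation for \<Theta> / \<epsilon> = 1/(1+r^2)
+ r \<zeta>, with the contribution of 1/(1+r^2) moved to the right.\<close>
definition heat_rhs :: "real \<Rightarrow> (real \<Rightarrow> real) \<Rightarrow> (real \<Rightarrow> real) \<Rightarrow> real \<Rightarrow> real" where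
  "heat_rhs \<epsilon> \<xi> \<zeta> r = (real d - 2) * r / (1 + r\<^sup>2) + 2 * r / (1 + r\<^sup>2)\<^sup>2
     - Cv / (2 * \<kappa>) * (density \<epsilon> \<xi> r * (r / (1 + r\<^sup>2))) + \<epsilon> / \<kappa> * heat_source \<epsilon> \<xi> \<zeta> r"

text \<open>The right-hand side of the integrated momentum equation without the transport term - r P U / 2,
divided by \<epsilon> r. The temperature is that of \<open>z\<close>, the new iterate, whereas the
density and the convective terms come from the old \<xi>.\<close>
definition force :: "real \<Rightarrow> (real \<Rightarrow> real) \<Rightarrow> (real \<Rightarrow> real) \<Rightarrow> real \<Rightarrow> real" where
  "force \<epsilon> \<xi> z r = \<epsilon> * (density \<epsilon> \<xi> r * (r ^ 3 * (mean d \<xi> r)\<^sup>2)) + R * ((density \<epsilon> \<xi> r * temp z r - P0) / r)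
     + (real d - 1) * \<epsilon> * (integral {0..r} (\<lambda>s. density \<epsilon> \<xi> s * (s ^ 3 * (mean d \<xi> s)\<^sup>2)) / r)"

text \<open>The new \<xi> that the momentum balance gives when \<open>w\<close> stands for the new U /
(\<epsilon> r^2).\<close>
definition div_new :: "real \<Rightarrow> (real \<Rightarrow> real) \<Rightarrow> (real \<Rightarrow> real) \<Rightarrow> (real \<Rightarrow> real) \<Rightarrow> real \<Rightarrow> real" where
  "div_new \<epsilon> \<xi> z w r = (force \<epsilon> \<xi> z r - density \<epsilon> \<xi> r * (r\<^sup>2 * w r) / 2) / \<nu>"

text \<open>From an old pair (\<xi>, \<zeta>) to the new \<zeta>, called \<open>z\<close>, and the new U /
(\<epsilon> r^2), called \<open>w\<close>. The equation for \<open>w\<close> is r w' + (d+1) w =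
\<open>div_new\<close>, which expresses that the new U has the new D as its divergence. Since
\<open>div_new\<close> contains - P r^2 w / 2, this equation has the damping term that the barrier
needs. The step is a relation and is stated on [0,T], so that solutions known only on an initial
interval can be compared with it.\<close>
definition picard_step :: "real \<Rightarrow> real \<Rightarrow> (real \<Rightarrow> real) \<Rightarrow> (real \<Rightarrow> real) \<Rightarrow> (real \<Rightarrow> real) \<Rightarrow> (real \<Rightarrow> real) \<Rightarrow> bool" where
  "picard_step \<epsilon> T \<xi> \<zeta> z w \<longleftrightarrow>
     continuous_on {0..T} z \<and> z 0 = 0 \<and> continuous_on {0..T} w \<and> w 0 = 0 \<and>
     (\<forall>r. 0 < r \<and> r < T \<longrightarrow>
       (z has_real_derivative (heat_rhs \<epsilon> \<xi> \<zeta> r - (real d - 1) * z r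
          - Cv / (2 * \<kappa>) * density \<epsilon> \<xi> r * r\<^sup>2 * z r) / r) (at r) \<and>
       (w has_real_derivative (force \<epsilon> \<xi> z r / \<nu> - (real d + 1) * w r
          - density \<epsilon> \<xi> r / (2 * \<nu>) * r\<^sup>2 * w r) / r) (at r))"

text \<open>The weighted ball of radius M on [0,T]. The smallness of \<epsilon> M keeps \<bar>U\<bar> below
r/8, away from the zero of r/2 - U in the mass equation.\<close>
definition admissible :: "real \<Rightarrow> real \<Rightarrow> real \<Rightarrow> real \<Rightarrow> (real \<Rightarrow> real) \<Rightarrow> bool" where
  "admissible \<eta> M \<epsilon> T \<xi> \<longleftrightarrow> 0 < \<eta> \<and> 0 \<le> M \<and> 0 \<le> \<epsilon> \<and> \<epsilon> * M \<le> \<eta> / 8 \<and>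
     continuous_on {0..T} \<xi> \<and> \<xi> 0 = 0 \<and> (\<forall>r\<in>{0..T}. \<bar>\<xi> r\<bar> \<le> M * decay \<eta> r ^ 3)"

context
  fixes \<eta> M \<epsilon> T \<xi>
  assumes adm: "admissible \<eta> M \<epsilon> T \<xi>"
begin

lemma
  shows eta0: "0 < \<eta>" and M0: "0 \<le> M" and eps0: "0 \<le> \<epsilon>" and epsM: "\<epsilon> * M \<le> \<eta> / 8"
    and cont_xi: "continuous_on {0..T} \<xi>" and xi_0: "\<xi> 0 = 0"
    and xi_bound: "\<And>r. 0 \<le> r \<Longrightarrow> r \<le> T \<Longrightarrow> \<bar>\<xi> r\<bar> \<le> M * decay \<eta> r ^ 3"
  using adm by (auto simp: admissible_def)

lemma mean_bound: "0 \<le> r \<Longrightarrow> r \<le> T \<Longrightarrow> \<bar>mean d \<xi> r\<bar> \<le> M * decay \<eta> r ^ 3"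
  by (intro abs_mean_le d_ge eta0 M0 continuous_on_subset[OF cont_xi] xi_bound) auto

lemma cont_mean: "continuous_on {0..T} (mean d \<xi>)"
  by (intro continuous_on_mean cont_xi xi_0)

lemma small_speed:
  assumes "0 \<le> r" "r \<le> T"
  shows "\<bar>\<epsilon> * (r * mean d \<xi> r)\<bar> \<le> 1/8"
proof -
  have "\<bar>\<epsilon> * (r * mean d \<xi> r)\<bar> = \<epsilon> * (r * \<bar>mean d \<xi> r\<bar>)"
    using assms eps0 by (simp add: abs_mult)
  also have "\<dots> \<le> \<epsilon> * (r * (M * decay \<eta> r ^ 3))"
    using assms eps0 mean_bound by (intro mult_left_mono) auto
  also have "\<dots> = \<epsilon> * M * (r * decay \<eta> r) * decay \<eta> r ^ 2" by (simp add: power3_eq_cube power2_eq_square)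
  also have "\<dots> \<le> \<eta> / 8 * (1 / \<eta>) * 1"
    using assms eps0 M0 epsM eta0 mult_decay_le[OF eta0, of r] decay_pos[OF eta0, of r] decay_le_one[OF eta0, of r]
    by (intro mult_mono power_le_one) auto
  finally show ?thesis using eta0 by simp
qed

lemma denominator_ge: "0 \<le> r \<Longrightarrow> r \<le> T \<Longrightarrow> 1/4 \<le> 1/2 - \<epsilon> * (r * mean d \<xi> r)"
  using small_speed[of r] by linarith

lemma cont_rate: "continuous_on {0..T} (rate \<epsilon> \<xi>)"
  unfolding rate_def using denominator_ge
  by (intro continuous_intros cont_xi cont_mean) force

lemma rate_bound:
  assumes "0 \<le> r" "r \<le> T"
  shows "\<bar>rate \<epsilon> \<xi> r\<bar> \<le> 4 * M * decay \<eta> r ^ 3"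
proof -
  have "\<bar>rate \<epsilon> \<xi> r\<bar> = \<bar>\<xi> r\<bar> / (1/2 - \<epsilon> * (r * mean d \<xi> r))"
    using denominator_ge[OF assms] by (simp add: rate_def)
  also have "\<dots> \<le> (M * decay \<eta> r ^ 3) / (1/4)"
    using denominator_ge[OF assms] xi_bound[OF assms] by (intro frac_le) auto
  finally show ?thesis by simp
qed

text \<open>This is what keeps the density between P0/2 and 2 P0.\<close>
lemma exponent_bound:
  assumes "0 \<le> r" "r \<le> T"
  shows "\<bar>\<epsilon> * integral {0..r} (rate \<epsilon> \<xi>)\<bar> \<le> 1/2"
proof -
  have "\<bar>integral {0..r} (rate \<epsilon> \<xi>)\<bar> \<le> integral {0..r} (\<lambda>s. 4 * M * decay \<eta> s ^ 2)"
  proof (rule abs_integral_le_const)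
    fix s assume s: "s \<in> {0..r}"
    have "4 * M * decay \<eta> s ^ 3 \<le> 4 * M * decay \<eta> s ^ 2"
      using M0 s by (intro mult_left_mono decay_pow_antimono eta0) auto
    then show "\<bar>rate \<epsilon> \<xi> s\<bar> \<le> 4 * M * decay \<eta> s ^ 2" using rate_bound[of s] s assms by auto
  qed (use assms in \<open>auto intro!: integrable_continuous_real continuous_intros continuous_on_decay eta0 continuous_on_subset[OF cont_rate]\<close>)
  also have "\<dots> = 4 * M * (r * decay \<eta> r)"
    using integral_unique[OF integral_decay_square[OF eta0 assms(1)]] by simp
  also have "\<dots> \<le> 4 * M * (1 / \<eta>)"
    using M0 mult_decay_le[OF eta0 assms(1)] by (intro mult_left_mono) auto
  finally have "\<epsilon> * \<bar>integral {0..r} (rate \<epsilon> \<xi>)\<bar> \<le> \<epsilon> * (4 * M * (1 / \<eta>))"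
    using eps0 by (intro mult_left_mono) auto
  also have "\<dots> = 4 * (\<epsilon> * M) / \<eta>" by simp
  also have "\<dots> \<le> 1/2" using epsM eta0 by (simp add: field_simps)
  finally show ?thesis using eps0 by (simp add: abs_mult)
qed

lemma density_0: "density \<epsilon> \<xi> 0 = P0"
  by (simp add: density_def)

lemma density_bounds:
  assumes "0 \<le> r" "r \<le> T"
  shows "P0 / 2 \<le> density \<epsilon> \<xi> r" and "density \<epsilon> \<xi> r \<le> 2 * P0"
proof -
  define x where "x = \<epsilon> * integral {0..r} (rate \<epsilon> \<xi>)"
  have x: "\<bar>x\<bar> \<le> 1/2" using exponent_bound[OF assms] unfolding x_def .
  have "1/2 \<le> exp x" using exp_ge_add_one_self[of x] x by linarith
  moreover have "exp x \<le> 2"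
  proof -
    have "1/2 \<le> exp (-x)" using exp_ge_add_one_self[of "-x"] x by linarith
    then show ?thesis by (simp add: exp_minus field_simps)
  qed
  ultimately show "P0 / 2 \<le> density \<epsilon> \<xi> r" "density \<epsilon> \<xi> r \<le> 2 * P0"
    using P0_pos unfolding density_def x_def[symmetric] by auto
qed

lemma cont_density: "continuous_on {0..T} (density \<epsilon> \<xi>)"
  unfolding density_def by (intro continuous_intros continuous_on_indefinite_integral cont_rate)

lemma density_has_derivative:
  assumes "0 < r" "r < T"
  shows "(density \<epsilon> \<xi> has_real_derivative \<epsilon> * (density \<epsilon> \<xi> r * rate \<epsilon> \<xi> r)) (at r)"
  unfolding density_def
  using integral_has_derivative_interior[OF cont_rate assms]
  by (auto intro!: derivative_eq_intros)

lemma cont_temp: "continuous_on {0..T} \<zeta> \<Longrightarrow> continuous_on {0..T} (temp \<zeta>)"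
  unfolding temp_def by (intro continuous_intros) (auto simp: add_nonneg_eq_0_iff)

lemma cont_heat_flux: "continuous_on {0..T} \<zeta> \<Longrightarrow> continuous_on {0..T} (heat_flux \<epsilon> \<xi> \<zeta>)"
  unfolding heat_flux_def work_def by (intro continuous_intros cont_density cont_mean cont_temp cont_xi) auto

end

end

lemma continuous_on_average:
  fixes g :: "real \<Rightarrow> real"
  assumes "continuous_on {0..T} g" "g 0 = 0"
  shows "continuous_on {0..T} (\<lambda>r. integral {0..r} g / r)"
  using continuous_on_mean[OF assms, of 0] by (simp add: mean_def)

context gas
begin

lemma density_zero [simp]: "density 0 \<xi> r = P0"
  by (simp add: density_def)

lemma mean_zero [simp]: "mean d (\<lambda>_. 0) r = 0"
  by (simp add: mean_def)

context
  fixes \<eta> M \<epsilon> T \<xi>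
  assumes adm: "admissible \<eta> M \<epsilon> T \<xi>"
begin

lemma density_minus_P0:
  assumes "0 \<le> r" "r \<le> T"
  shows "density \<epsilon> \<xi> r - P0 = \<epsilon> * integral {0..r} (\<lambda>s. density \<epsilon> \<xi> s * rate \<epsilon> \<xi> s)"
proof -
  have "((\<lambda>s. \<epsilon> * (density \<epsilon> \<xi> s * rate \<epsilon> \<xi> s)) has_integral density \<epsilon> \<xi> r - density \<epsilon> \<xi> 0) {0..r}"
    using assms density_has_derivative[OF adm]
    by (intro fundamental_theorem_of_calculus_interior)
       (auto intro!: continuous_on_subset[OF cont_density[OF adm]] simp flip: has_real_derivative_iff_has_vector_derivative)
  from integral_unique[OF this] show ?thesis by (simp add: density_def)
qed

lemma rate_0: "rate \<epsilon> \<xi> 0 = 0"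
  using xi_0[OF adm] by (simp add: rate_def)

lemma heat_flux_0: "heat_flux \<epsilon> \<xi> \<zeta> 0 = 0"
  by (simp add: heat_flux_def)

lemma cont_heat_rhs:
  assumes "continuous_on {0..T} \<zeta>"
  shows "continuous_on {0..T} (heat_rhs \<epsilon> \<xi> \<zeta>)"
proof -
  have nz: "1 + r\<^sup>2 \<noteq> 0" "(1 + r\<^sup>2)\<^sup>2 \<noteq> 0" for r :: real
    by (smt (verit) zero_le_power2 zero_eq_power2)+
  have A: "continuous_on {0..T} (\<lambda>r. integral {0..r} (heat_flux \<epsilon> \<xi> \<zeta>) / r)"
    by (rule continuous_on_average[OF cont_heat_flux[OF adm assms] heat_flux_0])
  have B: "continuous_on {0..T} (\<lambda>r. (real d - 2) * r / (1 + r\<^sup>2))"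
      "continuous_on {0..T} (\<lambda>r. 2 * r / (1 + r\<^sup>2)\<^sup>2)" "continuous_on {0..T} (\<lambda>r. r / (1 + r\<^sup>2))"
    by (intro continuous_intros ballI nz)+
  show ?thesis
    unfolding heat_rhs_def heat_source_def
    by (intro A B continuous_on_add continuous_on_diff continuous_on_mult continuous_on_const continuous_on_id
        continuous_on_power cont_density[OF adm] cont_mean[OF adm] cont_heat_flux[OF adm] assms)
qed

lemma heat_rhs_0: "heat_rhs \<epsilon> \<xi> \<zeta> 0 = 0"
  by (simp add: heat_rhs_def heat_source_def heat_flux_def)

text \<open>The quotient (P temp - P0) / r is singular term by term at 0. Here it is rewritten with P - P0 as
the integral of its derivative, which shows its continuity at 0 and the factor \<epsilon> in front
of the variation of the density.\<close>
lemma force_alt: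
  assumes "0 \<le> r" "r \<le> T" "z 0 = 0"
  shows "force \<epsilon> \<xi> z r = \<epsilon> * (density \<epsilon> \<xi> r * (r ^ 3 * (mean d \<xi> r)\<^sup>2))
     + R * (\<epsilon> * (integral {0..r} (\<lambda>s. density \<epsilon> \<xi> s * rate \<epsilon> \<xi> s) / r) * temp z r + P0 * (z r - r / (1 + r\<^sup>2)))
     + (real d - 1) * \<epsilon> * (integral {0..r} (\<lambda>s. density \<epsilon> \<xi> s * (s ^ 3 * (mean d \<xi> s)\<^sup>2)) / r)"
proof -
  have "(density \<epsilon> \<xi> r * temp z r - P0) / r =
      (density \<epsilon> \<xi> r - P0) / r * temp z r + P0 * ((temp z r - 1) / r)"
    by (cases "r = 0") (auto simp: field_simps)
  moreover have "(temp z r - 1) / r = z r - r / (1 + r\<^sup>2)"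
  proof (cases "r = 0")
    case False
    have "1 + r\<^sup>2 \<noteq> 0" by (smt (verit) zero_le_power2)
    then have "1 / (1 + r\<^sup>2) - 1 = - r * (r / (1 + r\<^sup>2))"
      by (simp add: field_simps power2_eq_square)
    then have "temp z r - 1 = r * (z r - r / (1 + r\<^sup>2))" unfolding temp_def by (simp add: algebra_simps)
    then show ?thesis using False by simp
  qed (use assms in simp)
  ultimately show ?thesis
    unfolding force_def by (simp only: density_minus_P0[OF assms(1,2)] times_divide_eq_right)
qed

lemma cont_force:
  assumes "continuous_on {0..T} z" "z 0 = 0"
  shows "continuous_on {0..T} (force \<epsilon> \<xi> z)"
proof -
  have nz: "1 + r\<^sup>2 \<noteq> 0" for r :: real
    by (smt (verit) zero_le_power2)
  have A: "continuous_on {0..T} (\<lambda>r. integral {0..r} (\<lambda>s. density \<epsilon> \<xi> s * rate \<epsilon> \<xi> s) / r)"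
      "continuous_on {0..T} (\<lambda>r. integral {0..r} (\<lambda>s. density \<epsilon> \<xi> s * (s ^ 3 * (mean d \<xi> s)\<^sup>2)) / r)"
    by (intro continuous_on_average continuous_on_mult continuous_on_power continuous_on_id
        cont_density[OF adm] cont_mean[OF adm] cont_rate[OF adm], simp add: rate_0)+
  have B: "continuous_on {0..T} (\<lambda>r. r / (1 + r\<^sup>2))"
    by (intro continuous_intros ballI nz)
  have "continuous_on {0..T} (\<lambda>r. \<epsilon> * (density \<epsilon> \<xi> r * (r ^ 3 * (mean d \<xi> r)\<^sup>2))
     + R * (\<epsilon> * (integral {0..r} (\<lambda>s. density \<epsilon> \<xi> s * rate \<epsilon> \<xi> s) / r) * temp z r + P0 * (z r - r / (1 + r\<^sup>2)))
     + (real d - 1) * \<epsilon> * (integral {0..r} (\<lambda>s. density \<epsilon> \<xi> s * (s ^ 3 * (mean d \<xi> s)\<^sup>2)) / r))"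
    by (intro A B continuous_on_add continuous_on_diff continuous_on_mult continuous_on_const continuous_on_id
        continuous_on_power cont_density[OF adm] cont_mean[OF adm] cont_temp[OF adm] assms)
  then show ?thesis
    by (rule continuous_on_eq) (use force_alt[where z = z] assms(2) in force)
qed

lemma force_0: "force \<epsilon> \<xi> z 0 = 0"
  by (simp add: force_def)

lemma cont_div_new:
  assumes "continuous_on {0..T} z" "z 0 = 0" "continuous_on {0..T} w"
  shows "continuous_on {0..T} (div_new \<epsilon> \<xi> z w)"
  unfolding div_new_def using nu_pos
  by (intro continuous_on_divide continuous_on_diff continuous_on_mult continuous_on_power continuous_on_const
      continuous_on_id cont_force cont_density[OF adm] assms) auto

lemma div_new_0: "div_new \<epsilon> \<xi> z w 0 = 0"
  by (simp add: div_new_def force_0)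

end

text \<open>The derivative of \<open>temp z\<close> when \<open>z\<close> is the new \<zeta>, with the
derivative of z eliminated by its equation.\<close>
definition temp_slope :: "real \<Rightarrow> (real \<Rightarrow> real) \<Rightarrow> (real \<Rightarrow> real) \<Rightarrow> (real \<Rightarrow> real) \<Rightarrow> real \<Rightarrow> real" where
  "temp_slope \<epsilon> \<xi> \<zeta> z r = - 2 * (r / (1 + r\<^sup>2)\<^sup>2) + z r + (heat_rhs \<epsilon> \<xi> \<zeta> r - (real d - 1) * z r
     - Cv / (2 * \<kappa>) * (density \<epsilon> \<xi> r * (r\<^sup>2 * z r)))"

text \<open>The derivative of r * \<open>force\<close>.\<close>
definition force_slope :: "real \<Rightarrow> (real \<Rightarrow> real) \<Rightarrow> (real \<Rightarrow> real) \<Rightarrow> (real \<Rightarrow> real) \<Rightarrow> real \<Rightarrow> real" where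
  "force_slope \<epsilon> \<xi> \<zeta> z r =
     \<epsilon> * (\<epsilon> * (density \<epsilon> \<xi> r * rate \<epsilon> \<xi> r * (r ^ 4 * (mean d \<xi> r)\<^sup>2))
        + density \<epsilon> \<xi> r * (r ^ 3 * (4 * (mean d \<xi> r)\<^sup>2 + 2 * (mean d \<xi> r * (\<xi> r - (real d + 1) * mean d \<xi> r)))))
     + R * (\<epsilon> * (density \<epsilon> \<xi> r * rate \<epsilon> \<xi> r * temp z r) + density \<epsilon> \<xi> r * temp_slope \<epsilon> \<xi> \<zeta> z r)
     + (real d - 1) * (\<epsilon> * (density \<epsilon> \<xi> r * (r ^ 3 * (mean d \<xi> r)\<^sup>2)))"

text \<open>\<nu> times the source of the differentiated equation for \<open>div_new\<close>.\<close>
definition div_source :: "real \<Rightarrow> (real \<Rightarrow> real) \<Rightarrow> (real \<Rightarrow> real) \<Rightarrow> (real \<Rightarrow> real) \<Rightarrow> (real \<Rightarrow> real) \<Rightarrow> real \<Rightarrow> real" where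
  "div_source \<epsilon> \<xi> \<zeta> z w r = force_slope \<epsilon> \<xi> \<zeta> z r + (real d - 2) / 2 * (density \<epsilon> \<xi> r * (r\<^sup>2 * w r))
     - \<epsilon> / 2 * (density \<epsilon> \<xi> r * rate \<epsilon> \<xi> r * (r ^ 3 * w r))"

context
  fixes \<eta> M \<epsilon> T \<xi> \<zeta> z w
  assumes adm: "admissible \<eta> M \<epsilon> T \<xi>" and step: "picard_step \<epsilon> T \<xi> \<zeta> z w"
begin

lemma temp_has_derivative:
  assumes r: "0 < r" "r < T"
  shows "(temp z has_real_derivative temp_slope \<epsilon> \<xi> \<zeta> z r) (at r)"
proof -
  have z: "(z has_real_derivative (heat_rhs \<epsilon> \<xi> \<zeta> r - (real d - 1) * z r
          - Cv / (2 * \<kappa>) * density \<epsilon> \<xi> r * r\<^sup>2 * z r) / r) (at r)"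
    using step r by (auto simp: picard_step_def)
  have nz: "1 + r\<^sup>2 \<noteq> 0" by (smt (verit) zero_le_power2)
  show ?thesis unfolding temp_def temp_slope_def
    by (rule derivative_eq_intros z refl nz | use nz r in \<open>simp add: power2_eq_square\<close>)+
qed

lemma radius_force_has_derivative:
  assumes r: "0 < r" "r < T"
  shows "((\<lambda>r. \<epsilon> * (density \<epsilon> \<xi> r * (r ^ 4 * (mean d \<xi> r)\<^sup>2)) + R * (density \<epsilon> \<xi> r * temp z r - P0)
     + (real d - 1) * \<epsilon> * integral {0..r} (\<lambda>s. density \<epsilon> \<xi> s * (s ^ 3 * (mean d \<xi> s)\<^sup>2)))
    has_real_derivative force_slope \<epsilon> \<xi> \<zeta> z r) (at r)"
proof -
  have I: "((\<lambda>r. integral {0..r} (\<lambda>s. density \<epsilon> \<xi> s * (s ^ 3 * (mean d \<xi> s)\<^sup>2))) has_real_derivative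
      density \<epsilon> \<xi> r * (r ^ 3 * (mean d \<xi> r)\<^sup>2)) (at r)"
    by (intro integral_has_derivative_interior[of T] r continuous_intros cont_density[OF adm] cont_mean[OF adm])
  have "((\<lambda>r. r ^ 4 * (mean d \<xi> r)\<^sup>2) has_real_derivative 4 * r ^ 3 * (mean d \<xi> r)\<^sup>2
      + 2 * mean d \<xi> r * ((\<xi> r - (real d + 1) * mean d \<xi> r) / r) * r ^ 4) (at r)"
    by (auto intro!: derivative_eq_intros mean_has_derivative[OF cont_xi[OF adm] r])
  then have M: "((\<lambda>r. r ^ 4 * (mean d \<xi> r)\<^sup>2) has_real_derivative
      r ^ 3 * (4 * (mean d \<xi> r)\<^sup>2 + 2 * (mean d \<xi> r * (\<xi> r - (real d + 1) * mean d \<xi> r)))) (at r)"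
    by (rule DERIV_cong) (use r in \<open>simp add: eval_nat_numeral field_simps\<close>)
  have "((\<lambda>r. \<epsilon> * (density \<epsilon> \<xi> r * (r ^ 4 * (mean d \<xi> r)\<^sup>2)) + R * (density \<epsilon> \<xi> r * temp z r - P0)
     + (real d - 1) * \<epsilon> * integral {0..r} (\<lambda>s. density \<epsilon> \<xi> s * (s ^ 3 * (mean d \<xi> s)\<^sup>2)))
    has_real_derivative
      \<epsilon> * (\<epsilon> * (density \<epsilon> \<xi> r * rate \<epsilon> \<xi> r) * (r ^ 4 * (mean d \<xi> r)\<^sup>2)
          + r ^ 3 * (4 * (mean d \<xi> r)\<^sup>2 + 2 * (mean d \<xi> r * (\<xi> r - (real d + 1) * mean d \<xi> r))) * density \<epsilon> \<xi> r)
     + R * (\<epsilon> * (density \<epsilon> \<xi> r * rate \<epsilon> \<xi> r) * temp z r + temp_slope \<epsilon> \<xi> \<zeta> z r * density \<epsilon> \<xi> r - 0)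
     + (real d - 1) * \<epsilon> * (density \<epsilon> \<xi> r * (r ^ 3 * (mean d \<xi> r)\<^sup>2))) (at r)"
    by (intro DERIV_add DERIV_cmult DERIV_diff DERIV_const DERIV_mult density_has_derivative[OF adm r] M I temp_has_derivative r)
  then show ?thesis unfolding force_slope_def
    by (rule DERIV_cong) (simp add: algebra_simps)
qed

text \<open>In the formula for \<open>div_new\<close> the force and the transport term decay only like 1/r,
and their cancellation is not visible. Differentiating the formula gives a linear equation of the
damped type for \<open>div_new\<close> itself, with a source that decays like 1/r, and the barrier
then yields the cubic decay.\<close>
lemma div_new_has_derivative:
  assumes r: "0 < r" "r < T"
  shows "(div_new \<epsilon> \<xi> z w has_real_derivative (div_source \<epsilon> \<xi> \<zeta> z w r / \<nu> - div_new \<epsilon> \<xi> z w r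
     - density \<epsilon> \<xi> r / (2 * \<nu>) * r\<^sup>2 * div_new \<epsilon> \<xi> z w r) / r) (at r)"
proof -
  let ?F = "\<lambda>r. \<epsilon> * (density \<epsilon> \<xi> r * (r ^ 4 * (mean d \<xi> r)\<^sup>2)) + R * (density \<epsilon> \<xi> r * temp z r - P0)
     + (real d - 1) * \<epsilon> * integral {0..r} (\<lambda>s. density \<epsilon> \<xi> s * (s ^ 3 * (mean d \<xi> s)\<^sup>2))"
  have Ff: "force \<epsilon> \<xi> z s = ?F s / s" if "0 < s" for s
    unfolding force_def using that by (simp add: field_simps eval_nat_numeral)
  have w: "(w has_real_derivative (force \<epsilon> \<xi> z r / \<nu> - (real d + 1) * w r
          - density \<epsilon> \<xi> r / (2 * \<nu>) * r\<^sup>2 * w r) / r) (at r)"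
    using step r by (auto simp: picard_step_def)
  let ?D = "div_new \<epsilon> \<xi> z w r"
  let ?P = "density \<epsilon> \<xi> r"
  have w': "(w has_real_derivative (?D - (real d + 1) * w r) / r) (at r)"
    by (rule DERIV_cong[OF w]) (simp add: div_new_def diff_divide_distrib)
  have fr: "force \<epsilon> \<xi> z r = \<nu> * ?D + ?P * (r\<^sup>2 * w r) / 2"
    using nu_pos unfolding div_new_def by simp
  have "((\<lambda>r. (?F r / r - density \<epsilon> \<xi> r * (r\<^sup>2 * w r) / 2) / \<nu>) has_real_derivative
    ((force_slope \<epsilon> \<xi> \<zeta> z r * r - ?F r * 1) / (r * r) -
      (\<epsilon> * (?P * rate \<epsilon> \<xi> r) * (r\<^sup>2 * w r) + (2 * r * w r + (?D - (real d + 1) * w r) / r * r\<^sup>2) * ?P) / 2) / \<nu>) (at r)"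
    using r nu_pos
    by (intro DERIV_cdivide DERIV_diff DERIV_divide DERIV_mult radius_force_has_derivative density_has_derivative[OF adm] w' DERIV_ident)
       (auto intro!: derivative_eq_intros)
  then have "((\<lambda>r. (?F r / r - density \<epsilon> \<xi> r * (r\<^sup>2 * w r) / 2) / \<nu>) has_real_derivative
     (div_source \<epsilon> \<xi> \<zeta> z w r / \<nu> - ?D - ?P / (2 * \<nu>) * r\<^sup>2 * ?D) / r) (at r)"
  proof (rule DERIV_cong)
    have "?F r = r * (\<nu> * ?D + ?P * (r\<^sup>2 * w r) / 2)" using Ff[of r] fr r by (simp add: field_simps)
    then show "((force_slope \<epsilon> \<xi> \<zeta> z r * r - ?F r * 1) / (r * r) -
      (\<epsilon> * (?P * rate \<epsilon> \<xi> r) * (r\<^sup>2 * w r) + (2 * r * w r + (?D - (real d + 1) * w r) / r * r\<^sup>2) * ?P) / 2) / \<nu>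
      = (div_source \<epsilon> \<xi> \<zeta> z w r / \<nu> - ?D - ?P / (2 * \<nu>) * r\<^sup>2 * ?D) / r"
      using r nu_pos unfolding div_source_def
      by (simp add: field_simps eval_nat_numeral)
  qed
  then show ?thesis
    by (rule has_derivative_cong_on_interval[where a = 0 and b = "r + 1"]) (use r in \<open>auto simp: div_new_def Ff\<close>)
qed

end

text \<open>The step is triangular: first z, from old data only, then w with z in its source.\<close>
lemma picard_step_exists:
  assumes adm: "\<And>T. admissible \<eta> M \<epsilon> T \<xi>" and \<zeta>: "continuous_on {0..} \<zeta>"
  obtains z w where "\<And>T. picard_step \<epsilon> T \<xi> \<zeta> z w" "continuous_on {0..} z"
proof -
  have \<zeta>T: "continuous_on {0..T} \<zeta>" for T
    using \<zeta> by (rule continuous_on_subset) auto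
  have P: "continuous_on {0..} (density \<epsilon> \<xi>)"
    by (intro continuous_on_halflineI cont_density[OF adm])
  have Pp: "0 \<le> density \<epsilon> \<xi> r" if "0 \<le> r" for r
    using density_bounds(1)[OF adm that order_refl] P0_pos by linarith
  obtain z where z: "continuous_on {0..} z" "z 0 = 0"
    "\<And>r. 0 < r \<Longrightarrow> (z has_real_derivative (heat_rhs \<epsilon> \<xi> \<zeta> r - real (d - 1) * z r - Cv / (2 * \<kappa>) * density \<epsilon> \<xi> r * r\<^sup>2 * z r) / r) (at r)"
  proof (rule linear_ode_solution[of "d - 1" "\<lambda>r. Cv / (2 * \<kappa>) * density \<epsilon> \<xi> r" "heat_rhs \<epsilon> \<xi> \<zeta>"])
    show "continuous_on {0..} (heat_rhs \<epsilon> \<xi> \<zeta>)"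
      by (intro continuous_on_halflineI cont_heat_rhs[OF adm] \<zeta>T)
  qed (use d_ge P Pp Cv_pos kappa_pos heat_rhs_0[OF adm] in \<open>auto intro!: continuous_intros\<close>)
  have zT: "continuous_on {0..T} z" for T
    using z(1) by (rule continuous_on_subset) auto
  obtain w where w: "continuous_on {0..} w" "w 0 = 0"
    "\<And>r. 0 < r \<Longrightarrow> (w has_real_derivative (force \<epsilon> \<xi> z r / \<nu> - real (d + 1) * w r - density \<epsilon> \<xi> r / (2 * \<nu>) * r\<^sup>2 * w r) / r) (at r)"
  proof (rule linear_ode_solution[of "d + 1" "\<lambda>r. density \<epsilon> \<xi> r / (2 * \<nu>)" "\<lambda>r. force \<epsilon> \<xi> z r / \<nu>"])
    show "continuous_on {0..} (\<lambda>r. force \<epsilon> \<xi> z r / \<nu>)"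
      using nu_pos by (intro continuous_on_halflineI continuous_intros cont_force[OF adm] zT z(2)) auto
  qed (use P Pp nu_pos force_0[OF adm] in \<open>auto intro!: continuous_intros\<close>)
  have wT: "continuous_on {0..T} w" for T
    using w(1) by (rule continuous_on_subset) auto
  have dr: "real (d - 1) = real d - 1" "real (d + 1) = real d + 1" using d_ge by auto
  show thesis
    using that[of z w] z w zT wT unfolding picard_step_def dr by blast
qed

end

section \<open>Deviation from the solution at zero temperature\<close>

lemma inverse_one_plus_square_le:
  fixes r :: real
  assumes "0 < \<eta>" "0 \<le> r"
  shows "1 / (1 + r\<^sup>2) \<le> 2 * (1 + \<eta>\<^sup>2) * decay \<eta> r ^ 2"
proof -
  have "(1 + \<eta> * r)\<^sup>2 \<le> 2 * (1 + \<eta>\<^sup>2) * (1 + r\<^sup>2)"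
  proof -
    have "0 \<le> (1 - \<eta> * r)\<^sup>2 + 2 * r\<^sup>2 + 2 * \<eta>\<^sup>2" by simp
    then show ?thesis by (simp add: algebra_simps power2_eq_square)
  qed
  moreover have "0 < 1 + \<eta> * r" "0 < 1 + r\<^sup>2" using assms by (simp_all add: add_pos_nonneg)
  ultimately show ?thesis by (simp add: decay_def field_simps)
qed

lemma radius_cancel: "(r::real) \<noteq> 0 \<Longrightarrow> r * (x / r - y / r) = x - y"
  by (simp add: right_diff_distrib)

text \<open>A family of Picard steps in one ball, with parameters of any size in (0,1] and on any intervals,
together with the solution zb, wb at \<epsilon> = 0, for which the density is P0 and every
nonlinear term is absent, so that no input enters. The conditions on \<eta> are those of the
barrier for the two kinds of linear equations, where the lower bound P0/2 for the density is used.\<close>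
locale picard_family = gas d R \<mu> lam Cv \<kappa> P0 + uniform_family \<eta> J pairs eps T
  for d R \<mu> lam Cv \<kappa> P0 \<eta> and J :: "'j set" and pairs eps T +
  fixes M B :: real and \<xi> \<zeta> z w :: "'j \<Rightarrow> real \<Rightarrow> real" and zb wb :: "real \<Rightarrow> real"
  assumes eta_small: "9 * \<eta>\<^sup>2 \<le> P0 / (4 * \<nu>)" "9 * \<eta>\<^sup>2 \<le> Cv * P0 / (4 * \<kappa>)"
    and adm: "\<And>j. j \<in> J \<Longrightarrow> admissible \<eta> M (eps j) (T j) (\<xi> j)"
    and adm_zeta: "\<And>j. j \<in> J \<Longrightarrow> admissible \<eta> M (eps j) (T j) (\<zeta> j)"
    and step: "\<And>j. j \<in> J \<Longrightarrow> picard_step (eps j) (T j) (\<xi> j) (\<zeta> j) (z j) (w j)"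
    and close: "\<And>j k \<delta> r. (j, k, \<delta>) \<in> pairs \<Longrightarrow> 0 \<le> r \<Longrightarrow> r \<le> T j \<Longrightarrow> \<bar>\<xi> j r - \<xi> k r\<bar> \<le> \<delta> * decay \<eta> r ^ 3"
      "\<And>j k \<delta> r. (j, k, \<delta>) \<in> pairs \<Longrightarrow> 0 \<le> r \<Longrightarrow> r \<le> T j \<Longrightarrow> \<bar>\<zeta> j r - \<zeta> k r\<bar> \<le> \<delta> * decay \<eta> r ^ 3"
    and M_nonneg: "0 \<le> M"
    and base: "\<And>T. picard_step 0 T (\<lambda>_. 0) (\<lambda>_. 0) zb wb"
      "\<And>r. 0 \<le> r \<Longrightarrow> \<bar>zb r\<bar> \<le> B * decay \<eta> r ^ 3" "\<And>r. 0 \<le> r \<Longrightarrow> \<bar>wb r\<bar> \<le> B * decay \<eta> r ^ 3"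
      "\<And>r. 0 \<le> r \<Longrightarrow> \<bar>div_new 0 (\<lambda>_. 0) zb wb r\<bar> \<le> B * decay \<eta> r ^ 3"
begin

lemma cont_zeta: "j \<in> J \<Longrightarrow> continuous_on {0..T j} (\<zeta> j)"
  using adm_zeta by (auto simp: admissible_def)

lemma adm_base: "admissible \<eta> 0 0 S (\<lambda>_. 0)"
  using eta_pos by (simp add: admissible_def)

lemma tame_xi: "tame 0 3 \<xi>"
proof (rule tameI[of "M + 1"])
  fix j r assume j: "j \<in> J" "0 \<le> r" "r \<le> T j"
  have "\<bar>\<xi> j r\<bar> \<le> M * decay \<eta> r ^ 3" using xi_bound[OF adm[OF j(1)] j(2,3)] .
  then show "\<bar>\<xi> j r\<bar> \<le> (M + 1) * wt 0 3 j r"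
    using decay_pos[OF eta_pos j(2)] by (simp add: wt_def distrib_right add_increasing2)
next
  fix j k \<delta> r assume j: "(j, k, \<delta>) \<in> pairs" "0 \<le> r" "r \<le> T j"
  then show "\<bar>\<xi> j r - \<xi> k r\<bar> \<le> (M + 1) * \<delta> * wt 0 3 j r"
    using close(1)[OF j] decay_pos[OF eta_pos j(2)] M_nonneg pairsD[OF j(1)]
    by (simp add: wt_def distrib_right add_increasing)
qed (use M_nonneg in auto)

lemma tame_zeta: "tame 0 3 \<zeta>"
proof (rule tameI[of "M + 1"])
  fix j r assume j: "j \<in> J" "0 \<le> r" "r \<le> T j"
  have "\<bar>\<zeta> j r\<bar> \<le> M * decay \<eta> r ^ 3" using xi_bound[OF adm_zeta[OF j(1)] j(2,3)] .
  then show "\<bar>\<zeta> j r\<bar> \<le> (M + 1) * wt 0 3 j r"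
    using decay_pos[OF eta_pos j(2)] by (simp add: wt_def distrib_right add_increasing2)
next
  fix j k \<delta> r assume j: "(j, k, \<delta>) \<in> pairs" "0 \<le> r" "r \<le> T j"
  then show "\<bar>\<zeta> j r - \<zeta> k r\<bar> \<le> (M + 1) * \<delta> * wt 0 3 j r"
    using close(2)[OF j] decay_pos[OF eta_pos j(2)] M_nonneg pairsD[OF j(1)]
    by (simp add: wt_def distrib_right add_increasing)
qed (use M_nonneg in auto)

lemma tame_mean: "tame 0 3 (\<lambda>j. mean d (\<xi> j))"
proof (rule tameI[of "M + 1"])
  fix j r assume j: "j \<in> J" "0 \<le> r" "r \<le> T j"
  have "\<bar>mean d (\<xi> j) r\<bar> \<le> M * decay \<eta> r ^ 3" using mean_bound[OF adm[OF j(1)] j(2,3)] .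
  then show "\<bar>mean d (\<xi> j) r\<bar> \<le> (M + 1) * wt 0 3 j r"
    using decay_pos[OF eta_pos j(2)] by (simp add: wt_def distrib_right add_increasing2)
next
  fix j k \<delta> r assume j: "(j, k, \<delta>) \<in> pairs" "0 \<le> r" "r \<le> T j"
  have J: "j \<in> J" "k \<in> J" "T k = T j" "0 \<le> \<delta>" using pairsD[OF j(1)] by auto
  have c: "continuous_on {0..r} (\<xi> j)" "continuous_on {0..r} (\<xi> k)"
    using j J continuous_on_subset[OF cont_xi[OF adm[OF J(1)]], of "{0..r}"]
      continuous_on_subset[OF cont_xi[OF adm[OF J(2)]], of "{0..r}"] by auto
  have "\<bar>mean d (\<lambda>s. \<xi> j s - \<xi> k s) r\<bar> \<le> \<delta> * decay \<eta> r ^ 3"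
    using j J by (intro abs_mean_le d_ge eta_pos continuous_intros c close(1)[OF j(1)]) auto
  then show "\<bar>mean d (\<xi> j) r - mean d (\<xi> k) r\<bar> \<le> (M + 1) * \<delta> * wt 0 3 j r"
    unfolding mean_diff[OF c] using decay_pos[OF eta_pos j(2)] M_nonneg J
    by (simp add: wt_def distrib_right add_increasing)
qed (use M_nonneg in auto)

lemma tame_mean_square: "tame 0 6 (\<lambda>j r. (mean d (\<xi> j) r)\<^sup>2)"
  using tame_mult[OF tame_mean tame_mean] by (simp add: power2_eq_square)

lemma tame_rate: "tame 0 3 (\<lambda>j. rate (eps j) (\<xi> j))"
proof -
  have "tame 0 0 (\<lambda>j r. 1/2 - eps j * (r * mean d (\<xi> j) r))"
  proof (intro tame_diff tame_const)
    show "tame 0 0 (\<lambda>j r. eps j * (r * mean d (\<xi> j) r))"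
      by (rule tame_product[OF tame_eps tame_radius[of 0 2]]) (use tame_mean in auto)
  qed
  then have "tame 0 0 (\<lambda>j r. 1 / (1/2 - eps j * (r * mean d (\<xi> j) r)))"
    by (rule tame_inverse[of _ "1/4"]) (use denominator_ge[OF adm] in auto)
  from tame_product[OF tame_xi this, of 0 3] show ?thesis
    by (intro tame_eq[where g = "\<lambda>j. rate (eps j) (\<xi> j)"]) (auto simp: rate_def)
qed

abbreviation (input) "dens j \<equiv> density (eps j) (\<xi> j)"

lemma tame_density: "tame 0 0 dens"
proof -
  have "tame 0 0 (\<lambda>j r. integral {0..r} (rate (eps j) (\<xi> j)))"
    by (rule tame_integral[OF tame_mono[OF tame_rate]]) (use cont_rate[OF adm] in auto)
  then have "tame 0 0 (\<lambda>j r. eps j * integral {0..r} (rate (eps j) (\<xi> j)))"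
    by (rule tame_product[OF tame_eps]) auto
  from tame_cmult[OF tame_exp[OF this], of P0] show ?thesis
    by (rule tame_eq) (simp add: density_def)
qed

lemma tame_density_rate: "tame 0 3 (\<lambda>j r. dens j r * rate (eps j) (\<xi> j) r)"
  using tame_mult[OF tame_density tame_rate] by simp

lemma cont_density_rate: "j \<in> J \<Longrightarrow> continuous_on {0..T j} (\<lambda>r. dens j r * rate (eps j) (\<xi> j) r)"
  by (intro continuous_on_mult cont_density[OF adm] cont_rate[OF adm])

lemma tame_density_deviation: "tame 1 0 (\<lambda>j r. dens j r - P0)"
proof -
  have "tame 1 0 (\<lambda>j r. eps j * integral {0..r} (\<lambda>s. dens j s * rate (eps j) (\<xi> j) s))"
    by (rule tame_product[OF tame_eps tame_integral[OF tame_mono[OF tame_density_rate]]]) (use cont_density_rate in auto)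
  then show ?thesis by (rule tame_eq) (use density_minus_P0[OF adm] in auto)
qed

lemma tame_density_slope: "tame 1 1 (\<lambda>j r. eps j * (integral {0..r} (\<lambda>s. dens j s * rate (eps j) (\<xi> j) s) / r))"
  by (rule tame_product[OF tame_eps tame_average[OF tame_mono[OF tame_density_rate]]]) (use cont_density_rate in auto)

lemma tame_inverse_one_plus_square: "tame 0 2 (\<lambda>j r. 1 / (1 + r\<^sup>2))"
  using inverse_one_plus_square_le[OF eta_pos] by (intro tame_fixed) auto

lemma tame_radius_over: "tame 0 1 (\<lambda>j r. r / (1 + r\<^sup>2))"
proof -
  have "tame 0 (1 + 1) (\<lambda>j r. 1 / (1 + r\<^sup>2))"
    using tame_inverse_one_plus_square by (simp only: one_add_one)
  from tame_radius_power[OF this] show ?thesis by simp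
qed

lemma tame_temp: "tame 0 3 f \<Longrightarrow> tame 0 2 (\<lambda>j. temp (f j))"
  unfolding temp_def by (intro tame_add tame_inverse_one_plus_square tame_radius) (simp add: numeral_3_eq_3)

lemma tame_work: "tame 0 2 (\<lambda>j. work (eps j) (\<xi> j) (\<zeta> j))"
proof -
  have 1: "tame 0 2 (\<lambda>j r. eps j * (r ^ 4 * (mean d (\<xi> j) r)\<^sup>2) / 2 + (Cv + R) * temp (\<zeta> j) r)"
  proof (intro tame_add tame_divide_const tame_cmult tame_temp tame_zeta)
    show "tame 0 2 (\<lambda>j r. eps j * (r ^ 4 * (mean d (\<xi> j) r)\<^sup>2))"
      by (rule tame_product[OF tame_eps tame_radius_power[of 0 4 2]]) (use tame_mean_square in auto)
  qed
  have 2: "tame 0 2 (\<lambda>j r. density (eps j) (\<xi> j) r * (eps j * (r ^ 4 * (mean d (\<xi> j) r)\<^sup>2) / 2 + (Cv + R) * temp (\<zeta> j) r))"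
    by (rule tame_product[OF tame_density 1]) auto
  have 3: "tame 0 2 (\<lambda>j r. r * (\<xi> j r - (real d - 1) * mean d (\<xi> j) r))" "tame 0 2 (\<lambda>j r. r * \<xi> j r)"
    by (rule tame_radius; use tame_diff[OF tame_xi tame_cmult[OF tame_mean]] tame_xi in \<open>simp add: numeral_3_eq_3 numeral_2_eq_2\<close>)+
  show ?thesis unfolding work_def by (intro tame_diff 2 tame_cmult 3)
qed

lemma tame_heat_flux: "tame 0 3 (\<lambda>j. heat_flux (eps j) (\<xi> j) (\<zeta> j))"
  unfolding heat_flux_def
  by (rule tame_radius_power) (use tame_mult[OF tame_mean tame_work] in simp)

lemma tame_density_square: "m \<le> 6 \<Longrightarrow> tame 0 (6 - m) (\<lambda>j r. dens j r * (r ^ m * (mean d (\<xi> j) r)\<^sup>2))"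
  by (rule tame_product[OF tame_density tame_radius_power[of 0 m "6 - m"]]) (use tame_mean_square in auto)

lemma tame_heat_source: "tame 0 1 (\<lambda>j. heat_source (eps j) (\<xi> j) (\<zeta> j))"
proof -
  have "tame 0 1 (\<lambda>j r. integral {0..r} (heat_flux (eps j) (\<xi> j) (\<zeta> j)) / r)"
    by (rule tame_average[OF tame_mono[OF tame_heat_flux]]) (use cont_heat_flux[OF adm cont_zeta] in auto)
  then show ?thesis unfolding heat_source_def
    using tame_density_square[of 5]
    by (intro tame_add tame_cmult tame_mono[OF tame_heat_flux]) auto
qed

text \<open>Both sources of deviation, the factor \<epsilon> of the nonlinear terms and the deviation of the
density from P0, have a factor \<epsilon>.\<close>
lemma tame_heat_rhs_deviation:
  "tame 1 1 (\<lambda>j r. heat_rhs (eps j) (\<xi> j) (\<zeta> j) r - heat_rhs 0 (\<lambda>_. 0) (\<lambda>_. 0) r)"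
proof -
  have "tame 1 1 (\<lambda>j r. - (Cv / (2 * \<kappa>)) * ((dens j r - P0) * (r / (1 + r\<^sup>2)))
      + (eps j * heat_source (eps j) (\<xi> j) (\<zeta> j) r) / \<kappa>)"
    by (intro tame_add tame_cmult tame_divide_const tame_product[OF tame_density_deviation tame_radius_over]
        tame_product[OF tame_eps tame_heat_source]) auto
  then show ?thesis
    by (rule tame_eq) (simp add: heat_rhs_def algebra_simps add_divide_distrib diff_divide_distrib)
qed

lemma tame_base: "tame 0 3 (\<lambda>j. zb)" "tame 0 3 (\<lambda>j. wb)" "tame 0 3 (\<lambda>j. div_new 0 (\<lambda>_. 0) zb wb)"
  using base by (auto intro!: tame_fixed)

lemma radius_square_base: "tame 0 3 f \<Longrightarrow> tame 0 1 (\<lambda>j r. r\<^sup>2 * f j r)"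
  by (rule tame_radius_power) simp

lemma picard_stepD:
  assumes "picard_step \<epsilon> S x y a b"
  shows "continuous_on {0..S} a" "a 0 = 0" "continuous_on {0..S} b" "b 0 = 0"
    and "\<And>r. 0 < r \<Longrightarrow> r < S \<Longrightarrow> (a has_real_derivative (heat_rhs \<epsilon> x y r - (real d - 1) * a r
          - Cv / (2 * \<kappa>) * density \<epsilon> x r * r\<^sup>2 * a r) / r) (at r)"
    and "\<And>r. 0 < r \<Longrightarrow> r < S \<Longrightarrow> (b has_real_derivative (force \<epsilon> x a r / \<nu> - (real d + 1) * b r
          - density \<epsilon> x r / (2 * \<nu>) * r\<^sup>2 * b r) / r) (at r)"
  using assms by (auto simp: picard_step_def)

text \<open>The difference z - zb solves the equation of z; the difference of the coefficients enters the
source as (P - P0) r^2 zb.\<close>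
lemma tame_z_deviation: "tame 1 3 (\<lambda>j r. z j r - zb r)"
proof (rule tame_linear_ode[where k = "real d - 1" and a = "\<lambda>j r. Cv / (2 * \<kappa>) * dens j r" and amin = "Cv * P0 / (4 * \<kappa>)"
      and g = "\<lambda>j r. heat_rhs (eps j) (\<xi> j) (\<zeta> j) r - heat_rhs 0 (\<lambda>_. 0) (\<lambda>_. 0) r - Cv / (2 * \<kappa>) * ((dens j r - P0) * (r\<^sup>2 * zb r))"
      and X' = "\<lambda>j r. (heat_rhs (eps j) (\<xi> j) (\<zeta> j) r - (real d - 1) * z j r - Cv / (2 * \<kappa>) * dens j r * r\<^sup>2 * z j r) / r
        - (heat_rhs 0 (\<lambda>_. 0) (\<lambda>_. 0) r - (real d - 1) * zb r - Cv / (2 * \<kappa>) * density 0 (\<lambda>_. 0) r * r\<^sup>2 * zb r) / r"])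
  show "tame 1 1 (\<lambda>j r. heat_rhs (eps j) (\<xi> j) (\<zeta> j) r - heat_rhs 0 (\<lambda>_. 0) (\<lambda>_. 0) r - Cv / (2 * \<kappa>) * ((dens j r - P0) * (r\<^sup>2 * zb r)))"
    by (intro tame_diff tame_heat_rhs_deviation tame_cmult tame_product[OF tame_density_deviation radius_square_base[OF tame_base(1)]]) auto
  show "tame 0 0 (\<lambda>j r. Cv / (2 * \<kappa>) * dens j r)" by (rule tame_cmult[OF tame_density])
  show "Cv * P0 / (4 * \<kappa>) \<le> Cv / (2 * \<kappa>) * dens j r" if "j \<in> J" "0 \<le> r" "r \<le> T j" for j r
    using density_bounds(1)[OF adm[OF that(1)] that(2,3)] Cv_pos kappa_pos
      mult_left_mono[of "P0 / 2" "dens j r" "Cv / (2 * \<kappa>)"] by simp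
  show "continuous_on {0..T j} (\<lambda>r. z j r - zb r)" if "j \<in> J" for j
    using picard_stepD(1)[OF step[OF that]] picard_stepD(1)[OF base(1)] by (intro continuous_intros) auto
  fix j r assume j: "j \<in> J" "0 < r" "r < T j"
  show "((\<lambda>r. z j r - zb r) has_real_derivative (heat_rhs (eps j) (\<xi> j) (\<zeta> j) r - (real d - 1) * z j r - Cv / (2 * \<kappa>) * dens j r * r\<^sup>2 * z j r) / r
        - (heat_rhs 0 (\<lambda>_. 0) (\<lambda>_. 0) r - (real d - 1) * zb r - Cv / (2 * \<kappa>) * density 0 (\<lambda>_. 0) r * r\<^sup>2 * zb r) / r) (at r)"
    by (rule DERIV_diff[OF picard_stepD(5)[OF step[OF j(1)] j(2,3)] picard_stepD(5)[OF base(1) j(2), of "r + 1"]]) simp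
  show "r * ((heat_rhs (eps j) (\<xi> j) (\<zeta> j) r - (real d - 1) * z j r - Cv / (2 * \<kappa>) * dens j r * r\<^sup>2 * z j r) / r
        - (heat_rhs 0 (\<lambda>_. 0) (\<lambda>_. 0) r - (real d - 1) * zb r - Cv / (2 * \<kappa>) * density 0 (\<lambda>_. 0) r * r\<^sup>2 * zb r) / r)
        + (real d - 1) * (z j r - zb r) + Cv / (2 * \<kappa>) * dens j r * r\<^sup>2 * (z j r - zb r)
     = heat_rhs (eps j) (\<xi> j) (\<zeta> j) r - heat_rhs 0 (\<lambda>_. 0) (\<lambda>_. 0) r - Cv / (2 * \<kappa>) * ((dens j r - P0) * (r\<^sup>2 * zb r))"
    using j by (subst radius_cancel) (simp_all add: algebra_simps diff_divide_distrib)
qed (use d_ge Cv_pos kappa_pos P0_pos eta_small picard_stepD(2)[OF step] picard_stepD(2)[OF base(1)] in auto)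

lemma tame_z: "tame 0 3 z"
  using tame_add[OF tame_mono[OF tame_z_deviation] tame_base(1)] by simp

lemma tame_square_average: "tame 0 1 (\<lambda>j r. integral {0..r} (\<lambda>s. dens j s * (s ^ 3 * (mean d (\<xi> j) s)\<^sup>2)) / r)"
proof (rule tame_average)
  show "tame 0 2 (\<lambda>j s. dens j s * (s ^ 3 * (mean d (\<xi> j) s)\<^sup>2))"
    using tame_mono[OF tame_density_square[of 3], of 0 2] by simp
  show "continuous_on {0..T j} (\<lambda>s. dens j s * (s ^ 3 * (mean d (\<xi> j) s)\<^sup>2))" if "j \<in> J" for j
    by (intro continuous_intros cont_density[OF adm] cont_mean[OF adm] that)
qed

lemma tame_force_deviation: "tame 1 1 (\<lambda>j r. force (eps j) (\<xi> j) (z j) r - force 0 (\<lambda>_. 0) zb r)"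
proof -
  have "tame 1 1 (\<lambda>j r. eps j * (dens j r * (r ^ 3 * (mean d (\<xi> j) r)\<^sup>2))
     + R * (eps j * (integral {0..r} (\<lambda>s. dens j s * rate (eps j) (\<xi> j) s) / r) * temp (z j) r + P0 * (z j r - zb r))
     + (real d - 1) * (eps j * (integral {0..r} (\<lambda>s. dens j s * (s ^ 3 * (mean d (\<xi> j) s)\<^sup>2)) / r)))"
    using tame_density_square[of 3]
    by (intro tame_add tame_cmult tame_product[OF tame_eps tame_square_average]
        tame_product[OF tame_density_slope tame_temp[OF tame_z]] tame_mono[OF tame_z_deviation]
        tame_product[OF tame_eps, of 0 3]) auto
  then show ?thesis
  proof (rule tame_eq)
    fix j r assume j: "j \<in> J" "0 \<le> r" "r \<le> T j"
    note j_force = force_alt[where z = "z j", OF adm[OF j(1)] j(2,3) picard_stepD(2)[OF step[OF j(1)]]]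
    note b_force = force_alt[where z = zb, OF adm_base j(2) order_refl picard_stepD(2)[OF base(1)]]
    show "force (eps j) (\<xi> j) (z j) r - force 0 (\<lambda>_. 0) zb r =
       eps j * (dens j r * (r ^ 3 * (mean d (\<xi> j) r)\<^sup>2))
     + R * (eps j * (integral {0..r} (\<lambda>s. dens j s * rate (eps j) (\<xi> j) s) / r) * temp (z j) r + P0 * (z j r - zb r))
     + (real d - 1) * (eps j * (integral {0..r} (\<lambda>s. dens j s * (s ^ 3 * (mean d (\<xi> j) s)\<^sup>2)) / r))"
      unfolding j_force b_force by (simp add: algebra_simps)
  qed
qed

lemma tame_w_deviation: "tame 1 3 (\<lambda>j r. w j r - wb r)"
proof (rule tame_linear_ode[where k = "real d + 1" and a = "\<lambda>j r. dens j r / (2 * \<nu>)" and amin = "P0 / (4 * \<nu>)"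
      and g = "\<lambda>j r. (force (eps j) (\<xi> j) (z j) r - force 0 (\<lambda>_. 0) zb r) / \<nu> - ((dens j r - P0) * (r\<^sup>2 * wb r)) / (2 * \<nu>)"
      and X' = "\<lambda>j r. (force (eps j) (\<xi> j) (z j) r / \<nu> - (real d + 1) * w j r - dens j r / (2 * \<nu>) * r\<^sup>2 * w j r) / r
        - (force 0 (\<lambda>_. 0) zb r / \<nu> - (real d + 1) * wb r - density 0 (\<lambda>_. 0) r / (2 * \<nu>) * r\<^sup>2 * wb r) / r"])
  show "tame 1 1 (\<lambda>j r. (force (eps j) (\<xi> j) (z j) r - force 0 (\<lambda>_. 0) zb r) / \<nu> - ((dens j r - P0) * (r\<^sup>2 * wb r)) / (2 * \<nu>))"
    by (intro tame_diff tame_divide_const tame_force_deviation tame_product[OF tame_density_deviation radius_square_base[OF tame_base(2)]]) auto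
  show "P0 / (4 * \<nu>) \<le> dens j r / (2 * \<nu>)" if "j \<in> J" "0 \<le> r" "r \<le> T j" for j r
    using density_bounds(1)[OF adm[OF that(1)] that(2,3)] nu_pos divide_right_mono[of "P0 / 2" "dens j r" "2 * \<nu>"] by simp
  show "continuous_on {0..T j} (\<lambda>r. w j r - wb r)" if "j \<in> J" for j
    using picard_stepD(3)[OF step[OF that]] picard_stepD(3)[OF base(1)] by (intro continuous_intros) auto
  fix j r assume j: "j \<in> J" "0 < r" "r < T j"
  show "((\<lambda>r. w j r - wb r) has_real_derivative (force (eps j) (\<xi> j) (z j) r / \<nu> - (real d + 1) * w j r - dens j r / (2 * \<nu>) * r\<^sup>2 * w j r) / r
        - (force 0 (\<lambda>_. 0) zb r / \<nu> - (real d + 1) * wb r - density 0 (\<lambda>_. 0) r / (2 * \<nu>) * r\<^sup>2 * wb r) / r) (at r)"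
    by (rule DERIV_diff[OF picard_stepD(6)[OF step[OF j(1)] j(2,3)] picard_stepD(6)[OF base(1) j(2), of "r + 1"]]) simp
  show "r * ((force (eps j) (\<xi> j) (z j) r / \<nu> - (real d + 1) * w j r - dens j r / (2 * \<nu>) * r\<^sup>2 * w j r) / r
        - (force 0 (\<lambda>_. 0) zb r / \<nu> - (real d + 1) * wb r - density 0 (\<lambda>_. 0) r / (2 * \<nu>) * r\<^sup>2 * wb r) / r)
        + (real d + 1) * (w j r - wb r) + dens j r / (2 * \<nu>) * r\<^sup>2 * (w j r - wb r)
     = (force (eps j) (\<xi> j) (z j) r - force 0 (\<lambda>_. 0) zb r) / \<nu> - ((dens j r - P0) * (r\<^sup>2 * wb r)) / (2 * \<nu>)"
    using j by (subst radius_cancel) (simp_all add: algebra_simps diff_divide_distrib)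
qed (use nu_pos P0_pos eta_small tame_divide_const[OF tame_density] picard_stepD(4)[OF step] picard_stepD(4)[OF base(1)] in auto)

lemma tame_w: "tame 0 3 w"
  using tame_add[OF tame_mono[OF tame_w_deviation] tame_base(2)] by simp

lemma tame_temp_slope_deviation:
  "tame 1 1 (\<lambda>j r. temp_slope (eps j) (\<xi> j) (\<zeta> j) (z j) r - temp_slope 0 (\<lambda>_. 0) (\<lambda>_. 0) zb r)"
proof -
  have "tame 1 1 (\<lambda>j r. (z j r - zb r) + ((heat_rhs (eps j) (\<xi> j) (\<zeta> j) r - heat_rhs 0 (\<lambda>_. 0) (\<lambda>_. 0) r)
     - (real d - 1) * (z j r - zb r) - Cv / (2 * \<kappa>) * ((dens j r - P0) * (r\<^sup>2 * z j r) + r\<^sup>2 * (P0 * (z j r - zb r)))))"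
    using tame_z_deviation
    by (intro tame_add tame_diff tame_cmult tame_mono[OF tame_z_deviation] tame_heat_rhs_deviation
        tame_product[OF tame_density_deviation radius_square_base[OF tame_z]] tame_radius_power) auto
  then show ?thesis by (rule tame_eq) (simp add: temp_slope_def algebra_simps)
qed

lemma tame_base_temp_slope: "tame 0 1 (\<lambda>j. temp_slope 0 (\<lambda>_. 0) (\<lambda>_. 0) zb)"
proof -
  have q: "tame 0 1 (\<lambda>j r. r / (1 + r\<^sup>2) * (1 / (1 + r\<^sup>2)))"
    by (rule tame_product[OF tame_radius_over tame_inverse_one_plus_square]) auto
  have "tame 0 1 (\<lambda>j r. - 2 * (r / (1 + r\<^sup>2) * (1 / (1 + r\<^sup>2))) + zb r
     + ((real d - 2) * (r / (1 + r\<^sup>2)) + 2 * (r / (1 + r\<^sup>2) * (1 / (1 + r\<^sup>2))) - Cv / (2 * \<kappa>) * (P0 * (r / (1 + r\<^sup>2)))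
       - (real d - 1) * zb r - Cv / (2 * \<kappa>) * (P0 * (r\<^sup>2 * zb r))))"
    by (intro tame_add tame_diff tame_cmult q tame_radius_over radius_square_base tame_base(1) tame_mono[OF tame_base(1)]) auto
  then show ?thesis
    by (rule tame_eq) (simp add: temp_slope_def heat_rhs_def power2_eq_square)
qed

lemma tame_temp_slope: "tame 0 1 (\<lambda>j. temp_slope (eps j) (\<xi> j) (\<zeta> j) (z j))"
  using tame_add[OF tame_mono[OF tame_temp_slope_deviation] tame_base_temp_slope] by simp

lemma tame_force_slope_deviation:
  "tame 1 1 (\<lambda>j r. force_slope (eps j) (\<xi> j) (\<zeta> j) (z j) r - force_slope 0 (\<lambda>_. 0) (\<lambda>_. 0) zb r)"
proof -
  have r4: "tame 0 2 (\<lambda>j r. r ^ 4 * (mean d (\<xi> j) r)\<^sup>2)"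
    by (rule tame_radius_power) (use tame_mean_square in simp)
  have 1: "tame 1 1 (\<lambda>j r. eps j * (dens j r * rate (eps j) (\<xi> j) r * (r ^ 4 * (mean d (\<xi> j) r)\<^sup>2)))"
    by (rule tame_product[OF tame_eps tame_mult[OF tame_density_rate r4]]) auto
  have 2: "tame 1 1 (\<lambda>j r. eps j * (eps j * (dens j r * rate (eps j) (\<xi> j) r * (r ^ 4 * (mean d (\<xi> j) r)\<^sup>2))))"
    by (rule tame_product[OF tame_eps 1]) auto
  have "tame 0 6 (\<lambda>j r. 4 * (mean d (\<xi> j) r)\<^sup>2 + 2 * (mean d (\<xi> j) r * (\<xi> j r - (real d + 1) * mean d (\<xi> j) r)))"
    by (intro tame_add tame_cmult tame_mean_square tame_product[OF tame_mean tame_diff[OF tame_xi tame_cmult[OF tame_mean]]]) auto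
  then have 3: "tame 0 3 (\<lambda>j r. r ^ 3 * (4 * (mean d (\<xi> j) r)\<^sup>2 + 2 * (mean d (\<xi> j) r * (\<xi> j r - (real d + 1) * mean d (\<xi> j) r))))"
    by (intro tame_radius_power) auto
  have 4: "tame 1 1 (\<lambda>j r. eps j * (dens j r * (r ^ 3 * (4 * (mean d (\<xi> j) r)\<^sup>2 + 2 * (mean d (\<xi> j) r * (\<xi> j r - (real d + 1) * mean d (\<xi> j) r))))))"
    by (rule tame_product[OF tame_eps tame_mult[OF tame_density 3]]) auto
  have 5: "tame 1 1 (\<lambda>j r. eps j * (dens j r * rate (eps j) (\<xi> j) r * temp (z j) r))"
    by (rule tame_product[OF tame_eps tame_mult[OF tame_density_rate tame_temp[OF tame_z]]]) auto
  have 6: "tame 1 1 (\<lambda>j r. eps j * (dens j r * (r ^ 3 * (mean d (\<xi> j) r)\<^sup>2)))"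
    using tame_density_square[of 3] by (intro tame_product[OF tame_eps, of 0 3]) auto
  have 7: "tame 1 1 (\<lambda>j r. (dens j r - P0) * temp_slope (eps j) (\<xi> j) (\<zeta> j) (z j) r)"
    by (rule tame_product[OF tame_density_deviation tame_temp_slope]) auto
  have "tame 1 1 (\<lambda>j r. eps j * (eps j * (dens j r * rate (eps j) (\<xi> j) r * (r ^ 4 * (mean d (\<xi> j) r)\<^sup>2)))
     + eps j * (dens j r * (r ^ 3 * (4 * (mean d (\<xi> j) r)\<^sup>2 + 2 * (mean d (\<xi> j) r * (\<xi> j r - (real d + 1) * mean d (\<xi> j) r)))))
     + R * (eps j * (dens j r * rate (eps j) (\<xi> j) r * temp (z j) r) + ((dens j r - P0) * temp_slope (eps j) (\<xi> j) (\<zeta> j) (z j) r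
        + P0 * (temp_slope (eps j) (\<xi> j) (\<zeta> j) (z j) r - temp_slope 0 (\<lambda>_. 0) (\<lambda>_. 0) zb r)))
     + (real d - 1) * (eps j * (dens j r * (r ^ 3 * (mean d (\<xi> j) r)\<^sup>2))))"
    by (intro tame_add tame_cmult 2 4 5 6 7 tame_temp_slope_deviation)
  then show ?thesis by (rule tame_eq) (simp add: force_slope_def algebra_simps)
qed

lemma tame_div_source_deviation:
  "tame 1 1 (\<lambda>j r. div_source (eps j) (\<xi> j) (\<zeta> j) (z j) (w j) r - div_source 0 (\<lambda>_. 0) (\<lambda>_. 0) zb wb r)"
proof -
  have r3w: "tame 0 0 (\<lambda>j r. r ^ 3 * w j r)"
    by (rule tame_radius_power) (use tame_w in simp)
  have r2w: "tame 1 1 (\<lambda>j r. r\<^sup>2 * (w j r - wb r))"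
    by (rule tame_radius_power) (use tame_w_deviation in simp)
  have "tame 1 1 (\<lambda>j r. (force_slope (eps j) (\<xi> j) (\<zeta> j) (z j) r - force_slope 0 (\<lambda>_. 0) (\<lambda>_. 0) zb r)
     + (real d - 2) / 2 * ((dens j r - P0) * (r\<^sup>2 * w j r) + P0 * (r\<^sup>2 * (w j r - wb r)))
     - (eps j * (dens j r * rate (eps j) (\<xi> j) r * (r ^ 3 * w j r))) / 2)"
    by (intro tame_add tame_diff tame_cmult tame_divide_const tame_force_slope_deviation r2w
        tame_product[OF tame_density_deviation radius_square_base[OF tame_w]]
        tame_product[OF tame_eps tame_mult[OF tame_density_rate r3w]]) auto
  then show ?thesis by (rule tame_eq) (simp add: div_source_def algebra_simps)
qed

lemma tame_div_deviation:
  "tame 1 3 (\<lambda>j r. div_new (eps j) (\<xi> j) (z j) (w j) r - div_new 0 (\<lambda>_. 0) zb wb r)"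
proof (rule tame_linear_ode[where k = 1 and a = "\<lambda>j r. dens j r / (2 * \<nu>)" and amin = "P0 / (4 * \<nu>)"
      and g = "\<lambda>j r. (div_source (eps j) (\<xi> j) (\<zeta> j) (z j) (w j) r - div_source 0 (\<lambda>_. 0) (\<lambda>_. 0) zb wb r) / \<nu>
         - ((dens j r - P0) * (r\<^sup>2 * div_new 0 (\<lambda>_. 0) zb wb r)) / (2 * \<nu>)"
      and X' = "\<lambda>j r. (div_source (eps j) (\<xi> j) (\<zeta> j) (z j) (w j) r / \<nu> - div_new (eps j) (\<xi> j) (z j) (w j) r
            - dens j r / (2 * \<nu>) * r\<^sup>2 * div_new (eps j) (\<xi> j) (z j) (w j) r) / r
        - (div_source 0 (\<lambda>_. 0) (\<lambda>_. 0) zb wb r / \<nu> - div_new 0 (\<lambda>_. 0) zb wb r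
            - density 0 (\<lambda>_. 0) r / (2 * \<nu>) * r\<^sup>2 * div_new 0 (\<lambda>_. 0) zb wb r) / r"])
  show "tame 1 1 (\<lambda>j r. (div_source (eps j) (\<xi> j) (\<zeta> j) (z j) (w j) r - div_source 0 (\<lambda>_. 0) (\<lambda>_. 0) zb wb r) / \<nu>
         - ((dens j r - P0) * (r\<^sup>2 * div_new 0 (\<lambda>_. 0) zb wb r)) / (2 * \<nu>))"
    by (intro tame_diff tame_divide_const tame_div_source_deviation
        tame_product[OF tame_density_deviation radius_square_base[OF tame_base(3)]]) auto
  show "P0 / (4 * \<nu>) \<le> dens j r / (2 * \<nu>)" if "j \<in> J" "0 \<le> r" "r \<le> T j" for j r
    using density_bounds(1)[OF adm[OF that(1)] that(2,3)] nu_pos divide_right_mono[of "P0 / 2" "dens j r" "2 * \<nu>"] by simp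
  show "continuous_on {0..T j} (\<lambda>r. div_new (eps j) (\<xi> j) (z j) (w j) r - div_new 0 (\<lambda>_. 0) zb wb r)" if "j \<in> J" for j
    using picard_stepD(1-3)[OF step[OF that]] picard_stepD(1-3)[OF base(1)]
    by (intro continuous_on_diff cont_div_new[OF adm[OF that]] cont_div_new[OF adm_base]) auto
  fix j r assume j: "j \<in> J" "0 < r" "r < T j"
  show "((\<lambda>r. div_new (eps j) (\<xi> j) (z j) (w j) r - div_new 0 (\<lambda>_. 0) zb wb r) has_real_derivative
     (div_source (eps j) (\<xi> j) (\<zeta> j) (z j) (w j) r / \<nu> - div_new (eps j) (\<xi> j) (z j) (w j) r
            - dens j r / (2 * \<nu>) * r\<^sup>2 * div_new (eps j) (\<xi> j) (z j) (w j) r) / r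
        - (div_source 0 (\<lambda>_. 0) (\<lambda>_. 0) zb wb r / \<nu> - div_new 0 (\<lambda>_. 0) zb wb r
            - density 0 (\<lambda>_. 0) r / (2 * \<nu>) * r\<^sup>2 * div_new 0 (\<lambda>_. 0) zb wb r) / r) (at r)"
    by (rule DERIV_diff[OF div_new_has_derivative[OF adm[OF j(1)] step[OF j(1)] j(2,3)]
          div_new_has_derivative[OF adm_base base(1) j(2), of "r + 1"]]) simp
  show "r * ((div_source (eps j) (\<xi> j) (\<zeta> j) (z j) (w j) r / \<nu> - div_new (eps j) (\<xi> j) (z j) (w j) r
            - dens j r / (2 * \<nu>) * r\<^sup>2 * div_new (eps j) (\<xi> j) (z j) (w j) r) / r
        - (div_source 0 (\<lambda>_. 0) (\<lambda>_. 0) zb wb r / \<nu> - div_new 0 (\<lambda>_. 0) zb wb r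
            - density 0 (\<lambda>_. 0) r / (2 * \<nu>) * r\<^sup>2 * div_new 0 (\<lambda>_. 0) zb wb r) / r)
     + 1 * (div_new (eps j) (\<xi> j) (z j) (w j) r - div_new 0 (\<lambda>_. 0) zb wb r)
     + dens j r / (2 * \<nu>) * r\<^sup>2 * (div_new (eps j) (\<xi> j) (z j) (w j) r - div_new 0 (\<lambda>_. 0) zb wb r)
     = (div_source (eps j) (\<xi> j) (\<zeta> j) (z j) (w j) r - div_source 0 (\<lambda>_. 0) (\<lambda>_. 0) zb wb r) / \<nu>
         - ((dens j r - P0) * (r\<^sup>2 * div_new 0 (\<lambda>_. 0) zb wb r)) / (2 * \<nu>)"
    using j by (subst radius_cancel) (simp_all add: algebra_simps diff_divide_distrib)
qed (use nu_pos P0_pos eta_small tame_divide_const[OF tame_density] div_new_0[OF adm] div_new_0[OF adm_base] in auto)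

end

context gas
begin

lemma eta_exists:
  obtains \<eta> where "0 < \<eta>" "9 * \<eta>\<^sup>2 \<le> P0 / (4 * \<nu>)" "9 * \<eta>\<^sup>2 \<le> Cv * P0 / (4 * \<kappa>)"
proof -
  define m where "m = min (P0 / (4 * \<nu>)) (Cv * P0 / (4 * \<kappa>))"
  have "0 < m" unfolding m_def using P0_pos nu_pos Cv_pos kappa_pos by simp
  then have "0 < sqrt (m / 9)" "9 * (sqrt (m / 9))\<^sup>2 \<le> m" by auto
  then show thesis using that[of "sqrt (m / 9)"] unfolding m_def by linarith
qed

text \<open>At \<epsilon> = 0 the density is constant and the source of z is explicit; the barrier bounds z,
then w, and then \<open>div_new\<close> through its differentiated equation.\<close>
lemma base_solution_exists:
  assumes \<eta>: "0 < \<eta>" "9 * \<eta>\<^sup>2 \<le> P0 / (4 * \<nu>)" "9 * \<eta>\<^sup>2 \<le> Cv * P0 / (4 * \<kappa>)"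
  obtains zb wb B where "0 < B" "\<And>T. picard_step 0 T (\<lambda>_. 0) (\<lambda>_. 0) zb wb"
    "\<And>r. 0 \<le> r \<Longrightarrow> \<bar>zb r\<bar> \<le> B * decay \<eta> r ^ 3" "\<And>r. 0 \<le> r \<Longrightarrow> \<bar>wb r\<bar> \<le> B * decay \<eta> r ^ 3"
    "\<And>r. 0 \<le> r \<Longrightarrow> \<bar>div_new 0 (\<lambda>_. 0) zb wb r\<bar> \<le> B * decay \<eta> r ^ 3"
proof -
  have adm0: "admissible \<eta> 0 0 T (\<lambda>_. 0)" for T
    using \<eta> by (simp add: admissible_def)
  obtain zb wb where step: "\<And>T. picard_step 0 T (\<lambda>_. 0) (\<lambda>_. 0) zb wb"
    using picard_step_exists[OF adm0] continuous_on_const by metis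
  have stepD: "continuous_on {0..T} zb" "zb 0 = 0" "continuous_on {0..T} wb" "wb 0 = 0"
    "0 < r \<Longrightarrow> r < T \<Longrightarrow> (zb has_real_derivative (heat_rhs 0 (\<lambda>_. 0) (\<lambda>_. 0) r - (real d - 1) * zb r
          - Cv / (2 * \<kappa>) * P0 * r\<^sup>2 * zb r) / r) (at r)"
    "0 < r \<Longrightarrow> r < T \<Longrightarrow> (wb has_real_derivative (force 0 (\<lambda>_. 0) zb r / \<nu> - (real d + 1) * wb r
          - P0 / (2 * \<nu>) * r\<^sup>2 * wb r) / r) (at r)" for T r
    using step[of T] by (auto simp: picard_step_def)
  let ?\<sigma> = "decay \<eta>"
  define q where "q = 2 * (1 + \<eta>\<^sup>2) / \<eta>"
  have q0: "0 < q" unfolding q_def using \<eta>(1) by (intro divide_pos_pos mult_pos_pos add_pos_nonneg) auto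
  have \<sigma>: "0 < ?\<sigma> r" "?\<sigma> r \<le> 1" if "0 \<le> r" for r
    using decay_pos decay_le_one \<eta>(1) that by auto
  have qr: "r / (1 + r\<^sup>2) \<le> q * ?\<sigma> r" if "0 \<le> r" for r
  proof -
    have "r * (1 / (1 + r\<^sup>2)) \<le> r * (2 * (1 + \<eta>\<^sup>2) * ?\<sigma> r ^ 2)"
      using inverse_one_plus_square_le[OF \<eta>(1) that] that by (intro mult_left_mono) auto
    also have "\<dots> = 2 * (1 + \<eta>\<^sup>2) * ((r * ?\<sigma> r) * ?\<sigma> r)" by (simp add: power2_eq_square)
    also have "\<dots> \<le> 2 * (1 + \<eta>\<^sup>2) * (1 / \<eta> * ?\<sigma> r)"
      using mult_decay_le[OF \<eta>(1) that] \<sigma>[OF that] by (intro mult_left_mono mult_right_mono) auto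
    finally show ?thesis by (simp add: q_def)
  qed
  have cube_le: "?\<sigma> r ^ 3 \<le> ?\<sigma> r" if "0 \<le> r" for r
    using decay_pow_antimono[OF \<eta>(1) that, of 1 3] by simp
  have r2cube: "r\<^sup>2 * ?\<sigma> r ^ 3 \<le> 1 / \<eta>\<^sup>2 * ?\<sigma> r" if "0 \<le> r" for r
  proof -
    have "r\<^sup>2 * ?\<sigma> r ^ 3 = (r * ?\<sigma> r)\<^sup>2 * ?\<sigma> r" by (simp add: power2_eq_square power3_eq_cube)
    also have "\<dots> \<le> (1 / \<eta>)\<^sup>2 * ?\<sigma> r"
      using mult_decay_le[OF \<eta>(1) that] \<sigma>[OF that] that by (intro mult_right_mono power_mono) auto
    finally show ?thesis by (simp add: power_divide)
  qed
  have dd: "0 \<le> real d - 2" "1 \<le> real d - 1" using d_ge by auto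
  let ?a = "Cv * P0 / (2 * \<kappa>)"
  have a0: "0 < ?a" using Cv_pos P0_pos kappa_pos by simp
  define H where "H = (real d + ?a) * q"
  have H0: "0 \<le> H" unfolding H_def using q0 a0 by simp
  have heat: "\<bar>heat_rhs 0 (\<lambda>_. 0) (\<lambda>_. 0) r\<bar> \<le> H * ?\<sigma> r" if r: "0 \<le> r" for r
  proof -
    define p where "p = r / (1 + r\<^sup>2)"
    have p0: "0 \<le> p" unfolding p_def using r by simp
    have i1: "0 \<le> 1 / (1 + r\<^sup>2)" "1 / (1 + r\<^sup>2) \<le> 1" by (auto simp: add_pos_nonneg)
    have eq: "heat_rhs 0 (\<lambda>_. 0) (\<lambda>_. 0) r = (real d - 2) * p + 2 * (p * (1 / (1 + r\<^sup>2))) - ?a * p"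
      unfolding heat_rhs_def p_def by (simp add: power2_eq_square)
    have "p * (1 / (1 + r\<^sup>2)) \<le> p * 1" "0 \<le> p * (1 / (1 + r\<^sup>2))"
      using mult_left_mono[OF i1(2) p0] mult_nonneg_nonneg[OF p0 i1(1)] by simp_all
    moreover have "0 \<le> (real d - 2) * p" "0 \<le> ?a * p"
      by (rule mult_nonneg_nonneg[OF dd(1) p0], rule mult_nonneg_nonneg[OF less_imp_le[OF a0] p0])
    ultimately have "\<bar>heat_rhs 0 (\<lambda>_. 0) (\<lambda>_. 0) r\<bar> \<le> (real d - 2) * p + 2 * p + ?a * p"
      unfolding eq by linarith
    also have "\<dots> = (real d + ?a) * p" by (simp add: algebra_simps)
    also have "\<dots> \<le> (real d + ?a) * (q * ?\<sigma> r)"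
      using qr[OF r] a0 unfolding p_def by (intro mult_left_mono) auto
    finally show ?thesis by (simp add: H_def)
  qed
  have zb: "\<bar>zb r\<bar> \<le> 2 * H * ?\<sigma> r ^ 3" if r: "0 \<le> r" for r
  proof (rule decay_bound_linear_ode[OF \<eta>(1) \<eta>(3) dd(2) stepD(1,2), where T = r and a = "\<lambda>_. ?a"])
    show "Cv * P0 / (4 * \<kappa>) \<le> ?a" using a0 by simp
    show "(zb has_real_derivative (heat_rhs 0 (\<lambda>_. 0) (\<lambda>_. 0) t - (real d - 1) * zb t
          - Cv / (2 * \<kappa>) * P0 * t\<^sup>2 * zb t) / t) (at t)" if "0 < t" "t < r" for t
      using stepD(5)[OF that] .
    show "\<bar>t * ((heat_rhs 0 (\<lambda>_. 0) (\<lambda>_. 0) t - (real d - 1) * zb t - Cv / (2 * \<kappa>) * P0 * t\<^sup>2 * zb t) / t)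
        + (real d - 1) * zb t + ?a * t\<^sup>2 * zb t\<bar> \<le> H * ?\<sigma> t" if "0 < t" "t < r" for t
      using heat[of t] that by (simp add: field_simps)
  qed (use H0 r in auto)
  define L where "L = R * P0 * (q + 2 * H)"
  have L0: "0 \<le> L" unfolding L_def using R_pos P0_pos q0 H0 by simp
  have force: "\<bar>force 0 (\<lambda>_. 0) zb r\<bar> \<le> L * ?\<sigma> r" if r: "0 \<le> r" for r
  proof -
    have eq: "force 0 (\<lambda>_. 0) zb r = R * (P0 * (zb r - r / (1 + r\<^sup>2)))"
      by (simp add: force_alt[where z = zb, OF adm0 r order_refl stepD(2)])
    have "\<bar>zb r - r / (1 + r\<^sup>2)\<bar> \<le> \<bar>zb r\<bar> + r / (1 + r\<^sup>2)"
      using abs_triangle_ineq4[of "zb r" "r / (1 + r\<^sup>2)"] r by simp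
    also have "\<dots> \<le> 2 * H * ?\<sigma> r + q * ?\<sigma> r"
      using zb[OF r] qr[OF r] mult_left_mono[OF cube_le[OF r], of "2 * H"] H0 by simp
    finally have "R * P0 * \<bar>zb r - r / (1 + r\<^sup>2)\<bar> \<le> R * P0 * ((q + 2 * H) * ?\<sigma> r)"
      using R_pos P0_pos by (intro mult_left_mono) (auto simp: algebra_simps)
    then show ?thesis unfolding eq L_def using R_pos P0_pos by (simp add: abs_mult mult_ac)
  qed
  have wb: "\<bar>wb r\<bar> \<le> 2 * (L / \<nu>) * ?\<sigma> r ^ 3" if r: "0 \<le> r" for r
  proof (rule decay_bound_linear_ode[where k = "real d + 1" and a = "\<lambda>_. P0 / (2 * \<nu>)" and T = r, OF \<eta>(1) \<eta>(2) _ stepD(3,4)])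
    show "P0 / (4 * \<nu>) \<le> P0 / (2 * \<nu>)" using P0_pos nu_pos by (intro divide_left_mono) auto
    show "(wb has_real_derivative (force 0 (\<lambda>_. 0) zb t / \<nu> - (real d + 1) * wb t - P0 / (2 * \<nu>) * t\<^sup>2 * wb t) / t) (at t)"
      if "0 < t" "t < r" for t
      using stepD(6)[OF that] .
    show "\<bar>t * ((force 0 (\<lambda>_. 0) zb t / \<nu> - (real d + 1) * wb t - P0 / (2 * \<nu>) * t\<^sup>2 * wb t) / t)
        + (real d + 1) * wb t + P0 / (2 * \<nu>) * t\<^sup>2 * wb t\<bar> \<le> L / \<nu> * ?\<sigma> t" if "0 < t" "t < r" for t
      using force[of t] nu_pos that by (simp add: field_simps)
  qed (use L0 nu_pos r in auto)
  have square: "\<bar>P0 * (r\<^sup>2 * f)\<bar> \<le> P0 * C / \<eta>\<^sup>2 * ?\<sigma> r" if r: "0 \<le> r" and f: "\<bar>f\<bar> \<le> C * ?\<sigma> r ^ 3" and C: "0 \<le> C" for r f C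
  proof -
    have "\<bar>P0 * (r\<^sup>2 * f)\<bar> = P0 * (r\<^sup>2 * \<bar>f\<bar>)" using P0_pos by (simp add: abs_mult)
    also have "\<dots> \<le> P0 * (r\<^sup>2 * (C * ?\<sigma> r ^ 3))" using f P0_pos by (intro mult_left_mono) auto
    also have "\<dots> = P0 * C * (r\<^sup>2 * ?\<sigma> r ^ 3)" by simp
    also have "\<dots> \<le> P0 * C * (1 / \<eta>\<^sup>2 * ?\<sigma> r)" using r2cube[OF r] P0_pos C by (intro mult_left_mono) auto
    finally show ?thesis by simp
  qed
  let ?X = "div_new 0 (\<lambda>_. 0) zb wb"
  define G where "G = 2 * q + 2 * H + (H + (real d - 1) * (2 * H) + Cv / (2 * \<kappa>) * (P0 * (2 * H) / \<eta>\<^sup>2))"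
  have slope: "\<bar>temp_slope 0 (\<lambda>_. 0) (\<lambda>_. 0) zb r\<bar> \<le> G * ?\<sigma> r" if r: "0 \<le> r" for r
  proof -
    have z1: "\<bar>zb r\<bar> \<le> 2 * H * ?\<sigma> r"
      using zb[OF r] mult_left_mono[OF cube_le[OF r], of "2 * H"] H0 by simp
    have p1: "0 \<le> r / (1 + r\<^sup>2)\<^sup>2" "r / (1 + r\<^sup>2)\<^sup>2 \<le> q * ?\<sigma> r"
    proof -
      have "r / (1 + r\<^sup>2)\<^sup>2 \<le> r / (1 + r\<^sup>2)"
        using r by (intro divide_left_mono) (auto simp: power2_eq_square add_pos_nonneg)
      then show "r / (1 + r\<^sup>2)\<^sup>2 \<le> q * ?\<sigma> r" using qr[OF r] by linarith
    qed (use r in simp)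
    have z2: "\<bar>(real d - 1) * zb r\<bar> \<le> (real d - 1) * (2 * H * ?\<sigma> r)"
      using z1 dd by (simp add: abs_mult mult_left_mono)
    have z3: "\<bar>Cv / (2 * \<kappa>) * (P0 * (r\<^sup>2 * zb r))\<bar> \<le> Cv / (2 * \<kappa>) * (P0 * (2 * H) / \<eta>\<^sup>2 * ?\<sigma> r)"
      unfolding abs_mult[of "Cv / (2 * \<kappa>)"]
      using square[OF r zb[OF r]] H0 Cv_pos kappa_pos by (intro mult_mono) auto
    have "\<bar>temp_slope 0 (\<lambda>_. 0) (\<lambda>_. 0) zb r\<bar> \<le> 2 * (q * ?\<sigma> r) + 2 * H * ?\<sigma> r
      + (H * ?\<sigma> r + (real d - 1) * (2 * H * ?\<sigma> r) + Cv / (2 * \<kappa>) * (P0 * (2 * H) / \<eta>\<^sup>2 * ?\<sigma> r))"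
      unfolding temp_slope_def density_zero using z1 z2 z3 p1 heat[OF r] by linarith
    also have "\<dots> = G * ?\<sigma> r" unfolding G_def by (simp add: algebra_simps)
    finally show ?thesis .
  qed
  define N where "N = R * (P0 * G) + (real d - 2) / 2 * (P0 * (2 * (L / \<nu>)) / \<eta>\<^sup>2)"
  have src: "\<bar>div_source 0 (\<lambda>_. 0) (\<lambda>_. 0) zb wb r\<bar> \<le> N * ?\<sigma> r" if r: "0 \<le> r" for r
  proof -
    have "\<bar>R * (P0 * temp_slope 0 (\<lambda>_. 0) (\<lambda>_. 0) zb r)\<bar> \<le> R * (P0 * (G * ?\<sigma> r))"
      using slope[OF r] R_pos P0_pos by (simp add: abs_mult)
    moreover have "\<bar>(real d - 2) / 2 * (P0 * (r\<^sup>2 * wb r))\<bar> \<le> (real d - 2) / 2 * (P0 * (2 * (L / \<nu>)) / \<eta>\<^sup>2 * ?\<sigma> r)"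
      unfolding abs_mult[of "(real d - 2) / 2"]
      using square[OF r wb[OF r]] L0 nu_pos dd by (intro mult_mono) auto
    ultimately have "\<bar>R * (P0 * temp_slope 0 (\<lambda>_. 0) (\<lambda>_. 0) zb r) + (real d - 2) / 2 * (P0 * (r\<^sup>2 * wb r))\<bar>
      \<le> R * (P0 * (G * ?\<sigma> r)) + (real d - 2) / 2 * (P0 * (2 * (L / \<nu>)) / \<eta>\<^sup>2 * ?\<sigma> r)"
      by linarith
    also have "\<dots> = N * ?\<sigma> r" by (simp add: N_def algebra_simps)
    finally show ?thesis by (simp add: div_source_def force_slope_def)
  qed
  have N0: "0 \<le> N" using src[of 0] by auto
  have X: "\<bar>?X r\<bar> \<le> 2 * (N / \<nu>) * ?\<sigma> r ^ 3" if r: "0 \<le> r" for r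
  proof (rule decay_bound_linear_ode[where k = 1 and a = "\<lambda>_. P0 / (2 * \<nu>)" and T = r, OF \<eta>(1) \<eta>(2)])
    show "P0 / (4 * \<nu>) \<le> P0 / (2 * \<nu>)" using P0_pos nu_pos by (intro divide_left_mono) auto
    show "continuous_on {0..r} ?X" by (rule cont_div_new[OF adm0 stepD(1,2,3)])
    show "?X 0 = 0" by (rule div_new_0[OF adm0])
    show "(?X has_real_derivative (div_source 0 (\<lambda>_. 0) (\<lambda>_. 0) zb wb t / \<nu> - ?X t - density 0 (\<lambda>_. 0) t / (2 * \<nu>) * t\<^sup>2 * ?X t) / t) (at t)"
      if "0 < t" "t < r" for t
      by (rule div_new_has_derivative[OF adm0 step that])
    show "\<bar>t * ((div_source 0 (\<lambda>_. 0) (\<lambda>_. 0) zb wb t / \<nu> - ?X t - density 0 (\<lambda>_. 0) t / (2 * \<nu>) * t\<^sup>2 * ?X t) / t)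
        + 1 * ?X t + P0 / (2 * \<nu>) * t\<^sup>2 * ?X t\<bar> \<le> N / \<nu> * ?\<sigma> t" if "0 < t" "t < r" for t
      using src[of t] nu_pos that by (simp add: field_simps)
  qed (use N0 nu_pos r in auto)
  define B where "B = 2 * H + 2 * (L / \<nu>) + 2 * (N / \<nu>) + 1"
  have pos: "0 \<le> L / \<nu>" "0 \<le> N / \<nu>" using L0 N0 nu_pos by auto
  have le: "C * ?\<sigma> r ^ 3 \<le> B * ?\<sigma> r ^ 3" if "C \<le> B" "0 \<le> r" for C r
    using that \<sigma>[OF that(2)] by (intro mult_right_mono) auto
  show thesis
  proof (rule that[of B zb wb])
    show "0 < B" unfolding B_def using H0 pos by linarith
    show "\<bar>zb r\<bar> \<le> B * ?\<sigma> r ^ 3" if "0 \<le> r" for r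
      using order_trans[OF zb le] that H0 pos unfolding B_def by force
    show "\<bar>wb r\<bar> \<le> B * ?\<sigma> r ^ 3" if "0 \<le> r" for r
      using order_trans[OF wb le] that H0 pos unfolding B_def by force
    show "\<bar>?X r\<bar> \<le> B * ?\<sigma> r ^ 3" if "0 \<le> r" for r
      using order_trans[OF X le] that H0 pos unfolding B_def by force
  qed (rule step)
qed

text \<open>The tame calculus for the family of all Picard steps in the ball of radius M, with all pairs of
inputs.\<close>
lemma contraction_estimate:
  assumes \<eta>: "0 < \<eta>" "9 * \<eta>\<^sup>2 \<le> P0 / (4 * \<nu>)" "9 * \<eta>\<^sup>2 \<le> Cv * P0 / (4 * \<kappa>)" and M: "0 \<le> M"
    and base: "\<And>T. picard_step 0 T (\<lambda>_. 0) (\<lambda>_. 0) zb wb"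
      "\<And>r. 0 \<le> r \<Longrightarrow> \<bar>zb r\<bar> \<le> B * decay \<eta> r ^ 3" "\<And>r. 0 \<le> r \<Longrightarrow> \<bar>wb r\<bar> \<le> B * decay \<eta> r ^ 3"
      "\<And>r. 0 \<le> r \<Longrightarrow> \<bar>div_new 0 (\<lambda>_. 0) zb wb r\<bar> \<le> B * decay \<eta> r ^ 3"
  obtains K where "0 < K"
    and "\<And>\<epsilon> T \<xi> \<zeta> z w r. 0 < \<epsilon> \<Longrightarrow> \<epsilon> \<le> 1 \<Longrightarrow> admissible \<eta> M \<epsilon> T \<xi> \<Longrightarrow> admissible \<eta> M \<epsilon> T \<zeta> \<Longrightarrow>
       picard_step \<epsilon> T \<xi> \<zeta> z w \<Longrightarrow> 0 \<le> r \<Longrightarrow> r \<le> T \<Longrightarrow>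
       \<bar>z r - zb r\<bar> \<le> K * \<epsilon> * decay \<eta> r ^ 3 \<and>
       \<bar>div_new \<epsilon> \<xi> z w r - div_new 0 (\<lambda>_. 0) zb wb r\<bar> \<le> K * \<epsilon> * decay \<eta> r ^ 3"
    and "\<And>\<epsilon> T \<xi> \<zeta> z w \<xi>' \<zeta>' z' w' \<delta> r. 0 < \<epsilon> \<Longrightarrow> \<epsilon> \<le> 1 \<Longrightarrow> 0 \<le> \<delta> \<Longrightarrow>
       admissible \<eta> M \<epsilon> T \<xi> \<Longrightarrow> admissible \<eta> M \<epsilon> T \<zeta> \<Longrightarrow> picard_step \<epsilon> T \<xi> \<zeta> z w \<Longrightarrow>
       admissible \<eta> M \<epsilon> T \<xi>' \<Longrightarrow> admissible \<eta> M \<epsilon> T \<zeta>' \<Longrightarrow> picard_step \<epsilon> T \<xi>' \<zeta>' z' w' \<Longrightarrow>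
       (\<forall>s\<in>{0..T}. \<bar>\<xi> s - \<xi>' s\<bar> \<le> \<delta> * decay \<eta> s ^ 3) \<Longrightarrow>
       (\<forall>s\<in>{0..T}. \<bar>\<zeta> s - \<zeta>' s\<bar> \<le> \<delta> * decay \<eta> s ^ 3) \<Longrightarrow> 0 \<le> r \<Longrightarrow> r \<le> T \<Longrightarrow>
       \<bar>z r - z' r\<bar> \<le> K * \<epsilon> * \<delta> * decay \<eta> r ^ 3 \<and>
       \<bar>div_new \<epsilon> \<xi> z w r - div_new \<epsilon> \<xi>' z' w' r\<bar> \<le> K * \<epsilon> * \<delta> * decay \<eta> r ^ 3"
proof -
  define e where "e = (\<lambda>(\<epsilon>::real, T::real, \<xi>::real\<Rightarrow>real, \<zeta>::real\<Rightarrow>real, z::real\<Rightarrow>real, w::real\<Rightarrow>real). \<epsilon>)"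
  define t where "t = (\<lambda>(\<epsilon>::real, T::real, \<xi>::real\<Rightarrow>real, \<zeta>::real\<Rightarrow>real, z::real\<Rightarrow>real, w::real\<Rightarrow>real). T)"
  define x where "x = (\<lambda>(\<epsilon>::real, T::real, \<xi>::real\<Rightarrow>real, \<zeta>::real\<Rightarrow>real, z::real\<Rightarrow>real, w::real\<Rightarrow>real). \<xi>)"
  define y where "y = (\<lambda>(\<epsilon>::real, T::real, \<xi>::real\<Rightarrow>real, \<zeta>::real\<Rightarrow>real, z::real\<Rightarrow>real, w::real\<Rightarrow>real). \<zeta>)"
  define z where "z = (\<lambda>(\<epsilon>::real, T::real, \<xi>::real\<Rightarrow>real, \<zeta>::real\<Rightarrow>real, z::real\<Rightarrow>real, w::real\<Rightarrow>real). z)"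
  define w where "w = (\<lambda>(\<epsilon>::real, T::real, \<xi>::real\<Rightarrow>real, \<zeta>::real\<Rightarrow>real, z::real\<Rightarrow>real, w::real\<Rightarrow>real). w)"
  note sel = e_def t_def x_def y_def z_def w_def
  (* The index of a step is the tuple of all its data. *)
  define J where "J = {j. 0 < e j \<and> e j \<le> 1 \<and> admissible \<eta> M (e j) (t j) (x j) \<and> admissible \<eta> M (e j) (t j) (y j) \<and>
      picard_step (e j) (t j) (x j) (y j) (z j) (w j)}"
  define pairs where "pairs = {(j, k, \<delta>). j \<in> J \<and> k \<in> J \<and> e k = e j \<and> t k = t j \<and> 0 \<le> \<delta> \<and>
      (\<forall>s\<in>{0..t j}. \<bar>x j s - x k s\<bar> \<le> \<delta> * decay \<eta> s ^ 3) \<and> (\<forall>s\<in>{0..t j}. \<bar>y j s - y k s\<bar> \<le> \<delta> * decay \<eta> s ^ 3)}"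
  interpret picard_family d R \<mu> lam Cv \<kappa> P0 \<eta> J pairs e t M B x y z w zb wb
    by unfold_locales (use assms in \<open>auto simp: J_def pairs_def\<close>)
  obtain K where K: "0 \<le> K" "\<And>j r. j \<in> J \<Longrightarrow> 0 \<le> r \<Longrightarrow> r \<le> t j \<Longrightarrow> \<bar>z j r - zb r\<bar> \<le> K * wt 1 3 j r"
    "\<And>j k \<delta> r. (j, k, \<delta>) \<in> pairs \<Longrightarrow> 0 \<le> r \<Longrightarrow> r \<le> t j \<Longrightarrow> \<bar>(z j r - zb r) - (z k r - zb r)\<bar> \<le> K * \<delta> * wt 1 3 j r"
    using tame_z_deviation by (rule tameE) (rule that)
  obtain L where L: "0 \<le> L" "\<And>j r. j \<in> J \<Longrightarrow> 0 \<le> r \<Longrightarrow> r \<le> t j \<Longrightarrow>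
       \<bar>div_new (e j) (x j) (z j) (w j) r - div_new 0 (\<lambda>_. 0) zb wb r\<bar> \<le> L * wt 1 3 j r"
    "\<And>j k \<delta> r. (j, k, \<delta>) \<in> pairs \<Longrightarrow> 0 \<le> r \<Longrightarrow> r \<le> t j \<Longrightarrow>
       \<bar>(div_new (e j) (x j) (z j) (w j) r - div_new 0 (\<lambda>_. 0) zb wb r)
         - (div_new (e k) (x k) (z k) (w k) r - div_new 0 (\<lambda>_. 0) zb wb r)\<bar> \<le> L * \<delta> * wt 1 3 j r"
    using tame_div_deviation by (rule tameE) (rule that)
  have le: "K * c \<le> (K + L + 1) * c" "L * c \<le> (K + L + 1) * c" if "0 \<le> c" for c
    using that K(1) L(1) by (auto intro!: mult_right_mono)
  show thesis
  proof (rule that[of "K + L + 1"])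
    fix \<epsilon> T \<xi> \<zeta> zz ww r
    assume a: "0 < \<epsilon>" "\<epsilon> \<le> 1" "admissible \<eta> M \<epsilon> T \<xi>" "admissible \<eta> M \<epsilon> T \<zeta>" "picard_step \<epsilon> T \<xi> \<zeta> zz ww" "0 \<le> r" "r \<le> T"
    let ?j = "(\<epsilon>, T, \<xi>, \<zeta>, zz, ww)"
    have J: "?j \<in> J" using a by (simp add: J_def sel)
    have c: "0 \<le> \<epsilon> * decay \<eta> r ^ 3" using a decay_pos[OF \<eta>(1), of r] by simp
    have proj: "e ?j = \<epsilon>" "t ?j = T" "x ?j = \<xi>" "z ?j = zz" "w ?j = ww" by (simp_all add: sel)
    have W: "wt 1 3 ?j r = \<epsilon> * decay \<eta> r ^ 3" unfolding wt_def proj by simp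
    show "\<bar>zz r - zb r\<bar> \<le> (K + L + 1) * \<epsilon> * decay \<eta> r ^ 3 \<and>
       \<bar>div_new \<epsilon> \<xi> zz ww r - div_new 0 (\<lambda>_. 0) zb wb r\<bar> \<le> (K + L + 1) * \<epsilon> * decay \<eta> r ^ 3"
      using K(2)[OF J, of r] L(2)[OF J, of r] a(6,7) le[OF c] unfolding W proj by (simp add: mult.assoc)
  next
    fix \<epsilon> T \<xi> \<zeta> zz ww \<xi>' \<zeta>' z' w' \<delta> r
    assume a: "0 < \<epsilon>" "\<epsilon> \<le> 1" "0 \<le> \<delta>"
      "admissible \<eta> M \<epsilon> T \<xi>" "admissible \<eta> M \<epsilon> T \<zeta>" "picard_step \<epsilon> T \<xi> \<zeta> zz ww"
      "admissible \<eta> M \<epsilon> T \<xi>'" "admissible \<eta> M \<epsilon> T \<zeta>'" "picard_step \<epsilon> T \<xi>' \<zeta>' z' w'"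
      "\<forall>s\<in>{0..T}. \<bar>\<xi> s - \<xi>' s\<bar> \<le> \<delta> * decay \<eta> s ^ 3"
      "\<forall>s\<in>{0..T}. \<bar>\<zeta> s - \<zeta>' s\<bar> \<le> \<delta> * decay \<eta> s ^ 3" "0 \<le> r" "r \<le> T"
    let ?j = "(\<epsilon>, T, \<xi>, \<zeta>, zz, ww)" and ?k = "(\<epsilon>, T, \<xi>', \<zeta>', z', w')"
    have J: "(?j, ?k, \<delta>) \<in> pairs" using a by (simp add: J_def pairs_def sel)
    have c: "0 \<le> \<epsilon> * \<delta> * decay \<eta> r ^ 3" using a decay_pos[OF \<eta>(1), of r] by simp
    have proj: "e ?j = \<epsilon>" "t ?j = T" "x ?j = \<xi>" "z ?j = zz" "w ?j = ww"
        "e ?k = \<epsilon>" "x ?k = \<xi>'" "z ?k = z'" "w ?k = w'" by (simp_all add: sel)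
    have W: "wt 1 3 ?j r = \<epsilon> * decay \<eta> r ^ 3" unfolding wt_def proj by simp
    show "\<bar>zz r - z' r\<bar> \<le> (K + L + 1) * \<epsilon> * \<delta> * decay \<eta> r ^ 3 \<and>
       \<bar>div_new \<epsilon> \<xi> zz ww r - div_new \<epsilon> \<xi>' z' w' r\<bar> \<le> (K + L + 1) * \<epsilon> * \<delta> * decay \<eta> r ^ 3"
      using K(3)[OF J, of r] L(3)[OF J, of r] a(12,13) le[OF c] unfolding W proj by (simp add: mult_ac)
  qed (use K(1) L(1) in auto)
qed

text \<open>A fixed pair of the Picard step. Its w is necessarily \<open>mean d \<xi>\<close>.\<close>
definition fixed_profile :: "real \<Rightarrow> real \<Rightarrow> (real \<Rightarrow> real) \<Rightarrow> (real \<Rightarrow> real) \<Rightarrow> bool" where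
  "fixed_profile \<epsilon> T \<xi> \<zeta> \<longleftrightarrow> picard_step \<epsilon> T \<xi> \<zeta> \<zeta> (mean d \<xi>) \<and>
     (\<forall>r\<in>{0..T}. \<xi> r = div_new \<epsilon> \<xi> \<zeta> (mean d \<xi>) r)"

end

section \<open>Fixed points of the Picard step\<close>

text \<open>The contraction principle for a weighted supremum norm. It is stated for sets of real functions on
an arbitrary index set, so that the norm and its completeness need no separate construction, and
pairs of functions are covered by a doubled index set.\<close>
lemma weighted_contraction_fixed_point:
  fixes S :: "('a \<Rightarrow> real) set" and w :: "'a \<Rightarrow> real" and \<Phi> :: "('a \<Rightarrow> real) \<Rightarrow> 'a \<Rightarrow> real"
  assumes f0: "f0 \<in> S" and self: "\<And>f. f \<in> S \<Longrightarrow> \<Phi> f \<in> S"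
    and w: "\<And>a. a \<in> A \<Longrightarrow> 0 \<le> w a" and M: "0 \<le> M" "\<And>f a. f \<in> S \<Longrightarrow> a \<in> A \<Longrightarrow> \<bar>f a\<bar> \<le> M * w a"
    and contr: "\<And>f g \<delta>. f \<in> S \<Longrightarrow> g \<in> S \<Longrightarrow> 0 \<le> \<delta> \<Longrightarrow> (\<And>a. a \<in> A \<Longrightarrow> \<bar>f a - g a\<bar> \<le> \<delta> * w a) \<Longrightarrow>
        (\<And>a. a \<in> A \<Longrightarrow> \<bar>\<Phi> f a - \<Phi> g a\<bar> \<le> \<delta> / 2 * w a)"
    and closed: "\<And>(F :: nat \<Rightarrow> 'a \<Rightarrow> real) f. (\<And>n. F n \<in> S) \<Longrightarrow>
        (\<And>e. e > 0 \<Longrightarrow> \<exists>N. \<forall>n\<ge>N. \<forall>a\<in>A. \<bar>F n a - f a\<bar> \<le> e * w a) \<Longrightarrow> f \<in> S"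
  obtains f where "f \<in> S" and "\<And>a. a \<in> A \<Longrightarrow> \<Phi> f a = f a"
proof -
  define F where "F n = (\<Phi> ^^ n) f0" for n
  have FS: "F n \<in> S" for n
    by (induction n) (auto simp: F_def f0 self)
  have step: "\<bar>F (n + m) a - F n a\<bar> \<le> 2 * M * (1/2) ^ n * w a" if "a \<in> A" for n m a
    using that
  proof (induction n arbitrary: a)
    case 0
    then show ?case using M(2)[OF FS[of m] 0] M(2)[OF FS[of 0] 0] by simp
  next
    case (Suc n)
    have "\<bar>\<Phi> (F (n + m)) a - \<Phi> (F n) a\<bar> \<le> (2 * M * (1/2) ^ n) / 2 * w a"
      using Suc M(1) by (intro contr FS) auto
    then show ?case by (simp add: F_def)
  qed
  have C: "Cauchy (\<lambda>n. F n a)" if a: "a \<in> A" for a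
  proof (rule metric_CauchyI)
    fix e :: real assume e: "0 < e"
    have "(\<lambda>n. 2 * M * (1/2) ^ n * w a) \<longlonglongrightarrow> 2 * M * 0 * w a"
      by (intro tendsto_intros LIMSEQ_power_zero) auto
    then have "\<forall>\<^sub>F n in sequentially. 2 * M * (1/2) ^ n * w a < e"
      using order_tendstoD(2)[of _ 0 sequentially e] e by simp
    then obtain N where N: "\<And>n. n \<ge> N \<Longrightarrow> 2 * M * (1/2) ^ n * w a < e"
      by (auto simp: eventually_sequentially)
    show "\<exists>N. \<forall>m\<ge>N. \<forall>n\<ge>N. dist (F m a) (F n a) < e"
    proof (intro exI allI impI)
      fix m n assume "N \<le> m" "N \<le> n"
      then show "dist (F m a) (F n a) < e"
        using step[OF a, of m "n - m"] step[OF a, of n "m - n"] N[of m] N[of n]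
        by (cases "m \<le> n") (auto simp: dist_real_def abs_minus_commute)
    qed
  qed
  define f where "f a = lim (\<lambda>n. F n a)" for a
  have lim: "(\<lambda>n. F n a) \<longlonglongrightarrow> f a" if "a \<in> A" for a
    unfolding f_def using C[OF that] Cauchy_convergent_iff convergent_LIMSEQ_iff by blast
  have conv: "\<bar>F n a - f a\<bar> \<le> 2 * M * (1/2) ^ n * w a" if "a \<in> A" for n a
  proof (rule tendsto_upperbound[of "\<lambda>m. \<bar>F n a - F (m + n) a\<bar>" _ sequentially])
    show "(\<lambda>m. \<bar>F n a - F (m + n) a\<bar>) \<longlonglongrightarrow> \<bar>F n a - f a\<bar>"
      using LIMSEQ_ignore_initial_segment[OF lim[OF that], of n] by (intro tendsto_intros)
    show "\<forall>\<^sub>F m in sequentially. \<bar>F n a - F (m + n) a\<bar> \<le> 2 * M * (1/2) ^ n * w a"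
      using step[OF that, of n] by (auto simp: abs_minus_commute add.commute)
  qed auto
  have fS: "f \<in> S"
  proof (rule closed[of F])
    fix e :: real assume e: "e > 0"
    have "(\<lambda>n. 2 * M * (1/2) ^ n) \<longlonglongrightarrow> 2 * M * 0"
      by (intro tendsto_intros LIMSEQ_power_zero) auto
    then have "\<forall>\<^sub>F n in sequentially. 2 * M * (1/2) ^ n < e"
      using order_tendstoD(2)[of _ 0 sequentially e] e by simp
    then obtain N where N: "\<And>n. n \<ge> N \<Longrightarrow> 2 * M * (1/2) ^ n < e"
      by (auto simp: eventually_sequentially)
    show "\<exists>N. \<forall>n\<ge>N. \<forall>a\<in>A. \<bar>F n a - f a\<bar> \<le> e * w a"
    proof (intro exI allI impI ballI)
      fix n a assume "N \<le> n" "a \<in> A"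
      then show "\<bar>F n a - f a\<bar> \<le> e * w a"
        using conv[of a n] N[of n] w[of a] by (meson less_imp_le mult_right_mono order_trans)
    qed
  qed (rule FS)
  moreover have "\<Phi> f a = f a" if a: "a \<in> A" for a
  proof -
    have "(\<lambda>n. F (Suc n) a - \<Phi> f a) \<longlonglongrightarrow> 0"
    proof (rule Lim_null_comparison[of _ "\<lambda>n. 2 * M * (1/2) ^ n / 2 * w a"])
      show "\<forall>\<^sub>F n in sequentially. norm (F (Suc n) a - \<Phi> f a) \<le> 2 * M * (1/2) ^ n / 2 * w a"
      proof (intro always_eventually allI)
        fix n
        have "\<bar>\<Phi> (F n) a - \<Phi> f a\<bar> \<le> 2 * M * (1/2) ^ n / 2 * w a"
          using conv M(1) a by (intro contr FS fS) auto
        then show "norm (F (Suc n) a - \<Phi> f a) \<le> 2 * M * (1/2) ^ n / 2 * w a" by (simp add: F_def)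
      qed
      have "(\<lambda>n. 2 * M * (1/2) ^ n / 2 * w a) \<longlonglongrightarrow> 2 * M * 0 / 2 * w a"
        by (intro tendsto_intros LIMSEQ_power_zero) auto
      then show "(\<lambda>n. 2 * M * (1/2) ^ n / 2 * w a) \<longlonglongrightarrow> 0" by simp
    qed
    from LIMSEQ_unique[OF LIM_zero_cancel[OF this] LIMSEQ_Suc[OF lim[OF a]]] show ?thesis .
  qed
  ultimately show thesis using that by blast
qed

text \<open>A gas with a choice of \<eta> and of the solution at \<epsilon> = 0, whose size B determines the
radius of the ball.\<close>
locale based_gas = gas d R \<mu> lam Cv \<kappa> P0
  for d R \<mu> lam Cv \<kappa> P0 +
  fixes \<eta> B :: real and zb wb :: "real \<Rightarrow> real"
  assumes eta: "0 < \<eta>" "9 * \<eta>\<^sup>2 \<le> P0 / (4 * \<nu>)" "9 * \<eta>\<^sup>2 \<le> Cv * P0 / (4 * \<kappa>)" and B_pos: "0 < B"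
    and base: "\<And>T. picard_step 0 T (\<lambda>_. 0) (\<lambda>_. 0) zb wb"
      "\<And>r. 0 \<le> r \<Longrightarrow> \<bar>zb r\<bar> \<le> B * decay \<eta> r ^ 3" "\<And>r. 0 \<le> r \<Longrightarrow> \<bar>wb r\<bar> \<le> B * decay \<eta> r ^ 3"
      "\<And>r. 0 \<le> r \<Longrightarrow> \<bar>div_new 0 (\<lambda>_. 0) zb wb r\<bar> \<le> B * decay \<eta> r ^ 3"
begin

text \<open>Every step from the ball of radius 4 B lands in the ball of radius 2 B when the deviation from the
solution at \<epsilon> = 0 is at most B. This strict improvement is used by the continuation
argument for uniqueness.\<close>
definition M :: real where "M = 4 * B"

lemma M_pos: "0 < M"
  using B_pos by (simp add: M_def)

text \<open>Causality: all ingredients of the step at r are integrals over [0,r].\<close>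
lemma picard_step_cong:
  assumes "picard_step \<epsilon> T \<xi> \<zeta> z w" and "0 \<le> T"
    and "\<And>r. 0 \<le> r \<Longrightarrow> r \<le> T \<Longrightarrow> \<xi>' r = \<xi> r" "\<And>r. 0 \<le> r \<Longrightarrow> r \<le> T \<Longrightarrow> \<zeta>' r = \<zeta> r"
    and "\<And>r. 0 \<le> r \<Longrightarrow> r \<le> T \<Longrightarrow> z' r = z r" "\<And>r. 0 \<le> r \<Longrightarrow> r \<le> T \<Longrightarrow> w' r = w r"
  shows "picard_step \<epsilon> T \<xi>' \<zeta>' z' w'"
proof -
  have mean: "mean d \<xi>' r = mean d \<xi> r" if "0 \<le> r" "r \<le> T" for r
    using assms(3) that by (intro mean_cong) auto
  have density: "density \<epsilon> \<xi>' r = density \<epsilon> \<xi> r" if "0 \<le> r" "r \<le> T" for r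
  proof -
    have "integral {0..r} (rate \<epsilon> \<xi>') = integral {0..r} (rate \<epsilon> \<xi>)"
      using assms(3) mean that by (intro integral_cong) (auto simp: rate_def)
    then show ?thesis by (simp add: density_def)
  qed
  have work: "work \<epsilon> \<xi>' \<zeta>' r = work \<epsilon> \<xi> \<zeta> r" if "0 \<le> r" "r \<le> T" for r
    using assms(3,4) mean density that by (simp add: work_def temp_def)
  have flux: "heat_flux \<epsilon> \<xi>' \<zeta>' r = heat_flux \<epsilon> \<xi> \<zeta> r" if "0 \<le> r" "r \<le> T" for r
    using work mean that by (simp add: heat_flux_def)
  have heat: "heat_rhs \<epsilon> \<xi>' \<zeta>' r = heat_rhs \<epsilon> \<xi> \<zeta> r" if "0 \<le> r" "r \<le> T" for r
  proof -
    have "integral {0..r} (heat_flux \<epsilon> \<xi>' \<zeta>') = integral {0..r} (heat_flux \<epsilon> \<xi> \<zeta>)"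
      using flux that by (intro integral_cong) auto
    then show ?thesis using density mean flux that by (simp add: heat_rhs_def heat_source_def)
  qed
  have force: "force \<epsilon> \<xi>' z' r = force \<epsilon> \<xi> z r" if "0 \<le> r" "r \<le> T" for r
  proof -
    have "integral {0..r} (\<lambda>s. density \<epsilon> \<xi>' s * (s ^ 3 * (mean d \<xi>' s)\<^sup>2)) = integral {0..r} (\<lambda>s. density \<epsilon> \<xi> s * (s ^ 3 * (mean d \<xi> s)\<^sup>2))"
      using density mean that by (intro integral_cong) auto
    then show ?thesis using density mean assms(5) that by (simp add: force_def temp_def)
  qed
  show ?thesis
    unfolding picard_step_def
  proof (intro conjI allI impI)
    show "continuous_on {0..T} z'"
      by (rule continuous_on_eq[of _ z]) (use assms in \<open>auto simp: picard_step_def\<close>)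
    show "continuous_on {0..T} w'"
      by (rule continuous_on_eq[of _ w]) (use assms in \<open>auto simp: picard_step_def\<close>)
    show "z' 0 = 0" "w' 0 = 0" using assms by (auto simp: picard_step_def)
    fix r assume r: "0 < r \<and> r < T"
    have "(z has_real_derivative (heat_rhs \<epsilon> \<xi> \<zeta> r - (real d - 1) * z r
          - Cv / (2 * \<kappa>) * density \<epsilon> \<xi> r * r\<^sup>2 * z r) / r) (at r)"
      using assms(1) r by (simp add: picard_step_def)
    then have "(z' has_real_derivative (heat_rhs \<epsilon> \<xi> \<zeta> r - (real d - 1) * z r
          - Cv / (2 * \<kappa>) * density \<epsilon> \<xi> r * r\<^sup>2 * z r) / r) (at r)"
      by (rule has_derivative_cong_on_interval[where a = 0 and b = T]) (use r assms(5) in auto)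
    moreover have "(w has_real_derivative (force \<epsilon> \<xi> z r / \<nu> - (real d + 1) * w r
          - density \<epsilon> \<xi> r / (2 * \<nu>) * r\<^sup>2 * w r) / r) (at r)"
      using assms(1) r by (simp add: picard_step_def)
    then have "(w' has_real_derivative (force \<epsilon> \<xi> z r / \<nu> - (real d + 1) * w r
          - density \<epsilon> \<xi> r / (2 * \<nu>) * r\<^sup>2 * w r) / r) (at r)"
      by (rule has_derivative_cong_on_interval[where a = 0 and b = T]) (use r assms(6) in auto)
    ultimately show "(z' has_real_derivative (heat_rhs \<epsilon> \<xi>' \<zeta>' r - (real d - 1) * z' r
          - Cv / (2 * \<kappa>) * density \<epsilon> \<xi>' r * r\<^sup>2 * z' r) / r) (at r)"
      "(w' has_real_derivative (force \<epsilon> \<xi>' z' r / \<nu> - (real d + 1) * w' r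
          - density \<epsilon> \<xi>' r / (2 * \<nu>) * r\<^sup>2 * w' r) / r) (at r)"
      using heat[of r] density[of r] force[of r] assms(5,6)[of r] r by simp_all
  qed
qed

text \<open>Both functions solve r m' + (d+1) m = \<xi> with the value 0 at 0.\<close>
lemma mean_of_divergence:
  assumes adm: "admissible \<eta> m \<epsilon> T \<xi>" and step: "picard_step \<epsilon> T \<xi> \<zeta> z w"
    and fix_xi: "\<And>r. 0 \<le> r \<Longrightarrow> r \<le> T \<Longrightarrow> \<xi> r = div_new \<epsilon> \<xi> z w r" and r: "0 \<le> r" "r \<le> T"
  shows "w r = mean d \<xi> r"
proof (rule linear_ode_unique[where X = w and Y = "mean d \<xi>" and a = "\<lambda>_. 0" and g = \<xi> and k = "real d + 1" and T = T])
  show "continuous_on {0..T} w" "w 0 = mean d \<xi> 0" using step by (auto simp: picard_step_def)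
  show "continuous_on {0..T} (mean d \<xi>)" by (rule cont_mean[OF adm])
  fix t assume t: "0 < t" "t < T"
  show "(mean d \<xi> has_real_derivative (\<xi> t - (real d + 1) * mean d \<xi> t - 0 * t\<^sup>2 * mean d \<xi> t) / t) (at t)"
    using mean_has_derivative[OF cont_xi[OF adm] t] by simp
  have "(w has_real_derivative (force \<epsilon> \<xi> z t / \<nu> - (real d + 1) * w t - density \<epsilon> \<xi> t / (2 * \<nu>) * t\<^sup>2 * w t) / t) (at t)"
    using step t by (auto simp: picard_step_def)
  then show "(w has_real_derivative (\<xi> t - (real d + 1) * w t - 0 * t\<^sup>2 * w t) / t) (at t)"
    by (rule DERIV_cong) (use fix_xi[of t] t in \<open>simp add: div_new_def diff_divide_distrib\<close>)
qed (use r in auto)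

text \<open>With the constant K of the contraction estimate, K \<epsilon> \<le> 1/2 makes the step a
contraction and K \<epsilon> \<le> B keeps it in the ball. Existence is needed on the whole
half-line, the improved bound and uniqueness on [0,T] for every T.\<close>
lemma fixed_profile_exists_unique:
  obtains \<epsilon>1 where "0 < \<epsilon>1" "\<epsilon>1 \<le> 1" "\<epsilon>1 * M \<le> \<eta> / 8"
    and "\<And>\<epsilon>. 0 < \<epsilon> \<Longrightarrow> \<epsilon> \<le> \<epsilon>1 \<Longrightarrow> \<exists>\<xi> \<zeta>. \<forall>T\<ge>0. admissible \<eta> M \<epsilon> T \<xi> \<and> admissible \<eta> M \<epsilon> T \<zeta> \<and> fixed_profile \<epsilon> T \<xi> \<zeta>"
    and "\<And>\<epsilon> T \<xi> \<zeta> r. 0 < \<epsilon> \<Longrightarrow> \<epsilon> \<le> \<epsilon>1 \<Longrightarrow> admissible \<eta> M \<epsilon> T \<xi> \<Longrightarrow> admissible \<eta> M \<epsilon> T \<zeta> \<Longrightarrow> fixed_profile \<epsilon> T \<xi> \<zeta> \<Longrightarrow>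
       0 \<le> r \<Longrightarrow> r \<le> T \<Longrightarrow> \<bar>\<xi> r\<bar> \<le> M / 2 * decay \<eta> r ^ 3 \<and> \<bar>\<zeta> r\<bar> \<le> M / 2 * decay \<eta> r ^ 3"
    and "\<And>\<epsilon> T \<xi> \<zeta> \<xi>' \<zeta>' r. 0 < \<epsilon> \<Longrightarrow> \<epsilon> \<le> \<epsilon>1 \<Longrightarrow> admissible \<eta> M \<epsilon> T \<xi> \<Longrightarrow> admissible \<eta> M \<epsilon> T \<zeta> \<Longrightarrow> fixed_profile \<epsilon> T \<xi> \<zeta> \<Longrightarrow>
       admissible \<eta> M \<epsilon> T \<xi>' \<Longrightarrow> admissible \<eta> M \<epsilon> T \<zeta>' \<Longrightarrow> fixed_profile \<epsilon> T \<xi>' \<zeta>' \<Longrightarrow>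
       0 \<le> r \<Longrightarrow> r \<le> T \<Longrightarrow> \<xi>' r = \<xi> r \<and> \<zeta>' r = \<zeta> r"
proof -
  obtain K where K: "0 < K"
    and dev: "\<And>\<epsilon> T \<xi> \<zeta> z w r. 0 < \<epsilon> \<Longrightarrow> \<epsilon> \<le> 1 \<Longrightarrow> admissible \<eta> M \<epsilon> T \<xi> \<Longrightarrow> admissible \<eta> M \<epsilon> T \<zeta> \<Longrightarrow>
       picard_step \<epsilon> T \<xi> \<zeta> z w \<Longrightarrow> 0 \<le> r \<Longrightarrow> r \<le> T \<Longrightarrow>
       \<bar>z r - zb r\<bar> \<le> K * \<epsilon> * decay \<eta> r ^ 3 \<and>
       \<bar>div_new \<epsilon> \<xi> z w r - div_new 0 (\<lambda>_. 0) zb wb r\<bar> \<le> K * \<epsilon> * decay \<eta> r ^ 3"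
    and lip: "\<And>\<epsilon> T \<xi> \<zeta> z w \<xi>' \<zeta>' z' w' \<delta> r. 0 < \<epsilon> \<Longrightarrow> \<epsilon> \<le> 1 \<Longrightarrow> 0 \<le> \<delta> \<Longrightarrow>
       admissible \<eta> M \<epsilon> T \<xi> \<Longrightarrow> admissible \<eta> M \<epsilon> T \<zeta> \<Longrightarrow> picard_step \<epsilon> T \<xi> \<zeta> z w \<Longrightarrow>
       admissible \<eta> M \<epsilon> T \<xi>' \<Longrightarrow> admissible \<eta> M \<epsilon> T \<zeta>' \<Longrightarrow> picard_step \<epsilon> T \<xi>' \<zeta>' z' w' \<Longrightarrow>
       (\<forall>s\<in>{0..T}. \<bar>\<xi> s - \<xi>' s\<bar> \<le> \<delta> * decay \<eta> s ^ 3) \<Longrightarrow>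
       (\<forall>s\<in>{0..T}. \<bar>\<zeta> s - \<zeta>' s\<bar> \<le> \<delta> * decay \<eta> s ^ 3) \<Longrightarrow> 0 \<le> r \<Longrightarrow> r \<le> T \<Longrightarrow>
       \<bar>z r - z' r\<bar> \<le> K * \<epsilon> * \<delta> * decay \<eta> r ^ 3 \<and>
       \<bar>div_new \<epsilon> \<xi> z w r - div_new \<epsilon> \<xi>' z' w' r\<bar> \<le> K * \<epsilon> * \<delta> * decay \<eta> r ^ 3"
    by (rule contraction_estimate[OF eta less_imp_le[OF M_pos] base]) (assumption+, rule that)
  (* The four bounds give \<epsilon> \<le> 1, the condition of admissibility, the contraction and the
     invariance of the ball. *)
  define \<epsilon>1 where "\<epsilon>1 = min 1 (min (\<eta> / (8 * M)) (min (1 / (2 * K)) (B / K)))"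
  have e1: "0 < \<epsilon>1" unfolding \<epsilon>1_def using eta(1) M_pos K B_pos by simp
  have small: "\<epsilon> \<le> 1" "\<epsilon> * M \<le> \<eta> / 8" "K * \<epsilon> \<le> 1/2" "K * \<epsilon> \<le> B" if "\<epsilon> \<le> \<epsilon>1" for \<epsilon>
  proof -
    have "\<epsilon> \<le> 1" "\<epsilon> \<le> \<eta> / (8 * M)" "\<epsilon> \<le> 1 / (2 * K)" "\<epsilon> \<le> B / K"
      using that unfolding \<epsilon>1_def by auto
    then show "\<epsilon> \<le> 1" "\<epsilon> * M \<le> \<eta> / 8" "K * \<epsilon> \<le> 1/2" "K * \<epsilon> \<le> B"
      using M_pos K by (auto simp: field_simps)
  qed
  have \<sigma>: "0 < decay \<eta> r ^ 3" if "0 \<le> r" for r using decay_pos[OF eta(1) that] by simp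
  have improved: "\<bar>z r\<bar> \<le> M / 2 * decay \<eta> r ^ 3" "\<bar>div_new \<epsilon> \<xi> z w r\<bar> \<le> M / 2 * decay \<eta> r ^ 3"
    if "0 < \<epsilon>" "\<epsilon> \<le> \<epsilon>1" "admissible \<eta> M \<epsilon> T \<xi>" "admissible \<eta> M \<epsilon> T \<zeta>" "picard_step \<epsilon> T \<xi> \<zeta> z w" "0 \<le> r" "r \<le> T"
    for \<epsilon> T \<xi> \<zeta> z w r
  proof -
    note d = dev[OF that(1) small(1)[OF that(2)] that(3-7)]
    have "K * \<epsilon> * decay \<eta> r ^ 3 \<le> B * decay \<eta> r ^ 3"
      using small(4)[OF that(2)] \<sigma>[OF that(6)] by (intro mult_right_mono) auto
    moreover have "M / 2 * decay \<eta> r ^ 3 = B * decay \<eta> r ^ 3 + B * decay \<eta> r ^ 3" by (simp add: M_def)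
    ultimately show "\<bar>z r\<bar> \<le> M / 2 * decay \<eta> r ^ 3" "\<bar>div_new \<epsilon> \<xi> z w r\<bar> \<le> M / 2 * decay \<eta> r ^ 3"
      using d base(2)[OF that(6)] base(4)[OF that(6)] by linarith+
  qed
  have half: "\<bar>z r - z' r\<bar> \<le> \<delta> / 2 * decay \<eta> r ^ 3 \<and> \<bar>div_new \<epsilon> \<xi> z w r - div_new \<epsilon> \<xi>' z' w' r\<bar> \<le> \<delta> / 2 * decay \<eta> r ^ 3"
    if "0 < \<epsilon>" "\<epsilon> \<le> \<epsilon>1" "0 \<le> \<delta>" "admissible \<eta> M \<epsilon> T \<xi>" "admissible \<eta> M \<epsilon> T \<zeta>" "picard_step \<epsilon> T \<xi> \<zeta> z w"
       "admissible \<eta> M \<epsilon> T \<xi>'" "admissible \<eta> M \<epsilon> T \<zeta>'" "picard_step \<epsilon> T \<xi>' \<zeta>' z' w'"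
       "\<forall>s\<in>{0..T}. \<bar>\<xi> s - \<xi>' s\<bar> \<le> \<delta> * decay \<eta> s ^ 3"
       "\<forall>s\<in>{0..T}. \<bar>\<zeta> s - \<zeta>' s\<bar> \<le> \<delta> * decay \<eta> s ^ 3" "0 \<le> r" "r \<le> T"
    for \<epsilon> T \<xi> \<zeta> z w \<xi>' \<zeta>' z' w' \<delta> r
  proof -
    have "K * \<epsilon> * \<delta> * decay \<eta> r ^ 3 \<le> 1/2 * \<delta> * decay \<eta> r ^ 3"
      using small(3)[OF that(2)] \<sigma>[OF that(12)] that(3) by (intro mult_right_mono) auto
    then show ?thesis using lip[OF that(1) small(1)[OF that(2)] that(3-13)] by auto
  qed
  show thesis
  proof (rule that[OF e1])
    show "\<epsilon>1 \<le> 1" "\<epsilon>1 * M \<le> \<eta> / 8" using small[OF order_refl] by auto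
  next
    fix \<epsilon> T \<xi> \<zeta> r
    assume a: "0 < \<epsilon>" "\<epsilon> \<le> \<epsilon>1" "admissible \<eta> M \<epsilon> T \<xi>" "admissible \<eta> M \<epsilon> T \<zeta>" "fixed_profile \<epsilon> T \<xi> \<zeta>" "0 \<le> r" "r \<le> T"
    have s: "picard_step \<epsilon> T \<xi> \<zeta> \<zeta> (mean d \<xi>)" and x: "\<xi> r = div_new \<epsilon> \<xi> \<zeta> (mean d \<xi>) r"
      using a(5-7) by (auto simp: fixed_profile_def)
    from improved[OF a(1-4) s a(6,7)] x
    show "\<bar>\<xi> r\<bar> \<le> M / 2 * decay \<eta> r ^ 3 \<and> \<bar>\<zeta> r\<bar> \<le> M / 2 * decay \<eta> r ^ 3" by simp
  next
    fix \<epsilon> T \<xi> \<zeta> \<xi>' \<zeta>' r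
    assume a: "0 < \<epsilon>" "\<epsilon> \<le> \<epsilon>1" "admissible \<eta> M \<epsilon> T \<xi>" "admissible \<eta> M \<epsilon> T \<zeta>" "fixed_profile \<epsilon> T \<xi> \<zeta>"
      "admissible \<eta> M \<epsilon> T \<xi>'" "admissible \<eta> M \<epsilon> T \<zeta>'" "fixed_profile \<epsilon> T \<xi>' \<zeta>'" "0 \<le> r" "r \<le> T"
    have s: "picard_step \<epsilon> T \<xi> \<zeta> \<zeta> (mean d \<xi>)" "\<And>r. 0 \<le> r \<Longrightarrow> r \<le> T \<Longrightarrow> \<xi> r = div_new \<epsilon> \<xi> \<zeta> (mean d \<xi>) r"
       "picard_step \<epsilon> T \<xi>' \<zeta>' \<zeta>' (mean d \<xi>')" "\<And>r. 0 \<le> r \<Longrightarrow> r \<le> T \<Longrightarrow> \<xi>' r = div_new \<epsilon> \<xi>' \<zeta>' (mean d \<xi>') r"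
      using a(5,8) by (auto simp: fixed_profile_def)
    (* Uniqueness on [0,T] iterates the contraction, starting from the bound 2 M for the distance of
       two elements of the ball. *)
    have iter: "\<forall>r. 0 \<le> r \<longrightarrow> r \<le> T \<longrightarrow> \<bar>\<zeta> r - \<zeta>' r\<bar> \<le> 2 * M * (1/2) ^ n * decay \<eta> r ^ 3 \<and> \<bar>\<xi> r - \<xi>' r\<bar> \<le> 2 * M * (1/2) ^ n * decay \<eta> r ^ 3" for n
    proof (induction n)
      case 0
      show ?case
        using xi_bound[OF a(3)] xi_bound[OF a(4)] xi_bound[OF a(6)] xi_bound[OF a(7)] by fastforce
    next
      case (Suc n)
      show ?case
      proof (intro allI impI)
        fix r assume r: "0 \<le> r" "r \<le> T"
        have "0 \<le> 2 * M * (1/2) ^ n" using M_pos by simp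
        from half[OF a(1,2) this a(3,4) s(1) a(6,7) s(3) _ _ r] Suc.IH s(2,4)[OF r]
        show "\<bar>\<zeta> r - \<zeta>' r\<bar> \<le> 2 * M * (1/2) ^ Suc n * decay \<eta> r ^ 3 \<and> \<bar>\<xi> r - \<xi>' r\<bar> \<le> 2 * M * (1/2) ^ Suc n * decay \<eta> r ^ 3"
          by simp
      qed
    qed
    have lim: "(\<lambda>n. 2 * M * (1/2) ^ n * decay \<eta> r ^ 3) \<longlonglongrightarrow> 2 * M * 0 * decay \<eta> r ^ 3"
      by (intro tendsto_intros LIMSEQ_power_zero) auto
    have "\<bar>\<zeta> r - \<zeta>' r\<bar> \<le> 0" "\<bar>\<xi> r - \<xi>' r\<bar> \<le> 0"
      using LIMSEQ_le_const[OF lim, of "\<bar>\<zeta> r - \<zeta>' r\<bar>"] LIMSEQ_le_const[OF lim, of "\<bar>\<xi> r - \<xi>' r\<bar>"] iter a(9,10) by auto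
    then show "\<xi>' r = \<xi> r \<and> \<zeta>' r = \<zeta> r" by auto
  next
    fix \<epsilon> assume e: "0 < \<epsilon>" "\<epsilon> \<le> \<epsilon>1"
    (* A pair of functions on the half-line is one function on the product with bool. *)
    define X where "X f = (\<lambda>r::real. f (True, r) :: real)" for f
    define Y where "Y f = (\<lambda>r::real. f (False, r) :: real)" for f
    define S where "S = {f. \<forall>T\<ge>0. admissible \<eta> M \<epsilon> T (X f) \<and> admissible \<eta> M \<epsilon> T (Y f)}"
    define A where "A = (UNIV :: bool set) \<times> {0 :: real..}"
    define wgt where "wgt = (\<lambda>(b :: bool, r). decay \<eta> r ^ 3)"
    have admT: "admissible \<eta> M \<epsilon> T x" if "\<And>T. 0 \<le> T \<Longrightarrow> admissible \<eta> M \<epsilon> T x" for T x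
    proof (cases "0 \<le> T")
      case False
      then have "{0..T} = {}" by auto
      then show ?thesis using that[of 0] by (simp add: admissible_def)
    qed (rule that)
    have ex: "\<exists>p. \<forall>T. picard_step \<epsilon> T (X f) (Y f) (fst p) (snd p)" if "f \<in> S" for f
    proof -
      have a: "admissible \<eta> M \<epsilon> T (X f)" "admissible \<eta> M \<epsilon> T (Y f)" for T
        using that admT unfolding S_def by auto
      have "continuous_on {0..} (Y f)"
        by (intro continuous_on_halflineI cont_xi[OF a(2)])
      from picard_step_exists[OF a(1) this] show ?thesis by (metis fst_conv snd_conv)
    qed
    (* The step is a relation; any choice of its result defines the map, since the estimates hold for
       every result. *)
    define p where "p f = (SOME p. \<forall>T. picard_step \<epsilon> T (X f) (Y f) (fst p) (snd p))" for f
    have p: "picard_step \<epsilon> T (X f) (Y f) (fst (p f)) (snd (p f))" if "f \<in> S" for f T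
      using someI_ex[OF ex[OF that]] unfolding p_def by blast
    define \<Phi> where "\<Phi> f = (\<lambda>(b, r). if b then div_new \<epsilon> (X f) (fst (p f)) (snd (p f)) r else fst (p f) r)" for f
    have XY: "X (\<Phi> f) = div_new \<epsilon> (X f) (fst (p f)) (snd (p f))" "Y (\<Phi> f) = fst (p f)" for f
      unfolding X_def Y_def \<Phi>_def by auto
    have Sadm: "admissible \<eta> M \<epsilon> T (X f)" "admissible \<eta> M \<epsilon> T (Y f)" if "f \<in> S" for f T
      using that admT unfolding S_def by auto
    have eM: "0 \<le> \<epsilon>" "\<epsilon> * M \<le> \<eta> / 8" "0 \<le> M" using e small[OF e(2)] M_pos by auto
    obtain f where f: "f \<in> S" "\<And>a. a \<in> A \<Longrightarrow> \<Phi> f a = f a"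
    proof (rule weighted_contraction_fixed_point[where S = S and \<Phi> = \<Phi> and A = A and w = wgt and M = M])
      show "(\<lambda>_. 0) \<in> S"
        unfolding S_def X_def Y_def using eta eM decay_pos[OF eta(1)]
        by (auto simp: admissible_def less_imp_le intro!: mult_nonneg_nonneg)
      show "0 \<le> M" using M_pos by simp
      show "0 \<le> wgt a" if "a \<in> A" for a
        using that \<sigma> unfolding A_def wgt_def by (auto simp: less_imp_le)
      show "\<bar>f a\<bar> \<le> M * wgt a" if fa: "f \<in> S" "a \<in> A" for f a
      proof -
        obtain b r where a: "a = (b, r)" "0 \<le> r" using fa(2) unfolding A_def by auto
        show ?thesis
          using xi_bound[OF Sadm(1)[OF fa(1)] a(2) order_refl] xi_bound[OF Sadm(2)[OF fa(1)] a(2) order_refl]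
          unfolding a(1) wgt_def X_def Y_def by (cases b) auto
      qed
      show "\<Phi> f \<in> S" if fS: "f \<in> S" for f
        unfolding S_def
      proof (intro CollectI allI impI conjI)
        fix T :: real assume T: "0 \<le> T"
        note st = p[OF fS, of T] and ad = Sadm[OF fS, of T]
        have le: "M / 2 * decay \<eta> r ^ 3 \<le> M * decay \<eta> r ^ 3" if "0 \<le> r" for r
          using \<sigma>[OF that] M_pos by (intro mult_right_mono) auto
        have bound: "\<bar>fst (p f) r\<bar> \<le> M * decay \<eta> r ^ 3"
            "\<bar>div_new \<epsilon> (X f) (fst (p f)) (snd (p f)) r\<bar> \<le> M * decay \<eta> r ^ 3" if "0 \<le> r" "r \<le> T" for r
          using improved[OF e ad st that] le[OF that(1)] by linarith+
        have cont: "continuous_on {0..T} (fst (p f))" "fst (p f) 0 = 0" "continuous_on {0..T} (snd (p f))"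
          using st unfolding picard_step_def by blast+
        show "admissible \<eta> M \<epsilon> T (X (\<Phi> f))" "admissible \<eta> M \<epsilon> T (Y (\<Phi> f))"
          unfolding XY admissible_def
          using eta(1) eM cont cont_div_new[OF ad(1) cont] div_new_0[OF ad(1)] bound by auto
      qed
      show "\<bar>\<Phi> f a - \<Phi> g a\<bar> \<le> \<delta> / 2 * wgt a"
        if fg: "f \<in> S" "g \<in> S" "0 \<le> \<delta>" and cl: "\<And>a. a \<in> A \<Longrightarrow> \<bar>f a - g a\<bar> \<le> \<delta> * wgt a" and aA: "a \<in> A" for f g \<delta> a
      proof -
        obtain b r where a: "a = (b, r)" "0 \<le> r" using aA unfolding A_def by auto
        have c: "\<bar>X f s - X g s\<bar> \<le> \<delta> * decay \<eta> s ^ 3" "\<bar>Y f s - Y g s\<bar> \<le> \<delta> * decay \<eta> s ^ 3" if "0 \<le> s" for s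
          using cl[of "(True, s)"] cl[of "(False, s)"] that unfolding A_def wgt_def X_def Y_def by auto
        show ?thesis
          using half[OF e fg(3) Sadm[OF fg(1)] p[OF fg(1)] Sadm[OF fg(2)] p[OF fg(2)] _ _ a(2) order_refl] c
          unfolding a(1) \<Phi>_def wgt_def by auto
      qed
      show "f \<in> S" if F: "\<And>n. F n \<in> S" and lim: "\<And>e. e > 0 \<Longrightarrow> \<exists>N. \<forall>n\<ge>N. \<forall>a\<in>A. \<bar>F n a - f a\<bar> \<le> e * wgt a"
        for F :: "nat \<Rightarrow> bool \<times> real \<Rightarrow> real" and f
      proof -
        have unif: "uniform_limit {0..} (\<lambda>n r. F n (b, r)) (\<lambda>r. f (b, r)) sequentially" for b
        proof (rule uniform_limitI)
          fix e :: real assume "0 < e"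
          then obtain N where N: "\<forall>n\<ge>N. \<forall>a\<in>A. \<bar>F n a - f a\<bar> \<le> e / 2 * wgt a" using lim[of "e / 2"] by auto
          show "\<forall>\<^sub>F n in sequentially. \<forall>r\<in>{0..}. dist (F n (b, r)) (f (b, r)) < e"
            unfolding eventually_sequentially
          proof (intro exI[of _ N] allI impI ballI)
            fix n :: nat and r :: real assume n: "N \<le> n" and r: "r \<in> {0..}"
            have "\<bar>F n (b, r) - f (b, r)\<bar> \<le> e / 2 * decay \<eta> r ^ 3"
              using N n r unfolding A_def wgt_def by auto
            also have "\<dots> \<le> e / 2 * 1"
              using \<open>0 < e\<close> decay_pos[OF eta(1), of r] decay_le_one[OF eta(1), of r] r by (intro mult_left_mono power_le_one) auto
            finally show "dist (F n (b, r)) (f (b, r)) < e" using \<open>0 < e\<close> by (simp add: dist_real_def)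
          qed
        qed
        have pt: "(\<lambda>n. F n (b, r)) \<longlonglongrightarrow> f (b, r)" if "0 \<le> r" for b r
          using tendsto_uniform_limitI[OF unif[of b], of r] that by auto
        have adm_lim: "admissible \<eta> M \<epsilon> T (\<lambda>r. f (b, r))" if ad: "\<And>n. admissible \<eta> M \<epsilon> T (\<lambda>r. F n (b, r))" and T: "0 \<le> T" for b T
          unfolding admissible_def
        proof (intro conjI ballI)
          show "0 < \<eta>" "0 \<le> M" "0 \<le> \<epsilon>" "\<epsilon> * M \<le> \<eta> / 8" using eta(1) eM by auto
          show "continuous_on {0..T} (\<lambda>r. f (b, r))"
            by (rule uniform_limit_theorem[OF _ uniform_limit_on_subset[OF unif]]) (use cont_xi[OF ad] in auto)
          show "f (b, 0) = 0"
            using pt[of 0 b] xi_0[OF ad] LIMSEQ_unique[of "\<lambda>n. F n (b, 0)" "f (b, 0)" 0] by simp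
          fix r assume r: "r \<in> {0..T}"
          show "\<bar>f (b, r)\<bar> \<le> M * decay \<eta> r ^ 3"
            by (rule LIMSEQ_le_const2[OF tendsto_rabs[OF pt]]) (use r xi_bound[OF ad] in auto)
        qed
        show ?thesis
          unfolding S_def X_def Y_def
          using F adm_lim unfolding S_def X_def Y_def by auto
      qed
    qed (rule that)
    define \<xi> where "\<xi> = X f"
    define \<zeta> where "\<zeta> = Y f"
    have ad: "admissible \<eta> M \<epsilon> T \<xi>" "admissible \<eta> M \<epsilon> T \<zeta>" for T
      using Sadm[OF f(1)] unfolding \<xi>_def \<zeta>_def by auto
    have st: "picard_step \<epsilon> T \<xi> \<zeta> (fst (p f)) (snd (p f))" for T
      using p[OF f(1)] unfolding \<xi>_def \<zeta>_def by auto
    have fx: "\<xi> r = div_new \<epsilon> \<xi> (fst (p f)) (snd (p f)) r" "\<zeta> r = fst (p f) r" if "0 \<le> r" for r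
      using f(2)[of "(True, r)"] f(2)[of "(False, r)"] that unfolding A_def \<Phi>_def \<xi>_def \<zeta>_def X_def Y_def by auto
    have m: "snd (p f) r = mean d \<xi> r" if "0 \<le> r" for r
      by (rule mean_of_divergence[OF ad(1) st fx(1) that order_refl])
    show "\<exists>\<xi> \<zeta>. \<forall>T\<ge>0. admissible \<eta> M \<epsilon> T \<xi> \<and> admissible \<eta> M \<epsilon> T \<zeta> \<and> fixed_profile \<epsilon> T \<xi> \<zeta>"
    proof (rule exI[of _ \<xi>], rule exI[of _ \<zeta>], intro allI impI conjI)
      fix T :: real assume T: "0 \<le> T"
      show "fixed_profile \<epsilon> T \<xi> \<zeta>"
        unfolding fixed_profile_def
      proof (intro conjI ballI)
        show "picard_step \<epsilon> T \<xi> \<zeta> \<zeta> (mean d \<xi>)"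
          by (rule picard_step_cong[OF st[of T] T]) (use fx m in auto)
        fix r assume "r \<in> {0..T}"
        then show "\<xi> r = div_new \<epsilon> \<xi> \<zeta> (mean d \<xi>) r"
          using fx(1)[of r] fx(2)[of r] m[of r] by (simp add: div_new_def force_def temp_def)
      qed
    qed (rule ad)+
  qed
qed

end

section \<open>The conservative form of the equations\<close>

lemma at_within_halfline: "0 < (r::real) \<Longrightarrow> at r within {0..} = at r"
  by (rule at_within_interior) (simp add: interior_real_atLeast)

lemma hderiv_eqI:
  assumes "0 \<le> r" and "(f has_real_derivative y) (at r within {0..})"
  shows "hderiv f r = y"
proof -
  have "at_right r \<le> at r within {0..}"
    by (rule at_le) (use assms(1) in auto)
  then have "at r within {0..} \<noteq> bot"
    using trivial_limit_at_right_real[of r] by (auto simp: bot_unique)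
  then show ?thesis unfolding hderiv_def
    using assms(2) by (intro vector_derivative_within) (auto simp: has_real_derivative_iff_has_vector_derivative)
qed

lemma hderiv_eq: "0 < r \<Longrightarrow> (f has_real_derivative y) (at r) \<Longrightarrow> hderiv f r = y"
  using hderiv_eqI[of r f y] at_within_halfline[of r] by simp

text \<open>The energy equation times r is an exact derivative up to (d-2) H. The weight r is the right one
because r (\<Theta>'' + (d-1)/r \<Theta>') = (r \<Theta>' + (d-2) \<Theta>)', - r E - r^2 E' / 2 =
- (r^2 E)' / 2 for the energy E = P (U^2/2 + C_V \<Theta>), and r (H' + (d-1)/r H) = (r H)' +
(d-2) H. The viscous terms on the right-hand side of the equation are the divergence of 2\<mu> U
U' + \<lambda> U D. Here n stands for d - 1 and the suffix d for derivatives.\<close>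
lemma energy_balance_algebra:
  fixes n r C R \<kappa> \<mu> lam P Pd U Ud Udd Q Qd Qdd :: real
  assumes r: "r \<noteq> 0"
  defines "D \<equiv> Ud + n / r * U" and "Dd \<equiv> Udd + n / r * Ud - n / r\<^sup>2 * U"
  defines "H \<equiv> U * P * (U\<^sup>2 / 2 + (C + R) * Q) - 2 * \<mu> * (U * Ud) - lam * (U * D)"
  defines "Hd \<equiv> Ud * P * (U\<^sup>2 / 2 + (C + R) * Q) + U * Pd * (U\<^sup>2 / 2 + (C + R) * Q) + U * P * (U * Ud + (C + R) * Qd)
     - 2 * \<mu> * (Ud\<^sup>2 + U * Udd) - lam * (Ud * D + U * Dd)"
  shows "- P * (U\<^sup>2 / 2 + C * Q)
       - (1/2) * r * (Pd * (U\<^sup>2 / 2 + C * Q) + P * (U * Ud + C * Qd))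
       + (Ud * P * (U\<^sup>2 / 2 + C * Q) + U * Pd * (U\<^sup>2 / 2 + C * Q) + U * P * (U * Ud + C * Qd)
          + (Ud * P * R * Q + U * Pd * R * Q + U * P * R * Qd))
       + n / r * (U * P * (U\<^sup>2 / 2 + C * Q) + U * P * R * Q)
       - \<kappa> * (Qdd + n / r * Qd)
     - (2 * \<mu> * (Ud\<^sup>2 + n / r\<^sup>2 * U\<^sup>2) + lam * (Ud + n / r * U)\<^sup>2
       + (2 * \<mu> + lam) * (Udd + n / r * Ud - n / r\<^sup>2 * U) * U)
    = (- (1/4) * (2 * r * P * U\<^sup>2 + r\<^sup>2 * Pd * U\<^sup>2 + 2 * r\<^sup>2 * P * U * Ud) + H + r * Hd + (n - 1) * H
       - \<kappa> * (r * Qdd + n * Qd) - 1/2 * C * (2 * r * P * Q + r\<^sup>2 * (Pd * Q + P * Qd))) / r"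
  unfolding H_def Hd_def D_def Dd_def using r
  by (simp add: field_simps power2_eq_square)

lemma mass_eq_iff:
  assumes r: "0 < r" and "(P has_real_derivative Pd) (at r)" "(U has_real_derivative Ud) (at r)"
  shows "mass_eq d P U r \<longleftrightarrow> (r / 2 - U r) * Pd = P r * (Ud + (real d - 1) / r * U r)"
  unfolding mass_eq_def hderiv_eq[OF r assms(2)] hderiv_eq[OF r assms(3)] by (auto simp: algebra_simps)

lemma momentum_eq_iff:
  assumes r: "0 < r" and P: "(P has_real_derivative Pd) (at r)" and U: "(U has_real_derivative Ud) (at r)"
    and Q: "(\<Theta> has_real_derivative Qd) (at r)" and Udd: "(hderiv U has_real_derivative Udd) (at r)"
  shows "momentum_eq d R \<mu> lam P U \<Theta> r \<longleftrightarrow>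
     - (1/2) * (P r * U r + r * (Pd * U r + P r * Ud)) + (Pd * (U r)\<^sup>2 + 2 * P r * U r * Ud)
       + (real d - 1) / r * P r * (U r)\<^sup>2 + R * (Pd * \<Theta> r + P r * Qd)
     = (2 * \<mu> + lam) * (Udd + (real d - 1) / r * Ud - (real d - 1) / r\<^sup>2 * U r)"
proof -
  have 1: "hderiv (\<lambda>s. P s * U s) r = Pd * U r + Ud * P r"
    by (rule hderiv_eq[OF r DERIV_mult[OF P U]])
  have 2: "hderiv (\<lambda>s. P s * (U s)\<^sup>2) r = Pd * (U r)\<^sup>2 + (2 * U r * Ud) * P r"
    by (rule hderiv_eq[OF r]) (auto intro!: derivative_eq_intros P U)
  have 3: "hderiv (\<lambda>s. P s * R * \<Theta> s) r = Pd * R * \<Theta> r + Qd * (P r * R)"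
    by (rule hderiv_eq[OF r]) (auto intro!: derivative_eq_intros P Q)
  show ?thesis
    unfolding momentum_eq_def 1 2 3 hderiv_eq[OF r U] hderiv_eq[OF r Udd] by (simp add: algebra_simps)
qed

text \<open>The convective flux of energy and pressure minus the work of the viscous stress.\<close>
definition energy_flux :: "nat \<Rightarrow> real \<Rightarrow> real \<Rightarrow> real \<Rightarrow> real \<Rightarrow> (real \<Rightarrow> real) \<Rightarrow> (real \<Rightarrow> real) \<Rightarrow> (real \<Rightarrow> real) \<Rightarrow> (real \<Rightarrow> real) \<Rightarrow> real \<Rightarrow> real" where
  "energy_flux d R \<mu> lam C P U U' \<Theta> s = U s * P s * ((U s)\<^sup>2 / 2 + (C + R) * \<Theta> s)
     - 2 * \<mu> * (U s * U' s) - lam * (U s * (U' s + (real d - 1) / s * U s))"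

lemma energy_flux_has_derivative:
  assumes r: "0 < r" and P: "(P has_real_derivative Pd) (at r)" and U: "(U has_real_derivative U' r) (at r)"
    and Q: "(\<Theta> has_real_derivative Qd) (at r)" and Udd: "(U' has_real_derivative Udd) (at r)"
  shows "(energy_flux d R \<mu> lam C P U U' \<Theta> has_real_derivative
     U' r * P r * ((U r)\<^sup>2 / 2 + (C + R) * \<Theta> r) + U r * Pd * ((U r)\<^sup>2 / 2 + (C + R) * \<Theta> r)
       + U r * P r * (U r * U' r + (C + R) * Qd) - 2 * \<mu> * ((U' r)\<^sup>2 + U r * Udd)
       - lam * (U' r * (U' r + (real d - 1) / r * U r) + U r * (Udd + (real d - 1) / r * U' r - (real d - 1) / r\<^sup>2 * U r))) (at r)"
proof -
  have n: "((\<lambda>s. (real d - 1) / s * U s) has_real_derivative (real d - 1) / r * U' r - (real d - 1) / r\<^sup>2 * U r) (at r)"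
    using r by (auto intro!: derivative_eq_intros U simp: power2_eq_square field_simps)
  have a: "((\<lambda>s. U s * P s) has_real_derivative U' r * P r + Pd * U r) (at r)"
    by (rule DERIV_mult[OF U P])
  have b: "((\<lambda>s. (U s)\<^sup>2 / 2 + (C + R) * \<Theta> s) has_real_derivative U r * U' r + (C + R) * Qd) (at r)"
    by (auto intro!: derivative_eq_intros U Q)
  have c: "((\<lambda>s. U s * P s * ((U s)\<^sup>2 / 2 + (C + R) * \<Theta> s) - 2 * \<mu> * (U s * U' s)
        - lam * (U s * (U' s + (real d - 1) / s * U s))) has_real_derivative
      ((U' r * P r + Pd * U r) * ((U r)\<^sup>2 / 2 + (C + R) * \<Theta> r) + (U r * U' r + (C + R) * Qd) * (U r * P r))
       - 2 * \<mu> * (U' r * U' r + Udd * U r)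
       - lam * (U' r * (U' r + (real d - 1) / r * U r) + (Udd + ((real d - 1) / r * U' r - (real d - 1) / r\<^sup>2 * U r)) * U r)) (at r)"
    by (intro DERIV_diff DERIV_cmult DERIV_mult[OF a b] DERIV_mult[OF U Udd] DERIV_mult[OF U DERIV_add[OF Udd n]])
  show ?thesis unfolding energy_flux_def
    by (rule DERIV_cong[OF c]) (simp add: algebra_simps power2_eq_square)
qed

lemma energy_eq_iff:
  assumes r: "0 < r" and P: "(P has_real_derivative Pd) (at r)" and U: "(U has_real_derivative Ud) (at r)"
    and Q: "(\<Theta> has_real_derivative Qd) (at r)" and Udd: "(hderiv U has_real_derivative Udd) (at r)"
    and Qdd: "(hderiv \<Theta> has_real_derivative Qdd) (at r)"
    and H: "(energy_flux d R \<mu> lam C P U (hderiv U) \<Theta> has_real_derivative Hd) (at r)"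
  shows "energy_eq d R \<mu> lam C \<kappa> P U \<Theta> r \<longleftrightarrow>
     \<kappa> * (r * Qdd + (real d - 1) * Qd) + 1/2 * C * (2 * r * P r * \<Theta> r + r\<^sup>2 * (Pd * \<Theta> r + P r * Qd))
     = - (1/4) * (2 * r * P r * (U r)\<^sup>2 + r\<^sup>2 * Pd * (U r)\<^sup>2 + 2 * r\<^sup>2 * P r * U r * Ud)
       + energy_flux d R \<mu> lam C P U (hderiv U) \<Theta> r + r * Hd
       + (real d - 2) * energy_flux d R \<mu> lam C P U (hderiv U) \<Theta> r"
proof -
  let ?n = "real d - 1"
  have hU: "hderiv U r = Ud" and hQ: "hderiv \<Theta> r = Qd" using hderiv_eq[OF r] U Q by auto
  have U': "(U has_real_derivative hderiv U r) (at r)" using U hU by simp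
  have Hd: "Hd = Ud * P r * ((U r)\<^sup>2 / 2 + (C + R) * \<Theta> r) + U r * Pd * ((U r)\<^sup>2 / 2 + (C + R) * \<Theta> r)
       + U r * P r * (U r * Ud + (C + R) * Qd) - 2 * \<mu> * (Ud\<^sup>2 + U r * Udd)
       - lam * (Ud * (Ud + ?n / r * U r) + U r * (Udd + ?n / r * Ud - ?n / r\<^sup>2 * U r))"
    using DERIV_unique[OF H energy_flux_has_derivative[OF r P U' Q Udd]] unfolding hU .
  have e: "((\<lambda>s. (U s)\<^sup>2 / 2 + C * \<Theta> s) has_real_derivative U r * Ud + C * Qd) (at r)"
    by (auto intro!: derivative_eq_intros U Q)
  have 1: "hderiv (\<lambda>s. P s * ((U s)\<^sup>2 / 2 + C * \<Theta> s)) r = Pd * ((U r)\<^sup>2 / 2 + C * \<Theta> r) + P r * (U r * Ud + C * Qd)"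
    by (rule hderiv_eq[OF r DERIV_cong[OF DERIV_mult[OF P e]]]) simp
  have UP: "((\<lambda>s. U s * P s) has_real_derivative Ud * P r + Pd * U r) (at r)"
    by (rule DERIV_mult[OF U P])
  have UPQ: "((\<lambda>s. U s * P s * R * \<Theta> s) has_real_derivative (Ud * P r + Pd * U r) * R * \<Theta> r + Qd * (U r * P r * R)) (at r)"
    by (rule DERIV_mult[OF DERIV_cmult_right[OF UP] Q])
  have 2: "hderiv (\<lambda>s. U s * P s * ((U s)\<^sup>2 / 2 + C * \<Theta> s) + U s * P s * R * \<Theta> s) r
     = Ud * P r * ((U r)\<^sup>2 / 2 + C * \<Theta> r) + U r * Pd * ((U r)\<^sup>2 / 2 + C * \<Theta> r) + U r * P r * (U r * Ud + C * Qd)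
          + (Ud * P r * R * \<Theta> r + U r * Pd * R * \<Theta> r + U r * P r * R * Qd)"
    by (rule hderiv_eq[OF r DERIV_cong[OF DERIV_add[OF DERIV_mult[OF UP e] UPQ]]]) (simp add: algebra_simps)
  define X where "X = - (1/4) * (2 * r * P r * (U r)\<^sup>2 + r\<^sup>2 * Pd * (U r)\<^sup>2 + 2 * r\<^sup>2 * P r * U r * Ud)
       + energy_flux d R \<mu> lam C P U (hderiv U) \<Theta> r + r * Hd
       + (real d - 2) * energy_flux d R \<mu> lam C P U (hderiv U) \<Theta> r"
  define Y where "Y = \<kappa> * (r * Qdd + (real d - 1) * Qd) + 1/2 * C * (2 * r * P r * \<Theta> r + r\<^sup>2 * (Pd * \<Theta> r + P r * Qd))"
  let ?L = "- P r * ((U r)\<^sup>2 / 2 + C * \<Theta> r)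
       - (1/2) * r * (Pd * ((U r)\<^sup>2 / 2 + C * \<Theta> r) + P r * (U r * Ud + C * Qd))
       + (Ud * P r * ((U r)\<^sup>2 / 2 + C * \<Theta> r) + U r * Pd * ((U r)\<^sup>2 / 2 + C * \<Theta> r) + U r * P r * (U r * Ud + C * Qd)
          + (Ud * P r * R * \<Theta> r + U r * Pd * R * \<Theta> r + U r * P r * R * Qd))
       + ?n / r * (U r * P r * ((U r)\<^sup>2 / 2 + C * \<Theta> r) + U r * P r * R * \<Theta> r)
       - \<kappa> * (Qdd + ?n / r * Qd)"
  let ?R = "2 * \<mu> * (Ud\<^sup>2 + ?n / r\<^sup>2 * (U r)\<^sup>2) + lam * (Ud + ?n / r * U r)\<^sup>2
       + (2 * \<mu> + lam) * (Udd + ?n / r * Ud - ?n / r\<^sup>2 * U r) * U r"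
  have "?L - ?R = (X - Y) / r"
    by (subst energy_balance_algebra, use r in simp, rule arg_cong[where f = "\<lambda>x. x / r"])
       (simp add: X_def Y_def Hd energy_flux_def hU algebra_simps)
  moreover have "a = b \<longleftrightarrow> y = x" if "a - b = (x - y) / r" for a b x y
  proof -
    have "a = b \<longleftrightarrow> (x - y) / r = 0" unfolding that[symmetric] by simp
    also have "\<dots> \<longleftrightarrow> y = x" using r by auto
    finally show ?thesis .
  qed
  ultimately have "?L = ?R \<longleftrightarrow> Y = X" by blast
  moreover have "energy_eq d R \<mu> lam C \<kappa> P U \<Theta> r \<longleftrightarrow> ?L = ?R"
    unfolding energy_eq_def 1 2 hU hQ hderiv_eq[OF r Udd] hderiv_eq[OF r Qdd] by simp
  ultimately show ?thesis unfolding X_def Y_def by simp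
qed

section \<open>Fixed points are solutions\<close>

lemma C1_halflineI:
  assumes "\<And>r. 0 \<le> r \<Longrightarrow> (f has_real_derivative g r) (at r within {0..})" and "continuous_on {0..} g"
  shows "C1_halfline f" and "\<And>r. 0 \<le> r \<Longrightarrow> hderiv f r = g r"
proof -
  show h: "hderiv f r = g r" if "0 \<le> r" for r
    using hderiv_eqI[OF that assms(1)[OF that]] .
  have "continuous_on {0..} (hderiv f)"
    by (rule continuous_on_eq[OF assms(2)]) (use h in auto)
  moreover have "f differentiable (at r within {0..})" if "0 \<le> r" for r
    using assms(1)[OF that] real_differentiable_def by blast
  ultimately show "C1_halfline f" unfolding C1_halfline_def by auto
qed

text \<open>This gives differentiability of U and \<Theta> at 0, where \<xi> and \<zeta> are merely
continuous.\<close>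
lemma radius_times_derivative_0:
  fixes f :: "real \<Rightarrow> real"
  assumes "continuous_on {0..1} f" "f 0 = 0"
  shows "((\<lambda>r. r * f r) has_real_derivative 0) (at 0 within {0..})"
proof -
  have "(f \<longlongrightarrow> 0) (at 0 within {0..1})"
    using assms(1)[unfolded continuous_on_def, rule_format, of 0] assms(2) by simp
  moreover have "at (0::real) within {0..1} = at 0 within {0..}"
    by (rule at_within_nhd[of _ "{..<1}"]) auto
  ultimately have "(f \<longlongrightarrow> 0) (at 0 within {0..})" by simp
  moreover have "\<forall>\<^sub>F r in at 0 within {0..}. f r = (r * f r - 0 * f 0) / (r - 0)"
    by (auto simp: eventually_at_filter)
  ultimately show ?thesis
    unfolding has_field_derivative_iff using tendsto_cong by force
qed

context based_gas
begin

definition velocity :: "real \<Rightarrow> (real \<Rightarrow> real) \<Rightarrow> real \<Rightarrow> real" where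
  "velocity \<epsilon> \<xi> r = \<epsilon> * (r * (r * mean d \<xi> r))"

definition temperature :: "real \<Rightarrow> (real \<Rightarrow> real) \<Rightarrow> real \<Rightarrow> real" where
  "temperature \<epsilon> \<zeta> r = \<epsilon> * temp \<zeta> r"

context
  fixes \<epsilon> \<xi> \<zeta>
  assumes eps: "0 < \<epsilon>"
    and adm_all: "\<And>T. 0 \<le> T \<Longrightarrow> admissible \<eta> M \<epsilon> T \<xi>" "\<And>T. 0 \<le> T \<Longrightarrow> admissible \<eta> M \<epsilon> T \<zeta>"
    and fixed: "\<And>T. 0 \<le> T \<Longrightarrow> fixed_profile \<epsilon> T \<xi> \<zeta>"
begin

abbreviation (input) "mm \<equiv> mean d \<xi>"
abbreviation (input) "PP \<equiv> density \<epsilon> \<xi>"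
abbreviation (input) "slope \<equiv> temp_slope \<epsilon> \<xi> \<zeta> \<zeta>"

definition dxi :: "real \<Rightarrow> real" where
  "dxi r = (div_source \<epsilon> \<xi> \<zeta> \<zeta> mm r / \<nu> - \<xi> r - PP r / (2 * \<nu>) * r\<^sup>2 * \<xi> r) / r"

lemma step_all: "0 \<le> T \<Longrightarrow> picard_step \<epsilon> T \<xi> \<zeta> \<zeta> mm"
  and xi_eq: "0 \<le> r \<Longrightarrow> \<xi> r = div_new \<epsilon> \<xi> \<zeta> mm r"
  using fixed[of T] fixed[of r] by (auto simp: fixed_profile_def)

lemma cont_all:
  shows "continuous_on {0..} \<xi>" "continuous_on {0..} \<zeta>" "continuous_on {0..} mm" "continuous_on {0..} PP"
    "continuous_on {0..} (rate \<epsilon> \<xi>)" "continuous_on {0..} slope"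
proof -
  show c: "continuous_on {0..} \<xi>" "continuous_on {0..} \<zeta>" "continuous_on {0..} mm" "continuous_on {0..} PP"
    "continuous_on {0..} (rate \<epsilon> \<xi>)"
    using cont_xi[OF adm_all(1)] cont_xi[OF adm_all(2)] cont_mean[OF adm_all(1)] cont_density[OF adm_all(1)] cont_rate[OF adm_all(1)]
    by (auto intro!: continuous_on_halflineI)
  have h: "continuous_on {0..} (heat_rhs \<epsilon> \<xi> \<zeta>)"
    by (intro continuous_on_halflineI cont_heat_rhs[OF adm_all(1)] continuous_on_subset[OF c(2)]) auto
  have nz: "(1 + r\<^sup>2)\<^sup>2 \<noteq> 0" for r :: real
    by (smt (verit) zero_le_power2 zero_eq_power2)
  have b: "continuous_on {0..} (\<lambda>r::real. r / (1 + r\<^sup>2)\<^sup>2)"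
    by (intro continuous_intros ballI nz)
  show "continuous_on {0..} slope"
    unfolding temp_slope_def
    by (intro b c h continuous_on_add continuous_on_diff continuous_on_mult continuous_on_const continuous_on_id continuous_on_power)
qed

lemma zeros: "\<xi> 0 = 0" "\<zeta> 0 = 0" "slope 0 = 0"
  using xi_0[OF adm_all(1)[of 0]] xi_0[OF adm_all(2)[of 0]] heat_rhs_0[OF adm_all(1)[of 0]]
  by (auto simp: temp_slope_def)

lemma mean_deriv: "0 < r \<Longrightarrow> (mm has_real_derivative (\<xi> r - (real d + 1) * mm r) / r) (at r)"
  by (rule mean_has_derivative[of "r + 1"]) (auto intro: continuous_on_subset[OF cont_all(1)])

lemma xi_deriv: "0 < r \<Longrightarrow> (\<xi> has_real_derivative dxi r) (at r)"
proof -
  assume r: "0 < r"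
  have "(div_new \<epsilon> \<xi> \<zeta> mm has_real_derivative (div_source \<epsilon> \<xi> \<zeta> \<zeta> mm r / \<nu> - div_new \<epsilon> \<xi> \<zeta> mm r
     - PP r / (2 * \<nu>) * r\<^sup>2 * div_new \<epsilon> \<xi> \<zeta> mm r) / r) (at r)"
    by (rule div_new_has_derivative[OF adm_all(1) step_all, of "r + 1"]) (use r in auto)
  then have "(div_new \<epsilon> \<xi> \<zeta> mm has_real_derivative dxi r) (at r)"
    unfolding dxi_def using xi_eq[of r] r by simp
  then show ?thesis
    by (rule has_derivative_cong_on_interval[where a = 0 and b = "r + 1"]) (use xi_eq r in auto)
qed

lemma density_deriv: "0 \<le> r \<Longrightarrow> (PP has_real_derivative \<epsilon> * (PP r * rate \<epsilon> \<xi> r)) (at r within {0..})"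
proof -
  assume r: "0 \<le> r"
  have "((\<lambda>r. integral {0..r} (rate \<epsilon> \<xi>)) has_real_derivative rate \<epsilon> \<xi> r) (at r within {0..r+1})"
    using r by (intro integral_has_real_derivative continuous_on_subset[OF cont_all(5)]) auto
  moreover have "at r within {0..r+1} = at r within {0..}"
    by (rule at_within_nhd[of _ "{..<r+1}"]) (use r in auto)
  ultimately have "((\<lambda>r. integral {0..r} (rate \<epsilon> \<xi>)) has_real_derivative rate \<epsilon> \<xi> r) (at r within {0..})" by simp
  then show ?thesis unfolding density_def by (auto intro!: derivative_eq_intros)
qed

lemma density_deriv_at: "0 < r \<Longrightarrow> (PP has_real_derivative \<epsilon> * (PP r * rate \<epsilon> \<xi> r)) (at r)"
  using density_deriv[of r] at_within_halfline[of r] by simp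

lemma velocity_deriv_at:
  assumes "0 < r"
  shows "(velocity \<epsilon> \<xi> has_real_derivative \<epsilon> * (r * (\<xi> r - (real d - 1) * mm r))) (at r)"
proof -
  have "(velocity \<epsilon> \<xi> has_real_derivative \<epsilon> * (r * mm r + r * (mm r + r * ((\<xi> r - (real d + 1) * mm r) / r)))) (at r)"
    using DERIV_cmult[OF DERIV_mult[OF DERIV_ident DERIV_mult[OF DERIV_ident mean_deriv[OF assms]]], of \<epsilon>]
    unfolding velocity_def[abs_def] by (rule DERIV_cong) (simp add: algebra_simps)
  then show ?thesis by (rule DERIV_cong) (use assms in \<open>simp add: field_simps\<close>)
qed

lemma velocity_deriv: "0 \<le> r \<Longrightarrow> (velocity \<epsilon> \<xi> has_real_derivative \<epsilon> * (r * (\<xi> r - (real d - 1) * mm r))) (at r within {0..})"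
proof (cases "r = 0")
  case True
  have "continuous_on {0..1} (\<lambda>r. r * mm r)"
    by (intro continuous_intros continuous_on_subset[OF cont_all(3)]) auto
  from radius_times_derivative_0[OF this]
  have "((\<lambda>r. r * (r * mm r)) has_real_derivative 0) (at 0 within {0..})" by simp
  from DERIV_cmult[OF this, of \<epsilon>] show ?thesis
    using True unfolding velocity_def[abs_def] by simp
qed (use velocity_deriv_at at_within_halfline in auto)

lemma temperature_deriv_at:
  assumes "0 < r"
  shows "(temperature \<epsilon> \<zeta> has_real_derivative \<epsilon> * slope r) (at r)"
  unfolding temperature_def[abs_def]
  by (intro DERIV_cmult temp_has_derivative[OF adm_all(1) step_all, of "r + 1"]) (use assms in auto)

lemma temperature_deriv: "0 \<le> r \<Longrightarrow> (temperature \<epsilon> \<zeta> has_real_derivative \<epsilon> * slope r) (at r within {0..})"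
proof (cases "r = 0")
  case True
  have "((\<lambda>r. r * \<zeta> r) has_real_derivative 0) (at 0 within {0..})"
    by (intro radius_times_derivative_0 continuous_on_subset[OF cont_all(2)] zeros) auto
  moreover have "((\<lambda>r::real. 1 / (1 + r\<^sup>2)) has_real_derivative 0) (at 0 within {0..})"
    by (auto intro!: derivative_eq_intros)
  ultimately have "(temp \<zeta> has_real_derivative 0 + 0) (at 0 within {0..})"
    unfolding temp_def[abs_def] by (intro DERIV_add)
  from DERIV_cmult[OF this, of \<epsilon>] show ?thesis
    using True zeros unfolding temperature_def[abs_def] by simp
qed (use temperature_deriv_at at_within_halfline in auto)

lemma
  shows C1_density: "C1_halfline PP" and hderiv_density: "\<And>r. 0 \<le> r \<Longrightarrow> hderiv PP r = \<epsilon> * (PP r * rate \<epsilon> \<xi> r)"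
    and C1_velocity: "C1_halfline (velocity \<epsilon> \<xi>)"
    and hderiv_velocity: "\<And>r. 0 \<le> r \<Longrightarrow> hderiv (velocity \<epsilon> \<xi>) r = \<epsilon> * (r * (\<xi> r - (real d - 1) * mm r))"
    and C1_temperature: "C1_halfline (temperature \<epsilon> \<zeta>)"
    and hderiv_temperature: "\<And>r. 0 \<le> r \<Longrightarrow> hderiv (temperature \<epsilon> \<zeta>) r = \<epsilon> * slope r"
proof -
  have "continuous_on {0..} (\<lambda>r. \<epsilon> * (PP r * rate \<epsilon> \<xi> r))"
    by (intro continuous_intros cont_all)
  from C1_halflineI[OF density_deriv this]
  show "C1_halfline PP" "\<And>r. 0 \<le> r \<Longrightarrow> hderiv PP r = \<epsilon> * (PP r * rate \<epsilon> \<xi> r)" by auto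
  have "continuous_on {0..} (\<lambda>r. \<epsilon> * (r * (\<xi> r - (real d - 1) * mm r)))"
    by (intro continuous_intros cont_all)
  from C1_halflineI[OF velocity_deriv this]
  show "C1_halfline (velocity \<epsilon> \<xi>)" "\<And>r. 0 \<le> r \<Longrightarrow> hderiv (velocity \<epsilon> \<xi>) r = \<epsilon> * (r * (\<xi> r - (real d - 1) * mm r))" by auto
  have "continuous_on {0..} (\<lambda>r. \<epsilon> * slope r)"
    by (intro continuous_intros cont_all)
  from C1_halflineI[OF temperature_deriv this]
  show "C1_halfline (temperature \<epsilon> \<zeta>)" "\<And>r. 0 \<le> r \<Longrightarrow> hderiv (temperature \<epsilon> \<zeta>) r = \<epsilon> * slope r" by auto
qed

lemma hderiv_velocity_deriv:
  assumes r: "0 < r"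
  shows "(hderiv (velocity \<epsilon> \<xi>) has_real_derivative
     \<epsilon> * ((\<xi> r - (real d - 1) * mm r) + r * (dxi r - (real d - 1) * ((\<xi> r - (real d + 1) * mm r) / r)))) (at r)"
proof (rule has_derivative_cong_on_interval[where a = 0 and b = "r + 1"])
  show "((\<lambda>r. \<epsilon> * (r * (\<xi> r - (real d - 1) * mm r))) has_real_derivative
     \<epsilon> * ((\<xi> r - (real d - 1) * mm r) + r * (dxi r - (real d - 1) * ((\<xi> r - (real d + 1) * mm r) / r)))) (at r)"
    by (auto intro!: derivative_eq_intros xi_deriv mean_deriv r)
qed (use r hderiv_velocity in auto)

lemma velocity_eq: "velocity \<epsilon> \<xi> r = \<epsilon> * (r\<^sup>2 * mm r)"
  by (simp add: velocity_def power2_eq_square)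

lemma velocity_over_radius: "0 < r \<Longrightarrow> (real d - 1) / r * velocity \<epsilon> \<xi> r = \<epsilon> * (r * ((real d - 1) * mm r))"
  by (simp add: velocity_def)

lemma mass: "0 < r \<Longrightarrow> mass_eq d PP (velocity \<epsilon> \<xi>) r"
proof -
  assume r: "0 < r"
  have den: "1/2 - \<epsilon> * (r * mm r) \<noteq> 0"
    using denominator_ge[OF adm_all(1)[of r], of r] r by auto
  have "(r / 2 - velocity \<epsilon> \<xi> r) * (\<epsilon> * (PP r * rate \<epsilon> \<xi> r))
      = r * (1/2 - \<epsilon> * (r * mm r)) * (\<epsilon> * (PP r * rate \<epsilon> \<xi> r))"
    by (simp add: velocity_def algebra_simps)
  also have "\<dots> = r * \<epsilon> * PP r * \<xi> r" unfolding rate_def using den by simp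
  also have "\<dots> = PP r * (\<epsilon> * (r * (\<xi> r - (real d - 1) * mm r)) + (real d - 1) / r * velocity \<epsilon> \<xi> r)"
    unfolding velocity_over_radius[OF r] by (simp add: algebra_simps)
  finally show ?thesis
    unfolding mass_eq_iff[OF r density_deriv_at[OF r] velocity_deriv_at[OF r]] .
qed

lemma momentum: "0 < r \<Longrightarrow> momentum_eq d R \<mu> lam PP (velocity \<epsilon> \<xi>) (temperature \<epsilon> \<zeta>) r"
proof -
  assume r: "0 < r"
  let ?D = "\<epsilon> * (PP r * rate \<epsilon> \<xi> r)"
  have x: "\<nu> * (\<xi> r + r * dxi r) = div_source \<epsilon> \<xi> \<zeta> \<zeta> mm r - PP r * r\<^sup>2 * \<xi> r / 2"
    unfolding dxi_def using r nu_pos by (simp add: field_simps)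
  have src: "div_source \<epsilon> \<xi> \<zeta> \<zeta> mm r = \<epsilon> * (?D * (r ^ 4 * (mm r)\<^sup>2)
        + PP r * (r ^ 3 * (4 * (mm r)\<^sup>2 + 2 * (mm r * (\<xi> r - (real d + 1) * mm r)))))
     + R * (?D * temp \<zeta> r + PP r * slope r) + (real d - 1) * (\<epsilon> * (PP r * (r ^ 3 * (mm r)\<^sup>2)))
     + (real d - 2) / 2 * (PP r * (r\<^sup>2 * mm r)) - ?D * (r ^ 3 * mm r) / 2"
    unfolding div_source_def force_slope_def by (simp add: algebra_simps)
  have lap: "\<epsilon> * ((\<xi> r - (real d - 1) * mm r) + r * (dxi r - (real d - 1) * ((\<xi> r - (real d + 1) * mm r) / r)))
      + (real d - 1) / r * (\<epsilon> * (r * (\<xi> r - (real d - 1) * mm r))) - (real d - 1) / r\<^sup>2 * (\<epsilon> * (r\<^sup>2 * mm r))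
     = \<epsilon> * (\<xi> r + r * dxi r)"
    using r by (simp add: field_simps)
  have "- (1/2) * (PP r * (\<epsilon> * (r\<^sup>2 * mm r)) + r * (?D * (\<epsilon> * (r\<^sup>2 * mm r)) + PP r * (\<epsilon> * (r * (\<xi> r - (real d - 1) * mm r)))))
       + (?D * (\<epsilon> * (r\<^sup>2 * mm r))\<^sup>2 + 2 * PP r * (\<epsilon> * (r\<^sup>2 * mm r)) * (\<epsilon> * (r * (\<xi> r - (real d - 1) * mm r))))
       + (real d - 1) / r * PP r * (\<epsilon> * (r\<^sup>2 * mm r))\<^sup>2 + R * (?D * (\<epsilon> * temp \<zeta> r) + PP r * (\<epsilon> * slope r))
     = \<epsilon> * (div_source \<epsilon> \<xi> \<zeta> \<zeta> mm r - PP r * r\<^sup>2 * \<xi> r / 2)"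
    unfolding src using r by (simp add: field_simps eval_nat_numeral)
  also have "\<dots> = \<nu> * (\<epsilon> * (\<xi> r + r * dxi r))" unfolding x[symmetric] by simp
  finally show ?thesis
    unfolding momentum_eq_iff[OF r density_deriv_at[OF r] velocity_deriv_at[OF r] temperature_deriv_at[OF r] hderiv_velocity_deriv[OF r]]
      velocity_eq lap[symmetric] temperature_def \<nu>_def .
qed

lemma energy_flux_eq:
  assumes "0 < s"
  shows "energy_flux d R \<mu> lam Cv PP (velocity \<epsilon> \<xi>) (hderiv (velocity \<epsilon> \<xi>)) (temperature \<epsilon> \<zeta>) s = \<epsilon>\<^sup>2 * heat_flux \<epsilon> \<xi> \<zeta> s"
proof -
  have D: "hderiv (velocity \<epsilon> \<xi>) s + (real d - 1) / s * velocity \<epsilon> \<xi> s = \<epsilon> * (s * \<xi> s)"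
    using assms unfolding velocity_over_radius[OF assms] by (simp add: hderiv_velocity algebra_simps)
  show ?thesis
    unfolding energy_flux_def D unfolding hderiv_velocity[OF less_imp_le[OF assms]]
    by (simp add: velocity_eq heat_flux_def work_def temperature_def algebra_simps eval_nat_numeral)
qed

text \<open>The integrated energy equation, divided by \<epsilon>. The term with 1/(1+r^2) in
\<open>heat_rhs\<close> combines with the constant through r^2/(1+r^2) = 1 - 1/(1+r^2).\<close>
lemma heat_balance:
  assumes "0 \<le> r"
  shows "\<kappa> * (r * slope r + (real d - 2) * temp \<zeta> r) + Cv / 2 * (PP r * (r\<^sup>2 * temp \<zeta> r))
     = (real d - 2) * \<kappa> + \<epsilon> * (- (1/4) * (PP r * (r ^ 6 * (mm r)\<^sup>2)) + r * heat_flux \<epsilon> \<xi> \<zeta> r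
        + (real d - 2) * integral {0..r} (heat_flux \<epsilon> \<xi> \<zeta>))"
proof -
  define q where "q = 1 / (1 + r\<^sup>2)"
  have nz: "1 + r\<^sup>2 \<noteq> 0" by (smt (verit) zero_le_power2)
  have q: "r\<^sup>2 * q = 1 - q" unfolding q_def using nz by (simp add: field_simps)
  have qq: "r / (1 + r\<^sup>2)\<^sup>2 = r * q\<^sup>2" "r / (1 + r\<^sup>2) = r * q" "(real d - 2) * r / (1 + r\<^sup>2) = (real d - 2) * (r * q)"
    "2 * r / (1 + r\<^sup>2)\<^sup>2 = 2 * (r * q\<^sup>2)"
    unfolding q_def by (auto simp: power_divide)
  define hs where "hs = heat_source \<epsilon> \<xi> \<zeta> r"
  have hs: "r * hs = - (1/4) * (PP r * (r ^ 6 * (mm r)\<^sup>2)) + r * heat_flux \<epsilon> \<xi> \<zeta> r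
        + (real d - 2) * integral {0..r} (heat_flux \<epsilon> \<xi> \<zeta>)"
    unfolding hs_def heat_source_def by (cases "r = 0") (auto simp: field_simps eval_nat_numeral)
  have "\<kappa> * (r * slope r + (real d - 2) * temp \<zeta> r) + Cv / 2 * (PP r * (r\<^sup>2 * temp \<zeta> r))
      = \<kappa> * (real d - 2) * (q + r\<^sup>2 * q) + \<epsilon> * (r * hs)"
    unfolding temp_slope_def heat_rhs_def temp_def hs_def[symmetric] q_def[symmetric] qq
    using kappa_pos by (simp add: field_simps power2_eq_square)
  then show ?thesis unfolding q hs by simp
qed

text \<open>\<Theta>'' exists because the heat balance expresses r \<Theta>' by differentiable functions.\<close>
lemma slope_deriv:
  assumes r: "0 < r"
  obtains y where "(slope has_real_derivative y) (at r)"
proof -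
  note dI = real_differentiable_def[THEN iffD2, OF exI]
  have I: "((\<lambda>r. integral {0..r} (heat_flux \<epsilon> \<xi> \<zeta>)) has_real_derivative heat_flux \<epsilon> \<xi> \<zeta> r) (at r)"
    by (intro integral_has_derivative_interior[of "r + 1"] cont_heat_flux[OF adm_all(1)] continuous_on_subset[OF cont_all(2)]) (use r in auto)
  have t: "(temp \<zeta> has_real_derivative slope r) (at r)"
    by (rule temp_has_derivative[OF adm_all(1) step_all, of "r + 1"]) (use r in auto)
  let ?G = "\<lambda>r. ((real d - 2) * \<kappa> + \<epsilon> * (- (1/4) * (PP r * (r ^ 6 * (mm r)\<^sup>2)) + r * heat_flux \<epsilon> \<xi> \<zeta> r
        + (real d - 2) * integral {0..r} (heat_flux \<epsilon> \<xi> \<zeta>)) - Cv / 2 * (PP r * (r\<^sup>2 * temp \<zeta> r))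
        - \<kappa> * ((real d - 2) * temp \<zeta> r)) / (\<kappa> * r)"
  have diff: "mm differentiable at r" "PP differentiable at r" "\<xi> differentiable at r" "temp \<zeta> differentiable at r"
      "(\<lambda>r. integral {0..r} (heat_flux \<epsilon> \<xi> \<zeta>)) differentiable at r"
    by (rule dI, rule mean_deriv[OF r] density_deriv_at[OF r] xi_deriv[OF r] t I)+
  have "heat_flux \<epsilon> \<xi> \<zeta> differentiable at r"
    unfolding heat_flux_def[abs_def] work_def by (intro derivative_intros diff) auto
  then have "?G differentiable at r"
    using r kappa_pos by (intro derivative_intros diff) auto
  then have "\<exists>y. (?G has_real_derivative y) (at r)"
    by (simp add: real_differentiable_def)
  then obtain y where y: "(?G has_real_derivative y) (at r)" ..
  have "slope s = ?G s" if "0 < s" for s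
  proof -
    have "\<kappa> * s * slope s = (real d - 2) * \<kappa> + \<epsilon> * (- (1/4) * (PP s * (s ^ 6 * (mm s)\<^sup>2)) + s * heat_flux \<epsilon> \<xi> \<zeta> s
        + (real d - 2) * integral {0..s} (heat_flux \<epsilon> \<xi> \<zeta>)) - Cv / 2 * (PP s * (s\<^sup>2 * temp \<zeta> s))
        - \<kappa> * ((real d - 2) * temp \<zeta> s)"
      using heat_balance[of s] that by (simp add: distrib_left mult.assoc)
    then show ?thesis using that kappa_pos by (metis (no_types, lifting) less_irrefl mult_pos_pos nonzero_mult_div_cancel_left)
  qed
  then have "(slope has_real_derivative y) (at r)"
    using r by (intro has_derivative_cong_on_interval[OF y, where a = 0 and b = "r + 1"]) auto
  then show thesis by (rule that)
qed

lemma hderiv_temperature_deriv: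
  assumes r: "0 < r" and y: "(slope has_real_derivative y) (at r)"
  shows "(hderiv (temperature \<epsilon> \<zeta>) has_real_derivative \<epsilon> * y) (at r)"
  by (rule has_derivative_cong_on_interval[OF DERIV_cmult[OF y], where a = 0 and b = "r + 1"]) (use r hderiv_temperature in auto)

text \<open>The energy equation is the derivative of the heat balance.\<close>
lemma energy: "0 < r \<Longrightarrow> energy_eq d R \<mu> lam Cv \<kappa> PP (velocity \<epsilon> \<xi>) (temperature \<epsilon> \<zeta>) r"
proof -
  assume r: "0 < r"
  obtain y where y: "(slope has_real_derivative y) (at r)" by (rule slope_deriv[OF r])
  let ?U = "velocity \<epsilon> \<xi>" and ?Q = "temperature \<epsilon> \<zeta>"
  let ?Ud = "\<epsilon> * (r * (\<xi> r - (real d - 1) * mm r))" and ?Pd = "\<epsilon> * (PP r * rate \<epsilon> \<xi> r)"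
  let ?H = "energy_flux d R \<mu> lam Cv PP ?U (hderiv ?U) ?Q"
  have Ud: "(?U has_real_derivative hderiv ?U r) (at r)"
    using velocity_deriv_at[OF r] hderiv_velocity[of r] r by simp
  obtain Hd where Hd: "(?H has_real_derivative Hd) (at r)"
    using energy_flux_has_derivative[OF r density_deriv_at[OF r] Ud temperature_deriv_at[OF r] hderiv_velocity_deriv[OF r]] by blast
  have I: "((\<lambda>r. integral {0..r} (heat_flux \<epsilon> \<xi> \<zeta>)) has_real_derivative heat_flux \<epsilon> \<xi> \<zeta> r) (at r)"
    by (intro integral_has_derivative_interior[of "r + 1"] cont_heat_flux[OF adm_all(1)] continuous_on_subset[OF cont_all(2)]) (use r in auto)
  let ?L = "\<lambda>s. \<kappa> * (s * (\<epsilon> * slope s) + (real d - 2) * ?Q s) + Cv / 2 * (PP s * (s\<^sup>2 * ?Q s))"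
  let ?R = "\<lambda>s. (real d - 2) * \<kappa> * \<epsilon> + (- (1/4) * (PP s * (s\<^sup>2 * (?U s)\<^sup>2)) + s * ?H s
        + (real d - 2) * (\<epsilon>\<^sup>2 * integral {0..s} (heat_flux \<epsilon> \<xi> \<zeta>)))"
  have LR: "?L s = ?R s" if "0 < s" for s
  proof -
    have "?L s = \<epsilon> * (\<kappa> * (s * slope s + (real d - 2) * temp \<zeta> s) + Cv / 2 * (PP s * (s\<^sup>2 * temp \<zeta> s)))"
      unfolding temperature_def by (simp add: algebra_simps)
    also have "\<dots> = ?R s"
      unfolding heat_balance[OF less_imp_le[OF that]] energy_flux_eq[OF that] velocity_eq
      by (simp add: algebra_simps eval_nat_numeral)
    finally show ?thesis .
  qed
  have dL: "(?L has_real_derivative \<kappa> * (1 * (\<epsilon> * slope r) + (\<epsilon> * y) * r + (real d - 2) * (\<epsilon> * slope r))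
      + Cv / 2 * (?Pd * (r\<^sup>2 * ?Q r) + (2 * r * ?Q r + (\<epsilon> * slope r) * r\<^sup>2) * PP r)) (at r)"
    by (intro DERIV_add DERIV_cmult DERIV_mult DERIV_ident y temperature_deriv_at[OF r] density_deriv_at[OF r])
       (auto intro!: derivative_eq_intros)
  have dR: "(?R has_real_derivative 0 + (- (1/4) * (?Pd * (r\<^sup>2 * (?U r)\<^sup>2) + (2 * r * (?U r)\<^sup>2 + (2 * ?U r * ?Ud) * r\<^sup>2) * PP r)
      + (1 * ?H r + Hd * r) + (real d - 2) * (\<epsilon>\<^sup>2 * heat_flux \<epsilon> \<xi> \<zeta> r))) (at r)"
    by (intro DERIV_add DERIV_cmult DERIV_mult DERIV_ident DERIV_const density_deriv_at[OF r] Hd I)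
       (auto intro!: derivative_eq_intros velocity_deriv_at[OF r])
  have "\<kappa> * (1 * (\<epsilon> * slope r) + (\<epsilon> * y) * r + (real d - 2) * (\<epsilon> * slope r))
      + Cv / 2 * (?Pd * (r\<^sup>2 * ?Q r) + (2 * r * ?Q r + (\<epsilon> * slope r) * r\<^sup>2) * PP r)
     = 0 + (- (1/4) * (?Pd * (r\<^sup>2 * (?U r)\<^sup>2) + (2 * r * (?U r)\<^sup>2 + (2 * ?U r * ?Ud) * r\<^sup>2) * PP r)
      + (1 * ?H r + Hd * r) + (real d - 2) * (\<epsilon>\<^sup>2 * heat_flux \<epsilon> \<xi> \<zeta> r))"
    by (rule DERIV_unique[OF has_derivative_cong_on_interval[OF dL, where a = 0 and b = "r + 1"] dR]) (use r LR in auto)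
  then show ?thesis
    unfolding energy_eq_iff[OF r density_deriv_at[OF r] velocity_deriv_at[OF r] temperature_deriv_at[OF r]
        hderiv_velocity_deriv[OF r] hderiv_temperature_deriv[OF r y] Hd]
    using energy_flux_eq[OF r] by (simp add: algebra_simps)
qed

text \<open>The linear bound on the slope is required for \<Theta>' = O(r) at the origin. It does not follow
from \<zeta> being continuous with value 0 there, and is derived from the heat balance in
\<open>slope_near_origin\<close>.\<close>
lemma profile_solution:
  assumes K: "\<And>r. 0 \<le> r \<Longrightarrow> r \<le> 1 \<Longrightarrow> \<bar>slope r\<bar> \<le> K * r"
  shows "profile_solution d R \<mu> lam Cv \<kappa> P0 \<epsilon> PP (velocity \<epsilon> \<xi>) (temperature \<epsilon> \<zeta>)"
  unfolding profile_solution_def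
proof (intro conjI allI impI C1_density C1_velocity C1_temperature mass momentum energy)
  fix r :: real assume r: "0 < r"
  show "hderiv (velocity \<epsilon> \<xi>) differentiable at r"
    using hderiv_velocity_deriv[OF r] real_differentiable_def by blast
  obtain y where y: "(slope has_real_derivative y) (at r)" by (rule slope_deriv[OF r])
  show "hderiv (temperature \<epsilon> \<zeta>) differentiable at r"
    using hderiv_temperature_deriv[OF r y] real_differentiable_def by blast
next
  show "PP 0 = P0" by (simp add: density_def)
  show "temperature \<epsilon> \<zeta> 0 = \<epsilon>" by (simp add: temperature_def temp_def)
  have m: "\<bar>mm r\<bar> \<le> M" "\<bar>\<xi> r\<bar> \<le> M" if "0 \<le> r" for r
  proof -
    have "M * decay \<eta> r ^ 3 \<le> M * 1"
      using M_pos decay_pos[OF eta(1) that] decay_le_one[OF eta(1) that] by (intro mult_left_mono power_le_one) auto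
    then show "\<bar>mm r\<bar> \<le> M" "\<bar>\<xi> r\<bar> \<le> M"
      using mean_bound[OF adm_all(1)[OF that] that order_refl] xi_bound[OF adm_all(1)[OF that] that order_refl] by linarith+
  qed
  have ev: "\<forall>\<^sub>F r in at_right (0::real). 0 < r \<and> r < 1"
    using eventually_at_right_real[of 0 1] by simp
  show "velocity \<epsilon> \<xi> \<in> O[at_right 0](\<lambda>r. r\<^sup>2)"
  proof (rule bigoI[of _ "\<epsilon> * M"])
    show "\<forall>\<^sub>F r in at_right 0. norm (velocity \<epsilon> \<xi> r) \<le> \<epsilon> * M * norm (r\<^sup>2)"
      using ev
    proof eventually_elim
      case (elim r)
      have "\<epsilon> * (r\<^sup>2 * \<bar>mm r\<bar>) \<le> \<epsilon> * (r\<^sup>2 * M)" using m(1)[of r] elim eps by (intro mult_left_mono) auto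
      then show ?case using eps by (simp add: velocity_eq abs_mult mult_ac)
    qed
  qed
  show "hderiv (velocity \<epsilon> \<xi>) \<in> O[at_right 0](\<lambda>r. r)"
  proof (rule bigoI[of _ "\<epsilon> * (real d * M)"])
    show "\<forall>\<^sub>F r in at_right 0. norm (hderiv (velocity \<epsilon> \<xi>) r) \<le> \<epsilon> * (real d * M) * norm r"
      using ev
    proof eventually_elim
      case (elim r)
      have n: "0 \<le> real d - 1" using d_ge by simp
      have "\<bar>\<xi> r - (real d - 1) * mm r\<bar> \<le> \<bar>\<xi> r\<bar> + (real d - 1) * \<bar>mm r\<bar>"
        using abs_triangle_ineq4[of "\<xi> r" "(real d - 1) * mm r"] n by (simp add: abs_mult)
      also have "\<dots> \<le> M + (real d - 1) * M" using m[of r] elim n by (intro add_mono mult_left_mono) auto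
      finally have "\<bar>\<xi> r - (real d - 1) * mm r\<bar> \<le> real d * M" by (simp add: algebra_simps)
      then have "\<epsilon> * (r * \<bar>\<xi> r - (real d - 1) * mm r\<bar>) \<le> \<epsilon> * (r * (real d * M))"
        using elim eps by (intro mult_left_mono) auto
      then show ?case using eps elim by (simp add: hderiv_velocity abs_mult mult_ac)
    qed
  qed
  show "hderiv (temperature \<epsilon> \<zeta>) \<in> O[at_right 0](\<lambda>r. r)"
  proof (rule bigoI[of _ "\<epsilon> * K"])
    show "\<forall>\<^sub>F r in at_right 0. norm (hderiv (temperature \<epsilon> \<zeta>) r) \<le> \<epsilon> * K * norm r"
      using ev
    proof eventually_elim
      case (elim r)
      have "\<epsilon> * \<bar>slope r\<bar> \<le> \<epsilon> * (K * r)" using K[of r] elim eps by (intro mult_left_mono) auto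
      then show ?case using eps elim by (simp add: hderiv_temperature abs_mult mult_ac)
    qed
  qed
qed (assumption+)?

end

end

section \<open>Solutions are fixed points\<close>

text \<open>Up to the first point where g reaches 3M/4 the bound g \<le> M holds, but there the improved bound
g \<le> M/2 contradicts the value 3M/4.\<close>
lemma bootstrap_bound:
  fixes g :: "real \<Rightarrow> real"
  assumes cont: "continuous_on {0..} g" and M: "0 < M" and g0: "g 0 \<le> M / 2"
    and improve: "\<And>t. 0 \<le> t \<Longrightarrow> (\<And>r. 0 \<le> r \<Longrightarrow> r \<le> t \<Longrightarrow> g r \<le> M) \<Longrightarrow> g t \<le> M / 2"
    and b: "0 \<le> b"
  shows "g b \<le> M"
proof (rule ccontr)
  assume bad: "\<not> g b \<le> M"
  have c: "continuous_on {0..t} g" for t by (rule continuous_on_subset[OF cont]) auto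
  define S where "S = {0..b} \<inter> g -` {3 * M / 4}"
  have "closed S" unfolding S_def
    by (rule continuous_closed_preimage[OF c]) auto
  then have "compact S" unfolding S_def by (metis bounded_Int bounded_closed_interval compact_eq_bounded_closed)
  moreover have "S \<noteq> {}"
    using IVT'[of g 0 "3 * M / 4" b] g0 bad M b c unfolding S_def by fastforce
  ultimately obtain t where t: "t \<in> S" "\<And>s. s \<in> S \<Longrightarrow> t \<le> s"
    using compact_attains_inf by metis
  have tb: "0 \<le> t" "t \<le> b" "g t = 3 * M / 4" using t(1) unfolding S_def by auto
  have "g r \<le> M" if r: "0 \<le> r" "r \<le> t" for r
  proof (rule ccontr)
    assume "\<not> g r \<le> M"
    then have "g 0 \<le> 3 * M / 4" "3 * M / 4 \<le> g r" using g0 M by auto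
    from IVT'[OF this r(1) c] obtain s where s: "0 \<le> s" "s \<le> r" "g s = 3 * M / 4" by blast
    then have "t \<le> s" using t(2)[of s] r tb unfolding S_def by auto
    then have "g r = 3 * M / 4" using s r tb by (metis order_antisym order_trans)
    then show False using \<open>\<not> g r \<le> M\<close> M by linarith
  qed
  from improve[OF tb(1) this] show False using tb M by linarith
qed

lemma continuous_on_halfline_extend:
  fixes f :: "real \<Rightarrow> real"
  assumes "\<And>r. 0 < r \<Longrightarrow> isCont f r" and "f 0 = 0"
    and "\<And>e. 0 < e \<Longrightarrow> \<exists>\<rho>>0. \<forall>r. 0 < r \<longrightarrow> r < \<rho> \<longrightarrow> \<bar>f r\<bar> \<le> e"
  shows "continuous_on {0..} f"
  unfolding continuous_on_eq_continuous_within
proof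
  fix r :: real assume "r \<in> {0..}"
  then consider "r = 0" | "0 < r" by fastforce
  then show "continuous (at r within {0..}) f"
  proof cases
    case 1
    show ?thesis
      unfolding 1 continuous_within_eps_delta
    proof (intro allI impI)
      fix e :: real assume e: "0 < e"
      then obtain \<rho> where \<rho>: "\<rho> > 0" "\<forall>r. 0 < r \<longrightarrow> r < \<rho> \<longrightarrow> \<bar>f r\<bar> \<le> e / 2" using assms(3)[of "e / 2"] by auto
      show "\<exists>\<delta>>0. \<forall>x'\<in>{0..}. dist x' 0 < \<delta> \<longrightarrow> dist (f x') (f 0) < e"
      proof (intro exI[of _ \<rho>] conjI ballI impI \<rho>)
        fix x :: real assume x: "x \<in> {0..}" "dist x 0 < \<rho>"
        show "dist (f x) (f 0) < e"
        proof (cases "x = 0")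
          case False
          then have "\<bar>f x\<bar> \<le> e / 2" using x \<rho>(2) by auto
          then show ?thesis using e assms(2) by simp
        qed (use e in simp)
      qed
    qed
  next
    case 2
    then show ?thesis using assms(1) continuous_at_imp_continuous_at_within by blast
  qed
qed

lemma continuous_on_halfline_isCont:
  fixes f :: "real \<Rightarrow> real"
  assumes "continuous_on {0..} f" "0 < r"
  shows "isCont f r"
  using assms by (metis at_within_halfline atLeast_iff continuous_on_eq_continuous_within less_imp_le)

lemma bigo_at_right_0D:
  fixes f g :: "real \<Rightarrow> real"
  assumes "f \<in> O[at_right 0](g)"
  obtains K \<rho> where "0 < K" "0 < \<rho>" "\<And>r. 0 < r \<Longrightarrow> r < \<rho> \<Longrightarrow> \<bar>f r\<bar> \<le> K * \<bar>g r\<bar>"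
proof -
  from landau_o.bigE[OF assms] obtain K where K: "K > 0" "\<forall>\<^sub>F r in at_right 0. norm (f r) \<le> K * norm (g r)"
    by blast
  from K(2) obtain \<rho> where "\<rho> > 0" "\<forall>r>0. r < \<rho> \<longrightarrow> norm (f r) \<le> K * norm (g r)"
    unfolding eventually_at_right_field by auto
  then show thesis using that[OF K(1), of \<rho>] by auto
qed

context based_gas
begin

context
  fixes \<epsilon> :: real and P U \<Theta> :: "real \<Rightarrow> real"
  assumes eps: "0 < \<epsilon>" and sol: "profile_solution d R \<mu> lam Cv \<kappa> P0 \<epsilon> P U \<Theta>"
begin

lemma sol_deriv:
  assumes "0 < r"
  shows "(P has_real_derivative hderiv P r) (at r)" "(U has_real_derivative hderiv U r) (at r)"
    "(\<Theta> has_real_derivative hderiv \<Theta> r) (at r)"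
    "\<exists>y. (hderiv U has_real_derivative y) (at r)" "\<exists>y. (hderiv \<Theta> has_real_derivative y) (at r)"
proof -
  have *: "(f has_real_derivative hderiv f r) (at r)" if "C1_halfline f" for f
  proof -
    have "f differentiable (at r)"
      using that assms at_within_halfline[OF assms] unfolding C1_halfline_def by (metis less_imp_le)
    then obtain y where y: "(f has_real_derivative y) (at r)" by (auto simp: real_differentiable_def)
    then show ?thesis using hderiv_eq[OF assms y] by simp
  qed
  show "(P has_real_derivative hderiv P r) (at r)" "(U has_real_derivative hderiv U r) (at r)"
    "(\<Theta> has_real_derivative hderiv \<Theta> r) (at r)"
    using sol * unfolding profile_solution_def by auto
  show "\<exists>y. (hderiv U has_real_derivative y) (at r)" "\<exists>y. (hderiv \<Theta> has_real_derivative y) (at r)"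
    using sol assms unfolding profile_solution_def by (auto simp: real_differentiable_def)
qed

lemma sol_cont:
  "continuous_on {0..} P" "continuous_on {0..} U" "continuous_on {0..} \<Theta>"
  "continuous_on {0..} (hderiv P)" "continuous_on {0..} (hderiv U)" "continuous_on {0..} (hderiv \<Theta>)"
proof -
  have *: "continuous_on {0..} f" if "C1_halfline f" for f
    using that differentiable_imp_continuous_within unfolding C1_halfline_def
    by (auto simp: continuous_on_eq_continuous_within)
  show "continuous_on {0..} P" "continuous_on {0..} U" "continuous_on {0..} \<Theta>"
    using sol * unfolding profile_solution_def by auto
  show "continuous_on {0..} (hderiv P)" "continuous_on {0..} (hderiv U)" "continuous_on {0..} (hderiv \<Theta>)"
    using sol unfolding profile_solution_def C1_halfline_def by auto
qed

lemma near_origin: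
  obtains K \<rho> where "0 < K" "0 < \<rho>" "\<rho> \<le> 1" "K * \<rho> \<le> 1/4"
    "\<And>r. 0 < r \<Longrightarrow> r < \<rho> \<Longrightarrow> \<bar>U r\<bar> \<le> K * r\<^sup>2" "\<And>r. 0 < r \<Longrightarrow> r < \<rho> \<Longrightarrow> \<bar>hderiv U r\<bar> \<le> K * r"
    "\<And>r. 0 < r \<Longrightarrow> r < \<rho> \<Longrightarrow> \<bar>hderiv \<Theta> r\<bar> \<le> K * r"
    "\<And>r. 0 < r \<Longrightarrow> r < \<rho> \<Longrightarrow> 0 \<le> P r \<and> P r \<le> 2 * P0"
proof -
  have O: "U \<in> O[at_right 0](\<lambda>r. r\<^sup>2)" "hderiv U \<in> O[at_right 0](\<lambda>r. r)" "hderiv \<Theta> \<in> O[at_right 0](\<lambda>r. r)"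
    and P_0: "P 0 = P0"
    using sol unfolding profile_solution_def by auto
  obtain K1 \<rho>1 where 1: "0 < K1" "0 < \<rho>1" "\<And>r. 0 < r \<Longrightarrow> r < \<rho>1 \<Longrightarrow> \<bar>U r\<bar> \<le> K1 * \<bar>r\<^sup>2\<bar>" by (rule bigo_at_right_0D[OF O(1)]) (rule that)
  obtain K2 \<rho>2 where 2: "0 < K2" "0 < \<rho>2" "\<And>r. 0 < r \<Longrightarrow> r < \<rho>2 \<Longrightarrow> \<bar>hderiv U r\<bar> \<le> K2 * \<bar>r\<bar>" by (rule bigo_at_right_0D[OF O(2)]) (rule that)
  obtain K3 \<rho>3 where 3: "0 < K3" "0 < \<rho>3" "\<And>r. 0 < r \<Longrightarrow> r < \<rho>3 \<Longrightarrow> \<bar>hderiv \<Theta> r\<bar> \<le> K3 * \<bar>r\<bar>" by (rule bigo_at_right_0D[OF O(3)]) (rule that)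
  have "continuous (at 0 within {0..}) P" using sol_cont(1) by (auto simp: continuous_on_eq_continuous_within)
  then obtain \<rho>4 where 4: "0 < \<rho>4" "\<And>r. 0 \<le> r \<Longrightarrow> r < \<rho>4 \<Longrightarrow> \<bar>P r - P0\<bar> < P0"
    using P0_pos P_0 unfolding continuous_within_eps_delta dist_real_def by force
  define K where "K = K1 + K2 + K3"
  define \<rho> where "\<rho> = min (min \<rho>1 \<rho>2) (min (min \<rho>3 \<rho>4) (min 1 (1 / (4 * K))))"
  have K: "0 < K" "K1 \<le> K" "K2 \<le> K" "K3 \<le> K" using 1 2 3 unfolding K_def by auto
  have \<rho>: "0 < \<rho>" "\<rho> \<le> \<rho>1" "\<rho> \<le> \<rho>2" "\<rho> \<le> \<rho>3" "\<rho> \<le> \<rho>4" "\<rho> \<le> 1" "\<rho> \<le> 1 / (4 * K)"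
    using 1 2 3 4 K unfolding \<rho>_def by auto
  have "K * \<rho> \<le> K * (1 / (4 * K))" using \<rho>(7) K(1) by (intro mult_left_mono) auto
  then have K\<rho>: "K * \<rho> \<le> 1/4" using K(1) by simp
  show thesis
  proof (rule that[OF K(1) \<rho>(1) \<rho>(6) K\<rho>])
    fix r assume r: "0 < r" "r < \<rho>"
    have "K1 * r\<^sup>2 \<le> K * r\<^sup>2" "K2 * r \<le> K * r" "K3 * r \<le> K * r"
      using K r by (auto intro!: mult_right_mono)
    moreover have "\<bar>U r\<bar> \<le> K1 * r\<^sup>2" "\<bar>hderiv U r\<bar> \<le> K2 * r" "\<bar>hderiv \<Theta> r\<bar> \<le> K3 * r"
      using 1(3)[of r] 2(3)[of r] 3(3)[of r] r \<rho> by auto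
    ultimately show "\<bar>U r\<bar> \<le> K * r\<^sup>2" "\<bar>hderiv U r\<bar> \<le> K * r" "\<bar>hderiv \<Theta> r\<bar> \<le> K * r"
      by linarith+
    show "0 \<le> P r \<and> P r \<le> 2 * P0" using 4(2)[of r] r \<rho> by auto
  qed
qed

lemma limit_at_origin_0:
  fixes f :: "real \<Rightarrow> real"
  assumes "continuous_on {0..} f" and "0 < \<rho>" and "\<And>r. 0 < r \<Longrightarrow> r < \<rho> \<Longrightarrow> \<bar>f r\<bar> \<le> K * r"
  shows "f 0 = 0"
proof -
  have "(f \<longlongrightarrow> f 0) (at_right 0)"
    using assms(1) unfolding continuous_on_def by (auto intro: tendsto_within_subset)
  moreover have "(f \<longlongrightarrow> 0) (at_right 0)"
  proof (rule Lim_null_comparison)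
    show "\<forall>\<^sub>F r in at_right 0. norm (f r) \<le> K * r"
      using eventually_at_right_real[OF assms(2)] by eventually_elim (use assms(3) in auto)
    have "((\<lambda>r. K * r) \<longlongrightarrow> K * 0) (at_right 0)" by (intro tendsto_intros)
    then show "((\<lambda>r. K * r) \<longlongrightarrow> 0) (at_right 0)" by simp
  qed
  ultimately show ?thesis using tendsto_unique trivial_limit_at_right_real by blast
qed

lemma origin_values: "U 0 = 0" "hderiv U 0 = 0" "P 0 = P0" "\<Theta> 0 = \<epsilon>"
proof -
  obtain K \<rho> where K: "0 < K" "0 < \<rho>" "\<rho> \<le> 1"
    "\<And>r. 0 < r \<Longrightarrow> r < \<rho> \<Longrightarrow> \<bar>U r\<bar> \<le> K * r\<^sup>2" "\<And>r. 0 < r \<Longrightarrow> r < \<rho> \<Longrightarrow> \<bar>hderiv U r\<bar> \<le> K * r"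
    by (rule near_origin) (rule that)
  show "hderiv U 0 = 0" by (rule limit_at_origin_0[OF sol_cont(5) K(2) K(5)])
  have "\<bar>U r\<bar> \<le> K * r" if "0 < r" "r < \<rho>" for r
  proof -
    have "K * r\<^sup>2 \<le> K * r" using that K by (intro mult_left_mono) (auto simp: power2_eq_square mult_left_le)
    then show ?thesis using K(4)[OF that] by linarith
  qed
  then show "U 0 = 0" by (rule limit_at_origin_0[OF sol_cont(2) K(2)])
  show "P 0 = P0" "\<Theta> 0 = \<epsilon>" using sol unfolding profile_solution_def by auto
qed

definition divergence :: "real \<Rightarrow> real" where
  "divergence r = hderiv U r + (real d - 1) / r * U r"

lemma cont_U_over_radius: "continuous_on {0..} (\<lambda>r. U r / r)"
proof (rule continuous_on_halfline_extend)
  show "isCont (\<lambda>r. U r / r) r" if "0 < r" for r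
    using continuous_on_halfline_isCont[OF sol_cont(2) that] that by (intro continuous_intros) auto
  obtain K \<rho> where K: "0 < K" "0 < \<rho>" "\<And>r. 0 < r \<Longrightarrow> r < \<rho> \<Longrightarrow> \<bar>U r\<bar> \<le> K * r\<^sup>2"
    by (rule near_origin) (rule that)
  fix e :: real assume e: "0 < e"
  show "\<exists>\<rho>>0. \<forall>r. 0 < r \<longrightarrow> r < \<rho> \<longrightarrow> \<bar>U r / r\<bar> \<le> e"
  proof (intro exI[of _ "min \<rho> (e / K)"] conjI allI impI)
    fix r assume r: "0 < r" "r < min \<rho> (e / K)"
    have "\<bar>U r / r\<bar> \<le> K * r" using K(3)[of r] r by (simp add: divide_le_eq power2_eq_square mult_ac)
    also have "\<dots> \<le> e" using r K(1) by (simp add: field_simps)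
    finally show "\<bar>U r / r\<bar> \<le> e" .
  qed (use K e in auto)
qed simp

lemma cont_divergence: "continuous_on {0..} divergence"
proof -
  have "continuous_on {0..} (\<lambda>r. hderiv U r + (real d - 1) * (U r / r))"
    by (intro continuous_intros sol_cont cont_U_over_radius)
  then show ?thesis unfolding divergence_def[abs_def] by simp
qed

lemma divergence_0: "divergence 0 = 0"
  by (simp add: divergence_def origin_values)

lemma sol_eqs:
  assumes "0 < r"
  shows "mass_eq d P U r" "momentum_eq d R \<mu> lam P U \<Theta> r" "energy_eq d R \<mu> lam Cv \<kappa> P U \<Theta> r"
  using sol assms unfolding profile_solution_def by auto

text \<open>The constant of integration is the value R P(0) \<Theta>(0) at the origin.\<close>
lemma momentum_integrated:
  assumes r: "0 \<le> r"
  shows "\<nu> * divergence r = - (1/2) * (r * (P r * U r)) + P r * (U r)\<^sup>2 + R * (P r * \<Theta> r - P0 * \<epsilon>)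
     + (real d - 1) * integral {0..r} (\<lambda>s. P s * U s * (U s / s))"
proof -
  let ?f = "\<lambda>s. - (1/2) * (s * (P s * U s)) + P s * (U s)\<^sup>2 + R * (P s * \<Theta> s) - \<nu> * divergence s"
  let ?g = "\<lambda>s. - (real d - 1) * (P s * U s * (U s / s))"
  have "(?g has_integral ?f r - ?f 0) {0..r}"
  proof (rule fundamental_theorem_of_calculus_interior[OF r])
    show "continuous_on {0..r} ?f"
      by (intro continuous_intros continuous_on_subset[OF sol_cont(1)] continuous_on_subset[OF sol_cont(2)]
          continuous_on_subset[OF sol_cont(3)] continuous_on_subset[OF cont_divergence]) auto
    fix s assume "s \<in> {0<..<r}"
    then have s: "0 < s" by simp
    note D = sol_deriv[OF s]
    obtain y where y: "(hderiv U has_real_derivative y) (at s)" using D(4) by blast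
    have n: "((\<lambda>s. (real d - 1) / s * U s) has_real_derivative (real d - 1) / s * hderiv U s - (real d - 1) / s\<^sup>2 * U s) (at s)"
      using s by (auto intro!: derivative_eq_intros D simp: power2_eq_square field_simps)
    have "(?f has_real_derivative - (1/2) * (1 * (P s * U s) + (hderiv P s * U s + hderiv U s * P s) * s)
       + (hderiv P s * (U s)\<^sup>2 + (2 * U s * hderiv U s) * P s) + R * (hderiv P s * \<Theta> s + hderiv \<Theta> s * P s)
       - \<nu> * (y + ((real d - 1) / s * hderiv U s - (real d - 1) / s\<^sup>2 * U s))) (at s)"
      unfolding divergence_def
      by (intro DERIV_add DERIV_diff DERIV_cmult DERIV_mult DERIV_ident D n y) (auto intro!: derivative_eq_intros D)
    moreover have "- (1/2) * (1 * (P s * U s) + (hderiv P s * U s + hderiv U s * P s) * s)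
       + (hderiv P s * (U s)\<^sup>2 + (2 * U s * hderiv U s) * P s) + R * (hderiv P s * \<Theta> s + hderiv \<Theta> s * P s)
       - \<nu> * (y + ((real d - 1) / s * hderiv U s - (real d - 1) / s\<^sup>2 * U s)) = - ((real d - 1) / s * P s * (U s)\<^sup>2)"
      using sol_eqs(2)[OF s] unfolding momentum_eq_iff[OF s D(1-3) y] \<nu>_def by (simp add: algebra_simps)
    moreover have "- ((real d - 1) / s * P s * (U s)\<^sup>2) = ?g s"
      using s by (simp add: power2_eq_square field_simps)
    ultimately show "(?f has_vector_derivative ?g s) (at s)"
      by (simp add: has_real_derivative_iff_has_vector_derivative)
  qed
  then have "integral {0..r} ?g = ?f r - ?f 0" by (rule integral_unique)
  moreover have "integral {0..r} ?g = - (real d - 1) * integral {0..r} (\<lambda>s. P s * U s * (U s / s))"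
    by (rule integral_mult_right)
  ultimately have "- (real d - 1) * integral {0..r} (\<lambda>s. P s * U s * (U s / s)) = ?f r - ?f 0" by simp
  then show ?thesis using divergence_0 origin_values by (simp add: algebra_simps)
qed

abbreviation (input) "HH \<equiv> energy_flux d R \<mu> lam Cv P U (hderiv U) \<Theta>"

lemma cont_HH: "continuous_on {0..} HH"
proof -
  have "continuous_on {0..} (\<lambda>s. U s * P s * ((U s)\<^sup>2 / 2 + (Cv + R) * \<Theta> s) - 2 * \<mu> * (U s * hderiv U s) - lam * (U s * divergence s))"
    by (intro continuous_intros sol_cont cont_divergence) auto
  then show ?thesis unfolding energy_flux_def[abs_def] divergence_def by simp
qed

lemma energy_integrated:
  assumes r: "0 \<le> r"
  shows "\<kappa> * (r * hderiv \<Theta> r + (real d - 2) * \<Theta> r) + Cv / 2 * (P r * (r\<^sup>2 * \<Theta> r))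
     = (real d - 2) * \<kappa> * \<epsilon> - (1/4) * (P r * (r\<^sup>2 * (U r)\<^sup>2)) + r * HH r + (real d - 2) * integral {0..r} HH"
proof -
  let ?f = "\<lambda>s. \<kappa> * (s * hderiv \<Theta> s + (real d - 2) * \<Theta> s) + Cv / 2 * (P s * (s\<^sup>2 * \<Theta> s))
     + (1/4) * (P s * (s\<^sup>2 * (U s)\<^sup>2)) - s * HH s"
  have "((\<lambda>s. (real d - 2) * HH s) has_integral ?f r - ?f 0) {0..r}"
  proof (rule fundamental_theorem_of_calculus_interior[OF r])
    show "continuous_on {0..r} ?f"
      by (intro continuous_intros continuous_on_subset[OF sol_cont(1)] continuous_on_subset[OF sol_cont(2)]
          continuous_on_subset[OF sol_cont(3)] continuous_on_subset[OF sol_cont(6)] continuous_on_subset[OF cont_HH]) auto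
    fix s assume "s \<in> {0<..<r}"
    then have s: "0 < s" by simp
    note D = sol_deriv[OF s]
    obtain y where y: "(hderiv U has_real_derivative y) (at s)" using D(4) by blast
    obtain q where q: "(hderiv \<Theta> has_real_derivative q) (at s)" using D(5) by blast
    obtain Hd where Hd: "(HH has_real_derivative Hd) (at s)"
      using energy_flux_has_derivative[OF s D(1) D(2) D(3) y] by blast
    have d1: "((\<lambda>s. s\<^sup>2 * \<Theta> s) has_real_derivative 2 * s * \<Theta> s + hderiv \<Theta> s * s\<^sup>2) (at s)"
      by (auto intro!: derivative_eq_intros D)
    have d2: "((\<lambda>s. s\<^sup>2 * (U s)\<^sup>2) has_real_derivative 2 * s * (U s)\<^sup>2 + (2 * U s * hderiv U s) * s\<^sup>2) (at s)"
      by (auto intro!: derivative_eq_intros D)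
    have "(?f has_real_derivative \<kappa> * ((1 * hderiv \<Theta> s + q * s) + (real d - 2) * hderiv \<Theta> s)
       + Cv / 2 * (hderiv P s * (s\<^sup>2 * \<Theta> s) + (2 * s * \<Theta> s + hderiv \<Theta> s * s\<^sup>2) * P s)
       + (1/4) * (hderiv P s * (s\<^sup>2 * (U s)\<^sup>2) + (2 * s * (U s)\<^sup>2 + (2 * U s * hderiv U s) * s\<^sup>2) * P s)
       - (1 * HH s + Hd * s)) (at s)"
      by (intro DERIV_add DERIV_diff DERIV_cmult DERIV_mult DERIV_ident D q Hd d1 d2)
    moreover have "\<kappa> * ((1 * hderiv \<Theta> s + q * s) + (real d - 2) * hderiv \<Theta> s)
       + Cv / 2 * (hderiv P s * (s\<^sup>2 * \<Theta> s) + (2 * s * \<Theta> s + hderiv \<Theta> s * s\<^sup>2) * P s)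
       + (1/4) * (hderiv P s * (s\<^sup>2 * (U s)\<^sup>2) + (2 * s * (U s)\<^sup>2 + (2 * U s * hderiv U s) * s\<^sup>2) * P s)
       - (1 * HH s + Hd * s) = (real d - 2) * HH s"
      using sol_eqs(3)[OF s] unfolding energy_eq_iff[OF s D(1-3) y q Hd] by (simp add: algebra_simps)
    ultimately show "(?f has_vector_derivative (real d - 2) * HH s) (at s)"
      by (simp add: has_real_derivative_iff_has_vector_derivative)
  qed
  then have "integral {0..r} (\<lambda>s. (real d - 2) * HH s) = ?f r - ?f 0" by (rule integral_unique)
  then have "(real d - 2) * integral {0..r} HH = ?f r - ?f 0" by simp
  then show ?thesis using origin_values by (simp add: algebra_simps)
qed

lemma temperature_near_origin:
  assumes K: "0 \<le> K" and Qd: "\<And>r. 0 < r \<Longrightarrow> r < \<rho> \<Longrightarrow> \<bar>hderiv \<Theta> r\<bar> \<le> K * r" and r: "0 < r" "r < \<rho>"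
  shows "\<bar>\<Theta> r - \<epsilon>\<bar> \<le> K * r\<^sup>2"
proof -
  obtain l z where z: "0 < z" "z < r" "(\<Theta> has_real_derivative l) (at z)" "\<Theta> r - \<Theta> 0 = (r - 0) * l"
    using MVT[of 0 r \<Theta>] r sol_deriv(3) continuous_on_subset[OF sol_cont(3), of "{0..r}"]
    by (auto simp: real_differentiable_def)
  then have l: "l = hderiv \<Theta> z" using DERIV_unique sol_deriv(3) by blast
  have "\<bar>l\<bar> \<le> K * r"
  proof -
    have "K * z \<le> K * r" using z K by (intro mult_left_mono) auto
    then show ?thesis using Qd[of z] z r unfolding l by linarith
  qed
  then have "r * \<bar>l\<bar> \<le> r * (K * r)" using r by (intro mult_left_mono) auto
  then show ?thesis using z(4) r origin_values by (simp add: abs_mult power2_eq_square mult_ac)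
qed

text \<open>Near 0 the solution gives only D = O(r). All terms of the integrated momentum equation are O(r^2)
except for R \<epsilon> (P - P0); and if \<bar>D\<bar> \<le> m r, the mass equation gives
\<bar>P'\<bar> \<le> 8 P0 m, hence \<bar>P - P0\<bar> \<le> 8 P0 m r. For small \<epsilon> this
improves the bound m r to (m/2) r + O(r^2), which is at most (3m/4) r on a smaller interval.
Repetition makes m arbitrarily small.\<close>
lemma divergence_over_radius_small:
  assumes small: "16 * (R * \<epsilon> * P0) \<le> \<nu>" and e: "0 < e"
  shows "\<exists>\<rho>>0. \<forall>r. 0 < r \<longrightarrow> r < \<rho> \<longrightarrow> \<bar>divergence r\<bar> \<le> e * r"
proof -
  obtain K \<rho> where K: "0 < K" and \<rho>: "0 < \<rho>" "\<rho> \<le> 1" "K * \<rho> \<le> 1/4"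
    and U: "\<And>r. 0 < r \<Longrightarrow> r < \<rho> \<Longrightarrow> \<bar>U r\<bar> \<le> K * r\<^sup>2" and Ud: "\<And>r. 0 < r \<Longrightarrow> r < \<rho> \<Longrightarrow> \<bar>hderiv U r\<bar> \<le> K * r"
    and Qd: "\<And>r. 0 < r \<Longrightarrow> r < \<rho> \<Longrightarrow> \<bar>hderiv \<Theta> r\<bar> \<le> K * r"
    and P: "\<And>r. 0 < r \<Longrightarrow> r < \<rho> \<Longrightarrow> 0 \<le> P r \<and> P r \<le> 2 * P0"
    by (rule near_origin) (rule that)
  define L where "L = P0 * K + 2 * P0 * K\<^sup>2 + 2 * R * P0 * K + (real d - 1) * (2 * P0 * K\<^sup>2)"
  have L0: "0 \<le> L" unfolding L_def using K P0_pos R_pos d_ge by simp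
  have Q: "\<bar>\<Theta> r - \<epsilon>\<bar> \<le> K * r\<^sup>2" if r: "0 < r" "r < \<rho>" for r
    by (rule temperature_near_origin[OF less_imp_le[OF K] Qd r])
  have Pdev: "\<bar>P r - P0\<bar> \<le> 8 * P0 * m * r"
    if r: "0 < r" "r < \<rho>" and m: "\<And>s. 0 < s \<Longrightarrow> s \<le> r \<Longrightarrow> \<bar>divergence s\<bar> \<le> m * s" for r m
  proof -
    obtain l z where z: "0 < z" "z < r" "(P has_real_derivative l) (at z)" "P r - P 0 = (r - 0) * l"
      using MVT[of 0 r P] r sol_deriv(1) continuous_on_subset[OF sol_cont(1), of "{0..r}"]
      by (auto simp: real_differentiable_def)
    have zr: "z < \<rho>" using z r by linarith
    have mass: "(z / 2 - U z) * l = P z * divergence z"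
      using sol_eqs(1)[OF z(1)] unfolding mass_eq_iff[OF z(1,3) sol_deriv(2)[OF z(1)]] divergence_def .
    have "K * z\<^sup>2 \<le> z / 4"
    proof -
      have "K * z \<le> K * \<rho>" using K zr by (intro mult_left_mono) auto
      then have "(K * z) * z \<le> 1/4 * z" using \<rho>(3) z by (intro mult_right_mono) auto
      then show ?thesis by (simp add: power2_eq_square mult_ac)
    qed
    then have ge: "z / 4 \<le> z / 2 - U z" using U[OF z(1) zr] by linarith
    have "z / 4 * \<bar>l\<bar> \<le> \<bar>(z / 2 - U z) * l\<bar>"
      unfolding abs_mult using ge z by (intro mult_right_mono) auto
    also have "\<dots> = P z * \<bar>divergence z\<bar>" unfolding mass using P[OF z(1) zr] by (simp add: abs_mult)
    also have "\<dots> \<le> (2 * P0) * (m * z)" using P[OF z(1) zr] m[of z] z P0_pos by (intro mult_mono) auto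
    finally have "z * \<bar>l\<bar> \<le> z * (8 * P0 * m)" by (simp add: algebra_simps)
    then have "\<bar>l\<bar> \<le> 8 * P0 * m" using z by simp
    then have "r * \<bar>l\<bar> \<le> r * (8 * P0 * m)" using r by (intro mult_left_mono) auto
    then show ?thesis using z(4) r origin_values by (simp add: abs_mult mult_ac)
  qed
  have main: "\<nu> * \<bar>divergence r\<bar> \<le> R * \<epsilon> * \<bar>P r - P0\<bar> + L * r\<^sup>2" if r: "0 < r" "r < \<rho>" for r
  proof -
    have r1: "r \<le> 1" using r \<rho> by linarith
    have p: "0 \<le> P r" "P r \<le> 2 * P0" using P[OF r] by auto
    have U1: "(U r)\<^sup>2 \<le> K\<^sup>2 * r\<^sup>2"
    proof -
      have "K * (r * r) \<le> K * (r * 1)" using K r1 r by (intro mult_left_mono) auto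
      then have "\<bar>U r\<bar> \<le> K * r" using U[OF r] by (simp add: power2_eq_square)
      then have "\<bar>U r\<bar>\<^sup>2 \<le> (K * r)\<^sup>2" by (intro power_mono) auto
      then show ?thesis by (simp add: power_mult_distrib)
    qed
    have t1: "\<bar>(1/2) * (r * (P r * U r))\<bar> \<le> P0 * K * r\<^sup>2"
    proof -
      have "\<bar>(1/2) * (r * (P r * U r))\<bar> = (1/2) * (r * (P r * \<bar>U r\<bar>))" using r p by (simp add: abs_mult)
      also have "\<dots> \<le> (1/2) * (1 * ((2 * P0) * (K * r\<^sup>2)))"
        using r r1 p U[OF r] P0_pos K by (intro mult_left_mono mult_mono mult_nonneg_nonneg) auto
      finally show ?thesis by simp
    qed
    have t2: "\<bar>P r * (U r)\<^sup>2\<bar> \<le> 2 * P0 * K\<^sup>2 * r\<^sup>2"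
      using mult_mono[OF p(2) U1] P0_pos p by (simp add: abs_mult mult_ac)
    have t3: "\<bar>R * (P r * \<Theta> r - P0 * \<epsilon>)\<bar> \<le> 2 * R * P0 * K * r\<^sup>2 + R * \<epsilon> * \<bar>P r - P0\<bar>"
    proof -
      have "P r * \<Theta> r - P0 * \<epsilon> = P r * (\<Theta> r - \<epsilon>) + \<epsilon> * (P r - P0)" by (simp add: algebra_simps)
      also have "\<bar>\<dots>\<bar> \<le> P r * \<bar>\<Theta> r - \<epsilon>\<bar> + \<epsilon> * \<bar>P r - P0\<bar>"
        using p eps by (metis abs_mult abs_of_nonneg abs_triangle_ineq less_imp_le)
      also have "\<dots> \<le> 2 * P0 * (K * r\<^sup>2) + \<epsilon> * \<bar>P r - P0\<bar>"
        using mult_mono[OF p(2) Q[OF r]] P0_pos by auto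
      finally have "R * \<bar>P r * \<Theta> r - P0 * \<epsilon>\<bar> \<le> R * (2 * P0 * (K * r\<^sup>2) + \<epsilon> * \<bar>P r - P0\<bar>)"
        using R_pos by (intro mult_left_mono) auto
      moreover have "R * (2 * P0 * (K * r\<^sup>2) + \<epsilon> * \<bar>P r - P0\<bar>) = 2 * R * P0 * K * r\<^sup>2 + R * \<epsilon> * \<bar>P r - P0\<bar>"
        by (simp add: algebra_simps)
      ultimately show ?thesis using R_pos by (simp only: abs_mult abs_of_pos)
    qed
    have t4: "\<bar>integral {0..r} (\<lambda>s. P s * U s * (U s / s))\<bar> \<le> 2 * P0 * K\<^sup>2 * r\<^sup>2"
    proof -
      have "\<bar>integral {0..r} (\<lambda>s. P s * U s * (U s / s))\<bar> \<le> integral {0..r} (\<lambda>s. 2 * P0 * K\<^sup>2 * r)"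
      proof (rule abs_integral_le_const)
        show "(\<lambda>s. P s * U s * (U s / s)) integrable_on {0..r}"
          by (intro integrable_continuous_real continuous_on_mult continuous_on_subset[OF sol_cont(1)]
              continuous_on_subset[OF sol_cont(2)] continuous_on_subset[OF cont_U_over_radius]) auto
        fix s assume s: "s \<in> {0..r}"
        show "\<bar>P s * U s * (U s / s)\<bar> \<le> 2 * P0 * K\<^sup>2 * r"
        proof (cases "s = 0")
          case True
          then show ?thesis using P0_pos r by simp
        next
          case False
          then have s: "0 < s" "s \<le> r" "s < \<rho>" "s \<le> 1" using s r r1 by auto
          have a: "\<bar>U s / s\<bar> \<le> K * s" using U[OF s(1,3)] s by (simp add: divide_le_eq power2_eq_square mult_ac)
          have "s\<^sup>2 \<le> 1" using s by (intro power_le_one) auto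
          then have "K * s\<^sup>2 \<le> K * 1" using K by (intro mult_left_mono) auto
          then have b: "\<bar>U s\<bar> \<le> K" using U[OF s(1,3)] by linarith
          have "\<bar>P s * U s * (U s / s)\<bar> = P s * \<bar>U s\<bar> * \<bar>U s / s\<bar>" using P[OF s(1,3)] by (simp add: abs_mult)
          also have "\<dots> \<le> (2 * P0) * K * (K * s)" using P[OF s(1,3)] a b P0_pos K by (intro mult_mono) auto
          also have "\<dots> \<le> (2 * P0) * K * (K * r)" using s P0_pos K by (intro mult_left_mono) auto
          finally show ?thesis by (simp add: power2_eq_square mult_ac)
        qed
      qed auto
      also have "\<dots> = 2 * P0 * K\<^sup>2 * r\<^sup>2" using r by (simp add: power2_eq_square)
      finally show ?thesis .
    qed
    have dn: "0 \<le> real d - 1" using d_ge by simp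
    have t5: "\<bar>(real d - 1) * integral {0..r} (\<lambda>s. P s * U s * (U s / s))\<bar> \<le> (real d - 1) * (2 * P0 * K\<^sup>2 * r\<^sup>2)"
      using mult_left_mono[OF t4 dn] dn by (simp add: abs_mult)
    have "\<bar>\<nu> * divergence r\<bar> \<le> P0 * K * r\<^sup>2 + 2 * P0 * K\<^sup>2 * r\<^sup>2 + (2 * R * P0 * K * r\<^sup>2 + R * \<epsilon> * \<bar>P r - P0\<bar>)
       + (real d - 1) * (2 * P0 * K\<^sup>2 * r\<^sup>2)"
      unfolding momentum_integrated[OF less_imp_le[OF r(1)]] using t1 t2 t3 t5 by linarith
    also have "\<dots> = R * \<epsilon> * \<bar>P r - P0\<bar> + L * r\<^sup>2" unfolding L_def by (simp add: algebra_simps)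
    finally show ?thesis using nu_pos by (simp add: abs_mult)
  qed
  (* The initial bound D = O(r) that the iteration improves. *)
  define m0 where "m0 = K + (real d - 1) * K + 1"
  have m0: "0 < m0" unfolding m0_def using K d_ge by (intro add_nonneg_pos add_nonneg_nonneg mult_nonneg_nonneg) auto
  have iter: "\<exists>\<rho>'>0. \<rho>' \<le> \<rho> \<and> (\<forall>r. 0 < r \<longrightarrow> r < \<rho>' \<longrightarrow> \<bar>divergence r\<bar> \<le> m0 * (3/4) ^ n * r)" for n
  proof (induction n)
    case 0
    have "\<bar>divergence r\<bar> \<le> m0 * r" if r: "0 < r" "r < \<rho>" for r
    proof -
      have dn: "0 \<le> (real d - 1) / r" using d_ge r by simp
      have "\<bar>(real d - 1) / r * U r\<bar> \<le> (real d - 1) / r * (K * r\<^sup>2)"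
        unfolding abs_mult using dn U[OF r] by (intro mult_mono) auto
      also have "\<dots> = (real d - 1) * K * r" using r by (simp add: power2_eq_square)
      finally have "\<bar>divergence r\<bar> \<le> K * r + (real d - 1) * K * r"
        unfolding divergence_def using Ud[OF r] by linarith
      then show ?thesis using r unfolding m0_def by (simp add: algebra_simps)
    qed
    then show ?case using \<rho>(1) by auto
  next
    case (Suc n)
    then obtain \<rho>' where r': "\<rho>' > 0" "\<rho>' \<le> \<rho>" "\<And>r. 0 < r \<Longrightarrow> r < \<rho>' \<Longrightarrow> \<bar>divergence r\<bar> \<le> m0 * (3/4) ^ n * r" by blast
    define m where "m = m0 * (3/4) ^ n"
    have m: "0 < m" unfolding m_def using m0 by simp
    (* On this interval L r^2 is at most (m/4) \<nu> r. *)
    define \<rho>'' where "\<rho>'' = min \<rho>' (m * \<nu> / (4 * (L + 1)))"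
    have pos: "0 < \<rho>''" unfolding \<rho>''_def using r'(1) m nu_pos L0 by simp
    have "\<bar>divergence r\<bar> \<le> m * (3/4) * r" if r: "0 < r" "r < \<rho>''" for r
    proof -
      have rr: "r < \<rho>'" "r < \<rho>" "r \<le> m * \<nu> / (4 * (L + 1))" using r r'(2) unfolding \<rho>''_def by auto
      have Pd: "\<bar>P r - P0\<bar> \<le> 8 * P0 * m * r"
        by (rule Pdev[OF r(1) rr(2)]) (use r' rr in \<open>auto simp: m_def\<close>)
      have "(L + 1) * r \<le> m * \<nu> / 4" using rr(3) L0 by (simp add: field_simps)
      then have "L * r \<le> m * \<nu> / 4" using r by (simp add: algebra_simps)
      then have q: "L * r * r \<le> m * \<nu> / 4 * r" using r by (intro mult_right_mono) auto
      have "R * \<epsilon> * \<bar>P r - P0\<bar> \<le> R * \<epsilon> * (8 * P0 * m * r)"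
        using Pd R_pos eps by (intro mult_left_mono) auto
      also have "\<dots> = 16 * (R * \<epsilon> * P0) * (m * r / 2)" by simp
      also have "\<dots> \<le> \<nu> * (m * r / 2)" using small m r by (intro mult_right_mono) auto
      finally have "\<nu> * \<bar>divergence r\<bar> \<le> \<nu> * (m * r / 2) + m * \<nu> / 4 * r"
        using main[OF r(1) rr(2)] q by (simp add: power2_eq_square mult_ac)
      also have "\<dots> = \<nu> * (m * (3/4) * r)" by (simp add: algebra_simps)
      finally show ?thesis using nu_pos by simp
    qed
    then show ?case using pos r'(2) unfolding m_def
      by (intro exI[of _ \<rho>'']) (auto simp: \<rho>''_def mult_ac)
  qed
  have "(\<lambda>n. m0 * (3/4) ^ n) \<longlonglongrightarrow> m0 * 0"
    by (intro tendsto_intros LIMSEQ_power_zero) auto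
  then have "\<forall>\<^sub>F n in sequentially. m0 * (3/4) ^ n < e"
    using order_tendstoD(2)[of _ 0 sequentially e] e by simp
  then obtain n where n: "m0 * (3/4) ^ n < e" using eventually_happens by force
  obtain \<rho>' where r': "\<rho>' > 0" "\<forall>r. 0 < r \<longrightarrow> r < \<rho>' \<longrightarrow> \<bar>divergence r\<bar> \<le> m0 * (3/4) ^ n * r"
    using iter[of n] by blast
  show ?thesis
  proof (intro exI[of _ \<rho>'] conjI allI impI r')
    fix r assume r: "0 < r" "r < \<rho>'"
    then have "m0 * (3/4) ^ n * r \<le> e * r" using n by (intro mult_right_mono) auto
    moreover have "\<bar>divergence r\<bar> \<le> m0 * (3/4) ^ n * r" using r'(2) r by blast
    ultimately show "\<bar>divergence r\<bar> \<le> e * r" by linarith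
  qed
qed

definition xi_of :: "real \<Rightarrow> real" where
  "xi_of r = divergence r / (\<epsilon> * r)"

definition zeta_of :: "real \<Rightarrow> real" where
  "zeta_of r = (\<Theta> r / \<epsilon> - 1 / (1 + r\<^sup>2)) / r"

lemma cont_zeta_of: "continuous_on {0..} zeta_of"
proof (rule continuous_on_halfline_extend)
  have nz: "1 + r\<^sup>2 \<noteq> 0" for r :: real by (smt (verit) zero_le_power2)
  show "isCont zeta_of r" if "0 < r" for r
    unfolding zeta_of_def[abs_def] using continuous_on_halfline_isCont[OF sol_cont(3) that] that eps nz
    by (intro continuous_intros) auto
  obtain K \<rho> where K: "0 < K" and \<rho>: "0 < \<rho>" and Qd: "\<And>r. 0 < r \<Longrightarrow> r < \<rho> \<Longrightarrow> \<bar>hderiv \<Theta> r\<bar> \<le> K * r"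
    by (rule near_origin) (rule that)
  fix e :: real assume e: "0 < e"
  define C where "C = K / \<epsilon> + 1"
  have C: "0 < C" unfolding C_def using K eps by (intro add_pos_pos divide_pos_pos) auto
  show "\<exists>\<rho>>0. \<forall>r. 0 < r \<longrightarrow> r < \<rho> \<longrightarrow> \<bar>zeta_of r\<bar> \<le> e"
  proof (intro exI[of _ "min \<rho> (e / C)"] conjI allI impI)
    fix r assume r: "0 < r" "r < min \<rho> (e / C)"
    have Q: "\<bar>\<Theta> r - \<epsilon>\<bar> \<le> K * r\<^sup>2" by (rule temperature_near_origin[OF less_imp_le[OF K] Qd]) (use r in auto)
    have eq: "\<Theta> r / \<epsilon> - 1 / (1 + r\<^sup>2) = (\<Theta> r - \<epsilon>) / \<epsilon> + (1 - 1 / (1 + r\<^sup>2))"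
      using eps by (simp add: diff_divide_distrib)
    have "\<bar>(\<Theta> r - \<epsilon>) / \<epsilon>\<bar> \<le> K / \<epsilon> * r\<^sup>2"
      using Q eps by (simp add: divide_right_mono)
    moreover have "\<bar>1 - 1 / (1 + r\<^sup>2)\<bar> \<le> r\<^sup>2"
    proof -
      have "1 - 1 / (1 + r\<^sup>2) = r\<^sup>2 / (1 + r\<^sup>2)" using nz[of r] by (simp add: field_simps)
      also have "\<dots> \<le> r\<^sup>2" by (simp add: divide_le_eq add_pos_nonneg) (simp add: algebra_simps)
      finally show ?thesis by (simp add: add_pos_nonneg)
    qed
    ultimately have "\<bar>\<Theta> r / \<epsilon> - 1 / (1 + r\<^sup>2)\<bar> \<le> K / \<epsilon> * r\<^sup>2 + r\<^sup>2"
      unfolding eq by (rule order_trans[OF abs_triangle_ineq add_mono])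
    then have "\<bar>\<Theta> r / \<epsilon> - 1 / (1 + r\<^sup>2)\<bar> \<le> C * r\<^sup>2" unfolding C_def by (simp add: distrib_right)
    then have "\<bar>zeta_of r\<bar> \<le> C * r" using r unfolding zeta_of_def by (simp add: divide_le_eq power2_eq_square mult_ac)
    also have "\<dots> \<le> e" using r C by (simp add: field_simps)
    finally show "\<bar>zeta_of r\<bar> \<le> e" .
  qed (use \<rho> C e in auto)
qed (simp add: zeta_of_def)

lemma cont_xi_of:
  assumes "16 * (R * \<epsilon> * P0) \<le> \<nu>"
  shows "continuous_on {0..} xi_of"
proof (rule continuous_on_halfline_extend)
  show "isCont xi_of r" if "0 < r" for r
    unfolding xi_of_def[abs_def] using continuous_on_halfline_isCont[OF cont_divergence that] that eps
    by (intro continuous_intros) auto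
  fix e :: real assume e: "0 < e"
  then have "0 < \<epsilon> * e" using eps by simp
  from divergence_over_radius_small[OF assms this] obtain \<rho> where \<rho>: "0 < \<rho>" "\<forall>r. 0 < r \<longrightarrow> r < \<rho> \<longrightarrow> \<bar>divergence r\<bar> \<le> \<epsilon> * e * r" by blast
  show "\<exists>\<rho>>0. \<forall>r. 0 < r \<longrightarrow> r < \<rho> \<longrightarrow> \<bar>xi_of r\<bar> \<le> e"
  proof (intro exI[of _ \<rho>] conjI allI impI \<rho>(1))
    fix r assume r: "0 < r" "r < \<rho>"
    then have "\<bar>divergence r\<bar> \<le> \<epsilon> * e * r" using \<rho>(2) by blast
    then show "\<bar>xi_of r\<bar> \<le> e" using r eps by (simp add: xi_of_def abs_mult divide_le_eq mult_ac)
  qed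
qed (simp add: xi_of_def)

lemma divergence_eq: "0 \<le> r \<Longrightarrow> divergence r = \<epsilon> * (r * xi_of r)"
  using eps by (cases "r = 0") (auto simp: xi_of_def divergence_0)

lemma Theta_eq: "0 \<le> r \<Longrightarrow> \<Theta> r = \<epsilon> * temp zeta_of r"
  using eps origin_values by (cases "r = 0") (auto simp: zeta_of_def temp_def)

text \<open>The definition of the divergence, integrated: (r^(d-1) U)' = r^(d-1) D.\<close>
lemma U_eq:
  assumes "continuous_on {0..} xi_of" "0 \<le> r"
  shows "U r = \<epsilon> * (r\<^sup>2 * mean d xi_of r)"
proof (cases "r = 0")
  case False
  then have r: "0 < r" using assms by simp
  have "d = (d - 2) + 2" using d_ge by simp
  then obtain m where m: "d = m + 2" by blast
  have "((\<lambda>s. s ^ d * xi_of s) has_integral r ^ Suc m * U r / \<epsilon> - 0 ^ Suc m * U 0 / \<epsilon>) {0..r}"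
  proof (rule fundamental_theorem_of_calculus_interior[OF assms(2)])
    show "continuous_on {0..r} (\<lambda>s. s ^ Suc m * U s / \<epsilon>)"
      using eps by (intro continuous_intros continuous_on_subset[OF sol_cont(2)]) auto
    fix s assume "s \<in> {0<..<r}"
    then have s: "0 < s" by simp
    have "((\<lambda>s. s ^ Suc m * U s / \<epsilon>) has_real_derivative (real (Suc m) * s ^ m * U s + hderiv U s * s ^ Suc m) / \<epsilon>) (at s)"
      using eps by (auto intro!: derivative_eq_intros sol_deriv(2)[OF s] simp del: power_Suc)
    moreover have "(real (Suc m) * s ^ m * U s + hderiv U s * s ^ Suc m) / \<epsilon> = s ^ d * xi_of s"
    proof -
      have "s ^ d = s * (s * s ^ m)" "real d - 1 = real (Suc m)" by (simp_all add: m)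
      then show ?thesis unfolding xi_of_def divergence_def using s eps by (simp add: field_simps)
    qed
    ultimately show "((\<lambda>s. s ^ Suc m * U s / \<epsilon>) has_vector_derivative s ^ d * xi_of s) (at s)"
      by (simp add: has_real_derivative_iff_has_vector_derivative)
  qed
  then have "integral {0..r} (\<lambda>s. s ^ d * xi_of s) = r ^ Suc m * U r / \<epsilon>" by (simp add: integral_unique)
  then show ?thesis unfolding mean_def using r eps m by (simp add: field_simps power2_eq_square)
qed (simp add: origin_values)

context
  fixes T :: real
  assumes adm_of: "admissible \<eta> M \<epsilon> T xi_of" "admissible \<eta> M \<epsilon> T zeta_of" and cont_xi: "continuous_on {0..} xi_of"
    and T_nonneg: "0 \<le> T"
begin

text \<open>The mass equation says that P and \<open>density \<epsilon> xi_of\<close> have the same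
logarithmic derivative.\<close>
lemma P_eq:
  assumes r: "0 \<le> r" "r \<le> T"
  shows "P r = density \<epsilon> xi_of r"
proof -
  let ?f = "\<lambda>s. P s / density \<epsilon> xi_of s"
  have pos: "density \<epsilon> xi_of s \<noteq> 0" for s using P0_pos by (simp add: density_def)
  have "?f r = ?f 0"
  proof (cases "r = 0")
    case False
    show ?thesis
    proof (rule DERIV_isconst_end[of 0 r ?f])
      show "0 < r" using r False by simp
      show "continuous_on {0..r} ?f"
        using r by (intro continuous_on_divide continuous_on_subset[OF sol_cont(1)] continuous_on_subset[OF cont_density[OF adm_of(1)]] ballI pos) auto
      fix s assume s: "0 < s" "s < r"
      let ?p = "density \<epsilon> xi_of s"
      have den: "1/4 \<le> 1/2 - \<epsilon> * (s * mean d xi_of s)"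
        by (rule denominator_ge[OF adm_of(1)]) (use s r in auto)
      have "(s / 2 - U s) * hderiv P s = P s * divergence s"
        using sol_eqs(1)[OF s(1)] unfolding mass_eq_iff[OF s(1) sol_deriv(1,2)[OF s(1)]] divergence_def .
      then have "s * ((1/2 - \<epsilon> * (s * mean d xi_of s)) * hderiv P s) = s * (P s * (\<epsilon> * xi_of s))"
        using s by (simp add: U_eq[OF cont_xi] divergence_eq algebra_simps power2_eq_square)
      then have "(1/2 - \<epsilon> * (s * mean d xi_of s)) * hderiv P s = P s * (\<epsilon> * xi_of s)" using s by simp
      then have h: "hderiv P s = P s * (\<epsilon> * rate \<epsilon> xi_of s)"
        unfolding rate_def using den by (simp add: field_simps)
      have "(?f has_real_derivative (hderiv P s * ?p - P s * (\<epsilon> * (?p * rate \<epsilon> xi_of s))) / (?p * ?p)) (at s)"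
        by (intro DERIV_divide sol_deriv(1) density_has_derivative[OF adm_of(1)] pos) (use s r in auto)
      then show "(?f has_real_derivative 0) (at s)"
        by (rule DERIV_cong) (simp add: h)
    qed
  qed simp
  then show ?thesis using pos[of r] pos[of 0] origin_values density_0[OF adm_of(1)] P0_pos by (simp add: field_simps)
qed

text \<open>The integrated momentum equation is the equation \<xi> = \<open>div_new\<close>, and the
integrated energy equation, divided by \<kappa> \<epsilon> r, is the equation for \<zeta>.\<close>
lemma fixed_profile_of: "fixed_profile \<epsilon> T xi_of zeta_of"
proof -
  let ?m = "mean d xi_of" and ?P = "density \<epsilon> xi_of"
  have UU: "U s = \<epsilon> * (s\<^sup>2 * ?m s)" if "0 \<le> s" for s by (rule U_eq[OF cont_xi that])
  have xi: "xi_of r = div_new \<epsilon> xi_of zeta_of ?m r" if r: "0 \<le> r" "r \<le> T" for r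
  proof (cases "r = 0")
    case True
    then show ?thesis using div_new_0[OF adm_of(1)] by (simp add: xi_of_def)
  next
    case False
    then have r0: "0 < r" using r by simp
    have I: "integral {0..r} (\<lambda>s. P s * U s * (U s / s)) = \<epsilon>\<^sup>2 * integral {0..r} (\<lambda>s. ?P s * (s ^ 3 * (?m s)\<^sup>2))"
    proof -
      have "integral {0..r} (\<lambda>s. P s * U s * (U s / s)) = integral {0..r} (\<lambda>s. \<epsilon>\<^sup>2 * (?P s * (s ^ 3 * (?m s)\<^sup>2)))"
      proof (rule integral_cong)
        fix s assume s: "s \<in> {0..r}"
        then show "P s * U s * (U s / s) = \<epsilon>\<^sup>2 * (?P s * (s ^ 3 * (?m s)\<^sup>2))"
          using r by (cases "s = 0") (auto simp: UU P_eq eval_nat_numeral)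
      qed
      then show ?thesis by simp
    qed
    define G where "G = \<epsilon> * (?P r * (r ^ 3 * (?m r)\<^sup>2)) * r + R * (?P r * temp zeta_of r - P0)
       + (real d - 1) * \<epsilon> * integral {0..r} (\<lambda>s. ?P s * (s ^ 3 * (?m s)\<^sup>2))"
    have G: "force \<epsilon> xi_of zeta_of r = G / r"
      unfolding G_def force_def using r0 by (simp add: field_simps)
    have "\<nu> * divergence r = - (1/2) * (r * (?P r * U r)) + ?P r * (U r)\<^sup>2 + R * (?P r * \<Theta> r - P0 * \<epsilon>)
       + (real d - 1) * (\<epsilon>\<^sup>2 * integral {0..r} (\<lambda>s. ?P s * (s ^ 3 * (?m s)\<^sup>2)))"
      using momentum_integrated[OF r(1)] unfolding I P_eq[OF r] .
    then have "\<epsilon> * (\<nu> * (r * xi_of r)) = \<epsilon> * (G - (1/2) * (r * (?P r * (r\<^sup>2 * ?m r))))"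
      unfolding G_def UU[OF r(1)] Theta_eq[OF r(1)] divergence_eq[OF r(1)] by (simp add: algebra_simps eval_nat_numeral)
    then have "\<nu> * (r * xi_of r) = G - (1/2) * (r * (?P r * (r\<^sup>2 * ?m r)))" using eps by simp
    then have "\<nu> * xi_of r = G / r - ?P r * (r\<^sup>2 * ?m r) / 2" using r0 by (simp add: field_simps)
    then show ?thesis unfolding div_new_def G using nu_pos by (simp add: field_simps)
  qed
  have flux: "HH s = \<epsilon>\<^sup>2 * heat_flux \<epsilon> xi_of zeta_of s" if s: "0 \<le> s" "s \<le> T" for s
  proof (cases "s = 0")
    case True
    then show ?thesis by (simp add: energy_flux_def heat_flux_def origin_values)
  next
    case False
    have D: "hderiv U s + (real d - 1) / s * U s = \<epsilon> * (s * xi_of s)"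
      using divergence_eq[OF s(1)] by (simp add: divergence_def)
    have "(real d - 1) / s * U s = (real d - 1) * \<epsilon> * (s * ?m s)"
      using False s by (simp add: UU power2_eq_square)
    then have Ud: "hderiv U s = \<epsilon> * (s * (xi_of s - (real d - 1) * ?m s))"
      using D by (simp add: algebra_simps)
    show ?thesis unfolding energy_flux_def D
      unfolding Ud UU[OF s(1)] P_eq[OF s] Theta_eq[OF s(1)] heat_flux_def work_def
      by (simp add: algebra_simps eval_nat_numeral)
  qed
  have zder: "(zeta_of has_real_derivative (heat_rhs \<epsilon> xi_of zeta_of r - (real d - 1) * zeta_of r
          - Cv / (2 * \<kappa>) * ?P r * r\<^sup>2 * zeta_of r) / r) (at r)" if r: "0 < r" "r < T" for r
  proof -
    have r': "0 \<le> r" "r \<le> T" using r by auto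
    define q where "q = 1 / (1 + r\<^sup>2)"
    have nz: "1 + r\<^sup>2 \<noteq> 0" by (smt (verit) zero_le_power2)
    have q: "r\<^sup>2 * q = 1 - q" unfolding q_def using nz by (simp add: field_simps)
    have qq: "r / (1 + r\<^sup>2)\<^sup>2 = r * q\<^sup>2" "r / (1 + r\<^sup>2) = r * q" "(real d - 2) * r / (1 + r\<^sup>2) = (real d - 2) * (r * q)"
      "2 * r / (1 + r\<^sup>2)\<^sup>2 = 2 * (r * q\<^sup>2)"
      unfolding q_def by (auto simp: power_divide)
    define z where "z = zeta_of r"
    define Q' where "Q' = hderiv \<Theta> r / \<epsilon>"
    have z: "\<Theta> r / \<epsilon> = q + r * z" using Theta_eq[OF r'(1)] eps by (simp add: temp_def q_def z_def)
    have d1: "((\<lambda>r::real. 1 / (1 + r\<^sup>2)) has_real_derivative - 2 * (r * q\<^sup>2)) (at r)"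
      unfolding q_def using nz by (auto intro!: derivative_eq_intros simp: power2_eq_square)
    have "(zeta_of has_real_derivative ((Q' - - 2 * (r * q\<^sup>2)) * r - (\<Theta> r / \<epsilon> - 1 / (1 + r\<^sup>2)) * 1) / (r * r)) (at r)"
      unfolding zeta_of_def[abs_def] Q'_def
      by (intro DERIV_divide DERIV_diff DERIV_cdivide sol_deriv(3) d1 DERIV_ident) (use r in auto)
    moreover have "((Q' - - 2 * (r * q\<^sup>2)) * r - (\<Theta> r / \<epsilon> - 1 / (1 + r\<^sup>2)) * 1) / (r * r) = (Q' + 2 * (r * q\<^sup>2) - z) / r"
      unfolding z q_def[symmetric] using r by (simp add: field_simps)
    ultimately have der: "(zeta_of has_real_derivative (Q' + 2 * (r * q\<^sup>2) - z) / r) (at r)" by simp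
    define hs where "hs = heat_source \<epsilon> xi_of zeta_of r"
    have hs: "r * hs = - (1/4) * (?P r * (r ^ 6 * (?m r)\<^sup>2)) + r * heat_flux \<epsilon> xi_of zeta_of r
        + (real d - 2) * integral {0..r} (heat_flux \<epsilon> xi_of zeta_of)"
      unfolding hs_def heat_source_def using r by (simp add: field_simps eval_nat_numeral)
    have I: "integral {0..r} HH = \<epsilon>\<^sup>2 * integral {0..r} (heat_flux \<epsilon> xi_of zeta_of)"
    proof -
      have "integral {0..r} HH = integral {0..r} (\<lambda>s. \<epsilon>\<^sup>2 * heat_flux \<epsilon> xi_of zeta_of s)"
        using r by (intro integral_cong flux) auto
      then show ?thesis by simp
    qed
    have "\<kappa> * (r * hderiv \<Theta> r + (real d - 2) * \<Theta> r) + Cv / 2 * (?P r * (r\<^sup>2 * \<Theta> r))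
       = (real d - 2) * \<kappa> * \<epsilon> + \<epsilon>\<^sup>2 * (r * hs)"
      using energy_integrated[OF r'(1)] unfolding I flux[OF r'] P_eq[OF r'] UU[OF r'(1)] hs
      by (simp add: algebra_simps eval_nat_numeral)
    moreover have "hderiv \<Theta> r = \<epsilon> * Q'" "\<Theta> r = \<epsilon> * (q + r * z)" using eps z unfolding Q'_def by (auto simp: field_simps)
    ultimately have "\<epsilon> * (\<kappa> * (r * Q' + (real d - 2) * (q + r * z)) + Cv / 2 * (?P r * (r\<^sup>2 * (q + r * z))))
       = \<epsilon> * ((real d - 2) * \<kappa> + \<epsilon> * (r * hs))"
      by (simp add: algebra_simps power2_eq_square)
    then have bal: "\<kappa> * (r * Q' + (real d - 2) * (q + r * z)) + Cv / 2 * (?P r * (r\<^sup>2 * (q + r * z)))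
       = (real d - 2) * \<kappa> * (q + r\<^sup>2 * q) + \<epsilon> * (r * hs)" using eps unfolding q by simp
    define c where "c = Cv / (2 * \<kappa>)"
    define e where "e = \<epsilon> / \<kappa>"
    have ce: "Cv / 2 = \<kappa> * c" "\<epsilon> * (r * hs) = \<kappa> * (e * (r * hs))" unfolding c_def e_def using kappa_pos by auto
    have "\<kappa> * (r * Q' + (real d - 2) * (q + r * z) + c * (?P r * (r\<^sup>2 * (q + r * z))))
       = \<kappa> * ((real d - 2) * (q + r\<^sup>2 * q) + e * (r * hs))" using bal unfolding ce by (simp only: distrib_left mult_ac)
    then have "r * Q' + (real d - 2) * (q + r * z) + c * (?P r * (r\<^sup>2 * (q + r * z))) = (real d - 2) * (q + r\<^sup>2 * q) + e * (r * hs)"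
      using kappa_pos by simp
    then have "r * (Q' + 2 * (r * q\<^sup>2) - z) = r * (heat_rhs \<epsilon> xi_of zeta_of r - (real d - 1) * z - c * ?P r * r\<^sup>2 * z)"
      unfolding heat_rhs_def hs_def[symmetric] qq c_def[symmetric] e_def[symmetric] by (simp add: algebra_simps power2_eq_square)
    then have "Q' + 2 * (r * q\<^sup>2) - z = heat_rhs \<epsilon> xi_of zeta_of r - (real d - 1) * z - Cv / (2 * \<kappa>) * ?P r * r\<^sup>2 * z"
      using r unfolding c_def by simp
    then show ?thesis using der unfolding z_def by simp
  qed
  have mder: "(?m has_real_derivative (force \<epsilon> xi_of zeta_of r / \<nu> - (real d + 1) * ?m r - ?P r / (2 * \<nu>) * r\<^sup>2 * ?m r) / r) (at r)"
    if r: "0 < r" "r < T" for r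
    by (rule DERIV_cong[OF mean_has_derivative[OF _ r]])
       (use xi[of r] r in \<open>auto simp: div_new_def diff_divide_distrib intro: continuous_on_subset[OF cont_xi]\<close>)
  show ?thesis
    unfolding fixed_profile_def picard_step_def
    using xi zder mder cont_mean[OF adm_of(1)] continuous_on_subset[OF cont_zeta_of, of "{0..T}"]
    by (auto simp: zeta_of_def)
qed

end

text \<open>The bound M in the definition of \<open>admissible\<close> is obtained by continuation: the
bootstrap function g is the smallest weighted bound at a single radius.\<close>
lemma sol_is_fixed_profile:
  assumes small: "16 * (R * \<epsilon> * P0) \<le> \<nu>" "\<epsilon> * M \<le> \<eta> / 8"
    and improve: "\<And>T \<xi> \<zeta> r. admissible \<eta> M \<epsilon> T \<xi> \<Longrightarrow> admissible \<eta> M \<epsilon> T \<zeta> \<Longrightarrow> fixed_profile \<epsilon> T \<xi> \<zeta> \<Longrightarrow>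
       0 \<le> r \<Longrightarrow> r \<le> T \<Longrightarrow> \<bar>\<xi> r\<bar> \<le> M / 2 * decay \<eta> r ^ 3 \<and> \<bar>\<zeta> r\<bar> \<le> M / 2 * decay \<eta> r ^ 3"
    and T: "0 \<le> T"
  shows "admissible \<eta> M \<epsilon> T xi_of" "admissible \<eta> M \<epsilon> T zeta_of" "fixed_profile \<epsilon> T xi_of zeta_of"
proof -
  (* The weighted size of both unknowns; it is continuous and vanishes at 0. *)
  define g where "g r = max \<bar>xi_of r\<bar> \<bar>zeta_of r\<bar> / decay \<eta> r ^ 3" for r
  have \<sigma>: "0 < decay \<eta> r ^ 3" if "0 \<le> r" for r using decay_pos[OF eta(1) that] by simp
  have c: "continuous_on {0..} xi_of" "continuous_on {0..} zeta_of"
    using cont_xi_of[OF small(1)] cont_zeta_of by auto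
  have adm_g: "admissible \<eta> M \<epsilon> t xi_of" "admissible \<eta> M \<epsilon> t zeta_of" if t: "\<And>r. 0 \<le> r \<Longrightarrow> r \<le> t \<Longrightarrow> g r \<le> M" for t
  proof -
    have "\<bar>xi_of r\<bar> \<le> M * decay \<eta> r ^ 3" "\<bar>zeta_of r\<bar> \<le> M * decay \<eta> r ^ 3" if "0 \<le> r" "r \<le> t" for r
      using t[OF that] \<sigma>[OF that(1)] unfolding g_def by (auto simp: divide_le_eq)
    then show "admissible \<eta> M \<epsilon> t xi_of" "admissible \<eta> M \<epsilon> t zeta_of"
      using eta(1) M_pos eps small(2) c continuous_on_subset[OF c(1), of "{0..t}"] continuous_on_subset[OF c(2), of "{0..t}"]
      by (auto simp: admissible_def xi_of_def zeta_of_def)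
  qed
  have bound: "g r \<le> M" if r: "0 \<le> r" for r
  proof (rule bootstrap_bound[OF _ M_pos _ _ r])
    show "continuous_on {0..} g"
      unfolding g_def using \<sigma>
      by (intro continuous_on_divide continuous_on_max continuous_on_rabs c continuous_on_power continuous_on_decay eta(1)) (auto simp: less_le)
    show "g 0 \<le> M / 2" using M_pos by (simp add: g_def xi_of_def zeta_of_def)
    show "g t \<le> M / 2" if t: "0 \<le> t" "\<And>r. 0 \<le> r \<Longrightarrow> r \<le> t \<Longrightarrow> g r \<le> M" for t
      using improve[OF adm_g[OF t(2)] fixed_profile_of[OF adm_g[OF t(2)] c(1) t(1)] t(1) order_refl] \<sigma>[OF t(1)]
      unfolding g_def by (auto simp: divide_le_eq)
  qed
  show "admissible \<eta> M \<epsilon> T xi_of" "admissible \<eta> M \<epsilon> T zeta_of" using adm_g bound by auto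
  then show "fixed_profile \<epsilon> T xi_of zeta_of" by (rule fixed_profile_of[OF _ _ c(1) T])
qed

end

lemma density_cong:
  assumes "\<And>s. 0 \<le> s \<Longrightarrow> s \<le> r \<Longrightarrow> \<xi>' s = \<xi> s"
  shows "density \<epsilon> \<xi>' r = density \<epsilon> \<xi> r"
proof -
  have "integral {0..r} (rate \<epsilon> \<xi>') = integral {0..r} (rate \<epsilon> \<xi>)"
    using assms mean_cong[of _ \<xi>' \<xi> d] by (intro integral_cong) (auto simp: rate_def)
  then show ?thesis by (simp add: density_def)
qed

lemma profile_solution_unique:
  assumes eps: "0 < \<epsilon>" and small: "16 * (R * \<epsilon> * P0) \<le> \<nu>" "\<epsilon> * M \<le> \<eta> / 8"
    and sol: "profile_solution d R \<mu> lam Cv \<kappa> P0 \<epsilon> P U \<Theta>"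
    and improve: "\<And>T \<xi> \<zeta> r. admissible \<eta> M \<epsilon> T \<xi> \<Longrightarrow> admissible \<eta> M \<epsilon> T \<zeta> \<Longrightarrow> fixed_profile \<epsilon> T \<xi> \<zeta> \<Longrightarrow>
       0 \<le> r \<Longrightarrow> r \<le> T \<Longrightarrow> \<bar>\<xi> r\<bar> \<le> M / 2 * decay \<eta> r ^ 3 \<and> \<bar>\<zeta> r\<bar> \<le> M / 2 * decay \<eta> r ^ 3"
    and unique: "\<And>T \<xi> \<zeta> \<xi>' \<zeta>' r. admissible \<eta> M \<epsilon> T \<xi> \<Longrightarrow> admissible \<eta> M \<epsilon> T \<zeta> \<Longrightarrow> fixed_profile \<epsilon> T \<xi> \<zeta> \<Longrightarrow>
       admissible \<eta> M \<epsilon> T \<xi>' \<Longrightarrow> admissible \<eta> M \<epsilon> T \<zeta>' \<Longrightarrow> fixed_profile \<epsilon> T \<xi>' \<zeta>' \<Longrightarrow>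
       0 \<le> r \<Longrightarrow> r \<le> T \<Longrightarrow> \<xi>' r = \<xi> r \<and> \<zeta>' r = \<zeta> r"
    and fixed: "\<And>T. 0 \<le> T \<Longrightarrow> admissible \<eta> M \<epsilon> T \<xi>" "\<And>T. 0 \<le> T \<Longrightarrow> admissible \<eta> M \<epsilon> T \<zeta>"
      "\<And>T. 0 \<le> T \<Longrightarrow> fixed_profile \<epsilon> T \<xi> \<zeta>"
    and r: "0 \<le> r"
  shows "P r = density \<epsilon> \<xi> r \<and> U r = velocity \<epsilon> \<xi> r \<and> \<Theta> r = temperature \<epsilon> \<zeta> r"
proof -
  let ?x = "xi_of \<epsilon> U" and ?y = "zeta_of \<epsilon> \<Theta>"
  have fp: "admissible \<eta> M \<epsilon> T ?x" "admissible \<eta> M \<epsilon> T ?y" "fixed_profile \<epsilon> T ?x ?y" if "0 \<le> T" for T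
    by (rule sol_is_fixed_profile[OF eps sol small _ that], rule improve, assumption+)+
  have eq: "?x s = \<xi> s" "?y s = \<zeta> s" if "0 \<le> s" for s
    using unique[OF fixed(1)[OF that] fixed(2)[OF that] fixed(3)[OF that] fp(1)[OF that] fp(2)[OF that] fp(3)[OF that] that order_refl]
    by blast+
  have c: "continuous_on {0..} ?x" by (rule cont_xi_of[OF eps sol small(1)])
  have "P r = density \<epsilon> ?x r"
    by (rule P_eq[OF eps sol fp(1)[OF r] fp(2)[OF r] c r r order_refl])
  also have "\<dots> = density \<epsilon> \<xi> r" by (rule density_cong) (use eq in auto)
  finally have 1: "P r = density \<epsilon> \<xi> r" .
  have "mean d ?x r = mean d \<xi> r" by (rule mean_cong) (use eq in auto)
  then have 2: "U r = velocity \<epsilon> \<xi> r"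
    using U_eq[OF eps sol c r] by (simp add: velocity_def power2_eq_square)
  have 3: "\<Theta> r = temperature \<epsilon> \<zeta> r"
    using Theta_eq[OF eps sol r] eq(2)[OF r] by (simp add: temperature_def temp_def)
  from 1 2 3 show ?thesis by blast
qed

end

section \<open>The temperature near the origin\<close>

context based_gas
begin

definition global_profile :: "real \<Rightarrow> (real \<Rightarrow> real) \<Rightarrow> (real \<Rightarrow> real) \<Rightarrow> bool" where
  "global_profile \<epsilon> \<xi> \<zeta> \<longleftrightarrow> 0 < \<epsilon> \<and> \<epsilon> \<le> 1 \<and>
     (\<forall>T\<ge>0. admissible \<eta> M \<epsilon> T \<xi> \<and> admissible \<eta> M \<epsilon> T \<zeta> \<and> fixed_profile \<epsilon> T \<xi> \<zeta>)"

lemma global_profileD: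
  assumes "global_profile \<epsilon> \<xi> \<zeta>"
  shows "0 < \<epsilon>" "\<epsilon> \<le> 1" "0 \<le> T \<Longrightarrow> admissible \<eta> M \<epsilon> T \<xi>" "0 \<le> T \<Longrightarrow> admissible \<eta> M \<epsilon> T \<zeta>" "0 \<le> T \<Longrightarrow> fixed_profile \<epsilon> T \<xi> \<zeta>"
  using assms by (auto simp: global_profile_def)

lemma global_profile_basic:
  assumes g: "global_profile \<epsilon> \<xi> \<zeta>" and r: "0 \<le> r"
  shows "\<bar>\<xi> r\<bar> \<le> M * decay \<eta> r ^ 3" "\<bar>mean d \<xi> r\<bar> \<le> M * decay \<eta> r ^ 3" "P0 / 2 \<le> density \<epsilon> \<xi> r" "density \<epsilon> \<xi> r \<le> 2 * P0"
    "\<bar>rate \<epsilon> \<xi> r\<bar> \<le> 4 * M * decay \<eta> r ^ 3"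
  using xi_bound[OF global_profileD(3)[OF g r] r order_refl] mean_bound[OF global_profileD(3)[OF g r] r order_refl]
    density_bounds[OF global_profileD(3)[OF g r] r order_refl] rate_bound[OF global_profileD(3)[OF g r] r order_refl] by auto

text \<open>A global profile is a Picard step from itself to itself, so the tame calculus applies with z =
\<zeta> and w = mean d \<xi>. Only the sizes are used, and the set of pairs is empty.\<close>
lemma uniform_bounds:
  obtains K where "0 < K"
    "\<And>\<epsilon> \<xi> \<zeta> r. global_profile \<epsilon> \<xi> \<zeta> \<Longrightarrow> 0 \<le> r \<Longrightarrow> \<bar>density \<epsilon> \<xi> r - P0\<bar> \<le> K * \<epsilon>"
    "\<And>\<epsilon> \<xi> \<zeta> r. global_profile \<epsilon> \<xi> \<zeta> \<Longrightarrow> 0 \<le> r \<Longrightarrow> \<bar>temp \<zeta> r\<bar> \<le> K * decay \<eta> r ^ 2"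
    "\<And>\<epsilon> \<xi> \<zeta> r. global_profile \<epsilon> \<xi> \<zeta> \<Longrightarrow> 0 \<le> r \<Longrightarrow> \<bar>temp_slope \<epsilon> \<xi> \<zeta> \<zeta> r\<bar> \<le> K * decay \<eta> r"
    "\<And>\<epsilon> \<xi> \<zeta> r. global_profile \<epsilon> \<xi> \<zeta> \<Longrightarrow> 0 \<le> r \<Longrightarrow> \<bar>heat_flux \<epsilon> \<xi> \<zeta> r\<bar> \<le> K * decay \<eta> r ^ 3"
    "\<And>\<epsilon> \<xi> \<zeta> r. global_profile \<epsilon> \<xi> \<zeta> \<Longrightarrow> 0 \<le> r \<Longrightarrow> \<bar>mean d \<xi> r * work \<epsilon> \<xi> \<zeta> r\<bar> \<le> K * decay \<eta> r ^ 3"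
proof -
  define e where "e = (\<lambda>(\<epsilon>::real, T::real, \<xi>::real\<Rightarrow>real, \<zeta>::real\<Rightarrow>real). \<epsilon>)"
  define t where "t = (\<lambda>(\<epsilon>::real, T::real, \<xi>::real\<Rightarrow>real, \<zeta>::real\<Rightarrow>real). T)"
  define x where "x = (\<lambda>(\<epsilon>::real, T::real, \<xi>::real\<Rightarrow>real, \<zeta>::real\<Rightarrow>real). \<xi>)"
  define y where "y = (\<lambda>(\<epsilon>::real, T::real, \<xi>::real\<Rightarrow>real, \<zeta>::real\<Rightarrow>real). \<zeta>)"
  note sel = e_def t_def x_def y_def
  define J where "J = {j. global_profile (e j) (x j) (y j) \<and> 0 \<le> t j}"
  interpret F: picard_family d R \<mu> lam Cv \<kappa> P0 \<eta> J "{}" e t M B x y y "\<lambda>j. mean d (x j)" zb wb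
  proof unfold_locales
    show "picard_step (e j) (t j) (x j) (y j) (y j) (mean d (x j))" if "j \<in> J" for j
      using that global_profileD(5)[of "e j" "x j" "y j" "t j"] unfolding J_def fixed_profile_def by auto
    show "admissible \<eta> M (e j) (t j) (x j)" "admissible \<eta> M (e j) (t j) (y j)" if "j \<in> J" for j
      using that global_profileD(3,4)[of "e j" "x j" "y j" "t j"] unfolding J_def by auto
  qed (use eta M_pos base global_profileD(1,2) in \<open>auto simp: J_def\<close>)
  have mw: "F.tame 0 3 (\<lambda>j r. mean d (x j) r * work (e j) (x j) (y j) r)"
    by (rule F.tame_product[OF F.tame_mean F.tame_work]) auto
  have get: "\<exists>K\<ge>0. \<forall>\<epsilon> \<xi> \<zeta> r. global_profile \<epsilon> \<xi> \<zeta> \<longrightarrow> 0 \<le> r \<longrightarrow> \<bar>f (\<epsilon>, r, \<xi>, \<zeta>) r\<bar> \<le> K * (\<epsilon> ^ k * decay \<eta> r ^ n)"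
    if "F.tame k n f" for k n f
  proof -
    from that obtain K where K: "0 \<le> K" "\<And>j r. j \<in> J \<Longrightarrow> 0 \<le> r \<Longrightarrow> r \<le> t j \<Longrightarrow> \<bar>f j r\<bar> \<le> K * F.wt k n j r"
      by (rule F.tameE) (rule that)
    show ?thesis
    proof (intro exI[of _ K] conjI K(1) allI impI)
      fix \<epsilon> \<xi> \<zeta> r assume g: "global_profile \<epsilon> \<xi> \<zeta>" and r: "(0::real) \<le> r"
      have proj: "e (\<epsilon>, r, \<xi>, \<zeta>) = \<epsilon>" "t (\<epsilon>, r, \<xi>, \<zeta>) = r" "x (\<epsilon>, r, \<xi>, \<zeta>) = \<xi>" "y (\<epsilon>, r, \<xi>, \<zeta>) = \<zeta>" by (simp_all add: sel)
      have J: "(\<epsilon>, r, \<xi>, \<zeta>) \<in> J" unfolding J_def mem_Collect_eq proj using g r by simp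
      show "\<bar>f (\<epsilon>, r, \<xi>, \<zeta>) r\<bar> \<le> K * (\<epsilon> ^ k * decay \<eta> r ^ n)"
        using K(2)[OF J, of r] r unfolding F.wt_def proj by simp
    qed
  qed
  obtain K1 where 1: "0 \<le> K1" "\<And>\<epsilon> \<xi> \<zeta> r. global_profile \<epsilon> \<xi> \<zeta> \<Longrightarrow> 0 \<le> r \<Longrightarrow> \<bar>density \<epsilon> \<xi> r - P0\<bar> \<le> K1 * \<epsilon>"
    using get[OF F.tame_density_deviation] by (auto simp: sel)
  obtain K2 where 2: "0 \<le> K2" "\<And>\<epsilon> \<xi> \<zeta> r. global_profile \<epsilon> \<xi> \<zeta> \<Longrightarrow> 0 \<le> r \<Longrightarrow> \<bar>temp \<zeta> r\<bar> \<le> K2 * decay \<eta> r ^ 2"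
    using get[OF F.tame_temp[OF F.tame_zeta]] by (auto simp: sel)
  obtain K3 where 3: "0 \<le> K3" "\<And>\<epsilon> \<xi> \<zeta> r. global_profile \<epsilon> \<xi> \<zeta> \<Longrightarrow> 0 \<le> r \<Longrightarrow> \<bar>temp_slope \<epsilon> \<xi> \<zeta> \<zeta> r\<bar> \<le> K3 * decay \<eta> r"
    using get[OF F.tame_temp_slope] by (auto simp: sel)
  obtain K4 where 4: "0 \<le> K4" "\<And>\<epsilon> \<xi> \<zeta> r. global_profile \<epsilon> \<xi> \<zeta> \<Longrightarrow> 0 \<le> r \<Longrightarrow> \<bar>heat_flux \<epsilon> \<xi> \<zeta> r\<bar> \<le> K4 * decay \<eta> r ^ 3"
    using get[OF F.tame_heat_flux] by (auto simp: sel)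
  obtain K5 where 5: "0 \<le> K5" "\<And>\<epsilon> \<xi> \<zeta> r. global_profile \<epsilon> \<xi> \<zeta> \<Longrightarrow> 0 \<le> r \<Longrightarrow> \<bar>mean d \<xi> r * work \<epsilon> \<xi> \<zeta> r\<bar> \<le> K5 * decay \<eta> r ^ 3"
    using get[OF mw] by (auto simp: sel)
  define K where "K = K1 + K2 + K3 + K4 + K5 + 1"
  have le: "K1 * c \<le> K * c" "K2 * c \<le> K * c" "K3 * c \<le> K * c" "K4 * c \<le> K * c" "K5 * c \<le> K * c" if "0 \<le> c" for c
    using that 1(1) 2(1) 3(1) 4(1) 5(1) unfolding K_def by (auto intro!: mult_right_mono)
  have \<sigma>: "0 \<le> decay \<eta> r ^ n" "0 \<le> decay \<eta> r" if "0 \<le> r" for r n using decay_pos[OF eta(1) that] by auto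
  show thesis
  proof (rule that[of K])
    show "0 < K" unfolding K_def using 1(1) 2(1) 3(1) 4(1) 5(1) by linarith
    fix \<epsilon> \<xi> \<zeta> r assume g: "global_profile \<epsilon> \<xi> \<zeta>" and r: "(0::real) \<le> r"
    show "\<bar>density \<epsilon> \<xi> r - P0\<bar> \<le> K * \<epsilon>" using 1(2)[OF g r] le(1)[of \<epsilon>] global_profileD(1)[OF g] by linarith
    show "\<bar>temp \<zeta> r\<bar> \<le> K * decay \<eta> r ^ 2" using 2(2)[OF g r] le(2)[OF \<sigma>(1)[OF r]] by (rule order_trans)
    show "\<bar>temp_slope \<epsilon> \<xi> \<zeta> \<zeta> r\<bar> \<le> K * decay \<eta> r" using 3(2)[OF g r] le(3)[OF \<sigma>(2)[OF r]] by (rule order_trans)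
    show "\<bar>heat_flux \<epsilon> \<xi> \<zeta> r\<bar> \<le> K * decay \<eta> r ^ 3" using 4(2)[OF g r] le(4)[OF \<sigma>(1)[OF r]] by (rule order_trans)
    show "\<bar>mean d \<xi> r * work \<epsilon> \<xi> \<zeta> r\<bar> \<le> K * decay \<eta> r ^ 3" using 5(2)[OF g r] le(5)[OF \<sigma>(1)[OF r]] by (rule order_trans)
  qed
qed

end

locale bounded_profiles = based_gas +
  fixes K :: real
  assumes K_pos: "0 < K"
    and density_dev: "global_profile \<epsilon> \<xi> \<zeta> \<Longrightarrow> 0 \<le> r \<Longrightarrow> \<bar>density \<epsilon> \<xi> r - P0\<bar> \<le> K * \<epsilon>"
    and temp_bound: "global_profile \<epsilon> \<xi> \<zeta> \<Longrightarrow> 0 \<le> r \<Longrightarrow> \<bar>temp \<zeta> r\<bar> \<le> K * decay \<eta> r ^ 2"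
    and slope_bound: "global_profile \<epsilon> \<xi> \<zeta> \<Longrightarrow> 0 \<le> r \<Longrightarrow> \<bar>temp_slope \<epsilon> \<xi> \<zeta> \<zeta> r\<bar> \<le> K * decay \<eta> r"
    and flux_bound: "global_profile \<epsilon> \<xi> \<zeta> \<Longrightarrow> 0 \<le> r \<Longrightarrow> \<bar>heat_flux \<epsilon> \<xi> \<zeta> r\<bar> \<le> K * decay \<eta> r ^ 3"
    and work_bound: "global_profile \<epsilon> \<xi> \<zeta> \<Longrightarrow> 0 \<le> r \<Longrightarrow> \<bar>mean d \<xi> r * work \<epsilon> \<xi> \<zeta> r\<bar> \<le> K * decay \<eta> r ^ 3"
begin

text \<open>The nonlinear part of the heat balance: r * \<open>heat_source\<close>, in a form that is regular
at 0.\<close>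
definition heat_total :: "real \<Rightarrow> (real \<Rightarrow> real) \<Rightarrow> (real \<Rightarrow> real) \<Rightarrow> real \<Rightarrow> real" where
  "heat_total \<epsilon> \<xi> \<zeta> r = - (1/4) * (density \<epsilon> \<xi> r * (r ^ 6 * (mean d \<xi> r)\<^sup>2)) + r * heat_flux \<epsilon> \<xi> \<zeta> r
     + (real d - 2) * integral {0..r} (heat_flux \<epsilon> \<xi> \<zeta>)"

lemma global_profile_balance:
  assumes "global_profile \<epsilon> \<xi> \<zeta>" "0 \<le> r"
  shows "\<kappa> * (r * temp_slope \<epsilon> \<xi> \<zeta> \<zeta> r + (real d - 2) * temp \<zeta> r) + Cv / 2 * (density \<epsilon> \<xi> r * (r\<^sup>2 * temp \<zeta> r))
     = (real d - 2) * \<kappa> + \<epsilon> * heat_total \<epsilon> \<xi> \<zeta> r"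
  unfolding heat_total_def by (rule heat_balance[OF global_profileD(1)[OF assms(1)] global_profileD(3-5)[OF assms(1)] assms(2)])

lemma global_profile_balance_divided:
  assumes "global_profile \<epsilon> \<xi> \<zeta>" "0 \<le> r"
  shows "r * temp_slope \<epsilon> \<xi> \<zeta> \<zeta> r + (real d - 2) * (temp \<zeta> r - 1) + Cv / (2 * \<kappa>) * (density \<epsilon> \<xi> r * (r\<^sup>2 * temp \<zeta> r))
     = \<epsilon> * heat_total \<epsilon> \<xi> \<zeta> r / \<kappa>"
proof -
  define c where "c = Cv / (2 * \<kappa>)"
  define e where "e = \<epsilon> * heat_total \<epsilon> \<xi> \<zeta> r / \<kappa>"
  have ce: "Cv / 2 = \<kappa> * c" "\<epsilon> * heat_total \<epsilon> \<xi> \<zeta> r = \<kappa> * e" unfolding c_def e_def using kappa_pos by auto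
  have "\<kappa> * (r * temp_slope \<epsilon> \<xi> \<zeta> \<zeta> r + (real d - 2) * (temp \<zeta> r - 1) + c * (density \<epsilon> \<xi> r * (r\<^sup>2 * temp \<zeta> r))) = \<kappa> * e"
    using global_profile_balance[OF assms] unfolding ce by (simp add: algebra_simps)
  then have "r * temp_slope \<epsilon> \<xi> \<zeta> \<zeta> r + (real d - 2) * (temp \<zeta> r - 1) + c * (density \<epsilon> \<xi> r * (r\<^sup>2 * temp \<zeta> r)) = e"
    using kappa_pos by simp
  then show ?thesis unfolding c_def e_def .
qed

lemma global_profile_temp_deriv: "global_profile \<epsilon> \<xi> \<zeta> \<Longrightarrow> 0 < r \<Longrightarrow> (temp \<zeta> has_real_derivative temp_slope \<epsilon> \<xi> \<zeta> \<zeta> r) (at r)"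
  using temp_has_derivative[OF global_profileD(3), of _ _ _ "r + 1" \<zeta> \<zeta> "mean d \<xi>" r] global_profileD(5)[of \<epsilon> \<xi> \<zeta> "r + 1"]
  by (auto simp: fixed_profile_def)

lemma global_profile_cont:
  assumes "global_profile \<epsilon> \<xi> \<zeta>"
  shows "continuous_on {0..} \<xi>" "continuous_on {0..} \<zeta>" "continuous_on {0..} (mean d \<xi>)"
    "continuous_on {0..} (density \<epsilon> \<xi>)" "continuous_on {0..} (rate \<epsilon> \<xi>)" "continuous_on {0..} (heat_flux \<epsilon> \<xi> \<zeta>)" "continuous_on {0..} (temp \<zeta>)"
proof -
  note c = cont_all[OF global_profileD(1)[OF assms] global_profileD(3-5)[OF assms]]
  show "continuous_on {0..} \<xi>" "continuous_on {0..} \<zeta>" "continuous_on {0..} (mean d \<xi>)"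
    "continuous_on {0..} (density \<epsilon> \<xi>)" "continuous_on {0..} (rate \<epsilon> \<xi>)" using c by blast+
  have z: "continuous_on {0..T} \<zeta>" for T by (rule continuous_on_subset[OF c(2)]) auto
  show "continuous_on {0..} (heat_flux \<epsilon> \<xi> \<zeta>)" "continuous_on {0..} (temp \<zeta>)"
    using cont_heat_flux[OF global_profileD(3)[OF assms] z] cont_temp[OF global_profileD(3)[OF assms] z] by (auto intro!: continuous_on_halflineI)
qed

lemma sigma: "0 \<le> r \<Longrightarrow> 0 < decay \<eta> r" "0 \<le> r \<Longrightarrow> decay \<eta> r \<le> 1" "0 \<le> r \<Longrightarrow> r * decay \<eta> r \<le> 1 / \<eta>"
  using decay_pos decay_le_one mult_decay_le eta(1) by auto

lemma radius_power_decay: "0 \<le> r \<Longrightarrow> r ^ n * decay \<eta> r ^ n \<le> 1 / \<eta> ^ n"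
  using power_mono[OF sigma(3), of r n] sigma(1)[of r] by (simp add: power_mult_distrib power_divide)

lemma dn: "0 \<le> real d - 2" "0 \<le> real d - 1"
  using d_ge by auto

lemma mean_square_bound:
  assumes "global_profile \<epsilon> \<xi> \<zeta>" "0 \<le> r" "n + k = 6"
  shows "\<bar>density \<epsilon> \<xi> r * (r ^ n * (mean d \<xi> r)\<^sup>2)\<bar> \<le> 2 * P0 * M\<^sup>2 / \<eta> ^ n * decay \<eta> r ^ k"
proof -
  have "(mean d \<xi> r)\<^sup>2 \<le> (M * decay \<eta> r ^ 3)\<^sup>2"
    using global_profile_basic(2)[OF assms(1,2)] by (metis abs_ge_zero power2_abs power_mono)
  then have m: "(mean d \<xi> r)\<^sup>2 \<le> M\<^sup>2 * decay \<eta> r ^ 6" by (simp add: power_mult_distrib flip: power_mult)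
  have p: "0 \<le> density \<epsilon> \<xi> r" "density \<epsilon> \<xi> r \<le> 2 * P0"
    using global_profile_basic(3,4)[OF assms(1,2)] P0_pos by auto
  have "r ^ n * (mean d \<xi> r)\<^sup>2 \<le> r ^ n * (M\<^sup>2 * decay \<eta> r ^ 6)" using m assms(2) by (intro mult_left_mono) auto
  also have "\<dots> = M\<^sup>2 * (r ^ n * decay \<eta> r ^ n) * decay \<eta> r ^ k"
    unfolding assms(3)[symmetric] power_add by simp
  also have "\<dots> \<le> M\<^sup>2 * (1 / \<eta> ^ n) * decay \<eta> r ^ k"
    using radius_power_decay[OF assms(2)] sigma(1)[OF assms(2)] by (intro mult_right_mono mult_left_mono) auto
  finally have "density \<epsilon> \<xi> r * (r ^ n * (mean d \<xi> r)\<^sup>2) \<le> 2 * P0 * (M\<^sup>2 * (1 / \<eta> ^ n) * decay \<eta> r ^ k)"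
    by (rule mult_mono[OF p(2)]) (use p P0_pos assms(2) in auto)
  then show ?thesis using p assms(2) by simp
qed

lemma heat_total_near_origin:
  assumes g: "global_profile \<epsilon> \<xi> \<zeta>" and r: "0 \<le> r"
  shows "\<bar>heat_total \<epsilon> \<xi> \<zeta> r\<bar> \<le> (P0 * M\<^sup>2 / \<eta> ^ 4 + K / \<eta> + real d * K / \<eta>) * r\<^sup>2"
proof -
  have "\<bar>density \<epsilon> \<xi> r * (r ^ 4 * (mean d \<xi> r)\<^sup>2)\<bar> \<le> 2 * P0 * M\<^sup>2 / \<eta> ^ 4 * decay \<eta> r ^ 2"
    by (rule mean_square_bound[OF g r]) simp
  also have "\<dots> \<le> 2 * P0 * M\<^sup>2 / \<eta> ^ 4 * 1"
    using sigma[OF r] P0_pos eta(1) by (intro mult_left_mono power_le_one) auto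
  finally have A: "r\<^sup>2 * \<bar>density \<epsilon> \<xi> r * (r ^ 4 * (mean d \<xi> r)\<^sup>2)\<bar> \<le> 2 * (P0 * M\<^sup>2 / \<eta> ^ 4 * r\<^sup>2)"
    using mult_left_mono[of "\<bar>density \<epsilon> \<xi> r * (r ^ 4 * (mean d \<xi> r)\<^sup>2)\<bar>" "2 * P0 * M\<^sup>2 / \<eta> ^ 4" "r\<^sup>2"] by (simp add: mult_ac)
  have "density \<epsilon> \<xi> r * (r ^ 6 * (mean d \<xi> r)\<^sup>2) = r\<^sup>2 * (density \<epsilon> \<xi> r * (r ^ 4 * (mean d \<xi> r)\<^sup>2))"
    by (simp add: eval_nat_numeral)
  then have B: "\<bar>- (1/4) * (density \<epsilon> \<xi> r * (r ^ 6 * (mean d \<xi> r)\<^sup>2))\<bar> = (1/4) * (r\<^sup>2 * \<bar>density \<epsilon> \<xi> r * (r ^ 4 * (mean d \<xi> r)\<^sup>2)\<bar>)"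
    by (simp add: abs_mult)
  have "0 \<le> P0 * M\<^sup>2 / \<eta> ^ 4 * r\<^sup>2" using P0_pos eta(1) by simp
  then have 1: "\<bar>- (1/4) * (density \<epsilon> \<xi> r * (r ^ 6 * (mean d \<xi> r)\<^sup>2))\<bar> \<le> P0 * M\<^sup>2 / \<eta> ^ 4 * r\<^sup>2"
    unfolding B using A by linarith
  have fl: "\<bar>heat_flux \<epsilon> \<xi> \<zeta> s\<bar> \<le> K / \<eta> * s" if s: "0 \<le> s" for s
  proof -
    have "\<bar>heat_flux \<epsilon> \<xi> \<zeta> s\<bar> = s\<^sup>2 * \<bar>mean d \<xi> s * work \<epsilon> \<xi> \<zeta> s\<bar>"
      unfolding heat_flux_def by (simp add: abs_mult)
    also have "\<dots> \<le> s\<^sup>2 * (K * decay \<eta> s ^ 3)" using work_bound[OF g s] by (intro mult_left_mono) auto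
    also have "\<dots> = K * s * (s * decay \<eta> s) * decay \<eta> s ^ 2" by (simp add: power2_eq_square power3_eq_cube)
    also have "\<dots> \<le> K * s * (1 / \<eta>) * 1"
      using sigma[OF s] s K_pos eta(1) by (intro mult_mono power_le_one) auto
    finally show ?thesis by simp
  qed
  have 2: "\<bar>r * heat_flux \<epsilon> \<xi> \<zeta> r\<bar> \<le> K / \<eta> * r\<^sup>2"
    using mult_left_mono[OF fl[OF r] r] r by (simp add: abs_mult power2_eq_square mult_ac)
  have 3: "\<bar>(real d - 2) * integral {0..r} (heat_flux \<epsilon> \<xi> \<zeta>)\<bar> \<le> real d * K / \<eta> * r\<^sup>2"
  proof -
    have "\<bar>integral {0..r} (heat_flux \<epsilon> \<xi> \<zeta>)\<bar> \<le> integral {0..r} (\<lambda>s. K / \<eta> * r)"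
    proof (rule abs_integral_le_const)
      fix s assume s: "s \<in> {0..r}"
      have "K / \<eta> * s \<le> K / \<eta> * r" using s K_pos eta(1) by (intro mult_left_mono) auto
      then show "\<bar>heat_flux \<epsilon> \<xi> \<zeta> s\<bar> \<le> K / \<eta> * r" using fl[of s] s by auto
    qed (auto intro!: integrable_continuous_real continuous_on_subset[OF global_profile_cont(6)[OF g]])
    also have "\<dots> = K / \<eta> * r\<^sup>2" using r by (simp add: power2_eq_square)
    finally have "(real d - 2) * \<bar>integral {0..r} (heat_flux \<epsilon> \<xi> \<zeta>)\<bar> \<le> real d * (K / \<eta> * r\<^sup>2)"
      using dn by (intro mult_mono) auto
    then show ?thesis using dn by (simp add: abs_mult)
  qed
  show ?thesis unfolding heat_total_def using 1 2 3 by (simp only: distrib_right)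
qed

definition temp_curvature :: real where
  "temp_curvature = (P0 * M\<^sup>2 / \<eta> ^ 4 + K / \<eta> + real d * K / \<eta>) / \<kappa> + Cv / \<kappa> * P0"

lemma temp_curvature_nonneg: "0 \<le> temp_curvature"
  unfolding temp_curvature_def using P0_pos K_pos eta(1) kappa_pos Cv_pos by simp

text \<open>In the heat balance for temp - 1, a multiple of r^2 is a supersolution because the source is
O(r^2).\<close>
lemma temp_near_origin:
  assumes g: "global_profile \<epsilon> \<xi> \<zeta>" and r: "0 \<le> r"
  shows "\<bar>temp \<zeta> r - 1\<bar> \<le> temp_curvature * r\<^sup>2"
proof (rule abs_le_supersolution[where X = "\<lambda>r. temp \<zeta> r - 1" and Z = "\<lambda>r. temp_curvature * r\<^sup>2" and p = 0 and T = r and k = "real d - 2"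
      and a = "\<lambda>r. Cv / (2 * \<kappa>) * density \<epsilon> \<xi> r" and X' = "temp_slope \<epsilon> \<xi> \<zeta> \<zeta>" and Z' = "\<lambda>r. temp_curvature * (2 * r)"])
  show "continuous_on {0..r} (\<lambda>r. temp \<zeta> r - 1)"
    by (intro continuous_intros continuous_on_subset[OF global_profile_cont(7)[OF g]]) auto
  show "\<bar>temp \<zeta> 0 - 1\<bar> \<le> temp_curvature * 0\<^sup>2" by (simp add: temp_def)
  fix t assume t: "0 < t" "t < r"
  show "((\<lambda>r. temp \<zeta> r - 1) has_real_derivative temp_slope \<epsilon> \<xi> \<zeta> \<zeta> t) (at t)"
    using DERIV_diff[OF global_profile_temp_deriv[OF g t(1)] DERIV_const] by simp
  show "((\<lambda>r. temp_curvature * r\<^sup>2) has_real_derivative temp_curvature * (2 * t)) (at t)"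
    by (auto intro!: derivative_eq_intros)
  have p: "0 \<le> density \<epsilon> \<xi> t" "density \<epsilon> \<xi> t \<le> 2 * P0" using global_profile_basic(3,4)[OF g, of t] t P0_pos by auto
  show a: "0 \<le> Cv / (2 * \<kappa>) * density \<epsilon> \<xi> t" using p Cv_pos kappa_pos by simp
  have "t * temp_slope \<epsilon> \<xi> \<zeta> \<zeta> t + (real d - 2) * (temp \<zeta> t - 1) + Cv / (2 * \<kappa>) * density \<epsilon> \<xi> t * t\<^sup>2 * (temp \<zeta> t - 1)
     = \<epsilon> * heat_total \<epsilon> \<xi> \<zeta> t / \<kappa> - Cv / (2 * \<kappa>) * density \<epsilon> \<xi> t * t\<^sup>2"
    unfolding global_profile_balance_divided[OF g less_imp_le[OF t(1)], symmetric] by (simp add: algebra_simps diff_divide_distrib)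
  also have "\<bar>\<dots>\<bar> \<le> \<bar>\<epsilon> * heat_total \<epsilon> \<xi> \<zeta> t / \<kappa>\<bar> + Cv / (2 * \<kappa>) * density \<epsilon> \<xi> t * t\<^sup>2"
  proof -
    have "0 \<le> Cv / (2 * \<kappa>) * density \<epsilon> \<xi> t * t\<^sup>2" by (rule mult_nonneg_nonneg[OF a]) simp
    then show ?thesis
      using abs_triangle_ineq4[of "\<epsilon> * heat_total \<epsilon> \<xi> \<zeta> t / \<kappa>" "Cv / (2 * \<kappa>) * density \<epsilon> \<xi> t * t\<^sup>2"] by linarith
  qed
  also have "\<dots> \<le> temp_curvature * t\<^sup>2"
  proof -
    have "\<epsilon> * \<bar>heat_total \<epsilon> \<xi> \<zeta> t\<bar> \<le> 1 * ((P0 * M\<^sup>2 / \<eta> ^ 4 + K / \<eta> + real d * K / \<eta>) * t\<^sup>2)"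
      using heat_total_near_origin[OF g less_imp_le[OF t(1)]] global_profileD(1,2)[OF g] by (intro mult_mono) auto
    then have "\<bar>\<epsilon> * heat_total \<epsilon> \<xi> \<zeta> t / \<kappa>\<bar> \<le> (P0 * M\<^sup>2 / \<eta> ^ 4 + K / \<eta> + real d * K / \<eta>) / \<kappa> * t\<^sup>2"
      using global_profileD(1)[OF g] kappa_pos by (simp add: abs_mult divide_right_mono)
    moreover have "Cv / (2 * \<kappa>) * density \<epsilon> \<xi> t * t\<^sup>2 \<le> Cv / (2 * \<kappa>) * (2 * P0) * t\<^sup>2"
      using p Cv_pos kappa_pos by (intro mult_right_mono mult_left_mono) auto
    ultimately show ?thesis unfolding temp_curvature_def by (simp add: distrib_right)
  qed
  also have "\<dots> \<le> t * (temp_curvature * (2 * t)) + (real d - 2) * (temp_curvature * t\<^sup>2) + Cv / (2 * \<kappa>) * density \<epsilon> \<xi> t * t\<^sup>2 * (temp_curvature * t\<^sup>2)"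
  proof -
    have "0 \<le> (real d - 2) * (temp_curvature * t\<^sup>2)" "0 \<le> Cv / (2 * \<kappa>) * density \<epsilon> \<xi> t * t\<^sup>2 * (temp_curvature * t\<^sup>2)" "0 \<le> temp_curvature * t\<^sup>2"
    proof -
      show k: "0 \<le> temp_curvature * t\<^sup>2" using temp_curvature_nonneg by simp
      show "0 \<le> (real d - 2) * (temp_curvature * t\<^sup>2)" by (rule mult_nonneg_nonneg[OF dn(1) k])
      show "0 \<le> Cv / (2 * \<kappa>) * density \<epsilon> \<xi> t * t\<^sup>2 * (temp_curvature * t\<^sup>2)"
        by (rule mult_nonneg_nonneg[OF mult_nonneg_nonneg[OF a zero_le_power2] k])
    qed
    moreover have "t * (temp_curvature * (2 * t)) = 2 * (temp_curvature * t\<^sup>2)" by (simp add: power2_eq_square)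
    ultimately show ?thesis by linarith
  qed
  finally show "\<bar>t * temp_slope \<epsilon> \<xi> \<zeta> \<zeta> t + (real d - 2) * (temp \<zeta> t - 1) + Cv / (2 * \<kappa>) * density \<epsilon> \<xi> t * t\<^sup>2 * (temp \<zeta> t - 1)\<bar>
    \<le> t * (temp_curvature * (2 * t)) + (real d - 2) * (temp_curvature * t\<^sup>2) + Cv / (2 * \<kappa>) * density \<epsilon> \<xi> t * t\<^sup>2 * (temp_curvature * t\<^sup>2)" .
qed (use r dn temp_curvature_nonneg in \<open>auto intro!: continuous_intros\<close>)

text \<open>The heat balance expresses r * slope by terms that are all O(r^2).\<close>
lemma slope_near_origin:
  obtains L where "0 < L" "\<And>\<epsilon> \<xi> \<zeta> r. global_profile \<epsilon> \<xi> \<zeta> \<Longrightarrow> 0 \<le> r \<Longrightarrow> \<bar>temp_slope \<epsilon> \<xi> \<zeta> \<zeta> r\<bar> \<le> L * r"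
proof -
  define L where "L = (P0 * M\<^sup>2 / \<eta> ^ 4 + K / \<eta> + real d * K / \<eta>) / \<kappa> + (real d - 2) * temp_curvature + Cv / \<kappa> * P0 * K + 1"
  have L: "0 < L" unfolding L_def
    using P0_pos K_pos eta(1) kappa_pos Cv_pos dn temp_curvature_nonneg by (intro add_nonneg_pos add_nonneg_nonneg mult_nonneg_nonneg divide_nonneg_nonneg) auto
  show thesis
  proof (rule that[OF L])
    fix \<epsilon> \<xi> \<zeta> r assume g: "global_profile \<epsilon> \<xi> \<zeta>" and r: "(0::real) \<le> r"
    have p: "0 \<le> density \<epsilon> \<xi> r" "density \<epsilon> \<xi> r \<le> 2 * P0" using global_profile_basic(3,4)[OF g r] P0_pos by auto
    have "r * temp_slope \<epsilon> \<xi> \<zeta> \<zeta> r = \<epsilon> * heat_total \<epsilon> \<xi> \<zeta> r / \<kappa> - (real d - 2) * (temp \<zeta> r - 1) - Cv / (2 * \<kappa>) * (density \<epsilon> \<xi> r * (r\<^sup>2 * temp \<zeta> r))"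
      unfolding global_profile_balance_divided[OF g r, symmetric] by (simp add: algebra_simps)
    moreover have "\<bar>\<epsilon> * heat_total \<epsilon> \<xi> \<zeta> r / \<kappa>\<bar> \<le> (P0 * M\<^sup>2 / \<eta> ^ 4 + K / \<eta> + real d * K / \<eta>) / \<kappa> * r\<^sup>2"
    proof -
      have "\<epsilon> * \<bar>heat_total \<epsilon> \<xi> \<zeta> r\<bar> \<le> 1 * ((P0 * M\<^sup>2 / \<eta> ^ 4 + K / \<eta> + real d * K / \<eta>) * r\<^sup>2)"
        using heat_total_near_origin[OF g r] global_profileD(1,2)[OF g] by (intro mult_mono) auto
      then show ?thesis using global_profileD(1)[OF g] kappa_pos by (simp add: abs_mult divide_right_mono)
    qed
    moreover have "\<bar>(real d - 2) * (temp \<zeta> r - 1)\<bar> \<le> (real d - 2) * temp_curvature * r\<^sup>2"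
      using mult_left_mono[OF temp_near_origin[OF g r] dn(1)] dn by (simp add: abs_mult mult.assoc)
    moreover have "\<bar>Cv / (2 * \<kappa>) * (density \<epsilon> \<xi> r * (r\<^sup>2 * temp \<zeta> r))\<bar> \<le> Cv / \<kappa> * P0 * K * r\<^sup>2"
    proof -
      have "\<bar>temp \<zeta> r\<bar> \<le> K * 1"
      proof -
        have "decay \<eta> r ^ 2 \<le> 1" using sigma[OF r] by (intro power_le_one) auto
        then have "K * decay \<eta> r ^ 2 \<le> K * 1" using K_pos by (intro mult_left_mono) auto
        then show ?thesis using temp_bound[OF g r] by linarith
      qed
      then have "density \<epsilon> \<xi> r * (r\<^sup>2 * \<bar>temp \<zeta> r\<bar>) \<le> 2 * P0 * (r\<^sup>2 * K)"
        using p P0_pos by (intro mult_mono) auto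
      then have "Cv / (2 * \<kappa>) * (density \<epsilon> \<xi> r * (r\<^sup>2 * \<bar>temp \<zeta> r\<bar>)) \<le> Cv / (2 * \<kappa>) * (2 * P0 * (r\<^sup>2 * K))"
        using Cv_pos kappa_pos by (intro mult_left_mono) auto
      then show ?thesis using p Cv_pos kappa_pos by (simp add: abs_mult mult_ac)
    qed
    ultimately have "\<bar>r * temp_slope \<epsilon> \<xi> \<zeta> \<zeta> r\<bar> \<le> (P0 * M\<^sup>2 / \<eta> ^ 4 + K / \<eta> + real d * K / \<eta>) / \<kappa> * r\<^sup>2
        + (real d - 2) * temp_curvature * r\<^sup>2 + Cv / \<kappa> * P0 * K * r\<^sup>2" by linarith
    also have "\<dots> \<le> L * r\<^sup>2" unfolding L_def by (simp add: distrib_right)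
    finally have "r * \<bar>temp_slope \<epsilon> \<xi> \<zeta> \<zeta> r\<bar> \<le> r * (L * r)" using r by (simp add: abs_mult power2_eq_square mult_ac)
    then show "\<bar>temp_slope \<epsilon> \<xi> \<zeta> \<zeta> r\<bar> \<le> L * r"
    proof (cases "r = 0")
      case True
      have "temp_slope \<epsilon> \<xi> \<zeta> \<zeta> 0 = 0" by (rule zeros(3)[OF global_profileD(1)[OF g] global_profileD(3-5)[OF g]])
      then show ?thesis using True by simp
    qed (use r in simp)
  qed
qed

section \<open>The far field\<close>

lemma limits_exist:
  assumes g: "global_profile \<epsilon> \<xi> \<zeta>"
  obtains Pinf I1 I2 where
    "\<And>r. 0 \<le> r \<Longrightarrow> \<bar>density \<epsilon> \<xi> r - Pinf\<bar> \<le> \<epsilon> * (4 * P0 * M / \<eta>) * decay \<eta> r ^ 2"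
    "\<And>r. 0 \<le> r \<Longrightarrow> \<bar>integral {0..r} (\<lambda>s. density \<epsilon> \<xi> s * (s ^ 3 * (mean d \<xi> s)\<^sup>2)) - I1\<bar> \<le> P0 * M\<^sup>2 / \<eta> ^ 4 * decay \<eta> r ^ 2"
    "\<And>r. 0 \<le> r \<Longrightarrow> \<bar>integral {0..r} (heat_flux \<epsilon> \<xi> \<zeta>) - I2\<bar> \<le> K / (2 * \<eta>) * decay \<eta> r ^ 2"
proof -
  have e: "0 \<le> \<epsilon>" using global_profileD(1)[OF g] by simp
  have "\<bar>density \<epsilon> \<xi> r * rate \<epsilon> \<xi> r\<bar> \<le> 8 * P0 * M * decay \<eta> r ^ 3" if "0 \<le> r" for r
  proof -
    have "\<bar>density \<epsilon> \<xi> r\<bar> * \<bar>rate \<epsilon> \<xi> r\<bar> \<le> (2 * P0) * (4 * M * decay \<eta> r ^ 3)"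
      using global_profile_basic(3,4,5)[OF g that] P0_pos by (intro mult_mono) auto
    then show ?thesis by (simp add: abs_mult)
  qed
  then have "\<bar>integral {0..r} (\<lambda>s. density \<epsilon> \<xi> s * rate \<epsilon> \<xi> s) - integral {0..s} (\<lambda>s. density \<epsilon> \<xi> s * rate \<epsilon> \<xi> s)\<bar>
     \<le> 8 * P0 * M / (2 * \<eta>) * decay \<eta> s ^ 2" if "0 \<le> s" "s \<le> r" for s r
    using that P0_pos M_pos global_profile_cont[OF g]
    by (intro integral_tail_decay[OF eta(1)] continuous_intros) auto
  then have "\<bar>density \<epsilon> \<xi> r - density \<epsilon> \<xi> s\<bar> \<le> \<epsilon> * (4 * P0 * M / \<eta>) * decay \<eta> s ^ 2" if "0 \<le> s" "s \<le> r" for s r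
  proof -
    have 1: "density \<epsilon> \<xi> r = P0 + \<epsilon> * integral {0..r} (\<lambda>s. density \<epsilon> \<xi> s * rate \<epsilon> \<xi> s)"
      using density_minus_P0[OF global_profileD(3)[OF g], of r r] that by simp
    have 2: "density \<epsilon> \<xi> s = P0 + \<epsilon> * integral {0..s} (\<lambda>s. density \<epsilon> \<xi> s * rate \<epsilon> \<xi> s)"
      using density_minus_P0[OF global_profileD(3)[OF g], of s s] that by simp
    have "\<bar>density \<epsilon> \<xi> r - density \<epsilon> \<xi> s\<bar> = \<epsilon> * \<bar>integral {0..r} (\<lambda>s. density \<epsilon> \<xi> s * rate \<epsilon> \<xi> s) - integral {0..s} (\<lambda>s. density \<epsilon> \<xi> s * rate \<epsilon> \<xi> s)\<bar>"
      unfolding 1 2 using e by (simp add: abs_mult flip: right_diff_distrib)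
    also have "\<dots> \<le> \<epsilon> * (8 * P0 * M / (2 * \<eta>) * decay \<eta> s ^ 2)"
      using \<open>\<And>s r. 0 \<le> s \<Longrightarrow> s \<le> r \<Longrightarrow> _\<close>[OF that] e by (intro mult_left_mono) auto
    finally show ?thesis by simp
  qed
  from limit_with_decay_rate[OF eta(1) this]
  obtain Pinf where 1: "\<And>r. 0 \<le> r \<Longrightarrow> \<bar>density \<epsilon> \<xi> r - Pinf\<bar> \<le> \<epsilon> * (4 * P0 * M / \<eta>) * decay \<eta> r ^ 2" by blast
  have "\<bar>integral {0..r} (\<lambda>s. density \<epsilon> \<xi> s * (s ^ 3 * (mean d \<xi> s)\<^sup>2)) - integral {0..s} (\<lambda>s. density \<epsilon> \<xi> s * (s ^ 3 * (mean d \<xi> s)\<^sup>2))\<bar>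
     \<le> 2 * P0 * M\<^sup>2 / \<eta> ^ 3 / (2 * \<eta>) * decay \<eta> s ^ 2" if "0 \<le> s" "s \<le> r" for s r
    using that P0_pos eta(1) global_profile_cont[OF g] mean_square_bound[OF g, of _ 3 3]
    by (intro integral_tail_decay[OF eta(1)] continuous_intros) auto
  from limit_with_decay_rate[OF eta(1) this]
  obtain I1 where 2: "\<And>r. 0 \<le> r \<Longrightarrow> \<bar>integral {0..r} (\<lambda>s. density \<epsilon> \<xi> s * (s ^ 3 * (mean d \<xi> s)\<^sup>2)) - I1\<bar> \<le> 2 * P0 * M\<^sup>2 / \<eta> ^ 3 / (2 * \<eta>) * decay \<eta> r ^ 2" by blast
  have c: "2 * P0 * M\<^sup>2 / \<eta> ^ 3 / (2 * \<eta>) = P0 * M\<^sup>2 / \<eta> ^ 4" by (simp add: eval_nat_numeral)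
  have "\<bar>integral {0..r} (heat_flux \<epsilon> \<xi> \<zeta>) - integral {0..s} (heat_flux \<epsilon> \<xi> \<zeta>)\<bar> \<le> K / (2 * \<eta>) * decay \<eta> s ^ 2" if "0 \<le> s" "s \<le> r" for s r
    using that K_pos global_profile_cont[OF g] flux_bound[OF g]
    by (intro integral_tail_decay[OF eta(1)]) auto
  from limit_with_decay_rate[OF eta(1) this]
  obtain I2 where 3: "\<And>r. 0 \<le> r \<Longrightarrow> \<bar>integral {0..r} (heat_flux \<epsilon> \<xi> \<zeta>) - I2\<bar> \<le> K / (2 * \<eta>) * decay \<eta> r ^ 2" by blast
  show thesis by (rule that[OF 1 2[unfolded c] 3])
qed

text \<open>The integrated momentum equation, divided by \<epsilon> and solved for the transport term P r U /
(2 \<epsilon>), the only term of which the limit at infinity is not yet known.\<close>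
lemma momentum_balance:
  assumes g: "global_profile \<epsilon> \<xi> \<zeta>" and r: "0 \<le> r"
  shows "density \<epsilon> \<xi> r * (r ^ 3 * mean d \<xi> r) / 2 = \<epsilon> * (density \<epsilon> \<xi> r * (r ^ 4 * (mean d \<xi> r)\<^sup>2)) + R * (density \<epsilon> \<xi> r * temp \<zeta> r - P0)
     + (real d - 1) * \<epsilon> * integral {0..r} (\<lambda>s. density \<epsilon> \<xi> s * (s ^ 3 * (mean d \<xi> s)\<^sup>2)) - \<nu> * (r * \<xi> r)"
proof (cases "r = 0")
  case False
  have "\<xi> r = div_new \<epsilon> \<xi> \<zeta> (mean d \<xi>) r"
    using global_profileD(5)[OF g r] r by (auto simp: fixed_profile_def)
  then have "\<nu> * \<xi> r = force \<epsilon> \<xi> \<zeta> r - density \<epsilon> \<xi> r * (r\<^sup>2 * mean d \<xi> r) / 2"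
    unfolding div_new_def using nu_pos by (simp add: field_simps)
  then have "r * (\<nu> * \<xi> r) = r * force \<epsilon> \<xi> \<zeta> r - r * (density \<epsilon> \<xi> r * (r\<^sup>2 * mean d \<xi> r) / 2)"
    by (simp add: right_diff_distrib)
  moreover have "r * force \<epsilon> \<xi> \<zeta> r = \<epsilon> * (density \<epsilon> \<xi> r * (r ^ 4 * (mean d \<xi> r)\<^sup>2)) + R * (density \<epsilon> \<xi> r * temp \<zeta> r - P0)
     + (real d - 1) * \<epsilon> * integral {0..r} (\<lambda>s. density \<epsilon> \<xi> s * (s ^ 3 * (mean d \<xi> s)\<^sup>2))"
    unfolding force_def using False by (simp add: field_simps eval_nat_numeral)
  moreover have "r * (density \<epsilon> \<xi> r * (r\<^sup>2 * mean d \<xi> r) / 2) = density \<epsilon> \<xi> r * (r ^ 3 * mean d \<xi> r) / 2"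
    by (simp add: eval_nat_numeral)
  moreover have "r * (\<nu> * \<xi> r) = \<nu> * (r * \<xi> r)" by simp
  ultimately show ?thesis by linarith
qed (simp add: temp_def density_def)

text \<open>The assumption on the source says that th / r^2 solves the heat balance up to an error O(r^(-2)),
which fixes th as a ratio of limits. Applied to c/r^4, the linear operator gives c/r^4 (d - 6 + a
r^2). Beyond the radius p the term a r^2 dominates, so c/r^4 is a supersolution for a source
O(r^(-2)).\<close>
lemma inverse_square_barrier:
  assumes g: "global_profile \<epsilon> \<xi> \<zeta>" and p: "1 \<le> p" "6 \<le> Cv * P0 / (4 * \<kappa>) * p\<^sup>2" and C: "0 \<le> C"
    and src: "\<And>t. p \<le> t \<Longrightarrow> \<bar>(real d - 2) + \<epsilon> * heat_total \<epsilon> \<xi> \<zeta> t / \<kappa> - Cv / (2 * \<kappa>) * density \<epsilon> \<xi> t * th - (real d - 4) * th / t\<^sup>2\<bar> \<le> C / t\<^sup>2"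
    and c: "2 * C / (Cv * P0 / (4 * \<kappa>)) \<le> c" "(K + \<bar>th\<bar>) * p ^ 4 \<le> c" and r: "p \<le> r"
  shows "\<bar>temp \<zeta> r - th / r\<^sup>2\<bar> \<le> c / r ^ 4"
proof (rule abs_le_supersolution[where X = "\<lambda>r. temp \<zeta> r - th / r\<^sup>2" and Z = "\<lambda>r. c / r ^ 4" and p = p and T = r and k = "real d - 2"
      and a = "\<lambda>r. Cv / (2 * \<kappa>) * density \<epsilon> \<xi> r" and X' = "\<lambda>r. temp_slope \<epsilon> \<xi> \<zeta> \<zeta> r + 2 * th / r ^ 3" and Z' = "\<lambda>r. - 4 * c / r ^ 5"])
  let ?\<alpha> = "Cv * P0 / (4 * \<kappa>)"
  have \<alpha>: "0 < ?\<alpha>" using Cv_pos P0_pos kappa_pos by simp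
  have c0: "0 \<le> c" using c(1) C \<alpha> by (meson divide_nonneg_pos mult_nonneg_nonneg order_trans zero_le_numeral)
  show "continuous_on {p..r} (\<lambda>r. temp \<zeta> r - th / r\<^sup>2)"
    using p by (intro continuous_intros continuous_on_subset[OF global_profile_cont(7)[OF g]]) auto
  show "continuous_on {p..r} (\<lambda>r. c / r ^ 4)" using p by (intro continuous_intros) auto
  show "\<bar>temp \<zeta> p - th / p\<^sup>2\<bar> \<le> c / p ^ 4"
  proof -
    have "decay \<eta> p ^ 2 \<le> 1" using sigma[of p] p by (intro power_le_one) auto
    then have "K * decay \<eta> p ^ 2 \<le> K * 1" using K_pos by (intro mult_left_mono) auto
    then have "\<bar>temp \<zeta> p\<bar> \<le> K" using temp_bound[OF g, of p] p by linarith
    moreover have "\<bar>th / p\<^sup>2\<bar> \<le> \<bar>th\<bar>"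
    proof -
      have "1 \<le> p\<^sup>2" by (rule one_le_power[OF p(1)])
      then have "\<bar>th\<bar> / p\<^sup>2 \<le> \<bar>th\<bar> / 1" by (intro divide_left_mono) auto
      then show ?thesis by simp
    qed
    ultimately have "\<bar>temp \<zeta> p - th / p\<^sup>2\<bar> \<le> K + \<bar>th\<bar>" by linarith
    also have "\<dots> \<le> c / p ^ 4" using c(2) p by (simp add: le_divide_eq)
    finally show ?thesis .
  qed
  fix t assume t: "p < t" "t < r"
  then have t0: "0 < t" "1 \<le> t" using p by auto
  show "((\<lambda>r. temp \<zeta> r - th / r\<^sup>2) has_real_derivative temp_slope \<epsilon> \<xi> \<zeta> \<zeta> t + 2 * th / t ^ 3) (at t)"
  proof -
    have "((\<lambda>r. th / r\<^sup>2) has_real_derivative - (2 * th / t ^ 3)) (at t)"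
      using t0 by (auto intro!: derivative_eq_intros simp: field_simps eval_nat_numeral)
    from DERIV_diff[OF global_profile_temp_deriv[OF g t0(1)] this] show ?thesis by simp
  qed
  show "((\<lambda>r. c / r ^ 4) has_real_derivative - 4 * c / t ^ 5) (at t)"
    using t0 by (auto intro!: derivative_eq_intros simp: field_simps eval_nat_numeral)
  have pr: "P0 / 2 \<le> density \<epsilon> \<xi> t" using global_profile_basic(3)[OF g, of t] t0 by simp
  have a: "?\<alpha> \<le> Cv / (2 * \<kappa>) * density \<epsilon> \<xi> t"
    using mult_left_mono[OF pr, of "Cv / (2 * \<kappa>)"] Cv_pos kappa_pos by simp
  then show a0: "0 \<le> Cv / (2 * \<kappa>) * density \<epsilon> \<xi> t" using \<alpha> by linarith
  have "t * (temp_slope \<epsilon> \<xi> \<zeta> \<zeta> t + 2 * th / t ^ 3) + (real d - 2) * (temp \<zeta> t - th / t\<^sup>2) + Cv / (2 * \<kappa>) * density \<epsilon> \<xi> t * t\<^sup>2 * (temp \<zeta> t - th / t\<^sup>2)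
     = (t * temp_slope \<epsilon> \<xi> \<zeta> \<zeta> t + (real d - 2) * (temp \<zeta> t - 1) + Cv / (2 * \<kappa>) * (density \<epsilon> \<xi> t * (t\<^sup>2 * temp \<zeta> t)))
       + (real d - 2) + (t * (2 * th / t ^ 3) - (real d - 2) * (th / t\<^sup>2)) - Cv / (2 * \<kappa>) * density \<epsilon> \<xi> t * (t\<^sup>2 * (th / t\<^sup>2))"
    by (simp only: algebra_simps)
  also have "t * (2 * th / t ^ 3) - (real d - 2) * (th / t\<^sup>2) = - ((real d - 4) * th / t\<^sup>2)"
    using t0 by (simp add: field_simps eval_nat_numeral)
  also have "t\<^sup>2 * (th / t\<^sup>2) = th" using t0 by simp
  also have "t * temp_slope \<epsilon> \<xi> \<zeta> \<zeta> t + (real d - 2) * (temp \<zeta> t - 1) + Cv / (2 * \<kappa>) * (density \<epsilon> \<xi> t * (t\<^sup>2 * temp \<zeta> t))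
     = \<epsilon> * heat_total \<epsilon> \<xi> \<zeta> t / \<kappa>"
    by (rule global_profile_balance_divided[OF g less_imp_le[OF t0(1)]])
  finally have "\<bar>t * (temp_slope \<epsilon> \<xi> \<zeta> \<zeta> t + 2 * th / t ^ 3) + (real d - 2) * (temp \<zeta> t - th / t\<^sup>2) + Cv / (2 * \<kappa>) * density \<epsilon> \<xi> t * t\<^sup>2 * (temp \<zeta> t - th / t\<^sup>2)\<bar>
     \<le> C / t\<^sup>2"
    using src[of t] t by (simp add: algebra_simps)
  also have "\<dots> \<le> c / t ^ 4 * (?\<alpha> * t\<^sup>2 / 2)"
  proof -
    have "C \<le> c * ?\<alpha> / 2" using c(1) \<alpha> by (simp only: pos_divide_le_eq) simp
    then have "C / t\<^sup>2 \<le> c * ?\<alpha> / 2 / t\<^sup>2" by (intro divide_right_mono) auto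
    also have "\<dots> = c / t ^ 4 * (?\<alpha> * t\<^sup>2 / 2)" using t0 by (simp add: field_simps eval_nat_numeral)
    finally show ?thesis .
  qed
  also have "\<dots> \<le> c / t ^ 4 * ((real d - 6) + Cv / (2 * \<kappa>) * density \<epsilon> \<xi> t * t\<^sup>2)"
  proof (rule mult_left_mono)
    have "?\<alpha> * p\<^sup>2 \<le> ?\<alpha> * t\<^sup>2" using \<alpha> t p by (intro mult_left_mono power_mono) auto
    moreover have "3 \<le> real d" using d_ge by simp
    moreover have "?\<alpha> * t\<^sup>2 \<le> Cv / (2 * \<kappa>) * density \<epsilon> \<xi> t * t\<^sup>2" using a by (intro mult_right_mono) auto
    moreover define x y where "x = ?\<alpha> * t\<^sup>2" and "y = Cv / (2 * \<kappa>) * density \<epsilon> \<xi> t * t\<^sup>2"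
    ultimately have "6 \<le> x" "x \<le> y" "3 \<le> real d"
      using order_trans[OF p(2)] by simp_all
    then have "x / 2 \<le> (real d - 6) + y" by linarith
    then show "?\<alpha> * t\<^sup>2 / 2 \<le> (real d - 6) + Cv / (2 * \<kappa>) * density \<epsilon> \<xi> t * t\<^sup>2"
      unfolding x_def y_def .
  qed (use c0 t0 in simp)
  also have "\<dots> = t * (- 4 * c / t ^ 5) + (real d - 2) * (c / t ^ 4) + Cv / (2 * \<kappa>) * density \<epsilon> \<xi> t * t\<^sup>2 * (c / t ^ 4)"
  proof -
    have "t * (- 4 * c / t ^ 5) = - 4 * (c / t ^ 4)" using t0 by (simp add: eval_nat_numeral)
    then show ?thesis by (simp only: algebra_simps)
  qed
  finally show "\<bar>t * (temp_slope \<epsilon> \<xi> \<zeta> \<zeta> t + 2 * th / t ^ 3) + (real d - 2) * (temp \<zeta> t - th / t\<^sup>2) + Cv / (2 * \<kappa>) * density \<epsilon> \<xi> t * t\<^sup>2 * (temp \<zeta> t - th / t\<^sup>2)\<bar>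
    \<le> t * (- 4 * c / t ^ 5) + (real d - 2) * (c / t ^ 4) + Cv / (2 * \<kappa>) * density \<epsilon> \<xi> t * t\<^sup>2 * (c / t ^ 4)" .
qed (use p r dn in auto)

text \<open>The momentum balance gives in the limit Pinf u / 2 = - R P0 + (d-1) \<epsilon> I1, and the heat
balance C_V Pinf th / 2 = (d-2) \<kappa> + \<epsilon> G, where I1 and G, the limit of
\<open>heat_total\<close>, are bounded independently of \<epsilon>. As Pinf = P0 + O(\<epsilon>),
this yields the expansions of u and th, and their signs for small \<epsilon>.\<close>
lemma far_field:
  obtains C p \<epsilon>2 where "0 < C" "1 \<le> p" "0 < \<epsilon>2"
    and "\<And>\<epsilon> \<xi> \<zeta>. global_profile \<epsilon> \<xi> \<zeta> \<Longrightarrow> \<epsilon> \<le> \<epsilon>2 \<Longrightarrow> \<exists>Pinf u th. 0 < Pinf \<and> u < 0 \<and> 0 < th \<and>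
       (\<forall>r\<ge>p. \<bar>density \<epsilon> \<xi> r - Pinf\<bar> \<le> C / r\<^sup>2 \<and> \<bar>r ^ 3 * mean d \<xi> r - u\<bar> \<le> C / r\<^sup>2 \<and> \<bar>temp \<zeta> r - th / r\<^sup>2\<bar> \<le> C / r ^ 4) \<and>
       \<bar>u + 2 * R\<bar> \<le> C * \<epsilon> \<and> \<bar>th - 2 * (real d - 2) * \<kappa> / (Cv * P0)\<bar> \<le> C * \<epsilon>"
proof -
  define n where "n = real d - 1"
  define m where "m = real d - 2"
  have nm: "2 \<le> n" "1 \<le> m" using d_ge unfolding n_def m_def by auto
  (* The constants bound, in this order: the tails of P and of the momentum integral, the limit A of
     the momentum balance, u, the deviation of u, the tails of the momentum balance, of r^3 mean and
     of heat_total, the limit G of heat_total, th, the deviation of th, and the source of the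
     barrier. None of them depends on \<epsilon>. *)
  define C1 where "C1 = 4 * P0 * M / \<eta>"
  define C2 where "C2 = P0 * M\<^sup>2 / \<eta> ^ 4"
  define C3 where "C3 = R * P0 + n * C2"
  define C4 where "C4 = 4 * C3 / P0"
  define C5 where "C5 = 4 / P0 * (R * C1 + n * C2)"
  define C6 where "C6 = 2 * P0 * M\<^sup>2 / \<eta> ^ 4 + 2 * R * P0 * K + n * C2 + \<nu> * M / \<eta>"
  define C7 where "C7 = 4 / P0 * (C6 + C1 * C4 / 2)"
  define C8 where "C8 = (2 * P0 * C7 * (M / \<eta> ^ 3 + C4) + C1 * C4\<^sup>2) / 4 + K / \<eta> + m * K / (2 * \<eta>)"
  define C9 where "C9 = P0 * C4\<^sup>2 / 2 + m * K / (2 * \<eta>)"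
  define C10 where "C10 = 4 / (Cv * P0) * (m * \<kappa> + C9)"
  define C11 where "C11 = 4 / (Cv * P0\<^sup>2) * (m * \<kappa> * C1 + C9 * P0)"
  define C12 where "C12 = (C8 / \<kappa> + Cv / (2 * \<kappa>) * C1 * C10) / \<eta>\<^sup>2 + real d * C10"
  define \<alpha> where "\<alpha> = Cv * P0 / (4 * \<kappa>)"
  (* Large enough for \<alpha> p^2 \<ge> 6, as the barrier requires. *)
  define p where "p = 1 + 6 / \<alpha>"
  define c where "c = 2 * C12 / \<alpha> + (K + C10) * p ^ 4"
  define C where "C = 1 + C1 / \<eta>\<^sup>2 + C7 / \<eta>\<^sup>2 + c + C5 + C11"
  define \<epsilon>2 where "\<epsilon>2 = min (P0 / (2 * (C1 + 1))) (min (R / (C5 + 1)) (m * \<kappa> / (Cv * P0 * (C11 + 1))))"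
  note pos = P0_pos R_pos Cv_pos kappa_pos K_pos M_pos eta(1) nu_pos
  have C1: "0 < C1" unfolding C1_def using pos by simp
  have C2: "0 < C2" unfolding C2_def using pos by simp
  have C3: "0 < C3" unfolding C3_def using pos C2 nm by (simp add: add_pos_pos)
  have C4: "0 < C4" unfolding C4_def using pos C3 by simp
  have C5: "0 < C5" unfolding C5_def using pos C1 C2 nm by (simp add: add_pos_pos)
  have C6: "0 < C6" unfolding C6_def using pos C2 nm by (intro add_pos_pos) auto
  have C7: "0 < C7" unfolding C7_def using pos C6 C1 C4 by (simp add: add_pos_pos)
  have C8: "0 < C8" unfolding C8_def using pos C7 C1 C4 nm by (intro add_pos_pos divide_pos_pos mult_pos_pos) auto
  have C9: "0 < C9" unfolding C9_def using pos C4 nm by (intro add_pos_pos divide_pos_pos mult_pos_pos) auto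
  have C10: "0 < C10" unfolding C10_def using pos C9 nm by (intro mult_pos_pos add_pos_pos divide_pos_pos) auto
  have C11: "0 < C11" unfolding C11_def using pos C9 C1 nm by (intro mult_pos_pos add_pos_pos divide_pos_pos) auto
  have C12: "0 < C12" unfolding C12_def using pos C8 C1 C10 d_ge by (intro mult_pos_pos add_pos_pos divide_pos_pos) auto
  have \<alpha>: "0 < \<alpha>" unfolding \<alpha>_def using pos by simp
  have p1: "1 \<le> p" unfolding p_def using \<alpha> by simp
  have p2: "6 \<le> \<alpha> * p\<^sup>2"
  proof -
    have "6 \<le> \<alpha> * p" unfolding p_def using \<alpha> by (simp add: distrib_left)
    also have "\<dots> \<le> \<alpha> * (p * p)" using \<alpha> p1 by (intro mult_left_mono) auto
    finally show ?thesis by (simp add: power2_eq_square)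
  qed
  have c0: "0 < c" unfolding c_def using C12 \<alpha> K_pos C10 p1 by (intro add_pos_pos divide_pos_pos mult_pos_pos) auto
  have q: "0 < C1 / \<eta>\<^sup>2" "0 < C7 / \<eta>\<^sup>2" using C1 C7 eta(1) by auto
  have C: "0 < C" "C1 / \<eta>\<^sup>2 \<le> C" "C7 / \<eta>\<^sup>2 \<le> C" "c \<le> C" "C5 \<le> C" "C11 \<le> C"
    unfolding C_def using q c0 C5 C11 by linarith+
  have e2: "0 < \<epsilon>2" unfolding \<epsilon>2_def using pos C1 C5 C11 nm by (simp add: add_pos_pos)
  have \<sigma>2: "decay \<eta> r ^ 2 \<le> 1 / \<eta>\<^sup>2 / r\<^sup>2" if "1 \<le> r" for r
    using radius_power_decay[of r 2] that
    by (intro pos_le_divide_eq[of "r\<^sup>2" "decay \<eta> r ^ 2" "1 / \<eta>\<^sup>2", THEN iffD2]) (auto simp: mult.commute)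
  show thesis
  proof (rule that[OF C(1) p1 e2])
    fix \<epsilon> \<xi> \<zeta> assume g: "global_profile \<epsilon> \<xi> \<zeta>" and small: "\<epsilon> \<le> \<epsilon>2"
    have e: "0 < \<epsilon>" "\<epsilon> \<le> 1" using global_profileD[OF g] by auto
    have "\<epsilon> \<le> P0 / (2 * (C1 + 1))" "\<epsilon> \<le> R / (C5 + 1)" "\<epsilon> \<le> m * \<kappa> / (Cv * P0 * (C11 + 1))"
      using small unfolding \<epsilon>2_def by auto
    then have "\<epsilon> * (2 * (C1 + 1)) \<le> P0" "\<epsilon> * (C5 + 1) \<le> R" "\<epsilon> * (Cv * P0 * (C11 + 1)) \<le> m * \<kappa>"
      using C1 C5 C11 pos by (simp_all add: pos_le_divide_eq)
    then have sm: "\<epsilon> * C1 \<le> P0 / 2" "\<epsilon> * C5 < R * 2" "Cv * P0 * (C11 * \<epsilon>) < 2 * (m * \<kappa>)"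
    proof -
      assume a: "\<epsilon> * (2 * (C1 + 1)) \<le> P0" "\<epsilon> * (C5 + 1) \<le> R" "\<epsilon> * (Cv * P0 * (C11 + 1)) \<le> m * \<kappa>"
      have b: "0 < \<epsilon> * (Cv * P0)" "0 < m * \<kappa>" using e pos nm by auto
      show "\<epsilon> * C1 \<le> P0 / 2" using a(1) e by (simp add: algebra_simps)
      show "\<epsilon> * C5 < R * 2" using a(2) e R_pos by (simp add: algebra_simps)
      have "Cv * P0 * (C11 * \<epsilon>) = \<epsilon> * (Cv * P0 * (C11 + 1)) - \<epsilon> * (Cv * P0)" by (simp add: algebra_simps)
      then show "Cv * P0 * (C11 * \<epsilon>) < 2 * (m * \<kappa>)" using a(3) b by linarith
    qed
    define P where "P = density \<epsilon> \<xi>"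
    define v where "v r = r ^ 3 * mean d \<xi> r" for r
    define F where "F r = integral {0..r} (\<lambda>s. P s * (s ^ 3 * (mean d \<xi> s)\<^sup>2))" for r
    define s where "s r = decay \<eta> r ^ 2" for r
    obtain Pinf I1 I2 where
      Pl: "\<And>r. 0 \<le> r \<Longrightarrow> \<bar>P r - Pinf\<bar> \<le> \<epsilon> * C1 * s r"
      and I1: "\<And>r. 0 \<le> r \<Longrightarrow> \<bar>F r - I1\<bar> \<le> C2 * s r"
      and I2: "\<And>r. 0 \<le> r \<Longrightarrow> \<bar>integral {0..r} (heat_flux \<epsilon> \<xi> \<zeta>) - I2\<bar> \<le> K / (2 * \<eta>) * s r"
      using limits_exist[OF g] unfolding P_def F_def C1_def C2_def s_def by blast
    have s01: "0 < s r" "s r \<le> 1" if "0 \<le> r" for r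
      unfolding s_def using sigma[OF that] by (auto intro: power_le_one)
    have s_0: "s 0 = 1" by (simp add: s_def)
    have Pinf: "\<bar>P0 - Pinf\<bar> \<le> \<epsilon> * C1" using Pl[of 0] by (simp add: s_0 P_def density_def)
    then have Pinf2: "P0 / 2 \<le> Pinf" "Pinf \<le> 2 * P0" using sm(1) P0_pos by linarith+
    then have Pinf0: "0 < Pinf" using P0_pos by linarith
    have I1b: "\<bar>I1\<bar> \<le> C2" using I1[of 0] by (simp add: s_0 F_def)
    have I2b: "\<bar>I2\<bar> \<le> K / (2 * \<eta>)" using I2[of 0] by (simp add: s_0)
    have Pb: "P0 / 2 \<le> P r" "P r \<le> 2 * P0" "0 < P r" if "0 \<le> r" for r
      using global_profile_basic(3,4)[OF g that] P0_pos unfolding P_def by linarith+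
    have Pl1: "\<bar>P r - Pinf\<bar> \<le> C1 * s r" if "0 \<le> r" for r
    proof -
      have "\<epsilon> * (C1 * s r) \<le> 1 * (C1 * s r)" using e C1 s01[OF that] by (intro mult_right_mono) auto
      then show ?thesis using Pl[OF that] by (simp add: mult.assoc)
    qed
    define A where "A = - R * P0 + n * \<epsilon> * I1"
    define u where "u = 2 * A / Pinf"
    have uP: "Pinf * u = 2 * A" unfolding u_def using Pinf0 by simp
    have nI: "\<bar>n * \<epsilon> * I1\<bar> \<le> n * C2 * \<epsilon>"
    proof -
      have "(n * \<epsilon>) * \<bar>I1\<bar> \<le> (n * \<epsilon>) * C2" using I1b nm e by (intro mult_left_mono) auto
      then show ?thesis using nm e by (simp add: abs_mult mult_ac)
    qed
    have Ab: "\<bar>A\<bar> \<le> C3"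
    proof -
      have "n * C2 * \<epsilon> \<le> n * C2 * 1" using nm C2 e by (intro mult_left_mono) auto
      moreover have "0 < R * P0" using pos by simp
      ultimately show ?thesis unfolding A_def C3_def using nI by linarith
    qed
    have ub: "\<bar>u\<bar> \<le> C4"
    proof -
      have "\<bar>u\<bar> = 2 * \<bar>A\<bar> / Pinf" unfolding u_def using Pinf0 by (simp add: abs_mult)
      also have "\<dots> \<le> 2 * C3 / (P0 / 2)" using Ab Pinf2 P0_pos by (intro frac_le) auto
      finally show ?thesis unfolding C4_def by simp
    qed
    have uR: "\<bar>u + 2 * R\<bar> \<le> C5 * \<epsilon>"
    proof -
      have "u + 2 * R = 2 * (A + R * Pinf) / Pinf" unfolding u_def using Pinf0 by (simp add: field_simps)
      then have "\<bar>u + 2 * R\<bar> = 2 * \<bar>A + R * Pinf\<bar> / Pinf" unfolding abs_divide abs_mult using Pinf0 by (simp only: abs_divide abs_mult abs_of_pos abs_numeral)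
      also have "\<dots> \<le> 2 * ((R * C1 + n * C2) * \<epsilon>) / (P0 / 2)"
      proof (rule frac_le)
        have eq: "A + R * Pinf = R * (Pinf - P0) + n * \<epsilon> * I1" unfolding A_def by (simp add: algebra_simps)
        have "\<bar>R * (Pinf - P0)\<bar> \<le> R * (\<epsilon> * C1)"
          using mult_left_mono[OF Pinf, of R] R_pos by (simp add: abs_mult abs_minus_commute)
        then have "\<bar>A + R * Pinf\<bar> \<le> R * (\<epsilon> * C1) + n * C2 * \<epsilon>"
          unfolding eq using nI by (rule order_trans[OF abs_triangle_ineq add_mono])
        also have "\<dots> = (R * C1 + n * C2) * \<epsilon>" by (simp add: algebra_simps)
        finally show "2 * \<bar>A + R * Pinf\<bar> \<le> 2 * ((R * C1 + n * C2) * \<epsilon>)" by simp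
      qed (use Pinf2 P0_pos R_pos C1 C2 nm e in auto)
      also have "\<dots> = C5 * \<epsilon>" unfolding C5_def by (simp add: field_simps)
      finally show ?thesis .
    qed
    have u0: "u < 0" using uR sm(2) by (simp add: mult.commute)
    have vP: "\<bar>P r * v r / 2 - A\<bar> \<le> C6 * s r" if r: "0 \<le> r" for r
    proof -
      have eq: "P r * v r / 2 - A = \<epsilon> * (P r * (r ^ 4 * (mean d \<xi> r)\<^sup>2)) + R * (P r * temp \<zeta> r) + n * \<epsilon> * (F r - I1) - \<nu> * (r * \<xi> r)"
        using momentum_balance[OF g r] unfolding P_def v_def F_def A_def n_def by (simp add: algebra_simps)
      have "\<bar>\<epsilon> * (P r * (r ^ 4 * (mean d \<xi> r)\<^sup>2))\<bar> \<le> 1 * (2 * P0 * M\<^sup>2 / \<eta> ^ 4 * s r)"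
        unfolding abs_mult[of \<epsilon>] P_def s_def using mean_square_bound[OF g r, of 4 2] e by (intro mult_mono) auto
      moreover have "\<bar>R * (P r * temp \<zeta> r)\<bar> \<le> R * ((2 * P0) * (K * s r))"
        unfolding abs_mult s_def using Pb[OF r] temp_bound[OF g r] R_pos P0_pos by (intro mult_mono) auto
      moreover have "\<bar>n * \<epsilon> * (F r - I1)\<bar> \<le> n * 1 * (C2 * s r)"
        unfolding abs_mult using I1[OF r] nm e by (intro mult_mono) auto
      moreover have "\<bar>\<nu> * (r * \<xi> r)\<bar> \<le> \<nu> * (M / \<eta> * s r)"
      proof -
        have "r * \<bar>\<xi> r\<bar> \<le> r * (M * decay \<eta> r ^ 3)" using global_profile_basic(1)[OF g r] r by (intro mult_left_mono) auto
        also have "\<dots> = M * (r * decay \<eta> r) * s r" unfolding s_def by (simp add: power2_eq_square power3_eq_cube)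
        also have "\<dots> \<le> M * (1 / \<eta>) * s r" using sigma(3)[OF r] M_pos s01[OF r] by (intro mult_right_mono mult_left_mono) auto
        finally have "\<nu> * (r * \<bar>\<xi> r\<bar>) \<le> \<nu> * (M * (1 / \<eta>) * s r)" using nu_pos by (intro mult_left_mono) auto
        then show ?thesis using r nu_pos by (simp add: abs_mult)
      qed
      ultimately have "\<bar>P r * v r / 2 - A\<bar> \<le> 1 * (2 * P0 * M\<^sup>2 / \<eta> ^ 4 * s r) + R * ((2 * P0) * (K * s r)) + n * 1 * (C2 * s r) + \<nu> * (M / \<eta> * s r)"
        unfolding eq by linarith
      also have "\<dots> = C6 * s r" unfolding C6_def by (simp add: algebra_simps)
      finally show ?thesis .
    qed
    have vu: "\<bar>v r - u\<bar> \<le> C7 * s r" if r: "0 \<le> r" for r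
    proof -
      have A_eq: "A = Pinf * u / 2" using uP by simp
      have "P r / 2 * (v r - u) = (P r * v r / 2 - A) - (P r - Pinf) * u / 2"
        unfolding A_eq by (simp add: field_simps)
      moreover have "\<bar>(P r - Pinf) * u / 2\<bar> \<le> (C1 * s r) * C4 / 2"
        using mult_mono[OF Pl1[OF r] ub] C1 s01[OF r] by (simp add: abs_mult)
      ultimately have "\<bar>P r / 2 * (v r - u)\<bar> \<le> C6 * s r + (C1 * s r) * C4 / 2" using vP[OF r] by linarith
      also have "\<dots> = (C6 + C1 * C4 / 2) * s r" by (simp add: algebra_simps)
      finally have x: "P r / 2 * \<bar>v r - u\<bar> \<le> (C6 + C1 * C4 / 2) * s r" using Pb[OF r] by (simp add: abs_mult)
      have "P0 / 4 * \<bar>v r - u\<bar> \<le> P r / 2 * \<bar>v r - u\<bar>" using Pb[OF r] by (intro mult_right_mono) auto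
      with x have "P0 / 4 * \<bar>v r - u\<bar> \<le> (C6 + C1 * C4 / 2) * s r" by linarith
      then show ?thesis unfolding C7_def using P0_pos by (simp add: field_simps)
    qed
    define G where "G = - (1/4) * (Pinf * u\<^sup>2) + m * I2"
    have u2: "u\<^sup>2 \<le> C4\<^sup>2" using ub by (metis abs_ge_zero power2_abs power_mono)
    have Gb: "\<bar>G\<bar> \<le> C9"
    proof -
      have "\<bar>- (1/4) * (Pinf * u\<^sup>2)\<bar> = (1/4) * (Pinf * u\<^sup>2)" using Pinf0 by (simp add: abs_mult)
      moreover have "Pinf * u\<^sup>2 \<le> (2 * P0) * C4\<^sup>2" using Pinf2 u2 P0_pos by (intro mult_mono) auto
      moreover have "\<bar>m * I2\<bar> \<le> m * (K / (2 * \<eta>))" unfolding abs_mult using I2b nm by (intro mult_mono) auto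
      ultimately show ?thesis unfolding G_def C9_def by simp
    qed
    have GG: "\<bar>heat_total \<epsilon> \<xi> \<zeta> r - G\<bar> \<le> C8 * s r" if r: "0 \<le> r" for r
    proof -
      have eq: "heat_total \<epsilon> \<xi> \<zeta> r - G = - (1/4) * (P r * ((v r - u) * (v r + u)) + (P r - Pinf) * u\<^sup>2)
          + r * heat_flux \<epsilon> \<xi> \<zeta> r + m * (integral {0..r} (heat_flux \<epsilon> \<xi> \<zeta>) - I2)"
        unfolding heat_total_def G_def P_def v_def m_def by (simp add: algebra_simps power2_eq_square eval_nat_numeral)
      have vb: "\<bar>v r\<bar> \<le> M / \<eta> ^ 3"
      proof -
        have "r ^ 3 * \<bar>mean d \<xi> r\<bar> \<le> r ^ 3 * (M * decay \<eta> r ^ 3)" using global_profile_basic(2)[OF g r] r by (intro mult_left_mono) auto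
        also have "\<dots> = M * (r ^ 3 * decay \<eta> r ^ 3)" by simp
        also have "\<dots> \<le> M * (1 / \<eta> ^ 3)" using radius_power_decay[OF r] M_pos by (intro mult_left_mono) auto
        finally show ?thesis unfolding v_def using r by (simp add: abs_mult)
      qed
      have lin: "\<bar>- (1/4) * (x1 + x2) + x3 + x4\<bar> \<le> (1/4) * (y1 + y2) + y3 + y4"
        if "\<bar>x1\<bar> \<le> y1" "\<bar>x2\<bar> \<le> y2" "\<bar>x3\<bar> \<le> y3" "\<bar>x4\<bar> \<le> y4" for x1 x2 x3 x4 y1 y2 y3 y4 :: real
      proof -
        have "x1 \<le> y1" "- x1 \<le> y1" "x2 \<le> y2" "- x2 \<le> y2" "x3 \<le> y3" "- x3 \<le> y3" "x4 \<le> y4" "- x4 \<le> y4"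
          using that by linarith+
        then show ?thesis by (simp add: abs_le_iff field_simps)
      qed
      have "\<bar>v r + u\<bar> \<le> M / \<eta> ^ 3 + C4" using vb ub by linarith
      then have "\<bar>P r * ((v r - u) * (v r + u))\<bar> \<le> (2 * P0) * ((C7 * s r) * (M / \<eta> ^ 3 + C4))"
        unfolding abs_mult using Pb[OF r] vu[OF r] P0_pos C7 s01[OF r] by (intro mult_mono) auto
      moreover have "\<bar>(P r - Pinf) * u\<^sup>2\<bar> \<le> (C1 * s r) * C4\<^sup>2"
        unfolding abs_mult using Pl1[OF r] u2 C1 s01[OF r] by (intro mult_mono) auto
      moreover have "\<bar>r * heat_flux \<epsilon> \<xi> \<zeta> r\<bar> \<le> K / \<eta> * s r"
      proof -
        have "r * \<bar>heat_flux \<epsilon> \<xi> \<zeta> r\<bar> \<le> r * (K * decay \<eta> r ^ 3)" using flux_bound[OF g r] r by (intro mult_left_mono) auto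
        also have "\<dots> = K * (r * decay \<eta> r) * s r" unfolding s_def by (simp add: power2_eq_square power3_eq_cube)
        also have "\<dots> \<le> K * (1 / \<eta>) * s r" using sigma(3)[OF r] K_pos s01[OF r] by (intro mult_right_mono mult_left_mono) auto
        finally show ?thesis using r by (simp add: abs_mult)
      qed
      moreover have "\<bar>m * (integral {0..r} (heat_flux \<epsilon> \<xi> \<zeta>) - I2)\<bar> \<le> m * (K / (2 * \<eta>) * s r)"
        unfolding abs_mult using I2[OF r] nm by (intro mult_mono) auto
      ultimately have "\<bar>heat_total \<epsilon> \<xi> \<zeta> r - G\<bar> \<le> (1/4) * ((2 * P0) * ((C7 * s r) * (M / \<eta> ^ 3 + C4)) + (C1 * s r) * C4\<^sup>2)
          + K / \<eta> * s r + m * (K / (2 * \<eta>) * s r)"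
        unfolding eq by (rule lin)
      also have "\<dots> = C8 * s r" unfolding C8_def by (simp add: algebra_simps add_divide_distrib)
      finally show ?thesis .
    qed
    define th where "th = 2 * (m * \<kappa> + \<epsilon> * G) / (Cv * Pinf)"
    have CP: "Cv * P0 / 2 \<le> Cv * Pinf" "0 < Cv * Pinf" using Pinf2 Pinf0 Cv_pos by auto
    have eG: "\<bar>\<epsilon> * G\<bar> \<le> C9 * \<epsilon>" using mult_left_mono[OF Gb, of \<epsilon>] e by (simp add: abs_mult mult.commute)
    have mk: "0 < m * \<kappa>" using nm pos by simp
    have thb: "\<bar>th\<bar> \<le> C10"
    proof -
      have "\<bar>th\<bar> = 2 * \<bar>m * \<kappa> + \<epsilon> * G\<bar> / (Cv * Pinf)"
        unfolding th_def using Pinf0 Cv_pos by (simp only: abs_divide abs_mult abs_of_pos abs_numeral)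
      also have "\<dots> \<le> 2 * (m * \<kappa> + C9) / (Cv * P0 / 2)"
      proof (rule frac_le)
        have "C9 * \<epsilon> \<le> C9 * 1" using C9 e by (intro mult_left_mono) auto
        then have "\<bar>\<epsilon> * G\<bar> \<le> C9" using eG by simp
        moreover have "\<bar>m * \<kappa>\<bar> \<le> m * \<kappa>" using mk by simp
        ultimately have "\<bar>m * \<kappa> + \<epsilon> * G\<bar> \<le> m * \<kappa> + C9"
          by (intro order_trans[OF abs_triangle_ineq] add_mono)
        then show "2 * \<bar>m * \<kappa> + \<epsilon> * G\<bar> \<le> 2 * (m * \<kappa> + C9)" by simp
      qed (use CP pos mk C9 in auto)
      also have "\<dots> = C10" unfolding C10_def using pos by (simp add: field_simps)
      finally show ?thesis .
    qed
    have thd: "\<bar>th - 2 * (real d - 2) * \<kappa> / (Cv * P0)\<bar> \<le> C11 * \<epsilon>"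
    proof -
      have "th - 2 * m * \<kappa> / (Cv * P0) = 2 * (m * \<kappa> * (P0 - Pinf) + \<epsilon> * G * P0) / (Cv * (Pinf * P0))"
        unfolding th_def using Pinf0 P0_pos Cv_pos by (simp add: field_simps)
      then have "\<bar>th - 2 * m * \<kappa> / (Cv * P0)\<bar> = 2 * \<bar>m * \<kappa> * (P0 - Pinf) + \<epsilon> * G * P0\<bar> / (Cv * (Pinf * P0))"
        using Pinf0 P0_pos Cv_pos by (simp only: abs_divide abs_mult abs_of_pos abs_numeral)
      also have "\<dots> \<le> 2 * ((m * \<kappa> * C1 + C9 * P0) * \<epsilon>) / (Cv * (P0 / 2 * P0))"
      proof (rule frac_le)
        have 1: "\<bar>m * \<kappa> * (P0 - Pinf)\<bar> \<le> m * \<kappa> * (\<epsilon> * C1)"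
          using mult_left_mono[OF Pinf, of "m * \<kappa>"] mk nm pos by (simp add: abs_mult)
        have 2: "\<bar>\<epsilon> * G * P0\<bar> \<le> C9 * \<epsilon> * P0"
          using mult_right_mono[OF eG, of P0] P0_pos by (simp add: abs_mult)
        have "\<bar>m * \<kappa> * (P0 - Pinf) + \<epsilon> * G * P0\<bar> \<le> m * \<kappa> * (\<epsilon> * C1) + C9 * \<epsilon> * P0"
          by (rule order_trans[OF abs_triangle_ineq add_mono[OF 1 2]])
        also have "\<dots> = (m * \<kappa> * C1 + C9 * P0) * \<epsilon>" by (simp add: algebra_simps)
        finally show "2 * \<bar>m * \<kappa> * (P0 - Pinf) + \<epsilon> * G * P0\<bar> \<le> 2 * ((m * \<kappa> * C1 + C9 * P0) * \<epsilon>)" by simp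
        show "Cv * (P0 / 2 * P0) \<le> Cv * (Pinf * P0)" using Pinf2 P0_pos Cv_pos by (intro mult_left_mono mult_right_mono) auto
        show "0 \<le> 2 * ((m * \<kappa> * C1 + C9 * P0) * \<epsilon>)"
          using nm kappa_pos C1 C9 P0_pos e by (intro mult_nonneg_nonneg add_nonneg_nonneg) auto
        show "0 < Cv * (P0 / 2 * P0)" using pos by simp
      qed
      also have "\<dots> = C11 * \<epsilon>" unfolding C11_def using pos by (simp add: field_simps power2_eq_square)
      finally show ?thesis unfolding m_def .
    qed
    have th0: "0 < th"
    proof -
      have "C11 * \<epsilon> < 2 * (m * \<kappa>) / (Cv * P0)"
        using sm(3) pos by (simp add: pos_less_divide_eq mult.commute)
      then show ?thesis using thd unfolding m_def[symmetric] by (simp add: mult.assoc)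
    qed
    have src: "\<bar>(real d - 2) + \<epsilon> * heat_total \<epsilon> \<xi> \<zeta> t / \<kappa> - Cv / (2 * \<kappa>) * density \<epsilon> \<xi> t * th - (real d - 4) * th / t\<^sup>2\<bar> \<le> C12 / t\<^sup>2"
      if t: "p \<le> t" for t
    proof -
      have t1: "1 \<le> t" "0 \<le> t" using t p1 by auto
      have bal: "m + \<epsilon> * G / \<kappa> = Cv / (2 * \<kappa>) * Pinf * th"
        unfolding th_def using CP kappa_pos Pinf0 Cv_pos by (simp add: field_simps)
      have "(real d - 2) + \<epsilon> * heat_total \<epsilon> \<xi> \<zeta> t / \<kappa> - Cv / (2 * \<kappa>) * density \<epsilon> \<xi> t * th - (real d - 4) * th / t\<^sup>2
        = (m + \<epsilon> * G / \<kappa> - Cv / (2 * \<kappa>) * Pinf * th) + \<epsilon> * (heat_total \<epsilon> \<xi> \<zeta> t - G) / \<kappa>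
          - Cv / (2 * \<kappa>) * (P t - Pinf) * th - (real d - 4) * th / t\<^sup>2"
        unfolding m_def P_def by (simp add: algebra_simps diff_divide_distrib)
      also have "\<dots> = \<epsilon> * (heat_total \<epsilon> \<xi> \<zeta> t - G) / \<kappa> - Cv / (2 * \<kappa>) * (P t - Pinf) * th - (real d - 4) * th / t\<^sup>2"
        unfolding bal by simp
      also have "\<bar>\<dots>\<bar> \<le> C8 / \<kappa> * s t + Cv / (2 * \<kappa>) * (C1 * s t) * C10 + real d * C10 / t\<^sup>2"
      proof -
        have h1: "\<bar>\<epsilon> * (heat_total \<epsilon> \<xi> \<zeta> t - G) / \<kappa>\<bar> \<le> C8 / \<kappa> * s t"
        proof -
          have "\<epsilon> * \<bar>heat_total \<epsilon> \<xi> \<zeta> t - G\<bar> \<le> 1 * (C8 * s t)"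
            by (rule mult_mono[OF e(2) GG[OF t1(2)]]) auto
          then have "\<epsilon> * \<bar>heat_total \<epsilon> \<xi> \<zeta> t - G\<bar> / \<kappa> \<le> 1 * (C8 * s t) / \<kappa>"
            using kappa_pos by (intro divide_right_mono) auto
          also have "\<dots> = C8 / \<kappa> * s t" by simp
          finally have "\<epsilon> * \<bar>heat_total \<epsilon> \<xi> \<zeta> t - G\<bar> / \<kappa> \<le> C8 / \<kappa> * s t" .
          then show ?thesis using e kappa_pos by (simp only: abs_divide abs_mult abs_of_pos)
        qed
        have h2: "\<bar>Cv / (2 * \<kappa>) * (P t - Pinf) * th\<bar> \<le> Cv / (2 * \<kappa>) * (C1 * s t) * C10"
          unfolding abs_mult using Pl1[OF t1(2)] thb Cv_pos kappa_pos C1 s01[OF t1(2)] by (intro mult_mono) auto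
        have h3: "\<bar>(real d - 4) * th / t\<^sup>2\<bar> \<le> real d * C10 / t\<^sup>2"
        proof -
          have "\<bar>real d - 4\<bar> \<le> real d" using d_ge by linarith
          then have "\<bar>real d - 4\<bar> * \<bar>th\<bar> \<le> real d * C10" using thb by (intro mult_mono) auto
          then show ?thesis by (simp add: abs_mult divide_right_mono)
        qed
        show ?thesis
          by (rule order_trans[OF abs_triangle_ineq4 add_mono[OF order_trans[OF abs_triangle_ineq4 add_mono[OF h1 h2]] h3]])
      qed
      also have "\<dots> = (C8 / \<kappa> + Cv / (2 * \<kappa>) * C1 * C10) * s t + real d * C10 / t\<^sup>2" by (simp add: algebra_simps)
      also have "\<dots> \<le> (C8 / \<kappa> + Cv / (2 * \<kappa>) * C1 * C10) * (1 / \<eta>\<^sup>2 / t\<^sup>2) + real d * C10 / t\<^sup>2"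
      proof -
        have "0 \<le> C8 / \<kappa> + Cv / (2 * \<kappa>) * C1 * C10" using C8 C1 C10 Cv_pos kappa_pos by simp
        then show ?thesis using \<sigma>2[OF t1(1)] unfolding s_def by (intro add_right_mono mult_left_mono) auto
      qed
      also have "\<dots> = C12 / t\<^sup>2" unfolding C12_def by (simp add: add_divide_distrib)
      finally show ?thesis .
    qed
    have far: "\<bar>density \<epsilon> \<xi> r - Pinf\<bar> \<le> C / r\<^sup>2 \<and> \<bar>r ^ 3 * mean d \<xi> r - u\<bar> \<le> C / r\<^sup>2 \<and> \<bar>temp \<zeta> r - th / r\<^sup>2\<bar> \<le> C / r ^ 4"
      if r: "p \<le> r" for r
    proof (intro conjI)
      have r1: "1 \<le> r" "0 \<le> r" using r p1 by auto
      have conv: "B * s r \<le> C / r\<^sup>2" if "B / \<eta>\<^sup>2 \<le> C" "0 \<le> B" for B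
      proof -
        have "B * s r \<le> B * (1 / \<eta>\<^sup>2 / r\<^sup>2)" using \<sigma>2[OF r1(1)] that unfolding s_def by (intro mult_left_mono) auto
        also have "\<dots> = (B / \<eta>\<^sup>2) / r\<^sup>2" by simp
        also have "\<dots> \<le> C / r\<^sup>2" using that by (intro divide_right_mono) auto
        finally show ?thesis .
      qed
      show "\<bar>density \<epsilon> \<xi> r - Pinf\<bar> \<le> C / r\<^sup>2"
        using Pl1[OF r1(2)] conv[OF C(2)] C1 unfolding P_def by linarith
      show "\<bar>r ^ 3 * mean d \<xi> r - u\<bar> \<le> C / r\<^sup>2"
        using vu[OF r1(2)] conv[OF C(3)] C7 unfolding v_def by linarith
      have c2: "(K + \<bar>th\<bar>) * p ^ 4 \<le> c"
      proof -
        have "(K + \<bar>th\<bar>) * p ^ 4 \<le> (K + C10) * p ^ 4" using thb p1 by (intro mult_right_mono) auto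
        moreover have "0 \<le> 2 * C12 / \<alpha>" using C12 \<alpha> by simp
        ultimately show ?thesis unfolding c_def by linarith
      qed
      have c1: "2 * C12 / (Cv * P0 / (4 * \<kappa>)) \<le> c"
        unfolding c_def \<alpha>_def using K_pos C10 p1 by simp
      have "\<bar>temp \<zeta> r - th / r\<^sup>2\<bar> \<le> c / r ^ 4"
        by (rule inverse_square_barrier[OF g p1 p2[unfolded \<alpha>_def] less_imp_le[OF C12] src c1 c2 r])
      also have "\<dots> \<le> C / r ^ 4" using C(4) r1 by (intro divide_right_mono) auto
      finally show "\<bar>temp \<zeta> r - th / r\<^sup>2\<bar> \<le> C / r ^ 4" .
    qed
    have "C5 * \<epsilon> \<le> C * \<epsilon>" "C11 * \<epsilon> \<le> C * \<epsilon>" using C(5,6) e by (auto intro!: mult_right_mono)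
    then show "\<exists>Pinf u th. 0 < Pinf \<and> u < 0 \<and> 0 < th \<and>
       (\<forall>r\<ge>p. \<bar>density \<epsilon> \<xi> r - Pinf\<bar> \<le> C / r\<^sup>2 \<and> \<bar>r ^ 3 * mean d \<xi> r - u\<bar> \<le> C / r\<^sup>2 \<and> \<bar>temp \<zeta> r - th / r\<^sup>2\<bar> \<le> C / r ^ 4) \<and>
       \<bar>u + 2 * R\<bar> \<le> C * \<epsilon> \<and> \<bar>th - 2 * (real d - 2) * \<kappa> / (Cv * P0)\<bar> \<le> C * \<epsilon>"
      using Pinf0 u0 th0 far uR thd by (intro exI[of _ Pinf] exI[of _ u] exI[of _ th]) force
  qed
qed

end

section \<open>Existence, uniqueness and asymptotics\<close>

theorem theorem3p2:
  fixes d :: nat and R \<mu> lam C\<^sub>V \<kappa> P\<^sub>0 :: real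
  assumes "d \<ge> 3"
    and "R > 0" and "\<mu> > 0" and "lam > 0" and "C\<^sub>V > 0" and "\<kappa> > 0" and "P\<^sub>0 > 0"
  shows "\<exists>\<epsilon>>0. \<exists>C>0. \<exists>r\<^sub>1>0. \<forall>\<Theta>\<^sub>0. 0 < \<Theta>\<^sub>0 \<and> \<Theta>\<^sub>0 < \<epsilon> \<longrightarrow>
    (\<exists>P U \<Theta>.
       profile_solution d R \<mu> lam C\<^sub>V \<kappa> P\<^sub>0 \<Theta>\<^sub>0 P U \<Theta> \<and>
       (\<forall>P2 U2 \<Theta>2. profile_solution d R \<mu> lam C\<^sub>V \<kappa> P\<^sub>0 \<Theta>\<^sub>0 P2 U2 \<Theta>2 \<longrightarrow>
          (\<forall>r\<ge>0. P2 r = P r \<and> U2 r = U r \<and> \<Theta>2 r = \<Theta> r)) \<and>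
       (\<forall>r\<ge>0. \<bar>U r\<bar> \<le> C * (\<Theta>\<^sub>0 * r\<^sup>2 / (1 + r) ^ 3) \<and>
              \<bar>hderiv U r\<bar> \<le> C * (\<Theta>\<^sub>0 * r / (1 + r) ^ 3) \<and>
              \<bar>\<Theta> r\<bar> \<le> C * (\<Theta>\<^sub>0 / (1 + r)\<^sup>2) \<and>
              \<bar>hderiv \<Theta> r\<bar> \<le> C * (\<Theta>\<^sub>0 * r / (1 + r)\<^sup>2)) \<and>
       (\<exists>Pinf Uinf \<Theta>inf. Pinf > 0 \<and> Uinf < 0 \<and> \<Theta>inf > 0 \<and>
          (\<forall>r\<ge>r\<^sub>1. \<bar>P r - Pinf\<bar> \<le> C * (1 / r\<^sup>2) \<and>
                  \<bar>U r - Uinf / r\<bar> \<le> C * (1 / r ^ 3) \<and>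
                  \<bar>\<Theta> r - \<Theta>inf / r\<^sup>2\<bar> \<le> C * (1 / r ^ 4)) \<and>
          \<bar>Uinf - (- 2 * R * \<Theta>\<^sub>0)\<bar> \<le> C * \<Theta>\<^sub>0\<^sup>2 \<and>
          \<bar>\<Theta>inf - 2 * (real d - 2) * \<kappa> / (C\<^sub>V * P\<^sub>0) * \<Theta>\<^sub>0\<bar> \<le> C * \<Theta>\<^sub>0\<^sup>2))"
proof -
  interpret gas d R \<mu> lam C\<^sub>V \<kappa> P\<^sub>0
    by unfold_locales (use assms in auto)
  obtain \<eta> where eta: "0 < \<eta>" "9 * \<eta>\<^sup>2 \<le> P\<^sub>0 / (4 * \<nu>)" "9 * \<eta>\<^sup>2 \<le> C\<^sub>V * P\<^sub>0 / (4 * \<kappa>)"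
    by (rule eta_exists)
  obtain zb wb B where base: "0 < B" "\<And>T. picard_step 0 T (\<lambda>_. 0) (\<lambda>_. 0) zb wb"
    "\<And>r. 0 \<le> r \<Longrightarrow> \<bar>zb r\<bar> \<le> B * decay \<eta> r ^ 3" "\<And>r. 0 \<le> r \<Longrightarrow> \<bar>wb r\<bar> \<le> B * decay \<eta> r ^ 3"
    "\<And>r. 0 \<le> r \<Longrightarrow> \<bar>div_new 0 (\<lambda>_. 0) zb wb r\<bar> \<le> B * decay \<eta> r ^ 3"
    by (rule base_solution_exists[OF eta]) (rule that)
  interpret based_gas d R \<mu> lam C\<^sub>V \<kappa> P\<^sub>0 \<eta> B zb wb
    by unfold_locales (use eta base in auto)
  obtain K where K: "0 < K"
    "\<And>\<epsilon> \<xi> \<zeta> r. global_profile \<epsilon> \<xi> \<zeta> \<Longrightarrow> 0 \<le> r \<Longrightarrow> \<bar>density \<epsilon> \<xi> r - P\<^sub>0\<bar> \<le> K * \<epsilon>"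
    "\<And>\<epsilon> \<xi> \<zeta> r. global_profile \<epsilon> \<xi> \<zeta> \<Longrightarrow> 0 \<le> r \<Longrightarrow> \<bar>temp \<zeta> r\<bar> \<le> K * decay \<eta> r ^ 2"
    "\<And>\<epsilon> \<xi> \<zeta> r. global_profile \<epsilon> \<xi> \<zeta> \<Longrightarrow> 0 \<le> r \<Longrightarrow> \<bar>temp_slope \<epsilon> \<xi> \<zeta> \<zeta> r\<bar> \<le> K * decay \<eta> r"
    "\<And>\<epsilon> \<xi> \<zeta> r. global_profile \<epsilon> \<xi> \<zeta> \<Longrightarrow> 0 \<le> r \<Longrightarrow> \<bar>heat_flux \<epsilon> \<xi> \<zeta> r\<bar> \<le> K * decay \<eta> r ^ 3"
    "\<And>\<epsilon> \<xi> \<zeta> r. global_profile \<epsilon> \<xi> \<zeta> \<Longrightarrow> 0 \<le> r \<Longrightarrow> \<bar>mean d \<xi> r * work \<epsilon> \<xi> \<zeta> r\<bar> \<le> K * decay \<eta> r ^ 3"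
    by (rule uniform_bounds) (rule that)
  interpret bounded_profiles d R \<mu> lam C\<^sub>V \<kappa> P\<^sub>0 \<eta> B zb wb K
    by unfold_locales (use K in auto)
  obtain \<epsilon>1 where e1: "0 < \<epsilon>1" "\<epsilon>1 \<le> 1" "\<epsilon>1 * M \<le> \<eta> / 8"
    and ex: "\<And>\<epsilon>. 0 < \<epsilon> \<Longrightarrow> \<epsilon> \<le> \<epsilon>1 \<Longrightarrow> \<exists>\<xi> \<zeta>. \<forall>T\<ge>0. admissible \<eta> M \<epsilon> T \<xi> \<and> admissible \<eta> M \<epsilon> T \<zeta> \<and> fixed_profile \<epsilon> T \<xi> \<zeta>"
    and improve: "\<And>\<epsilon> T \<xi> \<zeta> r. 0 < \<epsilon> \<Longrightarrow> \<epsilon> \<le> \<epsilon>1 \<Longrightarrow> admissible \<eta> M \<epsilon> T \<xi> \<Longrightarrow> admissible \<eta> M \<epsilon> T \<zeta> \<Longrightarrow> fixed_profile \<epsilon> T \<xi> \<zeta> \<Longrightarrow>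
       0 \<le> r \<Longrightarrow> r \<le> T \<Longrightarrow> \<bar>\<xi> r\<bar> \<le> M / 2 * decay \<eta> r ^ 3 \<and> \<bar>\<zeta> r\<bar> \<le> M / 2 * decay \<eta> r ^ 3"
    and unique: "\<And>\<epsilon> T \<xi> \<zeta> \<xi>' \<zeta>' r. 0 < \<epsilon> \<Longrightarrow> \<epsilon> \<le> \<epsilon>1 \<Longrightarrow> admissible \<eta> M \<epsilon> T \<xi> \<Longrightarrow> admissible \<eta> M \<epsilon> T \<zeta> \<Longrightarrow> fixed_profile \<epsilon> T \<xi> \<zeta> \<Longrightarrow>
       admissible \<eta> M \<epsilon> T \<xi>' \<Longrightarrow> admissible \<eta> M \<epsilon> T \<zeta>' \<Longrightarrow> fixed_profile \<epsilon> T \<xi>' \<zeta>' \<Longrightarrow>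
       0 \<le> r \<Longrightarrow> r \<le> T \<Longrightarrow> \<xi>' r = \<xi> r \<and> \<zeta>' r = \<zeta> r"
    by (rule fixed_profile_exists_unique) (rule that)
  obtain L where L: "0 < L" "\<And>\<epsilon> \<xi> \<zeta> r. global_profile \<epsilon> \<xi> \<zeta> \<Longrightarrow> 0 \<le> r \<Longrightarrow> \<bar>temp_slope \<epsilon> \<xi> \<zeta> \<zeta> r\<bar> \<le> L * r"
    by (rule slope_near_origin) (rule that)
  obtain C0 p \<epsilon>2 where far: "0 < C0" "1 \<le> p" "0 < \<epsilon>2"
    "\<And>\<epsilon> \<xi> \<zeta>. global_profile \<epsilon> \<xi> \<zeta> \<Longrightarrow> \<epsilon> \<le> \<epsilon>2 \<Longrightarrow> \<exists>Pinf u th. 0 < Pinf \<and> u < 0 \<and> 0 < th \<and>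
       (\<forall>r\<ge>p. \<bar>density \<epsilon> \<xi> r - Pinf\<bar> \<le> C0 / r\<^sup>2 \<and> \<bar>r ^ 3 * mean d \<xi> r - u\<bar> \<le> C0 / r\<^sup>2 \<and> \<bar>temp \<zeta> r - th / r\<^sup>2\<bar> \<le> C0 / r ^ 4) \<and>
       \<bar>u + 2 * R\<bar> \<le> C0 * \<epsilon> \<and> \<bar>th - 2 * (real d - 2) * \<kappa> / (C\<^sub>V * P\<^sub>0)\<bar> \<le> C0 * \<epsilon>"
    by (rule far_field) (rule that)
  (* The weight 1/(1 + \<eta> r) is comparable to the weight 1/(1 + r) of the theorem. *)
  define a where "a = 1 + 1 / \<eta>"
  have a: "1 \<le> a" unfolding a_def using eta by simp
  have \<sigma>: "decay \<eta> r \<le> a / (1 + r)" if "0 \<le> r" for r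
  proof -
    have "1 + r \<le> a * (1 + \<eta> * r)" unfolding a_def using eta that by (simp add: field_simps)
    moreover have "0 < 1 + \<eta> * r" "0 < 1 + r" using eta that by (simp_all add: add_pos_nonneg)
    ultimately show ?thesis unfolding decay_def by (simp add: field_simps)
  qed
  have \<sigma>n: "decay \<eta> r ^ n \<le> a ^ n / (1 + r) ^ n" if "0 \<le> r" for r n
    using power_mono[OF \<sigma>[OF that], of n] sigma(1)[OF that] by (simp add: power_divide)
  define C where "C = real d * M * a ^ 3 + K * a\<^sup>2 + 4 * L + 2 * K * a + C0"
  have "0 < a" using a by linarith
  then have parts: "0 < real d * M * a ^ 3" "0 < K * a\<^sup>2" "0 < 4 * L" "0 < 2 * K * a" "M * a ^ 3 \<le> real d * M * a ^ 3"
    using d_ge M_pos K L by (auto simp: mult_le_cancel_right1)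
  have C: "0 < C" "M * a ^ 3 \<le> C" "real d * M * a ^ 3 \<le> C" "K * a\<^sup>2 \<le> C" "4 * L \<le> C" "2 * K * a \<le> C" "C0 \<le> C"
    unfolding C_def using parts far(1) by linarith+
  define \<epsilon> where "\<epsilon> = min \<epsilon>1 (min \<epsilon>2 (\<nu> / (16 * R * P\<^sub>0)))"
  have \<epsilon>: "0 < \<epsilon>" unfolding \<epsilon>_def using e1 far nu_pos R_pos P0_pos by simp
  show ?thesis
  proof (rule exI[of _ \<epsilon>], intro conjI, rule \<epsilon>, rule exI[of _ C], intro conjI, rule C(1), rule exI[of _ p], intro conjI allI impI)
    show "0 < p" using far by simp
  next
    fix \<Theta>\<^sub>0 :: real assume "0 < \<Theta>\<^sub>0 \<and> \<Theta>\<^sub>0 < \<epsilon>"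
    then have e: "0 < \<Theta>\<^sub>0" "\<Theta>\<^sub>0 \<le> \<epsilon>1" "\<Theta>\<^sub>0 \<le> \<epsilon>2" "\<Theta>\<^sub>0 \<le> \<nu> / (16 * R * P\<^sub>0)" "\<Theta>\<^sub>0 \<le> 1"
      using e1 unfolding \<epsilon>_def by auto
    have small: "16 * (R * \<Theta>\<^sub>0 * P\<^sub>0) \<le> \<nu>"
      using e(4) R_pos P0_pos by (simp add: pos_le_divide_eq mult_ac)
    have smallM: "\<Theta>\<^sub>0 * M \<le> \<eta> / 8"
      using mult_right_mono[OF e(2), of M] M_pos e1(3) by linarith
    obtain \<xi> \<zeta> where sol: "\<forall>T\<ge>0. admissible \<eta> M \<Theta>\<^sub>0 T \<xi> \<and> admissible \<eta> M \<Theta>\<^sub>0 T \<zeta> \<and> fixed_profile \<Theta>\<^sub>0 T \<xi> \<zeta>"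
      using ex[OF e(1,2)] by blast
    have g: "global_profile \<Theta>\<^sub>0 \<xi> \<zeta>" using sol e by (simp add: global_profile_def)
    note gD = global_profileD(1)[OF g] global_profileD(3-5)[OF g]
    obtain Pinf u th where lim: "0 < Pinf" "u < 0" "0 < th"
      "\<And>r. p \<le> r \<Longrightarrow> \<bar>density \<Theta>\<^sub>0 \<xi> r - Pinf\<bar> \<le> C0 / r\<^sup>2" "\<And>r. p \<le> r \<Longrightarrow> \<bar>r ^ 3 * mean d \<xi> r - u\<bar> \<le> C0 / r\<^sup>2"
      "\<And>r. p \<le> r \<Longrightarrow> \<bar>temp \<zeta> r - th / r\<^sup>2\<bar> \<le> C0 / r ^ 4"
      "\<bar>u + 2 * R\<bar> \<le> C0 * \<Theta>\<^sub>0" "\<bar>th - 2 * (real d - 2) * \<kappa> / (C\<^sub>V * P\<^sub>0)\<bar> \<le> C0 * \<Theta>\<^sub>0"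
      using far(4)[OF g e(3)] by blast
    have scale: "\<Theta>\<^sub>0 * x \<le> C * (\<Theta>\<^sub>0 * y)" if "x \<le> A * y" "A \<le> C" "0 \<le> y" for x y A
    proof -
      have "A * y \<le> C * y" using that by (intro mult_right_mono) auto
      then have "\<Theta>\<^sub>0 * x \<le> \<Theta>\<^sub>0 * (C * y)" using that e(1) by (intro mult_left_mono) auto
      then show ?thesis by (simp add: mult_ac)
    qed
    have bounds: "\<bar>velocity \<Theta>\<^sub>0 \<xi> r\<bar> \<le> C * (\<Theta>\<^sub>0 * r\<^sup>2 / (1 + r) ^ 3) \<and>
              \<bar>hderiv (velocity \<Theta>\<^sub>0 \<xi>) r\<bar> \<le> C * (\<Theta>\<^sub>0 * r / (1 + r) ^ 3) \<and>
              \<bar>temperature \<Theta>\<^sub>0 \<zeta> r\<bar> \<le> C * (\<Theta>\<^sub>0 / (1 + r)\<^sup>2) \<and>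
              \<bar>hderiv (temperature \<Theta>\<^sub>0 \<zeta>) r\<bar> \<le> C * (\<Theta>\<^sub>0 * r / (1 + r)\<^sup>2)" if r: "0 \<le> r" for r
    proof (intro conjI)
      note b = global_profile_basic[OF g r]
      have s3: "M * decay \<eta> r ^ 3 \<le> M * a ^ 3 * (1 / (1 + r) ^ 3)"
        using mult_left_mono[OF \<sigma>n[OF r, of 3], of M] M_pos by simp
      have m: "r\<^sup>2 * \<bar>mean d \<xi> r\<bar> \<le> M * a ^ 3 * (r\<^sup>2 * (1 / (1 + r) ^ 3))"
        using mult_left_mono[of "\<bar>mean d \<xi> r\<bar>" "M * a ^ 3 * (1 / (1 + r) ^ 3)" "r\<^sup>2"] b(2) s3 by (simp add: mult_ac)
      show "\<bar>velocity \<Theta>\<^sub>0 \<xi> r\<bar> \<le> C * (\<Theta>\<^sub>0 * r\<^sup>2 / (1 + r) ^ 3)"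
        using scale[OF m C(2)] r e(1) by (simp add: velocity_eq[OF gD] abs_mult)
      have x: "\<bar>\<xi> r - (real d - 1) * mean d \<xi> r\<bar> \<le> real d * (M * decay \<eta> r ^ 3)"
      proof -
        have "\<bar>(real d - 1) * mean d \<xi> r\<bar> \<le> (real d - 1) * (M * decay \<eta> r ^ 3)"
          unfolding abs_mult using b(2) dn by (intro mult_mono) auto
        then have "\<bar>\<xi> r - (real d - 1) * mean d \<xi> r\<bar> \<le> M * decay \<eta> r ^ 3 + (real d - 1) * (M * decay \<eta> r ^ 3)"
          using b(1) by (intro order_trans[OF abs_triangle_ineq4] add_mono)
        then show ?thesis by (simp add: algebra_simps)
      qed
      have "r * \<bar>\<xi> r - (real d - 1) * mean d \<xi> r\<bar> \<le> r * (real d * (M * a ^ 3 * (1 / (1 + r) ^ 3)))"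
        using r x mult_left_mono[OF s3, of "real d"] by (intro mult_left_mono) auto
      then have x2: "r * \<bar>\<xi> r - (real d - 1) * mean d \<xi> r\<bar> \<le> real d * M * a ^ 3 * (r * (1 / (1 + r) ^ 3))"
        by (simp add: mult_ac)
      show "\<bar>hderiv (velocity \<Theta>\<^sub>0 \<xi>) r\<bar> \<le> C * (\<Theta>\<^sub>0 * r / (1 + r) ^ 3)"
        using scale[OF x2 C(3)] r e(1) by (simp add: hderiv_velocity[OF gD r] abs_mult)
      have t: "\<bar>temp \<zeta> r\<bar> \<le> K * a\<^sup>2 * (1 / (1 + r)\<^sup>2)"
        using K(3)[OF g r] mult_left_mono[OF \<sigma>n[OF r, of 2], of K] K(1) by simp
      show "\<bar>temperature \<Theta>\<^sub>0 \<zeta> r\<bar> \<le> C * (\<Theta>\<^sub>0 / (1 + r)\<^sup>2)"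
        using scale[OF t C(4)] e(1) by (simp add: temperature_def abs_mult)
      have "\<bar>temp_slope \<Theta>\<^sub>0 \<xi> \<zeta> \<zeta> r\<bar> \<le> C * (r * (1 / (1 + r)\<^sup>2))"
      (* The bound L r is used near the origin and the decay K decay \<eta> r away from it. *)
      proof (cases "r \<le> 1")
        case True
        have "(1 + r)\<^sup>2 \<le> 2\<^sup>2" using True r by (intro power_mono) auto
        then have "1 \<le> 4 * (1 / (1 + r)\<^sup>2)" using r by (simp add: pos_le_divide_eq)
        then have "L * r * 1 \<le> L * r * (4 * (1 / (1 + r)\<^sup>2))" using L(1) r by (intro mult_left_mono) auto
        then have "\<bar>temp_slope \<Theta>\<^sub>0 \<xi> \<zeta> \<zeta> r\<bar> \<le> 4 * L * (r * (1 / (1 + r)\<^sup>2))"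
          using L(2)[OF g r] by (simp add: mult_ac)
        also have "\<dots> \<le> C * (r * (1 / (1 + r)\<^sup>2))" using C(5) r by (intro mult_right_mono) auto
        finally show ?thesis .
      next
        case False
        have "1 / (1 + r) \<le> 2 * (r * (1 / (1 + r)\<^sup>2))"
        proof -
          have "(1 + r) / (1 + r)\<^sup>2 \<le> (2 * r) / (1 + r)\<^sup>2" using False by (intro divide_right_mono) auto
          moreover have "(1 + r) / (1 + r)\<^sup>2 = 1 / (1 + r)" using r by (simp add: power2_eq_square)
          ultimately show ?thesis by simp
        qed
        then have "K * a * (1 / (1 + r)) \<le> K * a * (2 * (r * (1 / (1 + r)\<^sup>2)))"
          using K(1) a by (intro mult_left_mono) auto
        moreover have "K * decay \<eta> r \<le> K * (a / (1 + r))" using \<sigma>[OF r] K(1) by (intro mult_left_mono) auto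
        ultimately have "\<bar>temp_slope \<Theta>\<^sub>0 \<xi> \<zeta> \<zeta> r\<bar> \<le> 2 * K * a * (r * (1 / (1 + r)\<^sup>2))"
          using K(4)[OF g r] by (simp add: mult_ac)
        also have "\<dots> \<le> C * (r * (1 / (1 + r)\<^sup>2))" using C(6) r by (intro mult_right_mono) auto
        finally show ?thesis .
      qed
      from scale[OF this order_refl] r e(1)
      show "\<bar>hderiv (temperature \<Theta>\<^sub>0 \<zeta>) r\<bar> \<le> C * (\<Theta>\<^sub>0 * r / (1 + r)\<^sup>2)"
        by (simp add: hderiv_temperature[OF gD r] abs_mult)
    qed
    have asym: "\<bar>density \<Theta>\<^sub>0 \<xi> r - Pinf\<bar> \<le> C * (1 / r\<^sup>2) \<and>
        \<bar>velocity \<Theta>\<^sub>0 \<xi> r - \<Theta>\<^sub>0 * u / r\<bar> \<le> C * (1 / r ^ 3) \<and>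
        \<bar>temperature \<Theta>\<^sub>0 \<zeta> r - \<Theta>\<^sub>0 * th / r\<^sup>2\<bar> \<le> C * (1 / r ^ 4)" if r: "p \<le> r" for r
    proof (intro conjI)
      have r0: "0 < r" using r far by linarith
      have le: "C0 / y \<le> C * (1 / y)" "\<Theta>\<^sub>0 * (C0 / y) \<le> C * (1 / y)" if "0 < y" for y
      proof -
        show 1: "C0 / y \<le> C * (1 / y)" using C(7) that by (simp add: divide_right_mono)
        have "\<Theta>\<^sub>0 * (C0 / y) \<le> 1 * (C0 / y)" using e far(1) that by (intro mult_right_mono) auto
        then show "\<Theta>\<^sub>0 * (C0 / y) \<le> C * (1 / y)" using 1 by linarith
      qed
      show "\<bar>density \<Theta>\<^sub>0 \<xi> r - Pinf\<bar> \<le> C * (1 / r\<^sup>2)"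
        using lim(4)[OF r] le(1)[of "r\<^sup>2"] r0 by (meson order_trans zero_less_power)
      have "velocity \<Theta>\<^sub>0 \<xi> r - \<Theta>\<^sub>0 * u / r = \<Theta>\<^sub>0 * (r ^ 3 * mean d \<xi> r - u) / r"
        using r0 by (simp add: velocity_def field_simps eval_nat_numeral)
      then have "\<bar>velocity \<Theta>\<^sub>0 \<xi> r - \<Theta>\<^sub>0 * u / r\<bar> = \<Theta>\<^sub>0 * \<bar>r ^ 3 * mean d \<xi> r - u\<bar> / r"
        using r0 e(1) by (simp only: abs_divide abs_mult abs_of_pos)
      also have "\<dots> \<le> \<Theta>\<^sub>0 * (C0 / r\<^sup>2) / r"
        using lim(5)[OF r] r0 e(1) by (intro divide_right_mono mult_left_mono) auto
      also have "\<dots> = \<Theta>\<^sub>0 * (C0 / r ^ 3)" by (simp add: eval_nat_numeral)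
      also have "\<dots> \<le> C * (1 / r ^ 3)" using r0 by (intro le(2)) auto
      finally show "\<bar>velocity \<Theta>\<^sub>0 \<xi> r - \<Theta>\<^sub>0 * u / r\<bar> \<le> C * (1 / r ^ 3)" .
      have "temperature \<Theta>\<^sub>0 \<zeta> r - \<Theta>\<^sub>0 * th / r\<^sup>2 = \<Theta>\<^sub>0 * (temp \<zeta> r - th / r\<^sup>2)"
        by (simp add: temperature_def right_diff_distrib)
      then have "\<bar>temperature \<Theta>\<^sub>0 \<zeta> r - \<Theta>\<^sub>0 * th / r\<^sup>2\<bar> = \<Theta>\<^sub>0 * \<bar>temp \<zeta> r - th / r\<^sup>2\<bar>"
        using e(1) by (simp only: abs_mult abs_of_pos)
      also have "\<dots> \<le> \<Theta>\<^sub>0 * (C0 / r ^ 4)" using lim(6)[OF r] e(1) by (intro mult_left_mono) auto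
      also have "\<dots> \<le> C * (1 / r ^ 4)" using r0 by (intro le(2)) auto
      finally show "\<bar>temperature \<Theta>\<^sub>0 \<zeta> r - \<Theta>\<^sub>0 * th / r\<^sup>2\<bar> \<le> C * (1 / r ^ 4)" .
    qed
    have quad: "\<Theta>\<^sub>0 * x \<le> C * \<Theta>\<^sub>0\<^sup>2" if "x \<le> C0 * \<Theta>\<^sub>0" for x
    proof -
      have "C0 * \<Theta>\<^sub>0 \<le> C * \<Theta>\<^sub>0" using C(7) e(1) by (intro mult_right_mono) auto
      then have "\<Theta>\<^sub>0 * x \<le> \<Theta>\<^sub>0 * (C * \<Theta>\<^sub>0)" using that e(1) by (intro mult_left_mono order_trans[OF that]) auto
      then show ?thesis by (simp add: power2_eq_square mult_ac)
    qed
    have Uinf: "\<bar>\<Theta>\<^sub>0 * u - (- 2 * R * \<Theta>\<^sub>0)\<bar> \<le> C * \<Theta>\<^sub>0\<^sup>2"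
    proof -
      have "\<Theta>\<^sub>0 * u - (- 2 * R * \<Theta>\<^sub>0) = \<Theta>\<^sub>0 * (u + 2 * R)" by (simp add: algebra_simps)
      then show ?thesis using quad[OF lim(7)] e(1) by (simp only: abs_mult abs_of_pos)
    qed
    have Tinf: "\<bar>\<Theta>\<^sub>0 * th - 2 * (real d - 2) * \<kappa> / (C\<^sub>V * P\<^sub>0) * \<Theta>\<^sub>0\<bar> \<le> C * \<Theta>\<^sub>0\<^sup>2"
    proof -
      have "\<Theta>\<^sub>0 * th - 2 * (real d - 2) * \<kappa> / (C\<^sub>V * P\<^sub>0) * \<Theta>\<^sub>0 = \<Theta>\<^sub>0 * (th - 2 * (real d - 2) * \<kappa> / (C\<^sub>V * P\<^sub>0))"
        by (simp add: right_diff_distrib)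
      then show ?thesis using quad[OF lim(8)] e(1) by (simp only: abs_mult abs_of_pos)
    qed
    have signs: "\<Theta>\<^sub>0 * u < 0" "0 < \<Theta>\<^sub>0 * th" using lim(2,3) e(1) by (auto simp: mult_pos_neg)
    have profile: "profile_solution d R \<mu> lam C\<^sub>V \<kappa> P\<^sub>0 \<Theta>\<^sub>0 (density \<Theta>\<^sub>0 \<xi>) (velocity \<Theta>\<^sub>0 \<xi>) (temperature \<Theta>\<^sub>0 \<zeta>)"
      by (rule profile_solution[OF gD L(2)[OF g]])
    have uniq: "P2 r = density \<Theta>\<^sub>0 \<xi> r \<and> U2 r = velocity \<Theta>\<^sub>0 \<xi> r \<and> \<Theta>2 r = temperature \<Theta>\<^sub>0 \<zeta> r"
      if "profile_solution d R \<mu> lam C\<^sub>V \<kappa> P\<^sub>0 \<Theta>\<^sub>0 P2 U2 \<Theta>2" "0 \<le> r" for P2 U2 \<Theta>2 r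
    proof (rule profile_solution_unique[OF e(1) small smallM that(1) _ _ gD(2-4) that(2)])
      fix T \<xi>' \<zeta>' r
      assume "admissible \<eta> M \<Theta>\<^sub>0 T \<xi>'" "admissible \<eta> M \<Theta>\<^sub>0 T \<zeta>'" "fixed_profile \<Theta>\<^sub>0 T \<xi>' \<zeta>'" "0 \<le> r" "r \<le> T"
      then show "\<bar>\<xi>' r\<bar> \<le> M / 2 * decay \<eta> r ^ 3 \<and> \<bar>\<zeta>' r\<bar> \<le> M / 2 * decay \<eta> r ^ 3"
        by (rule improve[OF e(1,2)])
    next
      fix T \<xi> \<zeta> \<xi>' \<zeta>' r
      assume "admissible \<eta> M \<Theta>\<^sub>0 T \<xi>" "admissible \<eta> M \<Theta>\<^sub>0 T \<zeta>" "fixed_profile \<Theta>\<^sub>0 T \<xi> \<zeta>"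
        "admissible \<eta> M \<Theta>\<^sub>0 T \<xi>'" "admissible \<eta> M \<Theta>\<^sub>0 T \<zeta>'" "fixed_profile \<Theta>\<^sub>0 T \<xi>' \<zeta>'" "0 \<le> r" "r \<le> T"
      then show "\<xi>' r = \<xi> r \<and> \<zeta>' r = \<zeta> r" by (rule unique[OF e(1,2)])
    qed
    have limits: "\<exists>Pinf Uinf \<Theta>inf. Pinf > 0 \<and> Uinf < 0 \<and> \<Theta>inf > 0 \<and>
          (\<forall>r\<ge>p. \<bar>density \<Theta>\<^sub>0 \<xi> r - Pinf\<bar> \<le> C * (1 / r\<^sup>2) \<and>
                  \<bar>velocity \<Theta>\<^sub>0 \<xi> r - Uinf / r\<bar> \<le> C * (1 / r ^ 3) \<and>
                  \<bar>temperature \<Theta>\<^sub>0 \<zeta> r - \<Theta>inf / r\<^sup>2\<bar> \<le> C * (1 / r ^ 4)) \<and>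
          \<bar>Uinf - (- 2 * R * \<Theta>\<^sub>0)\<bar> \<le> C * \<Theta>\<^sub>0\<^sup>2 \<and>
          \<bar>\<Theta>inf - 2 * (real d - 2) * \<kappa> / (C\<^sub>V * P\<^sub>0) * \<Theta>\<^sub>0\<bar> \<le> C * \<Theta>\<^sub>0\<^sup>2"
    proof (rule exI[of _ Pinf], rule exI[of _ "\<Theta>\<^sub>0 * u"], rule exI[of _ "\<Theta>\<^sub>0 * th"], intro conjI lim(1) signs Uinf Tinf)
      show "\<forall>r\<ge>p. \<bar>density \<Theta>\<^sub>0 \<xi> r - Pinf\<bar> \<le> C * (1 / r\<^sup>2) \<and>
                  \<bar>velocity \<Theta>\<^sub>0 \<xi> r - \<Theta>\<^sub>0 * u / r\<bar> \<le> C * (1 / r ^ 3) \<and>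
                  \<bar>temperature \<Theta>\<^sub>0 \<zeta> r - \<Theta>\<^sub>0 * th / r\<^sup>2\<bar> \<le> C * (1 / r ^ 4)"
        using asym by blast
    qed
    have bounds_all: "\<forall>r\<ge>0. \<bar>velocity \<Theta>\<^sub>0 \<xi> r\<bar> \<le> C * (\<Theta>\<^sub>0 * r\<^sup>2 / (1 + r) ^ 3) \<and>
              \<bar>hderiv (velocity \<Theta>\<^sub>0 \<xi>) r\<bar> \<le> C * (\<Theta>\<^sub>0 * r / (1 + r) ^ 3) \<and>
              \<bar>temperature \<Theta>\<^sub>0 \<zeta> r\<bar> \<le> C * (\<Theta>\<^sub>0 / (1 + r)\<^sup>2) \<and>
              \<bar>hderiv (temperature \<Theta>\<^sub>0 \<zeta>) r\<bar> \<le> C * (\<Theta>\<^sub>0 * r / (1 + r)\<^sup>2)"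
      using bounds by blast
    have uniq_all: "\<forall>P2 U2 \<Theta>2. profile_solution d R \<mu> lam C\<^sub>V \<kappa> P\<^sub>0 \<Theta>\<^sub>0 P2 U2 \<Theta>2 \<longrightarrow>
          (\<forall>r\<ge>0. P2 r = density \<Theta>\<^sub>0 \<xi> r \<and> U2 r = velocity \<Theta>\<^sub>0 \<xi> r \<and> \<Theta>2 r = temperature \<Theta>\<^sub>0 \<zeta> r)"
      by (intro allI impI) (rule uniq)
    from profile uniq_all bounds_all limits
    show "\<exists>P U \<Theta>.
       profile_solution d R \<mu> lam C\<^sub>V \<kappa> P\<^sub>0 \<Theta>\<^sub>0 P U \<Theta> \<and>
       (\<forall>P2 U2 \<Theta>2. profile_solution d R \<mu> lam C\<^sub>V \<kappa> P\<^sub>0 \<Theta>\<^sub>0 P2 U2 \<Theta>2 \<longrightarrow>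
          (\<forall>r\<ge>0. P2 r = P r \<and> U2 r = U r \<and> \<Theta>2 r = \<Theta> r)) \<and>
       (\<forall>r\<ge>0. \<bar>U r\<bar> \<le> C * (\<Theta>\<^sub>0 * r\<^sup>2 / (1 + r) ^ 3) \<and>
              \<bar>hderiv U r\<bar> \<le> C * (\<Theta>\<^sub>0 * r / (1 + r) ^ 3) \<and>
              \<bar>\<Theta> r\<bar> \<le> C * (\<Theta>\<^sub>0 / (1 + r)\<^sup>2) \<and>
              \<bar>hderiv \<Theta> r\<bar> \<le> C * (\<Theta>\<^sub>0 * r / (1 + r)\<^sup>2)) \<and>
       (\<exists>Pinf Uinf \<Theta>inf. Pinf > 0 \<and> Uinf < 0 \<and> \<Theta>inf > 0 \<and>
          (\<forall>r\<ge>p. \<bar>P r - Pinf\<bar> \<le> C * (1 / r\<^sup>2) \<and>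
                  \<bar>U r - Uinf / r\<bar> \<le> C * (1 / r ^ 3) \<and>
                  \<bar>\<Theta> r - \<Theta>inf / r\<^sup>2\<bar> \<le> C * (1 / r ^ 4)) \<and>
          \<bar>Uinf - (- 2 * R * \<Theta>\<^sub>0)\<bar> \<le> C * \<Theta>\<^sub>0\<^sup>2 \<and>
          \<bar>\<Theta>inf - 2 * (real d - 2) * \<kappa> / (C\<^sub>V * P\<^sub>0) * \<Theta>\<^sub>0\<bar> \<le> C * \<Theta>\<^sub>0\<^sup>2)"
      by (intro exI[of _ "density \<Theta>\<^sub>0 \<xi>"] exI[of _ "velocity \<Theta>\<^sub>0 \<xi>"] exI[of _ "temperature \<Theta>\<^sub>0 \<zeta>"] conjI)
  qed
qed

end
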